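(* Let $\pi$ be a cut-free DR-net of conclusion $A$, whose $\eta$-expansion is $\pi_\eta$. Then $\pi$ is in $\mathbf{L^3}$ iff, for all $k\in\mathbb N$, $\mathrm{cut}(\pi_\eta^\bullet,\theta^A_k)\to_\beta^\ast\pi_\eta^\bullet$.
   Context: Nets use links axiom, cut, one, bottom, tensor, par (conclusion $A\mathbin{⅋}B$), flat, pax, why not, of course, paragraph, with boxes; a DR-net is a net all of whose switchings (one premise kept per par/why not link, depth-zero boxes collapsed) are acyclic, recursively inside boxes, and with no $\flat$-formula conclusion; $\to_\beta^\ast$ is cut-elimination. An exponential indexing assigns integers to edges so that axiom conclusions and cut premises agree, premises and conclusion of one, bottom, tensor, par, flat, pax agree, premises of paragraph, of course and why not links have index one more than the conclusion, and all net conclusions agree; $\mathbf{L^3}$ is the set of DR-nets admitting one. Every net of $\mathbf{L^3}$ has a default exponential indexing with nonnegative values and $0$ on its conclusions; a subnet is at level $n$ if all its conclusions get $n$. For a formula $A$, $A^\bullet$ substitutes every atom $Z$ by $X\otimes X$ (and $Z^\bot$ by $X^\bot\mathbin{⅋}X^\bot$) for a fixed atom $X$; for an $\eta$-expanded net $\pi$, $\pi^\bullet$ replaces each atomic axiom by the net $id_{X\otimes X}$ (two axioms on $X$, a par on the two $X^\bot$, a tensor on the two $X$, wired left-to-left and right-to-right); $\gamma_{X,X}$ is the same net with crossed wiring. The test $\theta^A_k$ is the net of conclusions $(A^\bullet)^\bot,A^\bullet$ obtained from the $\eta$-expanded identity net $id_{A^\bullet}$ by replacing all its $id_{X\otimes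 X}$ subnets at level $k$ with $\gamma_{X,X}$. $\mathrm{cut}(\pi_\eta^\bullet,\theta^A_k)$ is the juxtaposition of the two nets with a cut link between the conclusion $A^\bullet$ of $\pi_\eta^\bullet$ and the conclusion $(A^\bullet)^\bot$ of $\theta^A_k$.
   Formalization: The formal theorem also assumes that no axiom link of π is on a formula built without atoms (only from 1 and ⊥); without this the equivalence fails, e.g. for an axiom 1,⊥ with a paragraph link on 1 and a par of §1 and ⊥, which is not in L³ but passes every test. *)

theory Defs
  imports Main "HOL-Library.FSet" "HOL-Library.Uprod"
begin

section \<open>Formulas\<close>

datatype form =
    Atom nat | NAtom nat
  | One | Bot
  | Tensor form form | Par form form
  | Bang form | Whynot form
  | Paragraph form

primrec dual :: "form \<Rightarrow> form" where
  "dual (Atom Z) = NAtom Z"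
| "dual (NAtom Z) = Atom Z"
| "dual One = Bot"
| "dual Bot = One"
| "dual (Tensor A B) = Par (dual A) (dual B)"
| "dual (Par A B) = Tensor (dual A) (dual B)"
| "dual (Bang A) = Whynot (dual A)"
| "dual (Whynot A) = Bang (dual A)"
| "dual (Paragraph A) = Paragraph (dual A)"

primrec atoms_of :: "form \<Rightarrow> nat set" where
  "atoms_of (Atom Z) = {Z}"
| "atoms_of (NAtom Z) = {Z}"
| "atoms_of One = {}"
| "atoms_of Bot = {}"
| "atoms_of (Tensor A B) = atoms_of A \<union> atoms_of B"
| "atoms_of (Par A B) = atoms_of A \<union> atoms_of B"
| "atoms_of (Bang A) = atoms_of A"
| "atoms_of (Whynot A) = atoms_of A"
| "atoms_of (Paragraph A) = atoms_of A"

text \<open>Edges carry either a formula or a flat formula.\<close>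

datatype label = Fm form | Fl form

section \<open>Nets\<close>

text \<open>
  A link is given by the edges it is attached to, premises first.  The conclusions of an axiom, the
  premises of a cut and the premises of a why not link are unordered.
\<close>

datatype 'e link =
    AxL "'e uprod"
  | CutL "'e uprod"
  | OneL 'e
  | BotL 'e
  | TensorL 'e 'e 'e
  | ParL 'e 'e 'e
  | FlatL 'e 'e
  | PaxL 'e 'e
  | WhynotL "'e fset" 'e
  | BangL 'e 'e
  | ParagraphL 'e 'e

primrec prems :: "'e link \<Rightarrow> 'e set" where
  "prems (AxL u) = {}"
| "prems (CutL u) = set_uprod u"
| "prems (OneL c) = {}"
| "prems (BotL c) = {}"
| "prems (TensorL p q c) = {p, q}"
| "prems (ParL p q c) = {p, q}"
| "prems (FlatL p c) = {p}"
| "prems (PaxL p c) = {p}"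
| "prems (WhynotL P c) = fset P"
| "prems (BangL p c) = {p}"
| "prems (ParagraphL p c) = {p}"

primrec concls :: "'e link \<Rightarrow> 'e set" where
  "concls (AxL u) = set_uprod u"
| "concls (CutL u) = {}"
| "concls (OneL c) = {c}"
| "concls (BotL c) = {c}"
| "concls (TensorL p q c) = {c}"
| "concls (ParL p q c) = {c}"
| "concls (FlatL p c) = {c}"
| "concls (PaxL p c) = {c}"
| "concls (WhynotL P c) = {c}"
| "concls (BangL p c) = {c}"
| "concls (ParagraphL p c) = {c}"

text \<open>
  A box is named by the conclusion of its of course link; \<open>loc N e\<close> is the innermost box containing
  the edge \<open>e\<close>, if any.  The doors of the box \<open>b\<close> are the of course link of conclusion \<open>b\<close> and the
  pax links whose premise lies in \<open>b\<close>; the conclusion of a door lies outside the box.  The values of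
  \<open>lab\<close> and \<open>loc\<close> outside \<open>edges N\<close> are irrelevant.
\<close>

record 'e net =
  links :: "'e link set"
  lab :: "'e \<Rightarrow> label"
  loc :: "'e \<Rightarrow> 'e option"

definition edges :: "'e net \<Rightarrow> 'e set" where
  "edges N = (\<Union>l\<in>links N. prems l \<union> concls l)"

definition conclusions :: "'e net \<Rightarrow> 'e set" where
  "conclusions N = {e \<in> edges N. \<forall>l\<in>links N. e \<notin> prems l}"

definition is_door :: "'e link \<Rightarrow> bool" where
  "is_door l \<longleftrightarrow> (\<exists>p c. l = PaxL p c \<or> l = BangL p c)"

primrec typed :: "'e net \<Rightarrow> 'e link \<Rightarrow> bool" where
  "typed N (AxL u) \<longleftrightarrow> (\<exists>e e' A. u = Upair e e' \<and> lab N e = Fm A \<and> lab N e' = Fm (dual A))"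
| "typed N (CutL u) \<longleftrightarrow> (\<exists>e e' A. u = Upair e e' \<and> lab N e = Fm A \<and> lab N e' = Fm (dual A))"
| "typed N (OneL c) \<longleftrightarrow> lab N c = Fm One"
| "typed N (BotL c) \<longleftrightarrow> lab N c = Fm Bot"
| "typed N (TensorL p q c) \<longleftrightarrow>
     p \<noteq> q \<and> (\<exists>A B. lab N p = Fm A \<and> lab N q = Fm B \<and> lab N c = Fm (Tensor A B))"
| "typed N (ParL p q c) \<longleftrightarrow>
     p \<noteq> q \<and> (\<exists>A B. lab N p = Fm A \<and> lab N q = Fm B \<and> lab N c = Fm (Par A B))"
| "typed N (FlatL p c) \<longleftrightarrow> (\<exists>A. lab N p = Fm A \<and> lab N c = Fl A)"
| "typed N (PaxL p c) \<longleftrightarrow> (\<exists>A. lab N p = Fl A \<and> lab N c = Fl A)"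
| "typed N (WhynotL P c) \<longleftrightarrow> (\<exists>A. (\<forall>p\<in>fset P. lab N p = Fl A) \<and> lab N c = Fm (Whynot A))"
| "typed N (BangL p c) \<longleftrightarrow> (\<exists>A. lab N p = Fm A \<and> lab N c = Fm (Bang A))"
| "typed N (ParagraphL p c) \<longleftrightarrow> (\<exists>A. lab N p = Fm A \<and> lab N c = Fm (Paragraph A))"

text \<open>
  Only doors cross the border of a box, and they cross exactly one border.  Since the conclusions of
  the whole net have to lie at depth zero, every pending edge of the content of a box is a premise of
  a door of that box.
\<close>

definition well_boxed :: "'e net \<Rightarrow> bool" where
  "well_boxed N \<longleftrightarrow>
     (\<forall>l\<in>links N. \<not> is_door l \<longrightarrow> (\<forall>e\<in>prems l \<union> concls l. \<forall>e'\<in>prems l \<union> concls l. loc N e = loc N e')) \<and>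
     (\<forall>p c. BangL p c \<in> links N \<longrightarrow> loc N p = Some c) \<and>
     (\<forall>p c. PaxL p c \<in> links N \<longrightarrow> (\<exists>b. loc N p = Some b \<and> loc N c = loc N b)) \<and>
     (\<forall>e\<in>edges N. \<forall>b. loc N e = Some b \<longrightarrow> (\<exists>a. BangL a b \<in> links N)) \<and>
     acyclic {(e, b). e \<in> edges N \<and> loc N e = Some b} \<and>
     (\<forall>e\<in>conclusions N. loc N e = None)"

definition is_net :: "'e net \<Rightarrow> bool" where
  "is_net N \<longleftrightarrow>
     finite (links N) \<and>
     (\<forall>e\<in>edges N. \<exists>!l. l \<in> links N \<and> e \<in> concls l) \<and>
     (\<forall>l\<in>links N. \<forall>l'\<in>links N. prems l \<inter> prems l' \<noteq> {} \<longrightarrow> l = l') \<and>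
     (\<forall>l\<in>links N. typed N l) \<and>
     well_boxed N"

text \<open>Nets are considered up to renaming of their edges.\<close>

definition net_iso :: "'e net \<Rightarrow> 'f net \<Rightarrow> bool" where
  "net_iso N M \<longleftrightarrow> (\<exists>f. bij_betw f (edges N) (edges M) \<and>
     map_link f ` links N = links M \<and>
     (\<forall>e\<in>edges N. lab M (f e) = lab N e \<and> loc M (f e) = map_option f (loc N e)))"

definition cut_free :: "'e net \<Rightarrow> bool" where
  "cut_free N \<longleftrightarrow> (\<forall>u. CutL u \<notin> links N)"

definition net_of_conclusion :: "'e net \<Rightarrow> form \<Rightarrow> bool" where
  "net_of_conclusion N A \<longleftrightarrow> (\<exists>c. conclusions N = {c} \<and> lab N c = Fm A)"

section \<open>Correctness\<close>

text \<open>A switching chooses one premise of each par link and of each why not link having premises.\<close>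

definition switched :: "'e link \<Rightarrow> bool" where
  "switched l \<longleftrightarrow> (\<exists>p q c. l = ParL p q c) \<or> (\<exists>P c. l = WhynotL P c)"

definition switching :: "'e net \<Rightarrow> ('e link \<Rightarrow> 'e) \<Rightarrow> bool" where
  "switching N S \<longleftrightarrow> (\<forall>l\<in>links N. switched l \<and> prems l \<noteq> {} \<longrightarrow> S l \<in> prems l)"

datatype 'e node = LinkN "'e link" | BoxN 'e

definition node_of :: "'e net \<Rightarrow> 'e link \<Rightarrow> 'e node" where
  "node_of N l = (case l of
      BangL p c \<Rightarrow> BoxN c
    | PaxL p c \<Rightarrow> BoxN (the (loc N p))
    | _ \<Rightarrow> LinkN l)"

text \<open>
  The switched graph of the content of the box \<open>b\<close> if \<open>B = Some b\<close>, of the whole net at depth zero if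
  \<open>B = None\<close>: the doors of a box lying there are collapsed into a single node, whereas the premises of
  the doors of \<open>b\<close> itself are pending.
\<close>

definition sw_edge :: "'e net \<Rightarrow> ('e link \<Rightarrow> 'e) \<Rightarrow> 'e option \<Rightarrow> 'e \<Rightarrow> 'e node \<Rightarrow> 'e node \<Rightarrow> bool" where
  "sw_edge N S B e u v \<longleftrightarrow> loc N e = B \<and>
     (\<exists>l\<in>links N. \<exists>l'\<in>links N. e \<in> concls l \<and> e \<in> prems l' \<and> \<not> is_door l' \<and>
        (switched l' \<longrightarrow> e = S l') \<and>
        ((u = node_of N l \<and> v = LinkN l') \<or> (v = node_of N l \<and> u = LinkN l')))"

primrec trail :: "('e \<Rightarrow> 'v \<Rightarrow> 'v \<Rightarrow> bool) \<Rightarrow> 'v \<Rightarrow> 'e list \<Rightarrow> 'v \<Rightarrow> bool" where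
  "trail J u [] v \<longleftrightarrow> u = v"
| "trail J u (e # es) v \<longleftrightarrow> (\<exists>w. J e u w \<and> trail J w es v)"

text \<open>An undirected multigraph is acyclic if no nonempty closed walk has pairwise distinct edges.\<close>

definition acyclic_graph :: "('e \<Rightarrow> 'v \<Rightarrow> 'v \<Rightarrow> bool) \<Rightarrow> bool" where
  "acyclic_graph J \<longleftrightarrow> (\<nexists>u es. es \<noteq> [] \<and> distinct es \<and> trail J u es u)"

definition DR_net :: "'e net \<Rightarrow> bool" where
  "DR_net N \<longleftrightarrow> is_net N \<and>
     (\<forall>S. switching N S \<longrightarrow>
        (\<forall>B\<in>insert None {Some b | a b. BangL a b \<in> links N}. acyclic_graph (sw_edge N S B))) \<and>
     (\<forall>e\<in>conclusions N. \<exists>A. lab N e = Fm A)"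

section \<open>Exponential indexings and \<open>L\<^sup>3\<close>\<close>

primrec indexed :: "('e \<Rightarrow> int) \<Rightarrow> 'e link \<Rightarrow> bool" where
  "indexed I (AxL u) \<longleftrightarrow> (\<forall>e\<in>set_uprod u. \<forall>e'\<in>set_uprod u. I e = I e')"
| "indexed I (CutL u) \<longleftrightarrow> (\<forall>e\<in>set_uprod u. \<forall>e'\<in>set_uprod u. I e = I e')"
| "indexed I (OneL c) \<longleftrightarrow> True"
| "indexed I (BotL c) \<longleftrightarrow> True"
| "indexed I (TensorL p q c) \<longleftrightarrow> I p = I c \<and> I q = I c"
| "indexed I (ParL p q c) \<longleftrightarrow> I p = I c \<and> I q = I c"
| "indexed I (FlatL p c) \<longleftrightarrow> I p = I c"
| "indexed I (PaxL p c) \<longleftrightarrow> I p = I c"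
| "indexed I (WhynotL P c) \<longleftrightarrow> (\<forall>p\<in>fset P. I p = I c + 1)"
| "indexed I (BangL p c) \<longleftrightarrow> I p = I c + 1"
| "indexed I (ParagraphL p c) \<longleftrightarrow> I p = I c + 1"

definition exp_indexing :: "'e net \<Rightarrow> ('e \<Rightarrow> int) \<Rightarrow> bool" where
  "exp_indexing N I \<longleftrightarrow> (\<forall>l\<in>links N. indexed I l) \<and>
     (\<forall>e\<in>conclusions N. \<forall>e'\<in>conclusions N. I e = I e')"

definition L3 :: "'e net \<Rightarrow> bool" where
  "L3 N \<longleftrightarrow> DR_net N \<and> (\<exists>I. exp_indexing N I)"

definition default_indexing :: "'e net \<Rightarrow> ('e \<Rightarrow> int) \<Rightarrow> bool" where
  "default_indexing N I \<longleftrightarrow> exp_indexing N I \<and> (\<forall>e\<in>edges N. I e \<ge> 0) \<and> (\<forall>e\<in>conclusions N. I e = 0)"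

section \<open>Eta-expansion\<close>

inductive eta_step :: "'e net \<Rightarrow> 'e net \<Rightarrow> bool" where
  unit: "\<lbrakk>AxL (Upair e e') \<in> links N; lab N e = Fm One\<rbrakk> \<Longrightarrow>
    eta_step N (N\<lparr>links := links N - {AxL (Upair e e')} \<union> {OneL e, BotL e'}\<rparr>)"
| mult: "\<lbrakk>AxL (Upair e e') \<in> links N; lab N e = Fm (Tensor A B);
     distinct [p, q, p', q']; {p, q, p', q'} \<inter> edges N = {}\<rbrakk> \<Longrightarrow>
    eta_step N \<lparr>
      links = links N - {AxL (Upair e e')} \<union>
        {TensorL p q e, ParL p' q' e', AxL (Upair p p'), AxL (Upair q q')},
      lab = (lab N)(p := Fm A, q := Fm B, p' := Fm (dual A), q' := Fm (dual B)),
      loc = (loc N)(p := loc N e, q := loc N e, p' := loc N e, q' := loc N e)\<rparr>"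
| para: "\<lbrakk>AxL (Upair e e') \<in> links N; lab N e = Fm (Paragraph A);
     distinct [p, p']; {p, p'} \<inter> edges N = {}\<rbrakk> \<Longrightarrow>
    eta_step N \<lparr>
      links = links N - {AxL (Upair e e')} \<union>
        {ParagraphL p e, ParagraphL p' e', AxL (Upair p p')},
      lab = (lab N)(p := Fm A, p' := Fm (dual A)),
      loc = (loc N)(p := loc N e, p' := loc N e)\<rparr>"
| expo: "\<lbrakk>AxL (Upair e e') \<in> links N; lab N e = Fm (Bang A);
     distinct [p, p', x, y]; {p, p', x, y} \<inter> edges N = {}\<rbrakk> \<Longrightarrow>
    eta_step N \<lparr>
      links = links N - {AxL (Upair e e')} \<union>
        {BangL p e, AxL (Upair p p'), FlatL p' x, PaxL x y, WhynotL {|y|} e'},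
      lab = (lab N)(p := Fm A, p' := Fm (dual A), x := Fl (dual A), y := Fl (dual A)),
      loc = (loc N)(p := Some e, p' := Some e, x := Some e, y := loc N e)\<rparr>"

definition eta_expanded :: "'e net \<Rightarrow> bool" where
  "eta_expanded N \<longleftrightarrow> (\<forall>e e'. AxL (Upair e e') \<in> links N \<longrightarrow>
     (\<exists>Z. lab N e = Fm (Atom Z) \<or> lab N e = Fm (NAtom Z)))"

definition eta_expansion :: "'e net \<Rightarrow> 'e net \<Rightarrow> bool" where
  "eta_expansion N N' \<longleftrightarrow> eta_step\<^sup>*\<^sup>* N N' \<and> eta_expanded N'"

definition ax_net :: "form \<Rightarrow> nat net" where
  "ax_net A = \<lparr>links = {AxL (Upair 0 1)},
     lab = (\<lambda>e. if e = 0 then Fm (dual A) else Fm A), loc = (\<lambda>_. None)\<rparr>"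

definition identity_net :: "form \<Rightarrow> nat net \<Rightarrow> bool" where
  "identity_net A N \<longleftrightarrow> eta_expansion (ax_net A) N"

section \<open>Cut-elimination\<close>

text \<open>
  The exponential step for a cut between the conclusion \<open>b\<close> of \<open>BangL a b\<close> and the conclusion \<open>w\<close> of
  \<open>WhynotL P w\<close>.  For each \<open>d \<in> P\<close> the pax links above \<open>d\<close> form a \<open>thread\<close> ending at a flat link,
  whose conclusion is \<open>thread_top\<close>.  The content of \<open>b\<close> is copied once for each \<open>d\<close>, at the place of
  that flat link, where it is cut against the premise of the flat link.  Each copy of a premise \<open>x\<close> of
  an auxiliary door of \<open>b\<close> is brought to the level of \<open>b\<close> by as many pax links as there are in the
  thread of \<open>d\<close> (the \<open>strand\<close>), and then by a copy of the pax links below the door, down to a why not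
  link, which thus has one premise for each \<open>d\<close> instead of one.
\<close>

definition pax_rel :: "'e net \<Rightarrow> 'e \<Rightarrow> 'e \<Rightarrow> bool" where
  "pax_rel N x y \<longleftrightarrow> PaxL x y \<in> links N"

definition inside :: "'e net \<Rightarrow> 'e \<Rightarrow> 'e set" where
  "inside N b = {e \<in> edges N. (\<lambda>x y. loc N x = Some y)\<^sup>+\<^sup>+ e b}"

definition thread :: "'e net \<Rightarrow> 'e \<Rightarrow> 'e set" where
  "thread N d = {z. (pax_rel N)\<^sup>*\<^sup>* z d}"

definition thread_top :: "'e net \<Rightarrow> 'e \<Rightarrow> 'e" where
  "thread_top N d = (THE z. z \<in> thread N d \<and> (\<exists>s. FlatL s z \<in> links N))"

definition aux_doors :: "'e net \<Rightarrow> 'e \<Rightarrow> ('e \<times> 'e) set" where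
  "aux_doors N b = {(x, y). PaxL x y \<in> links N \<and> loc N x = Some b}"

definition below :: "'e net \<Rightarrow> 'e \<Rightarrow> 'e set" where
  "below N b = {z. \<exists>(x, y)\<in>aux_doors N b. (pax_rel N)\<^sup>*\<^sup>* y z}"

text \<open>Names of the edges of the reduct.\<close>

datatype 'e redname = Keep 'e | Copy 'e 'e | Strand 'e 'e 'e

definition strand :: "'e net \<Rightarrow> 'e \<Rightarrow> 'e \<Rightarrow> 'e \<Rightarrow> 'e redname" where
  "strand N d x z = (if z = thread_top N d then Copy d x else Strand d x z)"

definition below_copy :: "'e net \<Rightarrow> 'e \<Rightarrow> 'e \<Rightarrow> 'e \<Rightarrow> 'e redname" where
  "below_copy N b d z =
     (if \<exists>x. (x, z) \<in> aux_doors N b then strand N d (THE x. (x, z) \<in> aux_doors N b) d else Copy d z)"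

definition exp_reduct :: "'e net \<Rightarrow> 'e \<Rightarrow> 'e \<Rightarrow> 'e fset \<Rightarrow> 'e \<Rightarrow> 'e redname net" where
  "exp_reduct N a b P w = \<lparr>
     links =
       map_link Keep ` {l \<in> links N. l \<notin> {CutL (Upair b w), BangL a b, WhynotL P w} \<and>
         concls l \<inter> (\<Union>d\<in>fset P. thread N d) = {} \<and>
         (prems l \<union> concls l) \<inter> inside N b = {} \<and>
         prems l \<inter> below N b = {}} \<union>
       (\<Union>d\<in>fset P. map_link (Copy d) ` {l \<in> links N. prems l \<union> concls l \<subseteq> inside N b}) \<union>
       {CutL (Upair (Keep s) (Copy d a)) | s d. d \<in> fset P \<and> FlatL s (thread_top N d) \<in> links N} \<union>
       {PaxL (strand N d x z) (strand N d x z') | d x y z z'.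
          d \<in> fset P \<and> (x, y) \<in> aux_doors N b \<and> z' \<in> thread N d \<and> PaxL z z' \<in> links N} \<union>
       {PaxL (below_copy N b d z) (below_copy N b d z') | d z z'.
          d \<in> fset P \<and> z \<in> below N b \<and> PaxL z z' \<in> links N} \<union>
       {WhynotL R (Keep v) | R Q v. WhynotL Q v \<in> links N \<and> fset Q \<inter> below N b \<noteq> {} \<and>
          fset R = Keep ` (fset Q - below N b) \<union>
            (\<Union>d\<in>fset P. below_copy N b d ` (fset Q \<inter> below N b))},
     lab = (\<lambda>n. case n of Keep e \<Rightarrow> lab N e | Copy d e \<Rightarrow> lab N e | Strand d x z \<Rightarrow> lab N x),
     loc = (\<lambda>n. case n of
         Keep e \<Rightarrow> map_option Keep (loc N e)
       | Copy d e \<Rightarrow>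
           (if e \<notin> inside N b then map_option Keep (loc N e)
            else if loc N e = Some b then map_option Keep (loc N (thread_top N d))
            else map_option (Copy d) (loc N e))
       | Strand d x z \<Rightarrow> map_option Keep (loc N z))\<rparr>"

inductive beta :: "'e net \<Rightarrow> 'e net \<Rightarrow> bool" where
  axiom: "\<lbrakk>AxL (Upair e f) \<in> links N; CutL (Upair f g) \<in> links N; e \<noteq> g\<rbrakk> \<Longrightarrow>
    beta N (N\<lparr>links := map_link (id(e := g)) `
      (links N - {AxL (Upair e f), CutL (Upair f g)})\<rparr>)"
| unit: "\<lbrakk>CutL (Upair e f) \<in> links N; OneL e \<in> links N; BotL f \<in> links N\<rbrakk> \<Longrightarrow>
    beta N (N\<lparr>links := links N - {CutL (Upair e f), OneL e, BotL f}\<rparr>)"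
| mult: "\<lbrakk>CutL (Upair e f) \<in> links N; TensorL p q e \<in> links N; ParL r s f \<in> links N\<rbrakk> \<Longrightarrow>
    beta N (N\<lparr>links := links N - {CutL (Upair e f), TensorL p q e, ParL r s f} \<union>
      {CutL (Upair p r), CutL (Upair q s)}\<rparr>)"
| para: "\<lbrakk>CutL (Upair e f) \<in> links N; ParagraphL p e \<in> links N; ParagraphL q f \<in> links N\<rbrakk> \<Longrightarrow>
    beta N (N\<lparr>links := links N - {CutL (Upair e f), ParagraphL p e, ParagraphL q f} \<union>
      {CutL (Upair p q)}\<rparr>)"
| expo: "\<lbrakk>CutL (Upair b w) \<in> links N; BangL a b \<in> links N; WhynotL P w \<in> links N;
     net_iso (exp_reduct N a b P w) N'\<rbrakk> \<Longrightarrow> beta N N'"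

definition reduces :: "'e net \<Rightarrow> 'f net \<Rightarrow> bool" where
  "reduces N M \<longleftrightarrow> (\<exists>N'. beta\<^sup>*\<^sup>* N N' \<and> net_iso N' M)"

section \<open>Atom substitution and tests\<close>

primrec bullet :: "nat \<Rightarrow> form \<Rightarrow> form" where
  "bullet X (Atom Z) = Tensor (Atom X) (Atom X)"
| "bullet X (NAtom Z) = Par (NAtom X) (NAtom X)"
| "bullet X One = One"
| "bullet X Bot = Bot"
| "bullet X (Tensor A B) = Tensor (bullet X A) (bullet X B)"
| "bullet X (Par A B) = Par (bullet X A) (bullet X B)"
| "bullet X (Bang A) = Bang (bullet X A)"
| "bullet X (Whynot A) = Whynot (bullet X A)"
| "bullet X (Paragraph A) = Paragraph (bullet X A)"

primrec bullet_label :: "nat \<Rightarrow> label \<Rightarrow> label" where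
  "bullet_label X (Fm A) = Fm (bullet X A)"
| "bullet_label X (Fl A) = Fl (bullet X A)"

text \<open>The links of \<open>id\<close> and \<open>\<gamma>\<close>, for conclusions \<open>t\<close> of formula \<open>X \<otimes> X\<close> and \<open>u\<close> of dual formula.\<close>

definition id_links :: "'e \<Rightarrow> 'e \<Rightarrow> 'e \<Rightarrow> 'e \<Rightarrow> 'e \<Rightarrow> 'e \<Rightarrow> 'e link set" where
  "id_links p q t p' q' u = {TensorL p q t, ParL p' q' u, AxL (Upair p p'), AxL (Upair q q')}"

definition gamma_links :: "'e \<Rightarrow> 'e \<Rightarrow> 'e \<Rightarrow> 'e \<Rightarrow> 'e \<Rightarrow> 'e \<Rightarrow> 'e link set" where
  "gamma_links p q t p' q' u = {TensorL p q t, ParL p' q' u, AxL (Upair p q'), AxL (Upair q p')}"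

datatype 'e sub = Whole 'e | Lft 'e | Rgt 'e

text \<open>Meant for eta-expanded nets.\<close>

definition bullet_net :: "nat \<Rightarrow> 'e net \<Rightarrow> 'e sub net" where
  "bullet_net X N = \<lparr>
     links = map_link Whole ` {l \<in> links N. \<forall>u. l \<noteq> AxL u} \<union>
       \<Union> {id_links (Lft e) (Rgt e) (Whole e) (Lft e') (Rgt e') (Whole e') | e e'.
            AxL (Upair e e') \<in> links N \<and> (\<exists>Z. lab N e = Fm (Atom Z))},
     lab = (\<lambda>n. case n of
         Whole e \<Rightarrow> bullet_label X (lab N e)
       | Lft e \<Rightarrow> if \<exists>Z. lab N e = Fm (Atom Z) then Fm (Atom X) else Fm (NAtom X)
       | Rgt e \<Rightarrow> if \<exists>Z. lab N e = Fm (Atom Z) then Fm (Atom X) else Fm (NAtom X)),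
     loc = (\<lambda>n. case n of
         Whole e \<Rightarrow> map_option Whole (loc N e)
       | Lft e \<Rightarrow> map_option Whole (loc N e)
       | Rgt e \<Rightarrow> map_option Whole (loc N e))\<rparr>"

definition id_subnet_at_level ::
  "nat \<Rightarrow> 'e net \<Rightarrow> nat \<Rightarrow> 'e \<Rightarrow> 'e \<Rightarrow> 'e \<Rightarrow> 'e \<Rightarrow> 'e \<Rightarrow> 'e \<Rightarrow> bool" where
  "id_subnet_at_level X N k p q t p' q' u \<longleftrightarrow>
     id_links p q t p' q' u \<subseteq> links N \<and> lab N p = Fm (Atom X) \<and> lab N q = Fm (Atom X) \<and>
     (\<exists>I. default_indexing N I \<and> I t = int k \<and> I u = int k)"

definition cross_level :: "nat \<Rightarrow> nat \<Rightarrow> 'e net \<Rightarrow> 'e net" where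
  "cross_level X k N = N\<lparr>links :=
     (links N - \<Union> {id_links p q t p' q' u | p q t p' q' u. id_subnet_at_level X N k p q t p' q' u}) \<union>
     \<Union> {gamma_links p q t p' q' u | p q t p' q' u. id_subnet_at_level X N k p q t p' q' u}\<rparr>"

definition is_test :: "nat \<Rightarrow> form \<Rightarrow> nat \<Rightarrow> nat net \<Rightarrow> bool" where
  "is_test X A k T \<longleftrightarrow> (\<exists>N. identity_net (bullet X A) N \<and> T = cross_level X k N)"

definition cut_nets :: "form \<Rightarrow> 'e net \<Rightarrow> 'f net \<Rightarrow> ('e + 'f) net" where
  "cut_nets F N M = \<lparr>
     links = map_link Inl ` links N \<union> map_link Inr ` links M \<union>
       {CutL (Upair (Inl c) (Inr d)) | c d. c \<in> conclusions N \<and> lab N c = Fm F \<and>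
          d \<in> conclusions M \<and> lab M d = Fm (dual F)},
     lab = case_sum (lab N) (lab M),
     loc = case_sum (map_option Inl \<circ> loc N) (map_option Inr \<circ> loc M)\<rparr>"

section \<open>Constant axioms\<close>

text \<open>
  An axiom on a formula built from units only (say \<open>One\<close>) forces its two conclusions to have the same
  index, but its eta-expansion consists of disconnected nets, which impose no such constraint, and the
  tests do not act on it.  For instance the net made of an axiom on \<open>One\<close>, a paragraph link on its
  conclusion \<open>One\<close> and a par link is not in \<open>L\<^sup>3\<close>, whereas its eta-expansion is.
\<close>

definition no_constant_axiom :: "'e net \<Rightarrow> bool" where
  "no_constant_axiom N \<longleftrightarrow> (\<forall>e e' A. AxL (Upair e e') \<in> links N \<and> lab N e = Fm A \<longrightarrow> atoms_of A \<noteq> {})"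

end

theory Submission
  imports Defs "HOL-Library.Countable"
begin

text \<open>
  Cutting an \<open>\<eta>\<close>-expanded cut-free net against an \<open>\<eta>\<close>-expanded identity rebuilds the net from its
  conclusion upwards.  The nets met on the way are, up to renaming, the states \<open>state D\<close>: \<open>D\<close> is a set of
  edges closed downwards, the links concluding in \<open>D\<close> have been rebuilt, and on each edge just above \<open>D\<close>
  (the \<open>front\<close>) a copy of the identity of its formula is waiting in a cut.  Every cut-elimination step leads
  from a state to a state with a larger \<open>D\<close>, and the only state without cuts is the final one, whence
  termination and uniqueness of the normal form.  With a test instead of the identity, the rebuilt net has its pair links
  \<open>X \<otimes> X\<close> and \<open>X\<^bsup>\<bottom>\<^esup> \<parr> X\<^bsup>\<bottom>\<^esup>\<close> crossed exactly at level \<open>k\<close>, where the level of an edge counts the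
  exponential and paragraph links below it.  This is isomorphic to the original net iff every axiom has
  both or none of its conclusions at level \<open>k\<close>, and an indexing exists iff the two conclusions of each
  axiom are at the same level.
\<close>

text \<open>The obstacle is that reducts have no canonical names: rule \<open>expo\<close> of
  \<open>beta\<close> admits every net isomorphic to \<open>exp_reduct\<close>, and cut nets, states
  and reducts live on different types of edges. So each step is compared with a state by an explicit
  renaming and carried between types along injections. The definite descriptions in the exponential
  rule commute with renamings only where they denote, hence the study of threads. A test crosses
  axioms, but the trees used here carry the crossing on the pair link on the side of
  \<open>bullet X A\<close>; exchanging the names of its two premises turns one into the other. The
  cut then copies the crossing onto the host independently at the two ends of each axiom. Two
  crossings on one axiom cancel by exchanging left and right; a single one cannot be undone, since
  the premises of tensor and par are ordered and axioms join like sides. Expansion erases the index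
  constraint of axioms built from units only. Hence indexings are weakened to constrain only the
  axioms whose formula has an atom, a condition that expansion preserves;
  \<open>no_constant_axiom\<close> makes it equivalent to the original one.\<close>

lemma set_link_eq: "set_link l = prems l \<union> concls l"
 by (cases l) auto

lemma prems_map [simp]: "prems (map_link f l) = f ` prems l"
 by (cases l) (auto simp: uprod.set_map)

lemma concls_map [simp]: "concls (map_link f l) = f ` concls l"
 by (cases l) (auto simp: uprod.set_map)

lemma edges_eq: "edges N = (\<Union>l\<in>links N. set_link l)"
 by (auto simp: edges_def set_link_eq)

lemma finite_set_link [simp]: "finite (set_link l)"
 by (cases l) auto

lemma set_link_subset: "l \<in> links N \<Longrightarrow> set_link l \<subseteq> edges N"
 by (auto simp: edges_eq)

lemma prems_subset: "l \<in> links N \<Longrightarrow> prems l \<subseteq> edges N"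
 and concls_subset: "l \<in> links N \<Longrightarrow> concls l \<subseteq> edges N"
 by (auto simp: edges_def)

lemma map_link_id_on: "(\<And>x. x \<in> set_link l \<Longrightarrow> f x = x) \<Longrightarrow> map_link f l = l"
 using link.map_cong0[of l f id] by (simp add: link.map_id)

lemma map_link_comp: "map_link f (map_link g l) = map_link (f \<circ> g) l"
 by (simp add: link.map_comp)

lemma map_link_cong: "(\<And>x. x \<in> set_link l \<Longrightarrow> f x = g x) \<Longrightarrow> map_link f l = map_link g l"
 by (rule link.map_cong0)

lemma edges_image: "(\<Union>l\<in>map_link f ` L. set_link l) = f ` (\<Union>l\<in>L. set_link l)"
 by (auto simp: link.set_map)

lemma map_link_eq_iffs:
 "map_link f l = AxL u \<longleftrightarrow> (\<exists>v. l = AxL v \<and> u = map_uprod f v)"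
 "map_link f l = CutL u \<longleftrightarrow> (\<exists>v. l = CutL v \<and> u = map_uprod f v)"
 "map_link f l = OneL c \<longleftrightarrow> (\<exists>c'. l = OneL c' \<and> c = f c')"
 "map_link f l = BotL c \<longleftrightarrow> (\<exists>c'. l = BotL c' \<and> c = f c')"
 "map_link f l = TensorL p q c \<longleftrightarrow> (\<exists>p' q' c'. l = TensorL p' q' c' \<and> p = f p' \<and> q = f q' \<and> c = f c')"
 "map_link f l = ParL p q c \<longleftrightarrow> (\<exists>p' q' c'. l = ParL p' q' c' \<and> p = f p' \<and> q = f q' \<and> c = f c')"
 "map_link f l = FlatL p c \<longleftrightarrow> (\<exists>p' c'. l = FlatL p' c' \<and> p = f p' \<and> c = f c')"
 "map_link f l = PaxL p c \<longleftrightarrow> (\<exists>p' c'. l = PaxL p' c' \<and> p = f p' \<and> c = f c')"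
 "map_link f l = WhynotL P c \<longleftrightarrow> (\<exists>P' c'. l = WhynotL P' c' \<and> P = f |`| P' \<and> c = f c')"
 "map_link f l = BangL p c \<longleftrightarrow> (\<exists>p' c'. l = BangL p' c' \<and> p = f p' \<and> c = f c')"
 "map_link f l = ParagraphL p c \<longleftrightarrow> (\<exists>p' c'. l = ParagraphL p' c' \<and> p = f p' \<and> c = f c')"
 by (cases l; auto)+

lemma mem_map_link_iffs:
 "AxL u \<in> map_link f ` L \<longleftrightarrow> (\<exists>v. AxL v \<in> L \<and> u = map_uprod f v)"
 "CutL u \<in> map_link f ` L \<longleftrightarrow> (\<exists>v. CutL v \<in> L \<and> u = map_uprod f v)"
 "OneL c \<in> map_link f ` L \<longleftrightarrow> (\<exists>c'. OneL c' \<in> L \<and> c = f c')"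
 "BotL c \<in> map_link f ` L \<longleftrightarrow> (\<exists>c'. BotL c' \<in> L \<and> c = f c')"
 "TensorL p q c \<in> map_link f ` L \<longleftrightarrow> (\<exists>p' q' c'. TensorL p' q' c' \<in> L \<and> p = f p' \<and> q = f q' \<and> c = f c')"
 "ParL p q c \<in> map_link f ` L \<longleftrightarrow> (\<exists>p' q' c'. ParL p' q' c' \<in> L \<and> p = f p' \<and> q = f q' \<and> c = f c')"
 "FlatL p c \<in> map_link f ` L \<longleftrightarrow> (\<exists>p' c'. FlatL p' c' \<in> L \<and> p = f p' \<and> c = f c')"
 "PaxL p c \<in> map_link f ` L \<longleftrightarrow> (\<exists>p' c'. PaxL p' c' \<in> L \<and> p = f p' \<and> c = f c')"
 "WhynotL P c \<in> map_link f ` L \<longleftrightarrow> (\<exists>P' c'. WhynotL P' c' \<in> L \<and> P = f |`| P' \<and> c = f c')"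
 "BangL p c \<in> map_link f ` L \<longleftrightarrow> (\<exists>p' c'. BangL p' c' \<in> L \<and> p = f p' \<and> c = f c')"
 "ParagraphL p c \<in> map_link f ` L \<longleftrightarrow> (\<exists>p' c'. ParagraphL p' c' \<in> L \<and> p = f p' \<and> c = f c')"
proof -
 have "X \<in> map_link f ` L \<longleftrightarrow> (\<exists>l\<in>L. map_link f l = X)" for X by auto
 then show
  "AxL u \<in> map_link f ` L \<longleftrightarrow> (\<exists>v. AxL v \<in> L \<and> u = map_uprod f v)"
  "CutL u \<in> map_link f ` L \<longleftrightarrow> (\<exists>v. CutL v \<in> L \<and> u = map_uprod f v)"
  "OneL c \<in> map_link f ` L \<longleftrightarrow> (\<exists>c'. OneL c' \<in> L \<and> c = f c')"
  "BotL c \<in> map_link f ` L \<longleftrightarrow> (\<exists>c'. BotL c' \<in> L \<and> c = f c')"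
  "TensorL p q c \<in> map_link f ` L \<longleftrightarrow> (\<exists>p' q' c'. TensorL p' q' c' \<in> L \<and> p = f p' \<and> q = f q' \<and> c = f c')"
  "ParL p q c \<in> map_link f ` L \<longleftrightarrow> (\<exists>p' q' c'. ParL p' q' c' \<in> L \<and> p = f p' \<and> q = f q' \<and> c = f c')"
  "FlatL p c \<in> map_link f ` L \<longleftrightarrow> (\<exists>p' c'. FlatL p' c' \<in> L \<and> p = f p' \<and> c = f c')"
  "PaxL p c \<in> map_link f ` L \<longleftrightarrow> (\<exists>p' c'. PaxL p' c' \<in> L \<and> p = f p' \<and> c = f c')"
  "WhynotL P c \<in> map_link f ` L \<longleftrightarrow> (\<exists>P' c'. WhynotL P' c' \<in> L \<and> P = f |`| P' \<and> c = f c')"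
  "BangL p c \<in> map_link f ` L \<longleftrightarrow> (\<exists>p' c'. BangL p' c' \<in> L \<and> p = f p' \<and> c = f c')"
  "ParagraphL p c \<in> map_link f ` L \<longleftrightarrow> (\<exists>p' c'. ParagraphL p' c' \<in> L \<and> p = f p' \<and> c = f c')"
  by (simp_all only: map_link_eq_iffs) blast+
qed

lemma map_uprod_eq_Upair:
 "map_uprod f v = Upair x y \<longleftrightarrow> (\<exists>a b. v = Upair a b \<and> x = f a \<and> y = f b)"
 by (cases v) (auto simp: Upair_inject)

section \<open>Isomorphisms of raw nets, box names included\<close>

definition reach :: "'e net \<Rightarrow> 'e set" where
 "reach N = edges N \<union> {b. \<exists>e\<in>edges N. loc N e = Some b}"

definition boxed :: "'e net \<Rightarrow> bool" where
 "boxed N \<longleftrightarrow> (\<forall>e\<in>edges N. \<forall>b. loc N e = Some b \<longrightarrow> b \<in> edges N)"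

text \<open>In a raw net \<open>loc\<close> may name a box that is not an edge. A renaming that is
  injective on \<open>edges\<close> only could identify such a name with another one, and its
  inverse would then not respect \<open>loc\<close>; hence injectivity on
  \<open>reach\<close>.\<close>

definition iso_by :: "('e \<Rightarrow> 'f) \<Rightarrow> 'e net \<Rightarrow> 'f net \<Rightarrow> bool" where
 "iso_by f N M \<longleftrightarrow> inj_on f (reach N) \<and> map_link f ` links N = links M \<and>
   (\<forall>e\<in>edges N. lab M (f e) = lab N e \<and> loc M (f e) = map_option f (loc N e))"

text \<open>Unlike \<open>net_iso\<close>, this relation is symmetric on all raw nets.\<close>

definition siso :: "'e net \<Rightarrow> 'f net \<Rightarrow> bool" where
 "siso N M \<longleftrightarrow> (\<exists>f. iso_by f N M)"

lemma boxed_reach: "boxed N \<Longrightarrow> reach N = edges N"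
 by (auto simp: boxed_def reach_def)

lemma iso_by_edges: "map_link f ` links N = links M \<Longrightarrow> edges M = f ` edges N"
 unfolding edges_eq by (metis edges_image)

lemma iso_by_edges': "iso_by f N M \<Longrightarrow> edges M = f ` edges N"
 unfolding iso_by_def using iso_by_edges by metis

lemma iso_by_reach: assumes "iso_by f N M" shows "reach M = f ` reach N"
proof -
 have e: "edges M = f ` edges N" using assms by (rule iso_by_edges')
 have "{b. \<exists>e\<in>edges M. loc M e = Some b} = f ` {b. \<exists>e\<in>edges N. loc N e = Some b}"
  using assms unfolding e iso_by_def by (auto simp: image_iff)
 then show ?thesis using e by (auto simp: reach_def)
qed

lemma net_iso_by:
 "net_iso N M \<longleftrightarrow> (\<exists>f. inj_on f (edges N) \<and> map_link f ` links N = links M \<and>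
   (\<forall>e\<in>edges N. lab M (f e) = lab N e \<and> loc M (f e) = map_option f (loc N e)))"
 unfolding net_iso_def bij_betw_def by (metis iso_by_edges)

lemma net_isoI:
 "\<lbrakk>inj_on f (edges N); map_link f ` links N = links M;
  \<And>e. e \<in> edges N \<Longrightarrow> lab M (f e) = lab N e; \<And>e. e \<in> edges N \<Longrightarrow> loc M (f e) = map_option f (loc N e)\<rbrakk>
  \<Longrightarrow> net_iso N M"
 unfolding net_iso_by by blast

lemma siso_net_iso: "siso N M \<Longrightarrow> net_iso N M"
 unfolding siso_def iso_by_def net_iso_by reach_def by (meson inj_on_Un)

text \<open>When boxes are named by edges, \<open>reach\<close> is just \<open>edges\<close>, so the
  two notions of isomorphism agree as soon as the source is \<open>boxed\<close>. This is the gate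
  through which every \<open>net_iso\<close> with a state becomes reversible.\<close>

lemma net_iso_siso: "net_iso N M \<Longrightarrow> boxed N \<Longrightarrow> siso N M"
 unfolding siso_def iso_by_def net_iso_by by (metis boxed_reach)

lemma net_iso_trans: assumes "net_iso N M" "net_iso M K" shows "net_iso N K"
proof -
 obtain f where f: "inj_on f (edges N)" "map_link f ` links N = links M"
   "\<forall>e\<in>edges N. lab M (f e) = lab N e \<and> loc M (f e) = map_option f (loc N e)"
  using assms(1) unfolding net_iso_by by blast
 obtain g where g: "inj_on g (edges M)" "map_link g ` links M = links K"
   "\<forall>e\<in>edges M. lab K (g e) = lab M e \<and> loc K (g e) = map_option g (loc M e)"
  using assms(2) unfolding net_iso_by by blast
 have e: "edges M = f ` edges N" using f(2) iso_by_edges by metis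
 show ?thesis
 proof (rule net_isoI[where f = "g \<circ> f"])
  show "inj_on (g \<circ> f) (edges N)" using f(1) g(1) e by (simp add: comp_inj_on)
  show "map_link (g \<circ> f) ` links N = links K"
   using f(2) g(2) by (simp add: map_link_comp[symmetric] image_image[symmetric])
 qed (use f(3) g(3) e in \<open>auto simp: option.map_comp\<close>)
qed

text \<open>The delicate clause is the one on \<open>loc\<close>: the inverse has to undo
  \<open>f\<close> on the name of a box, and that name lies in \<open>reach\<close> even when it is
  not an edge.\<close>

lemma iso_by_inverse: assumes "iso_by f N M"
 shows "iso_by (inv_into (reach N) f) M N" "\<And>e. e \<in> reach N \<Longrightarrow> inv_into (reach N) f (f e) = e"
proof -
 let ?g = "inv_into (reach N) f"
 have inj: "inj_on f (reach N)" and im: "map_link f ` links N = links M"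
  and lb: "\<And>e. e \<in> edges N \<Longrightarrow> lab M (f e) = lab N e"
  and lc: "\<And>e. e \<in> edges N \<Longrightarrow> loc M (f e) = map_option f (loc N e)"
  using assms by (auto simp: iso_by_def)
 show gf: "\<And>e. e \<in> reach N \<Longrightarrow> ?g (f e) = e" using inj by simp
 have eM: "edges M = f ` edges N" using im iso_by_edges by metis
 have rM: "reach M = f ` reach N" using iso_by_reach assms by blast
 have sub: "edges N \<subseteq> reach N" by (auto simp: reach_def)
 show "iso_by ?g M N" unfolding iso_by_def
 proof (intro conjI ballI)
  show "inj_on ?g (reach M)" by (metis inj_on_inv_into order_refl rM)
  have "map_link ?g (map_link f l) = l" if "l \<in> links N" for l
   unfolding map_link_comp by (rule map_link_id_on) (use that gf sub set_link_subset in fastforce)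
  then have "map_link ?g ` map_link f ` links N = links N"
   by (force simp: image_iff)
  then show "map_link ?g ` links M = links N" using im by simp
  fix e assume "e \<in> edges M"
  then obtain x where x: "e = f x" "x \<in> edges N" using eM by auto
  have gx: "?g e = x" using x gf sub by auto
  show "lab N (?g e) = lab M e" using x gx lb by simp
  show "loc N (?g e) = map_option ?g (loc M e)"
  proof (cases "loc N x")
   case None then show ?thesis using x gx lc by simp
  next
   case (Some b)
   then have "b \<in> reach N" using x by (auto simp: reach_def)
   then show ?thesis using x gx lc Some gf by simp
  qed
 qed
qed

lemma siso_sym: "siso N M \<Longrightarrow> siso M N"
 unfolding siso_def using iso_by_inverse(1) by blast

lemma siso_trans: assumes "siso N M" "siso M K" shows "siso N K"
proof -
 obtain f g where f: "iso_by f N M" and g: "iso_by g M K" using assms by (auto simp: siso_def)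
 have e: "edges M = f ` edges N" using f by (rule iso_by_edges')
 have r: "reach M = f ` reach N" using f iso_by_reach by blast
 have "iso_by (g \<circ> f) N K" unfolding iso_by_def
 proof (intro conjI)
  show "inj_on (g \<circ> f) (reach N)" using f g r by (simp add: comp_inj_on iso_by_def)
  show "map_link (g \<circ> f) ` links N = links K"
   using f g by (simp add: iso_by_def map_link_comp[symmetric] image_image[symmetric])
 qed (use f g e in \<open>auto simp: iso_by_def option.map_comp\<close>)
 then show ?thesis by (auto simp: siso_def)
qed

text \<open>A step of \<open>beta\<close> keeps the type of edges, whereas reducts are computed on
  composite names. An injection between the types provides a representative of a given net on the
  names of the other side.\<close>

lemma siso_embed: assumes "inj (i :: 'e \<Rightarrow> 'f)" shows "\<exists>M :: 'f net. siso (N :: 'e net) M"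
proof -
 let ?M = "\<lparr>links = map_link i ` links N, lab = lab N \<circ> inv i, loc = map_option i \<circ> loc N \<circ> inv i\<rparr>"
 have "iso_by i N ?M" using assms by (auto simp: iso_by_def intro: inj_on_subset)
 then show ?thesis by (auto simp: siso_def)
qed

subsection \<open>Invariance of cut-elimination under renaming\<close>

text \<open>The axiom, unit, multiplicative and paragraph rules act on the set of links alone, so
  they commute with a renaming. The exponential rule also invents names: its compatibility with
  \<open>f\<close> is delegated to \<open>exp\<close>, and \<open>i\<close> supplies names for the
  reduct.\<close>

lemma beta_transport:
 fixes N :: "'e net" and M :: "'f net"
 assumes iso: "iso_by f N M" and i: "inj (i :: 'e \<Rightarrow> 'f)" and b: "beta N N'"
  and exp: "\<And>a b P w. \<lbrakk>CutL (Upair b w) \<in> links N; BangL a b \<in> links N; WhynotL P w \<in> links N\<rbrakk> \<Longrightarrow>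
   siso (exp_reduct N a b P w) (exp_reduct M (f a) (f b) (f |`| P) (f w))"
 shows "\<exists>M'. beta M M' \<and> siso N' M'"
proof -
 have inj: "inj_on f (reach N)" and im: "links M = map_link f ` links N"
  and lb: "\<And>e. e \<in> edges N \<Longrightarrow> lab M (f e) = lab N e"
  and lc: "\<And>e. e \<in> edges N \<Longrightarrow> loc M (f e) = map_option f (loc N e)"
  using iso by (auto simp: iso_by_def)
 have inM: "map_link f l \<in> links M" if "l \<in> links N" for l using im that by auto
 \<comment> \<open>Injectivity passes from edges to links, so that deleting a redex commutes with
   the renaming (\<open>diff\<close>).\<close>
 have minj: "map_link f l = map_link f l' \<Longrightarrow> l = l'" if "l \<in> links N" "l' \<in> links N" for l l'
 proof (rule link.inj_map_strong)
  fix x y assume "x \<in> set_link l" "y \<in> set_link l'" "f x = f y"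
  moreover have "set_link l \<subseteq> reach N" "set_link l' \<subseteq> reach N"
   using that by (auto simp: reach_def edges_eq)
  ultimately show "x = y" using inj by (auto simp: inj_on_def)
 qed
 have fin: "siso (N\<lparr>links := L\<rparr>) (M\<lparr>links := map_link f ` L\<rparr>)"
  if L: "(\<Union>l\<in>L. set_link l) \<subseteq> edges N" for L
 proof -
  have e: "edges (N\<lparr>links := L\<rparr>) \<subseteq> edges N" using L by (auto simp: edges_eq)
  then have "reach (N\<lparr>links := L\<rparr>) \<subseteq> reach N" by (auto simp: reach_def)
  then have "iso_by f (N\<lparr>links := L\<rparr>) (M\<lparr>links := map_link f ` L\<rparr>)"
   using e inj lb lc unfolding iso_by_def by (auto intro: inj_on_subset)
  then show ?thesis by (auto simp: siso_def)
 qed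
 have diff: "links M - map_link f ` K = map_link f ` (links N - K)" if "K \<subseteq> links N" for K
  using minj that unfolding im by blast
 from b show ?thesis
 proof cases
  case (axiom e k g)
  have eg: "f e \<noteq> f g"
  proof
   assume "f e = f g"
   then have "e = g" using inj axiom(2,3) unfolding reach_def inj_on_def edges_eq by fastforce
   then show False using axiom(4) by simp
  qed
  let ?K = "links N - {AxL (Upair e k), CutL (Upair k g)}"
  have E: "{e, g} \<subseteq> edges N" using axiom(2,3) by (force simp: edges_eq)
  \<comment> \<open>The substitution of \<open>g\<close> for \<open>e\<close> commutes with
    \<open>f\<close> because no other edge of \<open>N\<close> is sent to
    \<open>f e\<close>.\<close>
  have "map_link (id(f e := f g)) ` map_link f ` ?K = map_link f ` map_link (id(e := g)) ` ?K"
  proof -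
   have "map_link (id(f e := f g)) (map_link f l) = map_link f (map_link (id(e := g)) l)"
    if "l \<in> links N" for l
    unfolding map_link_comp
   proof (rule map_link_cong)
    fix x assume "x \<in> set_link l"
    then have "x \<in> reach N" "e \<in> reach N" using that E by (auto simp: reach_def edges_eq)
    then show "(id(f e := f g) \<circ> f) x = (f \<circ> id(e := g)) x" using inj by (auto simp: inj_on_def)
   qed
   then show ?thesis by (auto simp: image_image intro!: image_cong)
  qed
  moreover have "links M - {AxL (Upair (f e) (f k)), CutL (Upair (f k) (f g))} = map_link f ` ?K"
   using diff[of "{AxL (Upair e k), CutL (Upair k g)}"] axiom by simp
  ultimately have eq: "map_link (id(f e := f g)) ` (links M - {AxL (Upair (f e) (f k)), CutL (Upair (f k) (f g))}) =
    map_link f ` map_link (id(e := g)) ` ?K" by simp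
  have "beta M (M\<lparr>links := map_link f ` map_link (id(e := g)) ` ?K\<rparr>)"
   unfolding eq[symmetric] using inM[OF axiom(2)] inM[OF axiom(3)] eg by (intro beta.axiom) auto
  moreover have "siso N' (M\<lparr>links := map_link f ` map_link (id(e := g)) ` ?K\<rparr>)"
   unfolding axiom(1)
   by (rule fin) (use E in \<open>auto simp: link.set_map edges_eq\<close>)
  ultimately show ?thesis by blast
 next
  case (unit e k)
  let ?L = "links N - {CutL (Upair e k), OneL e, BotL k}"
  have "beta M (M\<lparr>links := map_link f ` ?L\<rparr>)"
   using beta.unit[of "f e" "f k" M] inM[OF unit(2)] inM[OF unit(3)] inM[OF unit(4)]
    diff[of "{CutL (Upair e k), OneL e, BotL k}"] unit by simp
  moreover have "siso N' (M\<lparr>links := map_link f ` ?L\<rparr>)"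
   unfolding unit(1) by (rule fin) (auto simp: edges_eq)
  ultimately show ?thesis by blast
 next
  case (mult e k p q r s)
  let ?L = "links N - {CutL (Upair e k), TensorL p q e, ParL r s k} \<union> {CutL (Upair p r), CutL (Upair q s)}"
  have "beta M (M\<lparr>links := map_link f ` ?L\<rparr>)"
   using beta.mult[of "f e" "f k" M "f p" "f q" "f r" "f s"] inM[OF mult(2)] inM[OF mult(3)] inM[OF mult(4)]
    diff[of "{CutL (Upair e k), TensorL p q e, ParL r s k}"] mult by (simp add: image_Un)
  moreover have "siso N' (M\<lparr>links := map_link f ` ?L\<rparr>)"
   unfolding mult(1) by (rule fin) (use mult in \<open>force simp: edges_eq\<close>)
  ultimately show ?thesis by blast
 next
  case (para e k p q)
  let ?L = "links N - {CutL (Upair e k), ParagraphL p e, ParagraphL q k} \<union> {CutL (Upair p q)}"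
  have "beta M (M\<lparr>links := map_link f ` ?L\<rparr>)"
   using beta.para[of "f e" "f k" M "f p" "f q"] inM[OF para(2)] inM[OF para(3)] inM[OF para(4)]
    diff[of "{CutL (Upair e k), ParagraphL p e, ParagraphL q k}"] para by (simp add: image_Un)
  moreover have "siso N' (M\<lparr>links := map_link f ` ?L\<rparr>)"
   unfolding para(1) by (rule fin) (use para in \<open>force simp: edges_eq\<close>)
  ultimately show ?thesis by blast
 next
  case (expo b w a P)
  \<comment> \<open>Every net isomorphic to the exponential reduct is a legal result of the step.
    Hence a copy of \<open>N'\<close> itself, on the names of \<open>M\<close>, can be
    chosen.\<close>
  obtain M' :: "'f net" where M': "siso N' M'" using siso_embed[OF i] by blast
  have "net_iso (exp_reduct M (f a) (f b) (f |`| P) (f w)) M'"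
   by (rule net_iso_trans[OF net_iso_trans[OF siso_net_iso[OF siso_sym[OF exp[OF expo(1-3)]]] expo(4)]
    siso_net_iso[OF M']])
  moreover have "CutL (Upair (f b) (f w)) \<in> links M" "BangL (f a) (f b) \<in> links M" "WhynotL (f |`| P) (f w) \<in> links M"
   using inM[OF expo(1)] inM[OF expo(2)] inM[OF expo(3)] by auto
  ultimately have "beta M M'" by (intro beta.expo[of "f b" "f w" M "f a" "f |`| P"])
  then show ?thesis using M' by blast
 qed
qed

section \<open>Renaming of the exponential reduct\<close>

definition threads_ok :: "'e net \<Rightarrow> 'e fset \<Rightarrow> bool" where
 "threads_ok N P \<longleftrightarrow> (\<forall>d\<in>fset P. \<exists>!z. z \<in> thread N d \<and> (\<exists>s. FlatL s z \<in> links N))"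

text \<open>\<open>threads_ok\<close> and \<open>pax_unique\<close> say that the two definite
  descriptions in \<open>exp_reduct\<close> denote: the top of a thread, and the premise of an
  auxiliary door with given conclusion. Where \<open>THE\<close> does not denote, its value need not
  follow a renaming.\<close>

definition pax_unique :: "'e net \<Rightarrow> bool" where
 "pax_unique N \<longleftrightarrow> (\<forall>x x' y. PaxL x y \<in> links N \<longrightarrow> PaxL x' y \<in> links N \<longrightarrow> x = x')"

lemma pax_edges: "pax_rel N x y \<Longrightarrow> x \<in> edges N \<and> y \<in> edges N"
 by (force simp: pax_rel_def edges_eq)

lemma thread_edges: "d \<in> edges N \<Longrightarrow> thread N d \<subseteq> edges N"
 by (auto simp: thread_def) (metis converse_rtranclpE pax_edges)

lemma below_edges: "below N b \<subseteq> edges N"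
proof
 fix z assume "z \<in> below N b"
 then obtain x y where "PaxL x y \<in> links N" and r: "(pax_rel N)\<^sup>*\<^sup>* y z"
  by (auto simp: below_def aux_doors_def)
 then have "y \<in> edges N" by (force simp: edges_eq)
 with r show "z \<in> edges N" by (induction) (auto dest: pax_edges)
qed

lemma thread_top_props:
 assumes "threads_ok N P" "d \<in> fset P"
 shows "thread_top N d \<in> thread N d" "\<exists>s. FlatL s (thread_top N d) \<in> links N"
  "\<And>z s. z \<in> thread N d \<Longrightarrow> FlatL s z \<in> links N \<Longrightarrow> thread_top N d = z"
proof -
 have u: "\<exists>!z. z \<in> thread N d \<and> (\<exists>s. FlatL s z \<in> links N)" using assms by (auto simp: threads_ok_def)
 from theI'[OF u] show "thread_top N d \<in> thread N d" "\<exists>s. FlatL s (thread_top N d) \<in> links N"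
  by (auto simp: thread_top_def)
 then show "\<And>z s. z \<in> thread N d \<Longrightarrow> FlatL s z \<in> links N \<Longrightarrow> thread_top N d = z" using u by blast
qed

lemma exp_reduct_lab:
 "lab (exp_reduct N a b P w) (Keep e) = lab N e"
 "lab (exp_reduct N a b P w) (Copy d e) = lab N e"
 "lab (exp_reduct N a b P w) (Strand d e z) = lab N e"
 unfolding exp_reduct_def net.select_convs redname.case by (rule refl)+

lemma exp_reduct_loc:
 "loc (exp_reduct N a b P w) (Keep e) = map_option Keep (loc N e)"
 "loc (exp_reduct N a b P w) (Copy d e) =
   (if e \<notin> inside N b then map_option Keep (loc N e)
   else if loc N e = Some b then map_option Keep (loc N (thread_top N d))
   else map_option (Copy d) (loc N e))"
 "loc (exp_reduct N a b P w) (Strand d e z) = map_option Keep (loc N z)"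
 unfolding exp_reduct_def net.select_convs redname.case by (rule refl)+

lemma Collect_image_eq:
 "(\<And>l. l \<in> L \<Longrightarrow> C' (g l) = C l) \<Longrightarrow> {m \<in> g ` L. C' m} = g ` {l \<in> L. C l}"
 by auto

text \<open>Threads, doors, contents and the edges below doors are all defined from
  \<open>links\<close> and \<open>loc\<close>, so \<open>f\<close> carries those of \<open>N\<close>
  to those of \<open>M\<close>; with the descriptions well defined, \<open>map_redname f\<close> is
  then an isomorphism between the reducts. Most of the work is to check that nothing in
  \<open>M\<close> lies outside the image of \<open>N\<close>.\<close>

lemma exp_equiv:
 assumes iso: "iso_by f N M" and bx: "boxed N" and pu: "pax_unique N" and th: "threads_ok N P"
  and cut: "CutL (Upair b w) \<in> links N" and bang: "BangL a b \<in> links N" and wn: "WhynotL P w \<in> links N"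
 shows "siso (exp_reduct N a b P w) (exp_reduct M (f a) (f b) (f |`| P) (f w))"
proof -
 let ?E = "edges N"
 have inj: "inj_on f ?E" and im: "links M = map_link f ` links N"
  and lb: "\<And>e. e \<in> ?E \<Longrightarrow> lab M (f e) = lab N e"
  and lc: "\<And>e. e \<in> ?E \<Longrightarrow> loc M (f e) = map_option f (loc N e)"
  using iso boxed_reach[OF bx] by (auto simp: iso_by_def)
 have fE: "f x = f y \<longleftrightarrow> x = y" if "x \<in> ?E" "y \<in> ?E" for x y using inj that by (auto simp: inj_on_def)
 have eM: "edges M = f ` ?E" using iso by (rule iso_by_edges')
 have fmem: "f x \<in> f ` B \<Longrightarrow> B \<subseteq> ?E \<Longrightarrow> x \<in> ?E \<Longrightarrow> x \<in> B" for x B using fE by blast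
 have E: "set_link l \<subseteq> ?E" if "l \<in> links N" for l using that by (auto simp: edges_eq)
 have abw: "a \<in> ?E" "b \<in> ?E" "w \<in> ?E" "fset P \<subseteq> ?E" using E[OF bang] E[OF wn] by auto
 have locE: "loc N e = Some c \<Longrightarrow> e \<in> ?E \<Longrightarrow> c \<in> ?E" for e c using bx by (auto simp: boxed_def)
 have inM: "map_link f l \<in> links M" if "l \<in> links N" for l using im that by auto
 have flatM: "FlatL s z \<in> links M \<longleftrightarrow> (\<exists>s' z'. s = f s' \<and> z = f z' \<and> FlatL s' z' \<in> links N)" for s z
  unfolding im mem_map_link_iffs by blast
 have paxM: "PaxL s z \<in> links M \<longleftrightarrow> (\<exists>s' z'. s = f s' \<and> z = f z' \<and> PaxL s' z' \<in> links N)" for s z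
  unfolding im mem_map_link_iffs by blast
 have wnM: "WhynotL Q z \<in> links M \<longleftrightarrow> (\<exists>Q' z'. Q = f |`| Q' \<and> z = f z' \<and> WhynotL Q' z' \<in> links N)" for Q z
  unfolding im mem_map_link_iffs by blast
 have flatE: "FlatL s z \<in> links N \<Longrightarrow> s \<in> ?E \<and> z \<in> ?E" for s z using E by fastforce
 have paxE: "PaxL s z \<in> links N \<Longrightarrow> s \<in> ?E \<and> z \<in> ?E" for s z using E by fastforce
 have wnE: "WhynotL Q z \<in> links N \<Longrightarrow> fset Q \<subseteq> ?E \<and> z \<in> ?E" for Q z using E by fastforce
 have flatM': "FlatL (f s) (f z) \<in> links M \<longleftrightarrow> FlatL s z \<in> links N" if "s \<in> ?E" "z \<in> ?E" for s z
  using that flatM flatE fE by metis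
 have pr: "pax_rel M x y \<longleftrightarrow> (\<exists>x' y'. x = f x' \<and> y = f y' \<and> pax_rel N x' y')" for x y
  by (simp add: pax_rel_def paxM)
 have prE: "pax_rel N x y \<Longrightarrow> x \<in> ?E \<and> y \<in> ?E" for x y by (rule pax_edges)
 have up: "(pax_rel N)\<^sup>*\<^sup>* x y \<Longrightarrow> (pax_rel M)\<^sup>*\<^sup>* (f x) (f y)" for x y
  by (induction rule: rtranclp_induct) (auto simp: pr intro: rtranclp.rtrancl_into_rtrancl)
 \<comment> \<open>Chains of pax links in \<open>M\<close> lift to \<open>N\<close>: each link of
   the chain comes from \<open>N\<close>, and injectivity makes consecutive preimages meet. The same
   holds downwards in \<open>fwd\<close>, and for chains of boxes in \<open>lback\<close>.\<close>
 have bwd: "(pax_rel M)\<^sup>*\<^sup>* u v \<Longrightarrow> v = f d \<Longrightarrow> d \<in> ?E \<Longrightarrow> \<exists>z\<in>?E. u = f z \<and> (pax_rel N)\<^sup>*\<^sup>* z d" for u v d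
 proof (induction rule: converse_rtranclp_induct)
  case (step y z)
  then obtain z' where z': "z' \<in> ?E" "z = f z'" "(pax_rel N)\<^sup>*\<^sup>* z' d" by auto
  obtain y1 z1 where y1: "y = f y1" "z = f z1" "pax_rel N y1 z1" using step(1) pr by auto
  then have "z1 = z'" using z' fE prE by metis
  then show ?case using y1 z' prE by (metis converse_rtranclp_into_rtranclp)
 qed auto
 have fwd: "(pax_rel M)\<^sup>*\<^sup>* u v \<Longrightarrow> u = f d \<Longrightarrow> d \<in> ?E \<Longrightarrow> \<exists>z\<in>?E. v = f z \<and> (pax_rel N)\<^sup>*\<^sup>* d z" for u v d
 proof (induction rule: rtranclp_induct)
  case (step y z)
  then obtain z' where z': "z' \<in> ?E" "y = f z'" "(pax_rel N)\<^sup>*\<^sup>* d z'" by auto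
  obtain y1 z1 where y1: "y = f y1" "z = f z1" "pax_rel N y1 z1" using step(2) pr by auto
  then have "y1 = z'" using z' fE prE by metis
  then show ?case using y1 z' prE by (metis rtranclp.rtrancl_into_rtrancl)
 qed auto
 have thr: "thread M (f d) = f ` thread N d" if "d \<in> ?E" for d
  using that up bwd by (fastforce simp: thread_def)
 have thrE: "thread N d \<subseteq> ?E" if "d \<in> ?E" for d using that by (rule thread_edges)
 have top: "thread_top M (f d) = f (thread_top N d)" if "d \<in> fset P" for d
 proof -
  note t = thread_top_props[OF th that]
  have d: "d \<in> ?E" using that abw by auto
  show ?thesis unfolding thread_top_def[of M]
  proof (rule the_equality)
   show "f (thread_top N d) \<in> thread M (f d) \<and> (\<exists>s. FlatL s (f (thread_top N d)) \<in> links M)"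
    using t thr[OF d] flatM by blast
   fix z assume z: "z \<in> thread M (f d) \<and> (\<exists>s. FlatL s z \<in> links M)"
   then obtain z' where z': "z = f z'" "z' \<in> thread N d" using thr[OF d] by auto
   moreover obtain s where "FlatL s z' \<in> links N" using z z' flatM flatE fE thrE[OF d] by (metis subsetD)
   ultimately show "z = f (thread_top N d)" using t(3) by auto
  qed
 qed
 have topE: "thread_top N d \<in> ?E" if "d \<in> fset P" for d
  using thread_top_props(1)[OF th that] thrE abw that by blast
 have lup: "(\<lambda>x y. loc N x = Some y)\<^sup>+\<^sup>+ x y \<Longrightarrow> x \<in> ?E \<Longrightarrow> y \<in> ?E \<and> (\<lambda>x y. loc M x = Some y)\<^sup>+\<^sup>+ (f x) (f y)" for x y
 proof (induction rule: tranclp_induct)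
  case (step y z)
  then have "loc M (f y) = Some (f z)" "z \<in> ?E" using locE lc by auto
  then show ?case using step by (auto intro: tranclp.trancl_into_trancl)
 qed (use locE lc in auto)
 have lback: "(\<lambda>x y. loc M x = Some y)\<^sup>+\<^sup>+ u v \<Longrightarrow> u = f x \<Longrightarrow> x \<in> ?E \<Longrightarrow>
   \<exists>y\<in>?E. v = f y \<and> (\<lambda>x y. loc N x = Some y)\<^sup>+\<^sup>+ x y" for u v x
 proof (induction rule: tranclp_induct)
  case (base y)
  then show ?case using lc locE by fastforce
 next
  case (step y z)
  then obtain y' where y': "y' \<in> ?E" "y = f y'" "(\<lambda>x y. loc N x = Some y)\<^sup>+\<^sup>+ x y'" by auto
  then obtain z' where "loc N y' = Some z'" "z = f z'" using step(2) lc by auto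
  then show ?case using y' locE by (metis (mono_tags, lifting) tranclp.trancl_into_trancl)
 qed
 have ins: "inside M (f b) = f ` inside N b"
 proof (intro set_eqI iffI)
  fix v assume v: "v \<in> inside M (f b)"
  then obtain x where x: "v = f x" "x \<in> ?E" unfolding inside_def eM by blast
  with v have "(\<lambda>x y. loc M x = Some y)\<^sup>+\<^sup>+ (f x) (f b)" unfolding inside_def by blast
  from lback[OF this refl x(2)] obtain y where "y \<in> ?E" "f b = f y" "(\<lambda>x y. loc N x = Some y)\<^sup>+\<^sup>+ x y" by blast
  then show "v \<in> f ` inside N b" using x fE[OF abw(2)] unfolding inside_def by blast
 next
  fix v assume "v \<in> f ` inside N b"
  then show "v \<in> inside M (f b)" using lup unfolding inside_def eM by blast
 qed
 have insE: "inside N b \<subseteq> ?E" by (auto simp: inside_def)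
 have aux: "aux_doors M (f b) = map_prod f f ` aux_doors N b"
 proof (intro set_eqI iffI)
  fix u assume "u \<in> aux_doors M (f b)"
  then obtain x y where x: "u = (f x, f y)" "PaxL x y \<in> links N" "loc M (f x) = Some (f b)"
   unfolding aux_doors_def paxM by blast
  then obtain c where c: "loc N x = Some c" "f c = f b" using lc paxE by fastforce
  then have "c = b" using fE abw(2) locE paxE x(2) by metis
  then show "u \<in> map_prod f f ` aux_doors N b" using x c by (force simp: aux_doors_def)
 next
  fix u assume "u \<in> map_prod f f ` aux_doors N b"
  then show "u \<in> aux_doors M (f b)" using lc paxE unfolding aux_doors_def paxM by fastforce
 qed
 have auxE: "(x, y) \<in> aux_doors N b \<Longrightarrow> x \<in> ?E \<and> y \<in> ?E" for x y using paxE by (auto simp: aux_doors_def)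
 have bel: "below M (f b) = f ` below N b"
 proof (intro set_eqI iffI)
  fix v assume "v \<in> below M (f b)"
  then obtain x y where x: "(x, y) \<in> aux_doors N b" "(pax_rel M)\<^sup>*\<^sup>* (f y) v"
   unfolding below_def aux by auto
  with fwd[OF x(2) refl] auxE obtain z where "v = f z" "(pax_rel N)\<^sup>*\<^sup>* y z" by blast
  then show "v \<in> f ` below N b" using x(1) unfolding below_def by blast
 next
  fix v assume "v \<in> f ` below N b"
  then obtain x y z where x: "(x, y) \<in> aux_doors N b" "(pax_rel N)\<^sup>*\<^sup>* y z" "v = f z"
   unfolding below_def by auto
  then have "(f x, f y) \<in> aux_doors M (f b)" unfolding aux by force
  then show "v \<in> below M (f b)" using up x unfolding below_def by blast
 qed
 have belE: "below N b \<subseteq> ?E" by (rule below_edges)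
 let ?F = "map_redname f"
 \<comment> \<open>A set of names containing all edges of the reduct and all its box names. It is
   built from edges of \<open>N\<close> only, so that \<open>?F\<close> inherits injectivity from
   \<open>f\<close>.\<close>
 let ?R = "Keep ` ?E \<union> {Copy d e | d e. d \<in> fset P \<and> e \<in> ?E} \<union> {Strand d x z | d x z. d \<in> fset P \<and> x \<in> ?E \<and> z \<in> ?E}"
 have RE: "set_redname u \<subseteq> ?E" if "u \<in> ?R" for u using that abw(4) by auto
 have Finj: "inj_on ?F ?R"
 proof (rule inj_onI)
  fix u v assume "u \<in> ?R" "v \<in> ?R" "?F u = ?F v"
  then show "u = v" using RE[of u] RE[of v] fE by (intro redname.inj_map_strong[of u v f f]) blast+
 qed
 have str: "strand M (f d) (f x) (f z) = ?F (strand N d x z)" if "d \<in> fset P" "z \<in> ?E" for d x z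
  using top[OF that(1)] fE topE[OF that(1)] that by (auto simp: strand_def)
 have strR: "strand N d x z \<in> ?R" if "d \<in> fset P" "x \<in> ?E" "z \<in> ?E" for d x z
  using that by (auto simp: strand_def)
 have theN: "(THE x. (x, z) \<in> aux_doors N b) = x" if "(x, z) \<in> aux_doors N b" for x z
  using that pu by (intro the_equality) (auto simp: aux_doors_def pax_unique_def)
 have theM: "(THE x. (x, f z) \<in> aux_doors M (f b)) = f x" if "(x, z) \<in> aux_doors N b" for x z
 proof (rule the_equality)
  show "(f x, f z) \<in> aux_doors M (f b)" using that unfolding aux by force
  fix u assume "(u, f z) \<in> aux_doors M (f b)"
  then obtain x' z' where u: "u = f x'" "f z = f z'" "(x', z') \<in> aux_doors N b" unfolding aux by auto
  then have "z' = z" using that auxE fE by metis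
  then have "x' = x" using u(3) that pu unfolding aux_doors_def pax_unique_def by blast
  then show "u = f x" using u by simp
 qed
 have bc: "below_copy M (f b) (f d) (f z) = ?F (below_copy N b d z)" if "d \<in> fset P" "z \<in> ?E" for d z
 proof (cases "\<exists>x. (x, z) \<in> aux_doors N b")
  case True
  then obtain x where x: "(x, z) \<in> aux_doors N b" by auto
  then have xM: "(f x, f z) \<in> aux_doors M (f b)" unfolding aux by force
  have "d \<in> ?E" using that abw by auto
  then show ?thesis using x xM theN[OF x] theM[OF x] str[OF that(1), of d x] by (auto simp: below_copy_def)
 next
  case False
  moreover have "\<nexists>x. (x, f z) \<in> aux_doors M (f b)"
   using False that(2) auxE fE unfolding aux by auto
  ultimately show ?thesis by (simp add: below_copy_def)
 qed
 have bcR: "below_copy N b d z \<in> ?R" if "d \<in> fset P" "z \<in> ?E" for d z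
 proof (cases "\<exists>x. (x, z) \<in> aux_doors N b")
  case True
  then obtain x where x: "(x, z) \<in> aux_doors N b" by auto
  then show ?thesis using theN[OF x] strR[of d x d] that abw(4) auxE[OF x] unfolding below_copy_def by auto
 qed (use that in \<open>auto simp: below_copy_def\<close>)
 let ?X = "exp_reduct N a b P w" and ?Y = "exp_reduct M (f a) (f b) (f |`| P) (f w)"
 let ?T = "\<Union>d\<in>fset P. thread N d"
 have TE: "?T \<subseteq> ?E" using thrE abw by blast
 have TM: "(\<Union>d\<in>fset (f |`| P). thread M d) = f ` ?T"
 proof -
  have "thread M (f d) = f ` thread N d" if "d \<in> fset P" for d using thr that abw by blast
  then show ?thesis by (simp add: image_UN)
 qed
 have disj: "f ` A \<inter> f ` B = {} \<longleftrightarrow> A \<inter> B = {}" if "A \<subseteq> ?E" "B \<subseteq> ?E" for A B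
  using inj_on_image_Int[OF inj that] by (metis image_is_empty)
 have sub: "f ` A \<subseteq> f ` B \<longleftrightarrow> A \<subseteq> B" if "A \<subseteq> ?E" "B \<subseteq> ?E" for A B
  using that fE by blast
 have minj: "map_link f l = map_link f l' \<longleftrightarrow> l = l'" if "l \<in> links N" "l' \<in> links N" for l l'
  using link.inj_map_strong[of l l' f f] E[OF that(1)] E[OF that(2)] fE by blast
 have prE': "prems l \<subseteq> ?E" and coE': "concls l \<subseteq> ?E" if "l \<in> links N" for l
  using E[OF that] by (auto simp: set_link_eq)
 have FK: "map_link ?F (map_link Keep l) = map_link Keep (map_link f l)" for l
  unfolding map_link_comp by (rule map_link_cong) simp
 have FKS: "map_link ?F ` map_link Keep ` S = map_link Keep ` map_link f ` S" for S
  by (simp add: image_image FK)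
 have FC: "map_link ?F (map_link (Copy d) l) = map_link (Copy (f d)) (map_link f l)" for d l
  unfolding map_link_comp by (rule map_link_cong) simp
 \<comment> \<open>The links of \<open>exp_reduct\<close> form a union of six families, which are
   transported one at a time in \<open>K1\<close> to \<open>K6\<close>.\<close>
 have K1: "map_link ?F ` map_link Keep ` {l \<in> links N. l \<notin> {CutL (Upair b w), BangL a b, WhynotL P w} \<and>
     concls l \<inter> ?T = {} \<and> (prems l \<union> concls l) \<inter> inside N b = {} \<and> prems l \<inter> below N b = {}} =
   map_link Keep ` {l \<in> links M. l \<notin> {CutL (Upair (f b) (f w)), BangL (f a) (f b), WhynotL (f |`| P) (f w)} \<and>
     concls l \<inter> (\<Union>d\<in>fset (f |`| P). thread M d) = {} \<and>
     (prems l \<union> concls l) \<inter> inside M (f b) = {} \<and> prems l \<inter> below M (f b) = {}}"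
  (is "_ ` _ ` ?A = _ ` ?B")
 proof -
  have "(map_link f l \<notin> {CutL (Upair (f b) (f w)), BangL (f a) (f b), WhynotL (f |`| P) (f w)} \<and>
     concls (map_link f l) \<inter> f ` ?T = {} \<and>
     (prems (map_link f l) \<union> concls (map_link f l)) \<inter> f ` inside N b = {} \<and> prems (map_link f l) \<inter> f ` below N b = {}) \<longleftrightarrow>
    (l \<notin> {CutL (Upair b w), BangL a b, WhynotL P w} \<and>
     concls l \<inter> ?T = {} \<and> (prems l \<union> concls l) \<inter> inside N b = {} \<and> prems l \<inter> below N b = {})"
   if l: "l \<in> links N" for l
  proof -
   have 1: "map_link f l \<notin> {CutL (Upair (f b) (f w)), BangL (f a) (f b), WhynotL (f |`| P) (f w)} \<longleftrightarrow>
     l \<notin> {CutL (Upair b w), BangL a b, WhynotL P w}"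
    using minj[OF l cut] minj[OF l bang] minj[OF l wn] by simp
   have 2: "(f ` prems l \<union> f ` concls l) \<inter> f ` inside N b = {} \<longleftrightarrow> (prems l \<union> concls l) \<inter> inside N b = {}"
    unfolding image_Un[symmetric] by (rule disj[OF _ insE]) (use prE'[OF l] coE'[OF l] in blast)
   show ?thesis by (simp only: prems_map concls_map 1 2 disj[OF coE'[OF l] TE] disj[OF prE'[OF l] belE])
  qed
  note eqv = this
  have "?B = map_link f ` ?A" unfolding TM ins bel im
   by (rule Collect_image_eq) (rule eqv)
  from this[symmetric] show ?thesis unfolding FKS by (rule arg_cong)
 qed
 have K2: "map_link ?F ` (\<Union>d\<in>fset P. map_link (Copy d) ` {l \<in> links N. prems l \<union> concls l \<subseteq> inside N b}) =
   (\<Union>d\<in>fset (f |`| P). map_link (Copy d) ` {l \<in> links M. prems l \<union> concls l \<subseteq> inside M (f b)})"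
 proof -
  have "prems (map_link f l) \<union> concls (map_link f l) \<subseteq> f ` inside N b \<longleftrightarrow> prems l \<union> concls l \<subseteq> inside N b"
   if l: "l \<in> links N" for l
   unfolding prems_map concls_map image_Un[symmetric] by (rule sub[OF _ insE]) (use prE'[OF l] coE'[OF l] in blast)
  then have "{l \<in> links M. prems l \<union> concls l \<subseteq> inside M (f b)} =
   map_link f ` {l \<in> links N. prems l \<union> concls l \<subseteq> inside N b}" unfolding ins im
   by (intro Collect_image_eq)
  then show ?thesis by (simp add: image_UN image_image FC)
 qed
 have K3: "map_link ?F ` {CutL (Upair (Keep s) (Copy d a)) | s d. d \<in> fset P \<and> FlatL s (thread_top N d) \<in> links N} =
   {CutL (Upair (Keep s) (Copy d (f a))) | s d. d \<in> fset (f |`| P) \<and> FlatL s (thread_top M d) \<in> links M}"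
  (is "_ ` ?A = ?B")
 proof (intro set_eqI iffI)
  fix l assume "l \<in> map_link ?F ` ?A"
  then obtain s d where "l = CutL (Upair (Keep (f s)) (Copy (f d) (f a)))" "d \<in> fset P"
   "FlatL s (thread_top N d) \<in> links N" by auto
  then show "l \<in> ?B" using top flatM by fastforce
 next
  fix l assume "l \<in> ?B"
  then obtain s d where l: "l = CutL (Upair (Keep s) (Copy (f d) (f a)))" "d \<in> fset P"
   "FlatL s (f (thread_top N d)) \<in> links M" using top by auto
  then obtain s' where "s = f s'" "FlatL s' (thread_top N d) \<in> links N"
   using flatM flatE topE fE by metis
  then show "l \<in> map_link ?F ` ?A" using l by (force simp: image_iff)
 qed
 have K4: "map_link ?F ` {PaxL (strand N d x z) (strand N d x z') | d x y z z'.
     d \<in> fset P \<and> (x, y) \<in> aux_doors N b \<and> z' \<in> thread N d \<and> PaxL z z' \<in> links N} =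
   {PaxL (strand M d x z) (strand M d x z') | d x y z z'.
     d \<in> fset (f |`| P) \<and> (x, y) \<in> aux_doors M (f b) \<and> z' \<in> thread M d \<and> PaxL z z' \<in> links M}"
  (is "_ ` ?A = ?B")
 proof (intro set_eqI iffI)
  fix l assume "l \<in> map_link ?F ` ?A"
  then obtain d x y z z' where h: "l = map_link ?F (PaxL (strand N d x z) (strand N d x z'))"
   "d \<in> fset P" "(x, y) \<in> aux_doors N b" "z' \<in> thread N d" "PaxL z z' \<in> links N" by blast
  then have "l = PaxL (strand M (f d) (f x) (f z)) (strand M (f d) (f x) (f z'))"
   using str paxE by simp
  moreover have "f d \<in> fset (f |`| P)" "(f x, f y) \<in> aux_doors M (f b)" "f z' \<in> thread M (f d)" "PaxL (f z) (f z') \<in> links M"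
   using h(2) apply simp
   using h(3) unfolding aux apply force
   using h(2,4) thr abw apply blast
   using h(5) paxM apply blast
   done
  ultimately show "l \<in> ?B" by blast
 next
  fix l assume "l \<in> ?B"
  then obtain d x y z z' where h: "l = PaxL (strand M (f d) (f x) z) (strand M (f d) (f x) z')"
   "d \<in> fset P" "(x, y) \<in> aux_doors N b" "z' \<in> thread M (f d)" "PaxL z z' \<in> links M" using aux by auto
  then obtain t t' where t: "z = f t" "z' = f t'" "PaxL t t' \<in> links N" using paxM by blast
  have dE: "d \<in> ?E" using h abw by auto
  have "t' \<in> thread N d"
   by (rule fmem[OF _ thrE[OF dE]]) (use h(4) thr[OF dE] t paxE in auto)
  moreover have "l = map_link ?F (PaxL (strand N d x t) (strand N d x t'))"
   using h t str paxE by simp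
  ultimately show "l \<in> map_link ?F ` ?A" using h t by blast
 qed
 have K5: "map_link ?F ` {PaxL (below_copy N b d z) (below_copy N b d z') | d z z'.
     d \<in> fset P \<and> z \<in> below N b \<and> PaxL z z' \<in> links N} =
   {PaxL (below_copy M (f b) d z) (below_copy M (f b) d z') | d z z'.
     d \<in> fset (f |`| P) \<and> z \<in> below M (f b) \<and> PaxL z z' \<in> links M}"
  (is "_ ` ?A = ?B")
 proof (intro set_eqI iffI)
  fix l assume "l \<in> map_link ?F ` ?A"
  then obtain d z z' where h: "l = map_link ?F (PaxL (below_copy N b d z) (below_copy N b d z'))"
   "d \<in> fset P" "z \<in> below N b" "PaxL z z' \<in> links N" by blast
  then have "l = PaxL (below_copy M (f b) (f d) (f z)) (below_copy M (f b) (f d) (f z'))"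
   using bc paxE by simp
  moreover have "f d \<in> fset (f |`| P)" "f z \<in> below M (f b)" "PaxL (f z) (f z') \<in> links M"
   using h(2) apply simp
   using h(3) unfolding bel apply blast
   using h(4) paxM apply blast
   done
  ultimately show "l \<in> ?B" by blast
 next
  fix l assume "l \<in> ?B"
  then obtain d z z' where h: "l = PaxL (below_copy M (f b) (f d) z) (below_copy M (f b) (f d) z')"
   "d \<in> fset P" "z \<in> below M (f b)" "PaxL z z' \<in> links M" by auto
  then obtain t t' where t: "z = f t" "z' = f t'" "PaxL t t' \<in> links N" using paxM by blast
  have "t \<in> below N b" by (rule fmem[OF _ belE]) (use h(3) bel t paxE in auto)
  moreover have "l = map_link ?F (PaxL (below_copy N b d t) (below_copy N b d t'))"
   using h t bc paxE by simp
  ultimately show "l \<in> map_link ?F ` ?A" using h t by blast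
 qed
 let ?W = "\<lambda>Q. Keep ` (fset Q - below N b) \<union> (\<Union>d\<in>fset P. below_copy N b d ` (fset Q \<inter> below N b))"
 let ?W' = "\<lambda>Q. Keep ` (fset Q - below M (f b)) \<union> (\<Union>d\<in>fset (f |`| P). below_copy M (f b) d ` (fset Q \<inter> below M (f b)))"
 have W: "?W' (f |`| Q) = ?F ` ?W Q" if "fset Q \<subseteq> ?E" for Q
 proof -
  have "f ` fset Q - f ` below N b = f ` (fset Q - below N b)"
   using inj_on_image_set_diff[OF inj _ belE, of "fset Q"] that by auto
  moreover have "f ` fset Q \<inter> f ` below N b = f ` (fset Q \<inter> below N b)"
   using inj_on_image_Int[OF inj that belE] by simp
  moreover have "below_copy M (f b) (f d) ` f ` (fset Q \<inter> below N b) = ?F ` below_copy N b d ` (fset Q \<inter> below N b)"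
   if "d \<in> fset P" for d
   using bc[OF that] \<open>fset Q \<subseteq> ?E\<close> by (auto simp: image_image intro!: image_cong)
  ultimately show ?thesis by (simp add: bel image_Un image_UN image_image)
 qed
 have K6: "map_link ?F ` {WhynotL R (Keep v) | R Q v. WhynotL Q v \<in> links N \<and> fset Q \<inter> below N b \<noteq> {} \<and> fset R = ?W Q} =
   {WhynotL R (Keep v) | R Q v. WhynotL Q v \<in> links M \<and> fset Q \<inter> below M (f b) \<noteq> {} \<and> fset R = ?W' Q}"
  (is "_ ` ?A = ?B")
 proof (intro set_eqI iffI)
  fix l assume "l \<in> map_link ?F ` ?A"
  then obtain k where k: "l = map_link ?F k" "k \<in> ?A" by (rule imageE)
  then obtain R Q v where R: "k = WhynotL R (Keep v)" and h': "WhynotL Q v \<in> links N"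
   "fset Q \<inter> below N b \<noteq> {}" "fset R = ?W Q"
   using k(2) unfolding mem_Collect_eq by (elim exE conjE) (rule that)
  have h: "l = WhynotL (?F |`| R) (Keep (f v))" using k(1) R by simp
  note h = h h'
  have QE: "fset Q \<subseteq> ?E" using wnE[OF h(2)] by simp
  have "WhynotL (f |`| Q) (f v) \<in> links M" using h(2) wnM by blast
  moreover have "fset (f |`| Q) \<inter> below M (f b) \<noteq> {}" using h(3) bel by auto
  moreover have "fset (?F |`| R) = ?W' (f |`| Q)" using W[OF QE] h(4) by simp
  ultimately show "l \<in> ?B" unfolding h(1) mem_Collect_eq by (intro exI conjI) (rule refl)
 next
  fix l assume "l \<in> ?B"
  then obtain R Q0 v0 where h0: "l = WhynotL R (Keep v0)" "WhynotL Q0 v0 \<in> links M"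
   "fset Q0 \<inter> below M (f b) \<noteq> {}" "fset R = ?W' Q0"
   unfolding mem_Collect_eq by (elim exE conjE) (rule that)
  from h0(2) obtain Q v where "Q0 = f |`| Q" "v0 = f v" "WhynotL Q v \<in> links N" unfolding wnM by blast
  with h0 have h: "l = WhynotL R (Keep (f v))" "WhynotL Q v \<in> links N"
   "fset (f |`| Q) \<inter> below M (f b) \<noteq> {}" "fset R = ?W' (f |`| Q)" by (simp_all only: not_False_eq_True)
  have QE: "fset Q \<subseteq> ?E" using wnE[OF h(2)] by simp
  \<comment> \<open>The premises of the why not link of the reduct are given only through their set;
    finiteness of \<open>P\<close> and \<open>Q\<close> makes that set an
    \<open>fset\<close>.\<close>
  obtain R' where R': "fset R' = ?W Q" using finite_fset
   by (intro that[of "Abs_fset (?W Q)"] Abs_fset_inverse) auto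
  have "R = ?F |`| R'" using h(4) R' W[OF QE] by (metis fimage.rep_eq fset_inject)
  moreover have "fset Q \<inter> below N b \<noteq> {}"
   using h(3) unfolding bel fimage.rep_eq using disj[OF QE belE] by simp
  ultimately have l: "l = map_link ?F (WhynotL R' (Keep v))" and n: "fset Q \<inter> below N b \<noteq> {}"
   using h(1) by auto
  have "WhynotL R' (Keep v) \<in> ?A" unfolding mem_Collect_eq
   using h(2) n R' by (intro exI conjI) (rule refl)
  then show "l \<in> map_link ?F ` ?A" unfolding l by (rule imageI)
 qed
 have links: "map_link ?F ` links ?X = links ?Y"
  unfolding exp_reduct_def net.simps image_Un K1 K2 K3 K4 K5 K6 ..
 have lR: "set_link l \<subseteq> ?R" if "l \<in> links ?X" for l
 proof -
  have 1: "set_link (map_link Keep l) \<subseteq> ?R" if "l \<in> links N" for l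
   using E[OF that] by (auto simp: link.set_map)
  have 2: "set_link (map_link (Copy d) l) \<subseteq> ?R" if "l \<in> links N" "d \<in> fset P" for l d
   using E[OF that(1)] that(2) by (auto simp: link.set_map)
  have 3: "set_link (CutL (Upair (Keep s) (Copy d a))) \<subseteq> ?R"
   if "d \<in> fset P" "FlatL s z \<in> links N" for s d z
   using flatE[OF that(2)] that(1) abw by auto
  have 4: "set_link (PaxL (strand N d x z) (strand N d x z')) \<subseteq> ?R"
   if "d \<in> fset P" "(x, y) \<in> aux_doors N b" "PaxL z z' \<in> links N" for d x y z z'
   using strR[of d x z] strR[of d x z'] auxE[OF that(2)] paxE[OF that(3)] that(1) by (simp del: Un_iff)
  have 5: "set_link (PaxL (below_copy N b d z) (below_copy N b d z')) \<subseteq> ?R"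
   if "d \<in> fset P" "PaxL z z' \<in> links N" for d z z'
   using bcR[of d z] bcR[of d z'] paxE[OF that(2)] that(1) by (simp del: Un_iff)
  have 6: "set_link (WhynotL R (Keep v)) \<subseteq> ?R" if "WhynotL Q v \<in> links N" "fset R = ?W Q" for R Q v
  proof -
   have "below_copy N b d z \<in> ?R" if "d \<in> fset P" "z \<in> fset Q" for d z
    using bcR[OF that(1)] that(2) wnE[OF \<open>WhynotL Q v \<in> links N\<close>] by blast
   then have "?W Q \<subseteq> ?R" using wnE[OF that(1)] by blast
   moreover have "Keep v \<in> ?R" using wnE[OF that(1)] by blast
   moreover have "set_link (WhynotL R (Keep v)) = insert (Keep v) (?W Q)" using that(2) by auto
   ultimately show ?thesis by (simp only: insert_subset simp_thms)
  qed
  show ?thesis using that unfolding exp_reduct_def net.simps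
   apply (elim UnE)
   subgoal by (elim imageE CollectE conjE, hypsubst, rule 1, assumption)
   subgoal by (elim UN_E imageE CollectE conjE, hypsubst, rule 2, assumption+)
   subgoal by (elim CollectE exE conjE, hypsubst, rule 3, assumption+)
   subgoal by (elim CollectE exE conjE, hypsubst, rule 4, assumption+)
   subgoal by (elim CollectE exE conjE, hypsubst, rule 5, assumption+)
   subgoal by (elim CollectE exE conjE, hypsubst, rule 6, assumption+)
   done
 qed
 have eR: "edges ?X \<subseteq> ?R" unfolding edges_eq[of ?X] by (intro UN_least) (rule lR)
 have insM: "f e \<in> inside M (f b) \<longleftrightarrow> e \<in> inside N b" if "e \<in> ?E" for e
  unfolding ins using that insE fmem by blast
 have labX: "lab ?Y (?F u) = lab ?X u" and
  locX: "loc ?Y (?F u) = map_option ?F (loc ?X u) \<and> (\<forall>v. loc ?X u = Some v \<longrightarrow> v \<in> ?R)" if u: "u \<in> ?R" for u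
 proof -
  consider (1) e where "u = Keep e" "e \<in> ?E" | (2) d e where "u = Copy d e" "d \<in> fset P" "e \<in> ?E"
   | (3) d x z where "u = Strand d x z" "x \<in> ?E" "z \<in> ?E" using u by blast
  then have "lab ?Y (?F u) = lab ?X u \<and> loc ?Y (?F u) = map_option ?F (loc ?X u) \<and>
   (\<forall>v. loc ?X u = Some v \<longrightarrow> v \<in> ?R)"
  proof cases
   case 1 then show ?thesis
    using locE by (auto simp: exp_reduct_lab exp_reduct_loc lb lc option.map_comp comp_def)
  next
   case 2
   have c: "loc M (f e) = Some (f b) \<longleftrightarrow> loc N e = Some b"
    using lc[OF 2(3)] locE[OF _ 2(3)] fE abw(2) by auto
   have l: "loc M (f e) = map_option f (loc N e)" "loc M (f (thread_top N d)) = map_option f (loc N (thread_top N d))"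
    using lc 2(3) topE[OF 2(2)] by blast+
   have "v \<in> ?R" if "loc ?X u = Some v" for v
    using that 2(1,2) locE[OF _ 2(3)] locE[OF _ topE[OF 2(2)]]
    unfolding 2(1) exp_reduct_loc by (auto split: if_splits)
   moreover have "loc ?Y (?F u) = map_option ?F (loc ?X u)"
    unfolding 2(1) redname.map exp_reduct_loc insM[OF 2(3)] c top[OF 2(2)]
    unfolding l
    by (simp add: option.map_comp comp_def)
   ultimately show ?thesis using 2(3) unfolding 2(1) by (simp add: exp_reduct_lab lb)
  next
   case 3 then show ?thesis
    using locE by (auto simp: exp_reduct_lab exp_reduct_loc lb lc option.map_comp comp_def)
  qed
  then show "lab ?Y (?F u) = lab ?X u" "loc ?Y (?F u) = map_option ?F (loc ?X u) \<and> (\<forall>v. loc ?X u = Some v \<longrightarrow> v \<in> ?R)"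
   by blast+
 qed
 have rR: "reach ?X \<subseteq> ?R"
 proof
  fix v assume "v \<in> reach ?X"
  then consider "v \<in> edges ?X" | u where "u \<in> edges ?X" "loc ?X u = Some v" unfolding reach_def by blast
  then show "v \<in> ?R"
  proof cases
   case 1 then show ?thesis by (rule subsetD[OF eR])
  next
   case 2
   from conjunct2[OF locX[OF subsetD[OF eR 2(1)]]] have "loc ?X u = Some v \<longrightarrow> v \<in> ?R" by (rule spec)
   then show ?thesis using 2(2) by (rule mp)
  qed
 qed
 have "iso_by ?F ?X ?Y"
  unfolding iso_by_def
 proof (intro conjI ballI)
  fix e assume "e \<in> edges ?X"
  then have e: "e \<in> ?R" by (rule subsetD[OF eR])
  show "lab ?Y (?F e) = lab ?X e" by (rule labX[OF e])
  show "loc ?Y (?F e) = map_option ?F (loc ?X e)" by (rule conjunct1[OF locX[OF e]])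
 qed (rule inj_on_subset[OF Finj rR], rule links)
 then show ?thesis unfolding siso_def by (intro exI[of _ ?F])
qed

lemma beta_iso_forward:
 fixes N :: "'e net" and M :: "'f net"
 assumes "siso N M" "inj (i :: 'e \<Rightarrow> 'f)" "beta N N'" "boxed N" "pax_unique N"
  "\<And>a b P w. \<lbrakk>CutL (Upair b w) \<in> links N; BangL a b \<in> links N; WhynotL P w \<in> links N\<rbrakk> \<Longrightarrow> threads_ok N P"
 shows "\<exists>M'. beta M M' \<and> siso N' M'"
proof -
 obtain f where f: "iso_by f N M" using assms(1) by (auto simp: siso_def)
 show ?thesis
  by (rule beta_transport[OF f assms(2,3)]) (rule exp_equiv[OF f assms(4,5) assms(6)])
qed

text \<open>The structural conditions are assumed for \<open>N\<close> alone, so the forward version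
  cannot simply be applied to the inverse isomorphism. The exponential redex of \<open>M\<close> is
  pulled back to \<open>N\<close>, \<open>exp_equiv\<close> is applied there, and the isomorphism of
  the reducts is inverted.\<close>

lemma beta_iso_backward:
 fixes N :: "'e net" and M :: "'f net"
 assumes "siso N M" "inj (i :: 'f \<Rightarrow> 'e)" "beta M M'" "boxed N" "pax_unique N"
  "\<And>a b P w. \<lbrakk>CutL (Upair b w) \<in> links N; BangL a b \<in> links N; WhynotL P w \<in> links N\<rbrakk> \<Longrightarrow> threads_ok N P"
 shows "\<exists>N'. beta N N' \<and> siso N' M'"
proof -
 obtain f where f: "iso_by f N M" using assms(1) by (auto simp: siso_def)
 let ?g = "inv_into (reach N) f"
 note g = iso_by_inverse[OF f]
 have im: "links M = map_link f ` links N" using f by (simp add: iso_by_def)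
 have "\<exists>N'. beta N N' \<and> siso M' N'"
 proof (rule beta_transport[OF g(1) assms(2,3)])
  fix a b P w
  assume h: "CutL (Upair b w) \<in> links M" "BangL a b \<in> links M" "WhynotL P w \<in> links M"
  obtain u where u: "CutL u \<in> links N" "map_uprod f u = Upair b w" using h(1) unfolding im mem_map_link_iffs by auto
  obtain b0 w0 where bw: "u = Upair b0 w0" "f b0 = b" "f w0 = w" using u(2) unfolding map_uprod_eq_Upair by blast
  obtain a1 b1 where ab: "BangL a1 b1 \<in> links N" "f a1 = a" "f b1 = b" using h(2) unfolding im mem_map_link_iffs by auto
  obtain P1 w1 where pw: "WhynotL P1 w1 \<in> links N" "f |`| P1 = P" "f w1 = w" using h(3) unfolding im mem_map_link_iffs by auto
  have r: "set_link l \<subseteq> reach N" if "l \<in> links N" for l using that by (auto simp: reach_def edges_eq)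
  have gg: "?g (f e) = e" if "e \<in> set_link l" "l \<in> links N" for e l using g(2) r that by blast
  \<comment> \<open>The cut, the of course link and the why not link are pulled back separately;
    injectivity shows that their preimages still meet in the same edges.\<close>
  have "b1 = b0" using gg[OF _ ab(1), of b1] gg[OF _ u(1), of b0] bw ab by simp
  moreover have "w1 = w0" using gg[OF _ pw(1), of w1] gg[OF _ u(1), of w0] bw pw by simp
  ultimately have n: "CutL (Upair b1 w1) \<in> links N" using u bw by simp
  have e: "?g a = a1" "?g b = b1" "?g w = w1" "?g |`| P = P1"
   using gg[OF _ ab(1), of a1] gg[OF _ ab(1), of b1] gg[OF _ pw(1), of w1] ab pw
    gg[OF _ pw(1)] by (auto simp: fset.map_comp intro!: fset.map_ident_strong)
  have "siso (exp_reduct N a1 b1 P1 w1) (exp_reduct M (f a1) (f b1) (f |`| P1) (f w1))"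
   by (rule exp_equiv[OF f assms(4,5) assms(6)[OF n ab(1) pw(1)] n ab(1) pw(1)])
  then show "siso (exp_reduct M a b P w) (exp_reduct N (?g a) (?g b) (?g |`| P) (?g w))"
   unfolding e using ab pw siso_sym by blast
 qed
 then show ?thesis using siso_sym by blast
qed

section \<open>Producers, consumers and boxes in a well-formed net\<close>

lemma producer_unique:
 "\<lbrakk>is_net N; l \<in> links N; l' \<in> links N; e \<in> concls l; e \<in> concls l'\<rbrakk> \<Longrightarrow> l = l'"
 unfolding is_net_def edges_def by blast

lemma consumer_unique:
 "\<lbrakk>is_net N; l \<in> links N; l' \<in> links N; e \<in> prems l; e \<in> prems l'\<rbrakk> \<Longrightarrow> l = l'"
 unfolding is_net_def by blast

lemma producer_ex: "is_net N \<Longrightarrow> e \<in> edges N \<Longrightarrow> \<exists>l\<in>links N. e \<in> concls l"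
 unfolding is_net_def by blast

lemma net_typed: "is_net N \<Longrightarrow> l \<in> links N \<Longrightarrow> typed N l"
 unfolding is_net_def by blast

lemma loc_link:
 assumes "is_net N" "l \<in> links N" "\<not> is_door l" "e \<in> set_link l" "e' \<in> set_link l"
 shows "loc N e = loc N e'"
 using assms unfolding is_net_def well_boxed_def set_link_eq by blast

lemma loc_bang: "is_net N \<Longrightarrow> BangL p c \<in> links N \<Longrightarrow> loc N p = Some c"
 unfolding is_net_def well_boxed_def by blast

lemma loc_pax: "is_net N \<Longrightarrow> PaxL p c \<in> links N \<Longrightarrow> \<exists>b. loc N p = Some b \<and> loc N c = loc N b"
 unfolding is_net_def well_boxed_def by blast

lemma loc_box: "is_net N \<Longrightarrow> e \<in> edges N \<Longrightarrow> loc N e = Some b \<Longrightarrow> \<exists>a. BangL a b \<in> links N"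
 unfolding is_net_def well_boxed_def by blast

lemma net_boxed: assumes "is_net N" shows "boxed N"
 unfolding boxed_def
proof (intro ballI allI impI)
 fix e b assume "e \<in> edges N" "loc N e = Some b"
 then obtain a where "BangL a b \<in> links N" using loc_box[OF assms] by blast
 from concls_subset[OF this] show "b \<in> edges N" by simp
qed

lemma net_finite: assumes "is_net N" shows "finite (edges N)"
 using assms unfolding is_net_def edges_eq by auto

lemma net_pax_unique: "is_net N \<Longrightarrow> pax_unique N"
 unfolding pax_unique_def using producer_unique by (metis concls.simps(8) insertI1 link.inject(8))

subsection \<open>Nesting of boxes\<close>

definition box_rel :: "'e net \<Rightarrow> ('e \<times> 'e) set" where
 "box_rel N = {(e, b). e \<in> edges N \<and> loc N e = Some b}"

text \<open>The depth of an edge. The boxes around an edge form a finite chain by acyclicity, so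
  counting them gives a number that drops by one on leaving a box.\<close>

definition nesting :: "'e net \<Rightarrow> 'e \<Rightarrow> nat" where
 "nesting N e = card ((box_rel N)\<^sup>+ `` {e})"

lemma box_rel_finite: assumes "is_net N" shows "finite (box_rel N)"
proof (rule finite_subset)
 show "box_rel N \<subseteq> edges N \<times> edges N" using net_boxed[OF assms] by (auto simp: box_rel_def boxed_def)
qed (use net_finite[OF assms] in simp)

lemma box_rel_acyclic: "is_net N \<Longrightarrow> acyclic (box_rel N)"
 unfolding is_net_def well_boxed_def box_rel_def by blast

lemma nesting_Some: assumes N: "is_net N" and e: "e \<in> edges N" "loc N e = Some b"
 shows "nesting N e = Suc (nesting N b)"
proof -
 have "(box_rel N)\<^sup>+ `` {e} = insert b ((box_rel N)\<^sup>+ `` {b})"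
 proof -
  have "(e, x) \<in> (box_rel N)\<^sup>+ \<longleftrightarrow> x = b \<or> (b, x) \<in> (box_rel N)\<^sup>+" for x
  proof
   assume "(e, x) \<in> (box_rel N)\<^sup>+"
   then show "x = b \<or> (b, x) \<in> (box_rel N)\<^sup>+"
    by (cases rule: converse_tranclE) (use e in \<open>auto simp: box_rel_def\<close>)
  next
   have eb: "(e, b) \<in> box_rel N" using e by (auto simp: box_rel_def)
   assume "x = b \<or> (b, x) \<in> (box_rel N)\<^sup>+"
   then show "(e, x) \<in> (box_rel N)\<^sup>+" using eb by (meson r_into_trancl' trancl_into_trancl2)
  qed
  then show ?thesis by auto
 qed
 moreover have "b \<notin> (box_rel N)\<^sup>+ `` {b}" using box_rel_acyclic[OF N] by (auto simp: acyclic_def)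
 moreover have "finite ((box_rel N)\<^sup>+ `` {b})" using box_rel_finite[OF N] by simp
 ultimately show ?thesis unfolding nesting_def by simp
qed

lemma nesting_cong: assumes N: "is_net N" and e: "e \<in> edges N" "e' \<in> edges N" "loc N e = loc N e'"
 shows "nesting N e = nesting N e'"
proof (cases "loc N e")
 case None
 have "(box_rel N)\<^sup>+ `` {x} = {}" if "loc N x = None" for x
 proof -
  have "(x, y) \<notin> box_rel N" for y using that by (simp add: box_rel_def)
  then show ?thesis using converse_tranclE by (metis Image_singleton_iff equals0I)
 qed
 then have "(box_rel N)\<^sup>+ `` {e} = {}" "(box_rel N)\<^sup>+ `` {e'} = {}" using None e by simp_all
 then show ?thesis by (simp add: nesting_def)
qed (use nesting_Some[OF N] e in auto)

lemma nesting_pax: assumes N: "is_net N" and p: "PaxL x y \<in> links N"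
 shows "nesting N x = Suc (nesting N y)"
proof -
 obtain b where b: "loc N x = Some b" "loc N y = loc N b" using loc_pax[OF N p] by auto
 have e: "x \<in> edges N" "y \<in> edges N" using p by (force simp: edges_def)+
 then have "b \<in> edges N" using b net_boxed[OF N] by (auto simp: boxed_def)
 then show ?thesis using nesting_Some[OF N e(1) b(1)] nesting_cong[OF N e(2) _ b(2)] by simp
qed

subsection \<open>Descent to the conclusions\<close>

text \<open>The factor two makes room for the flat formula on \<open>A\<close> strictly between
  \<open>A\<close> and \<open>Whynot A\<close>. Thus every link raises the rank from premise to
  conclusion, except pax links, which keep it and decrease \<open>nesting\<close>.\<close>

primrec rank :: "label \<Rightarrow> nat" where
 "rank (Fm A) = 2 * size A"
| "rank (Fl A) = Suc (2 * size A)"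

lemma descent: assumes N: "is_net N" and l: "l \<in> links N" "p \<in> prems l" "c \<in> concls l"
 shows "rank (lab N p) < rank (lab N c) \<or> (rank (lab N p) = rank (lab N c) \<and> nesting N c < nesting N p)"
 using net_typed[OF N l(1)] l nesting_pax[OF N] by (cases l) auto

text \<open>A walk downwards increases the rank, or keeps it and leaves a box. Ranks are bounded in
  a finite net, so the walk stops; without cuts it can stop only at a conclusion. This replaces an
  induction on the construction of the net.\<close>

lemma down_induct [consumes 3, case_names conclusion premise]:
 assumes N: "is_net N" and cf: "cut_free N" and e: "e \<in> edges N"
  and base: "\<And>c. c \<in> conclusions N \<Longrightarrow> P c"
  and step: "\<And>l p c. \<lbrakk>l \<in> links N; p \<in> prems l; c \<in> concls l; P c\<rbrakk> \<Longrightarrow> P p"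
 shows "P e"
proof -
 let ?K = "Max ((rank \<circ> lab N) ` edges N)"
 have K: "rank (lab N x) \<le> ?K" if "x \<in> edges N" for x using that net_finite[OF N] by simp
 have "wf (measures [\<lambda>e. ?K - rank (lab N e), nesting N])" by simp
 then show ?thesis using e
 proof (induction e rule: wf_induct_rule)
  case (less e)
  show ?case
  proof (cases "e \<in> conclusions N")
   case False
   then obtain l where l: "l \<in> links N" "e \<in> prems l" using less.prems by (auto simp: conclusions_def)
   have "concls l \<noteq> {}" using l cf by (cases l) (auto simp: cut_free_def)
   then obtain c where c: "c \<in> concls l" by auto
   have cE: "c \<in> edges N" using c l by (auto simp: edges_def)
   have "(c, e) \<in> measures [\<lambda>e. ?K - rank (lab N e), nesting N]"
    using descent[OF N l c] K[OF cE] by auto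
   then have "P c" using less.IH cE by blast
   then show ?thesis using step l c by blast
  qed (rule base)
 qed
qed

subsection \<open>Threads\<close>

lemma net_thread:
 assumes N: "is_net N" and d: "d \<in> edges N" "lab N d = Fl A" and z: "z \<in> thread N d"
 shows "lab N z = Fl A" "z \<in> edges N"
proof -
 have "(pax_rel N)\<^sup>*\<^sup>* z d" using z by (simp add: thread_def)
 then have "lab N z = Fl A \<and> z \<in> edges N"
 proof (induction rule: converse_rtranclp_induct)
  case (step y z)
  then show ?case using net_typed[OF N, of "PaxL y z"] pax_edges[of N y z] by (auto simp: pax_rel_def)
 qed (use d in simp)
 then show "lab N z = Fl A" "z \<in> edges N" by auto
qed

text \<open>An edge concludes at most one pax link, so the way up from \<open>d\<close> along pax
  links is forced and two points on it are comparable.\<close>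

lemma thread_linear:
 assumes N: "is_net N" and "(pax_rel N)\<^sup>*\<^sup>* z d" "(pax_rel N)\<^sup>*\<^sup>* z' d"
 shows "(pax_rel N)\<^sup>*\<^sup>* z z' \<or> (pax_rel N)\<^sup>*\<^sup>* z' z"
 using assms(2,3)
proof (induction rule: rtranclp_induct)
 case (step y w)
 show ?case
 proof (cases "z' = w")
  case True
  then show ?thesis using step(1,2) by (metis rtranclp.rtrancl_into_rtrancl)
 next
  case False
  then obtain y' where y': "(pax_rel N)\<^sup>*\<^sup>* z' y'" "pax_rel N y' w"
   using step.prems by (metis rtranclp.cases)
  have "y' = y" using y'(2) step(2) net_pax_unique[OF N] by (auto simp: pax_rel_def pax_unique_def)
  then show ?thesis using step.IH y' by blast
 qed
qed simp

text \<open>At an edge of maximal nesting in the thread the producer cannot be a pax link, whose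
  premise would be one box deeper; typing leaves only a flat link. A second such edge would be
  comparable with the first and therefore also conclude a pax link.\<close>

lemma net_thread_top:
 assumes N: "is_net N" and d: "d \<in> edges N" "lab N d = Fl A"
 shows "\<exists>!z. z \<in> thread N d \<and> (\<exists>s. FlatL s z \<in> links N)"
proof -
 have fin: "finite (thread N d)" using net_finite[OF N] net_thread(2)[OF N d] by (meson finite_subset subsetI)
 have "d \<in> thread N d" by (simp add: thread_def)
 then have "Max (nesting N ` thread N d) \<in> nesting N ` thread N d" using fin by (intro Max_in) auto
 then obtain z where z: "z \<in> thread N d" and zM: "nesting N z = Max (nesting N ` thread N d)" by auto
 have mx: "nesting N y \<le> nesting N z" if "y \<in> thread N d" for y
  unfolding zM using fin that by (intro Max_ge) auto
 note zz = net_thread[OF N d z]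
 obtain l where l: "l \<in> links N" "z \<in> concls l" using producer_ex[OF N zz(2)] by auto
 have "\<nexists>x. l = PaxL x z"
 proof
  assume "\<exists>x. l = PaxL x z"
  then obtain x where x: "PaxL x z \<in> links N" using l by auto
  then have "x \<in> thread N d" using z by (auto simp: thread_def pax_rel_def intro: converse_rtranclp_into_rtranclp)
  then show False using mx nesting_pax[OF N x] by fastforce
 qed
 then have ex: "\<exists>s. FlatL s z \<in> links N" using l net_typed[OF N l(1)] zz by (cases l) auto
 have nopax: False if "FlatL s x \<in> links N" "PaxL y x \<in> links N" for s x y
  using producer_unique[OF N that, of x] by simp
 show ?thesis
 proof (rule ex1I[of _ z])
  fix z' assume z': "z' \<in> thread N d \<and> (\<exists>s. FlatL s z' \<in> links N)"
  then have "(pax_rel N)\<^sup>*\<^sup>* z z' \<or> (pax_rel N)\<^sup>*\<^sup>* z' z"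
   using thread_linear[OF N] z by (auto simp: thread_def)
  then show "z' = z"
   using z' ex nopax by (metis pax_rel_def rtranclp.cases)
 qed (use z ex in simp)
qed

lemma net_threads_ok: assumes N: "is_net N" and w: "WhynotL P w \<in> links N" shows "threads_ok N P"
 unfolding threads_ok_def
proof
 fix d assume d: "d \<in> fset P"
 have "d \<in> edges N" using w d by (force simp: edges_def)
 moreover obtain A where "lab N d = Fl A" using net_typed[OF N w] d by auto
 ultimately show "\<exists>!z. z \<in> thread N d \<and> (\<exists>s. FlatL s z \<in> links N)" using net_thread_top[OF N] by blast
qed

text \<open>From a common edge the two threads go down together, because an edge has one consumer.
  Neither \<open>d\<close> nor \<open>d'\<close> is a premise of a pax link, so they end at the same
  edge.\<close>

lemma thread_disjoint:
 assumes N: "is_net N" and w: "WhynotL P w \<in> links N" "WhynotL P' w' \<in> links N" "d \<in> fset P" "d' \<in> fset P'"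
  and z: "z \<in> thread N d" "z \<in> thread N d'"
 shows "d = d'"
proof -
 have "(pax_rel N)\<^sup>*\<^sup>* z d" "(pax_rel N)\<^sup>*\<^sup>* z d'" using z by (auto simp: thread_def)
 then have "(pax_rel N)\<^sup>*\<^sup>* d d' \<or> (pax_rel N)\<^sup>*\<^sup>* d' d"
 proof (induction rule: converse_rtranclp_induct)
  case (step y z)
  from step.prems show ?case
  proof (cases rule: converse_rtranclpE)
   case base
   then show ?thesis using step.hyps by (metis converse_rtranclp_into_rtranclp)
  next
   case (step x)
   then have "x = z" using \<open>pax_rel N y z\<close> consumer_unique[OF N, of "PaxL y x" "PaxL y z" y]
    by (auto simp: pax_rel_def)
   then show ?thesis using step(2) \<open>(pax_rel N)\<^sup>*\<^sup>* z d' \<Longrightarrow> _\<close> by blast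
  qed
 qed auto
 moreover have "\<not> pax_rel N d x" for x
  using consumer_unique[OF N w(1), of "PaxL d x" d] w(3) by (auto simp: pax_rel_def)
 moreover have "\<not> pax_rel N d' x" for x
  using consumer_unique[OF N w(2), of "PaxL d' x" d'] w(4) by (auto simp: pax_rel_def)
 ultimately show ?thesis by (metis converse_rtranclpE)
qed

subsection \<open>Levels\<close>

text \<open>The constraints of all links except axioms already determine an index from its value at
  the conclusions. This is the solution with value 0 there; an indexing exists when it happens to
  agree at the axioms.\<close>

definition levelling :: "'e net \<Rightarrow> ('e \<Rightarrow> nat) \<Rightarrow> bool" where
 "levelling N lv \<longleftrightarrow> (\<forall>l\<in>links N. (\<forall>u. l \<noteq> AxL u) \<longrightarrow> indexed (\<lambda>e. int (lv e)) l) \<and>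
   (\<forall>c\<in>conclusions N. lv c = 0)"

primrec weight :: "'e link \<Rightarrow> nat" where
 "weight (AxL u) = 0" | "weight (CutL u) = 0" | "weight (OneL c) = 0" | "weight (BotL c) = 0"
| "weight (TensorL p q c) = 0" | "weight (ParL p q c) = 0" | "weight (FlatL p c) = 0" | "weight (PaxL p c) = 0"
| "weight (WhynotL P c) = 1" | "weight (BangL p c) = 1" | "weight (ParagraphL p c) = 1"

text \<open>Counts the links of weight one met on the way down to a conclusion. As a relation it
  needs no termination argument; totality comes from \<open>down_induct\<close> and functionality
  from unique consumers.\<close>

inductive level_rel :: "'e net \<Rightarrow> 'e \<Rightarrow> nat \<Rightarrow> bool" for N where
 base: "c \<in> conclusions N \<Longrightarrow> level_rel N c 0"
| step: "\<lbrakk>l \<in> links N; p \<in> prems l; c \<in> concls l; level_rel N c n\<rbrakk> \<Longrightarrow> level_rel N p (n + weight l)"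

lemma one_conclusion: "p \<in> prems l \<Longrightarrow> c \<in> concls l \<Longrightarrow> c' \<in> concls l \<Longrightarrow> c = c'"
 by (cases l) auto

lemma level_rel_unique: assumes N: "is_net N" and "level_rel N e n" "level_rel N e m" shows "n = m"
 using assms(2,3)
proof (induction arbitrary: m rule: level_rel.induct)
 case (base c)
 from base.prems show ?case by cases (use base in \<open>auto simp: conclusions_def\<close>)
next
 case (step l p c n)
 from step.prems show ?case
 proof cases
  case base
  then have "p \<notin> prems l" using step.hyps(1) unfolding conclusions_def by blast
  then show ?thesis using step.hyps(2) by (rule notE)
 next
  case (step l' c' n')
  then have "l' = l" using consumer_unique[OF N] \<open>l \<in> links N\<close> \<open>p \<in> prems l\<close> by blast
  then show ?thesis using step step.IH \<open>p \<in> prems l\<close> \<open>c \<in> concls l\<close> one_conclusion by metis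
 qed
qed

lemma levelling_ex: assumes N: "is_net N" and cf: "cut_free N" shows "\<exists>lv. levelling N lv"
proof -
 define lv where "lv e = (THE n. level_rel N e n)" for e
 have lv: "level_rel N e n \<Longrightarrow> lv e = n" for e n
  unfolding lv_def using level_rel_unique[OF N] by blast
 have ex: "\<exists>n. level_rel N e n" if "e \<in> edges N" for e
  using N cf that by (induction e rule: down_induct) (blast intro: level_rel.intros)+
 have w: "lv p = lv c + weight l" if "l \<in> links N" "p \<in> prems l" "c \<in> concls l" for l p c
 proof -
  have "c \<in> edges N" using that by (auto simp: edges_def)
  then obtain n where n: "level_rel N c n" using ex by blast
  show ?thesis using lv[OF n] lv[OF level_rel.step[OF that n]] by simp
 qed
 have "indexed (\<lambda>e. int (lv e)) l" if "l \<in> links N" "\<forall>u. l \<noteq> AxL u" for l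
 proof -
  have "\<forall>p\<in>prems l. \<forall>c\<in>concls l. lv p = lv c + weight l" using w[OF that(1)] by blast
  then show ?thesis using that cf by (cases l) (simp_all add: cut_free_def)
 qed
 note indexed = this
 have "levelling N lv" unfolding levelling_def
 proof (intro conjI ballI impI)
  fix c assume "c \<in> conclusions N"
  then show "lv c = 0" by (intro lv level_rel.base)
 qed (rule indexed)
 then show ?thesis by blast
qed

text \<open>Through each link other than an axiom, \<open>I\<close> and \<open>lv\<close> change by
  the same amount, and every edge of a cut-free net is reached upwards from a conclusion.\<close>

lemma indexing_levelling:
 assumes N: "is_net N" and cf: "cut_free N" and lv: "levelling N lv" and c: "\<And>c. c \<in> conclusions N \<Longrightarrow> I c = i"
  and I: "\<And>l. \<lbrakk>l \<in> links N; \<forall>u. l \<noteq> AxL u\<rbrakk> \<Longrightarrow> indexed I l" and e: "e \<in> edges N"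
 shows "I e = i + int (lv e)"
 using N cf e
proof (induction e rule: down_induct)
 case (conclusion d)
 then show ?case using lv c by (auto simp: levelling_def)
next
 case (premise l p d)
 have ax: "\<forall>u. l \<noteq> AxL u" using premise.hyps(2) by (cases l) auto
 have 1: "indexed I l" by (rule I[OF premise.hyps(1) ax])
 have 2: "indexed (\<lambda>e. int (lv e)) l" using lv ax premise.hyps(1) unfolding levelling_def by blast
 have "\<forall>u. l \<noteq> CutL u" using cf premise.hyps(1) by (auto simp: cut_free_def)
 then have "I p - I d = int (lv p) - int (lv d)"
 proof (cases l)
  case (AxL u)
  then show ?thesis using ax by blast
 next
  case (CutL u)
  then show ?thesis using premise.hyps(3) by simp
 qed (use 1 2 premise.hyps(2,3) in auto)
 then show ?case using premise.IH by simp
qed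

subsection \<open>Expanded identities\<close>

text \<open>Names of edges in the expanded identity are paths in the formula. At each subformula,
  \<open>Pos\<close> carries the subformula and \<open>Neg\<close> its dual; at an exponential,
  \<open>Flt\<close> and \<open>Aux\<close> are the premise and the conclusion of the auxiliary
  door.\<close>

datatype nm = Neg | Pos | Flt | Aux | Lt nm | Rt nm | Sub nm

lemma Upair_swap: "Upair x y = Upair y x"
 by (simp add: Upair_inject)

lemma dual_dual [simp]: "dual (dual A) = A"
 by (induction A) auto

text \<open>The formulas of the conclusions of the pair links. In \<open>bullet X A\<close> they
  come only from substituted atoms, since \<open>bullet\<close> never yields a bare atom.\<close>

definition atom_pair :: "form \<Rightarrow> bool" where
 "atom_pair F \<longleftrightarrow> (\<exists>a b. F = Tensor (Atom a) (Atom b) \<or> F = Par (NAtom a) (NAtom b))"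

text \<open>The predicate \<open>tw\<close> selects the levels at which the wiring is crossed, and
  \<open>j\<close> is the level of the root. The crossing sits on the pair link of the
  \<open>Pos\<close> side, so that axioms still join equal paths on both sides;
  \<open>crossed_bullet\<close> relates this to crossed axioms.\<close>

primrec idl :: "form \<Rightarrow> (nat \<Rightarrow> bool) \<Rightarrow> nat \<Rightarrow> nm link set" where
 "idl (Atom Z) tw j = {AxL (Upair Neg Pos)}"
| "idl (NAtom Z) tw j = {AxL (Upair Neg Pos)}"
| "idl One tw j = {BotL Neg, OneL Pos}"
| "idl Bot tw j = {OneL Neg, BotL Pos}"
| "idl (Tensor A B) tw j = {ParL (Lt Neg) (Rt Neg) Neg,
   if tw j \<and> atom_pair (Tensor A B) then TensorL (Rt Pos) (Lt Pos) Pos else TensorL (Lt Pos) (Rt Pos) Pos}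
   \<union> map_link Lt ` idl A tw j \<union> map_link Rt ` idl B tw j"
| "idl (Par A B) tw j = {TensorL (Lt Neg) (Rt Neg) Neg,
   if tw j \<and> atom_pair (Par A B) then ParL (Rt Pos) (Lt Pos) Pos else ParL (Lt Pos) (Rt Pos) Pos}
   \<union> map_link Lt ` idl A tw j \<union> map_link Rt ` idl B tw j"
| "idl (Bang A) tw j = {WhynotL {|Aux|} Neg, PaxL Flt Aux, FlatL (Sub Neg) Flt, BangL (Sub Pos) Pos}
   \<union> map_link Sub ` idl A tw (Suc j)"
| "idl (Whynot A) tw j = {BangL (Sub Neg) Neg, FlatL (Sub Pos) Flt, PaxL Flt Aux, WhynotL {|Aux|} Pos}
   \<union> map_link Sub ` idl A tw (Suc j)"
| "idl (Paragraph A) tw j = {ParagraphL (Sub Neg) Neg, ParagraphL (Sub Pos) Pos}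
   \<union> map_link Sub ` idl A tw (Suc j)"

primrec idlab :: "form \<Rightarrow> nm \<Rightarrow> label" where
 "idlab (Atom Z) = (\<lambda>n. if n = Neg then Fm (NAtom Z) else Fm (Atom Z))"
| "idlab (NAtom Z) = (\<lambda>n. if n = Neg then Fm (Atom Z) else Fm (NAtom Z))"
| "idlab One = (\<lambda>n. if n = Neg then Fm Bot else Fm One)"
| "idlab Bot = (\<lambda>n. if n = Neg then Fm One else Fm Bot)"
| "idlab (Tensor A B) = (\<lambda>n. case n of Lt m \<Rightarrow> idlab A m | Rt m \<Rightarrow> idlab B m
   | Neg \<Rightarrow> Fm (dual (Tensor A B)) | _ \<Rightarrow> Fm (Tensor A B))"
| "idlab (Par A B) = (\<lambda>n. case n of Lt m \<Rightarrow> idlab A m | Rt m \<Rightarrow> idlab B m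
   | Neg \<Rightarrow> Fm (dual (Par A B)) | _ \<Rightarrow> Fm (Par A B))"
| "idlab (Bang A) = (\<lambda>n. case n of Sub m \<Rightarrow> idlab A m | Flt \<Rightarrow> Fl (dual A) | Aux \<Rightarrow> Fl (dual A)
   | Neg \<Rightarrow> Fm (dual (Bang A)) | _ \<Rightarrow> Fm (Bang A))"
| "idlab (Whynot A) = (\<lambda>n. case n of Sub m \<Rightarrow> idlab A m | Flt \<Rightarrow> Fl A | Aux \<Rightarrow> Fl A
   | Neg \<Rightarrow> Fm (dual (Whynot A)) | _ \<Rightarrow> Fm (Whynot A))"
| "idlab (Paragraph A) = (\<lambda>n. case n of Sub m \<Rightarrow> idlab A m
   | Neg \<Rightarrow> Fm (dual (Paragraph A)) | _ \<Rightarrow> Fm (Paragraph A))"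

primrec idloc :: "form \<Rightarrow> nm \<Rightarrow> nm option" where
 "idloc (Atom Z) = (\<lambda>_. None)"
| "idloc (NAtom Z) = (\<lambda>_. None)"
| "idloc One = (\<lambda>_. None)"
| "idloc Bot = (\<lambda>_. None)"
| "idloc (Tensor A B) = (\<lambda>n. case n of Lt m \<Rightarrow> map_option Lt (idloc A m) | Rt m \<Rightarrow> map_option Rt (idloc B m) | _ \<Rightarrow> None)"
| "idloc (Par A B) = (\<lambda>n. case n of Lt m \<Rightarrow> map_option Lt (idloc A m) | Rt m \<Rightarrow> map_option Rt (idloc B m) | _ \<Rightarrow> None)"
| "idloc (Bang A) = (\<lambda>n. case n of Sub m \<Rightarrow> (case idloc A m of None \<Rightarrow> Some Pos | Some k \<Rightarrow> Some (Sub k))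
   | Flt \<Rightarrow> Some Pos | _ \<Rightarrow> None)"
| "idloc (Whynot A) = (\<lambda>n. case n of Sub m \<Rightarrow> (case idloc A m of None \<Rightarrow> Some Neg | Some k \<Rightarrow> Some (Sub k))
   | Flt \<Rightarrow> Some Neg | _ \<Rightarrow> None)"
| "idloc (Paragraph A) = (\<lambda>n. case n of Sub m \<Rightarrow> map_option Sub (idloc A m) | _ \<Rightarrow> None)"

primrec nms :: "form \<Rightarrow> nm set" where
 "nms (Atom Z) = {Neg, Pos}"
| "nms (NAtom Z) = {Neg, Pos}"
| "nms One = {Neg, Pos}"
| "nms Bot = {Neg, Pos}"
| "nms (Tensor A B) = {Neg, Pos} \<union> Lt ` nms A \<union> Rt ` nms B"
| "nms (Par A B) = {Neg, Pos} \<union> Lt ` nms A \<union> Rt ` nms B"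
| "nms (Bang A) = {Neg, Pos, Flt, Aux} \<union> Sub ` nms A"
| "nms (Whynot A) = {Neg, Pos, Flt, Aux} \<union> Sub ` nms A"
| "nms (Paragraph A) = {Neg, Pos} \<union> Sub ` nms A"

lemma nms_root [simp]: "Neg \<in> nms F" "Pos \<in> nms F"
 by (cases F; simp)+

lemma idl_names: "(\<Union>l\<in>idl F tw j. set_link l) = nms F"
proof (induction F arbitrary: j)
 case (Tensor A B)
 have "(\<Union>l\<in>idl (Tensor A B) tw j. set_link l) = {Lt Neg, Rt Neg, Neg, Lt Pos, Rt Pos, Pos} \<union>
   Lt ` (\<Union>l\<in>idl A tw j. set_link l) \<union> Rt ` (\<Union>l\<in>idl B tw j. set_link l)"
  by (auto simp: link.set_map)
 then show ?case using Tensor by auto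
next
 case (Par A B)
 have "(\<Union>l\<in>idl (Par A B) tw j. set_link l) = {Lt Neg, Rt Neg, Neg, Lt Pos, Rt Pos, Pos} \<union>
   Lt ` (\<Union>l\<in>idl A tw j. set_link l) \<union> Rt ` (\<Union>l\<in>idl B tw j. set_link l)"
  by (auto simp: link.set_map)
 then show ?case using Par by auto
next
 case (Bang A)
 have "(\<Union>l\<in>idl (Bang A) tw j. set_link l) = {Sub Neg, Sub Pos, Neg, Pos, Flt, Aux} \<union>
   Sub ` (\<Union>l\<in>idl A tw (Suc j). set_link l)"
  by (auto simp: link.set_map)
 then show ?case using Bang by auto
next
 case (Whynot A)
 have "(\<Union>l\<in>idl (Whynot A) tw j. set_link l) = {Sub Neg, Sub Pos, Neg, Pos, Flt, Aux} \<union>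
   Sub ` (\<Union>l\<in>idl A tw (Suc j). set_link l)"
  by (auto simp: link.set_map)
 then show ?case using Whynot by auto
next
 case (Paragraph A)
 have "(\<Union>l\<in>idl (Paragraph A) tw j. set_link l) = {Sub Neg, Sub Pos, Neg, Pos} \<union>
   Sub ` (\<Union>l\<in>idl A tw (Suc j). set_link l)"
  by (auto simp: link.set_map)
 then show ?case using Paragraph by auto
qed auto

lemma idl_set_link: "l \<in> idl F tw j \<Longrightarrow> set_link l \<subseteq> nms F"
 using idl_names by blast

lemma idlab_root [simp]: "idlab F Neg = Fm (dual F)" "idlab F Pos = Fm F"
 by (cases F; simp)+

lemma idloc_root [simp]: "idloc F Neg = None" "idloc F Pos = None"
 by (cases F; simp)+

lemma idloc_closed: "n \<in> nms F \<Longrightarrow> idloc F n = Some m \<Longrightarrow> m \<in> nms F"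
 by (induction F arbitrary: n m) (auto split: option.splits)

lemma idl_no_cut: "CutL u \<notin> idl F tw j"
 by (induction F arbitrary: u j) (auto simp: mem_map_link_iffs)

text \<open>A door of the tree belongs to a box of the tree. Hence a grafted identity never
  contributes an auxiliary door to a box of the host.\<close>

lemma idl_pax_loc: "PaxL n m \<in> idl F tw j \<Longrightarrow> idloc F n \<noteq> None"
 by (induction F arbitrary: n m j) (auto simp: mem_map_link_iffs split: if_splits option.splits)

lemma idl_pax_flt: "PaxL n m \<in> idl F tw j \<Longrightarrow> m \<noteq> Flt \<and> m \<noteq> Neg \<and> m \<noteq> Pos"
 by (cases F) (auto simp: mem_map_link_iffs split: if_splits)

lemma idl_pax_unique: "PaxL n m \<in> idl F tw j \<Longrightarrow> PaxL n' m \<in> idl F tw j \<Longrightarrow> n = n'"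
 by (induction F arbitrary: n m n' j) (auto simp: mem_map_link_iffs split: if_splits)

lemma chain_map:
 assumes "(\<lambda>x y. g x = Some y)\<^sup>*\<^sup>* x m" "\<And>x y. g x = Some y \<Longrightarrow> h (c x) = Some (c y)"
 shows "(\<lambda>x y. h x = Some y)\<^sup>*\<^sup>* (c x) (c m)"
 using assms(1) by (induction rule: rtranclp_induct) (auto intro: rtranclp.rtrancl_into_rtrancl assms(2))

text \<open>Following boxes outwards leaves the tree after finitely many of them. So all edges of a
  grafted identity lie inside every box that contains its root.\<close>

lemma idloc_chain:
 "n \<in> nms F \<Longrightarrow> \<exists>m. (\<lambda>x y. idloc F x = Some y)\<^sup>*\<^sup>* n m \<and> idloc F m = None"
proof (induction F arbitrary: n)
 case (Tensor A B)
 have l: "(\<lambda>x y. idloc A x = Some y)\<^sup>*\<^sup>* x m \<Longrightarrow> (\<lambda>x y. idloc (Tensor A B) x = Some y)\<^sup>*\<^sup>* (Lt x) (Lt m)" for x m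
  by (erule chain_map[where c = Lt]) simp
 have r: "(\<lambda>x y. idloc B x = Some y)\<^sup>*\<^sup>* x m \<Longrightarrow> (\<lambda>x y. idloc (Tensor A B) x = Some y)\<^sup>*\<^sup>* (Rt x) (Rt m)" for x m
  by (erule chain_map[where c = Rt]) simp
 consider "n = Neg \<or> n = Pos" | k where "n = Lt k" "k \<in> nms A" | k where "n = Rt k" "k \<in> nms B"
  using Tensor.prems by auto
 then show ?case
 proof cases
  case 1 then show ?thesis by (intro exI[of _ n]) auto
 next
  case 2 then show ?thesis using Tensor.IH(1)[OF 2(2)] l by fastforce
 next
  case 3 then show ?thesis using Tensor.IH(2)[OF 3(2)] r by fastforce
 qed
next
 case (Par A B)
 have l: "(\<lambda>x y. idloc A x = Some y)\<^sup>*\<^sup>* x m \<Longrightarrow> (\<lambda>x y. idloc (Par A B) x = Some y)\<^sup>*\<^sup>* (Lt x) (Lt m)" for x m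
  by (erule chain_map[where c = Lt]) simp
 have r: "(\<lambda>x y. idloc B x = Some y)\<^sup>*\<^sup>* x m \<Longrightarrow> (\<lambda>x y. idloc (Par A B) x = Some y)\<^sup>*\<^sup>* (Rt x) (Rt m)" for x m
  by (erule chain_map[where c = Rt]) simp
 consider "n = Neg \<or> n = Pos" | k where "n = Lt k" "k \<in> nms A" | k where "n = Rt k" "k \<in> nms B"
  using Par.prems by auto
 then show ?case
 proof cases
  case 1 then show ?thesis by (intro exI[of _ n]) auto
 next
  case 2 then show ?thesis using Par.IH(1)[OF 2(2)] l by fastforce
 next
  case 3 then show ?thesis using Par.IH(2)[OF 3(2)] r by fastforce
 qed
next
 case (Bang A)
 have s: "(\<lambda>x y. idloc A x = Some y)\<^sup>*\<^sup>* x m \<Longrightarrow> (\<lambda>x y. idloc (Bang A) x = Some y)\<^sup>*\<^sup>* (Sub x) (Sub m)" for x m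
  by (erule chain_map[where c = Sub]) simp
 consider "n = Neg \<or> n = Pos \<or> n = Aux" | "n = Flt" | k where "n = Sub k" "k \<in> nms A"
  using Bang.prems by auto
 then show ?case
 proof cases
  case 1 then show ?thesis by (intro exI[of _ n]) auto
 next
  case 2 then show ?thesis by (intro exI[of _ Pos]) (auto intro!: r_into_rtranclp)
 next
  case 3
  then obtain m where m: "(\<lambda>x y. idloc A x = Some y)\<^sup>*\<^sup>* k m" "idloc A m = None" using Bang.IH by blast
  then have "idloc (Bang A) (Sub m) = Some Pos" by simp
  then have "(\<lambda>x y. idloc (Bang A) x = Some y)\<^sup>*\<^sup>* n Pos"
   using s[OF m(1)] 3 by (metis (mono_tags, lifting) rtranclp.rtrancl_into_rtrancl)
  then show ?thesis by (intro exI[of _ Pos]) auto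
 qed
next
 case (Whynot A)
 have s: "(\<lambda>x y. idloc A x = Some y)\<^sup>*\<^sup>* x m \<Longrightarrow> (\<lambda>x y. idloc (Whynot A) x = Some y)\<^sup>*\<^sup>* (Sub x) (Sub m)" for x m
  by (erule chain_map[where c = Sub]) simp
 consider "n = Neg \<or> n = Pos \<or> n = Aux" | "n = Flt" | k where "n = Sub k" "k \<in> nms A"
  using Whynot.prems by auto
 then show ?case
 proof cases
  case 1 then show ?thesis by (intro exI[of _ n]) auto
 next
  case 2 then show ?thesis by (intro exI[of _ Neg]) (auto intro!: r_into_rtranclp)
 next
  case 3
  then obtain m where m: "(\<lambda>x y. idloc A x = Some y)\<^sup>*\<^sup>* k m" "idloc A m = None" using Whynot.IH by blast
  then have "idloc (Whynot A) (Sub m) = Some Neg" by simp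
  then have "(\<lambda>x y. idloc (Whynot A) x = Some y)\<^sup>*\<^sup>* n Neg"
   using s[OF m(1)] 3 by (metis (mono_tags, lifting) rtranclp.rtrancl_into_rtrancl)
  then show ?thesis by (intro exI[of _ Neg]) auto
 qed
next
 case (Paragraph A)
 have s: "(\<lambda>x y. idloc A x = Some y)\<^sup>*\<^sup>* x m \<Longrightarrow> (\<lambda>x y. idloc (Paragraph A) x = Some y)\<^sup>*\<^sup>* (Sub x) (Sub m)" for x m
  by (erule chain_map[where c = Sub]) simp
 consider "n = Neg \<or> n = Pos" | k where "n = Sub k" "k \<in> nms A"
  using Paragraph.prems by auto
 then show ?case
 proof cases
  case 1 then show ?thesis by (intro exI[of _ n]) auto
 next
  case 2 then show ?thesis using Paragraph.IH[OF 2(2)] s by fastforce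
 qed
qed auto

lemma union_absorb: "X = A \<union> (F \<union> W) \<Longrightarrow> A \<subseteq> E \<union> W \<Longrightarrow> E \<subseteq> A \<Longrightarrow> F \<subseteq> E \<Longrightarrow> X = E \<union> W"
 by blast

lemma union_shuffle: "(L \<union> {m}) \<union> (G \<union> H) = L \<union> G \<union> insert m H"
 by blast

lemma links_update: "links (M\<lparr>links := L\<rparr>) = L"
 by simp

subsection \<open>Stages of the reduction\<close>

text \<open>Edges of the host, and edges \<open>n\<close> of the identity grafted on the host edge
  \<open>e\<close>.\<close>

datatype 'e name = Old 'e | New 'e nm

text \<open>The predicate \<open>tw\<close> is left arbitrary, so that the whole reduction is
  analysed once for all tests. Atomic axioms ensure that the identity waiting at an axiom is itself
  a single axiom.\<close>

locale host =
 fixes N :: "'e net" and lv :: "'e \<Rightarrow> nat" and tw :: "nat \<Rightarrow> bool"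
 assumes net: "is_net N" and cf: "cut_free N" and lev: "levelling N lv"
  and atomic: "\<And>e e'. AxL (Upair e e') \<in> links N \<Longrightarrow> \<exists>Z. lab N e = Fm (Atom Z) \<or> lab N e = Fm (NAtom Z)"
  and concl_Fm: "\<And>e. e \<in> conclusions N \<Longrightarrow> \<exists>A. lab N e = Fm A"
begin

definition fm :: "'e \<Rightarrow> form" where
 "fm e = (case lab N e of Fm A \<Rightarrow> A | Fl A \<Rightarrow> A)"

text \<open>The last clause reflects the exponential rule: a cut on a why not link consumes the pax
  links above it in the same step, so flat formulas enter together with the conclusion below them
  and no identity ever waits on one.\<close>

definition stage :: "'e set \<Rightarrow> bool" where
 "stage D \<longleftrightarrow> D \<subseteq> edges N \<and> (\<forall>l\<in>links N. \<forall>p\<in>prems l. p \<in> D \<longrightarrow> concls l \<subseteq> D) \<and>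
   (\<forall>l\<in>links N. \<forall>p\<in>prems l. \<forall>A. lab N p = Fl A \<longrightarrow> concls l \<subseteq> D \<longrightarrow> p \<in> D)"

definition front :: "'e set \<Rightarrow> 'e set" where
 "front D = {e \<in> edges N. (\<exists>A. lab N e = Fm A) \<and> e \<notin> D \<and> (\<forall>l\<in>links N. e \<in> prems l \<longrightarrow> concls l \<subseteq> D)}"

text \<open>An edge of the front is split by its cut: its upper half keeps the name
  \<open>Old e\<close>, and the link below it is now fed by the positive root of the
  identity.\<close>

definition low :: "'e set \<Rightarrow> 'e \<Rightarrow> 'e name" where
 "low D e = (if e \<in> front D then New e Pos else Old e)"

definition swapped :: "'e set \<Rightarrow> 'e \<Rightarrow> bool" where
 "swapped D c \<longleftrightarrow> c \<in> D \<and> tw (lv c) \<and> atom_pair (fm c)"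

primrec lk :: "'e set \<Rightarrow> 'e link \<Rightarrow> 'e name link" where
 "lk D (AxL u) = AxL (map_uprod Old u)"
| "lk D (CutL u) = CutL (map_uprod (low D) u)"
| "lk D (OneL c) = OneL (Old c)"
| "lk D (BotL c) = BotL (Old c)"
| "lk D (TensorL p q c) = (if swapped D c then TensorL (low D q) (low D p) (Old c) else TensorL (low D p) (low D q) (Old c))"
| "lk D (ParL p q c) = (if swapped D c then ParL (low D q) (low D p) (Old c) else ParL (low D p) (low D q) (Old c))"
| "lk D (FlatL p c) = FlatL (low D p) (Old c)"
| "lk D (PaxL p c) = PaxL (low D p) (Old c)"
| "lk D (WhynotL P c) = WhynotL (low D |`| P) (Old c)"
| "lk D (BangL p c) = BangL (low D p) (Old c)"
| "lk D (ParagraphL p c) = ParagraphL (low D p) (Old c)"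

definition graft :: "'e \<Rightarrow> 'e name link set" where
 "graft e = insert (CutL (Upair (Old e) (New e Neg))) (map_link (New e) ` idl (fm e) tw (lv e))"

definition state :: "'e set \<Rightarrow> 'e name net" where
 "state D = \<lparr>links = lk D ` links N \<union> (\<Union>e\<in>front D. graft e),
   lab = (\<lambda>x. case x of Old e \<Rightarrow> lab N e | New e n \<Rightarrow> idlab (fm e) n),
   loc = (\<lambda>x. case x of Old e \<Rightarrow> map_option Old (loc N e)
    | New e n \<Rightarrow> (case idloc (fm e) n of None \<Rightarrow> map_option Old (loc N e) | Some m \<Rightarrow> Some (New e m)))\<rparr>"

lemma state_simps [simp]:
 "links (state D) = lk D ` links N \<union> (\<Union>e\<in>front D. graft e)"
 "lab (state D) (Old e) = lab N e"
 "lab (state D) (New e n) = idlab (fm e) n"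
 "loc (state D) (Old e) = map_option Old (loc N e)"
 "loc (state D) (New e n) =
   (case idloc (fm e) n of None \<Rightarrow> map_option Old (loc N e) | Some m \<Rightarrow> Some (New e m))"
 by (simp_all add: state_def)

lemma lk_prems [simp]: "prems (lk D l) = low D ` prems l"
 by (cases l) (auto simp: uprod.set_map)

lemma lk_concls [simp]: "concls (lk D l) = Old ` concls l"
 by (cases l) (auto simp: uprod.set_map)

lemma no_cut [simp]: "CutL u \<notin> links N"
 using cf by (simp add: cut_free_def)

lemma fm_Fm: "lab N e = Fm A \<Longrightarrow> fm e = A"
 by (simp add: fm_def)

lemma front_D: "e \<in> front D \<Longrightarrow> e \<in> edges N" "e \<in> front D \<Longrightarrow> e \<notin> D"
 "e \<in> front D \<Longrightarrow> lab N e = Fm (fm e)"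
 by (auto simp: front_def fm_def)

lemma graft_set_link: "(\<Union>l\<in>graft e. set_link l) = insert (Old e) (New e ` nms (fm e))"
proof -
 have "(\<Union>l\<in>map_link (New e) ` idl (fm e) tw (lv e). set_link l) = New e ` nms (fm e)"
  unfolding edges_image idl_names ..
 then show ?thesis by (auto simp: graft_def)
qed

lemma state_edges: "edges (state D) = Old ` edges N \<union> (\<Union>e\<in>front D. New e ` nms (fm e))"
proof -
 have 1: "(\<Union>l\<in>lk D ` links N. set_link l) \<subseteq> Old ` edges N \<union> (\<Union>e\<in>front D. New e ` nms (fm e))"
  using prems_subset concls_subset by (fastforce simp: set_link_eq low_def)
 have 2: "Old e \<in> (\<Union>l\<in>lk D ` links N. set_link l)" if "e \<in> edges N" for e
  using producer_ex[OF net that] by (auto simp: set_link_eq)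
 have 3: "(\<Union>l\<in>(\<Union>e\<in>front D. graft e). set_link l) = Old ` front D \<union> (\<Union>e\<in>front D. New e ` nms (fm e))"
  using graft_set_link by auto
 have "edges (state D) = (\<Union>l\<in>lk D ` links N. set_link l) \<union> (\<Union>l\<in>(\<Union>e\<in>front D. graft e). set_link l)"
  by (simp add: edges_eq)
 then have 4: "edges (state D) = (\<Union>l\<in>lk D ` links N. set_link l) \<union> (Old ` front D \<union> (\<Union>e\<in>front D. New e ` nms (fm e)))"
  by (simp only: 3)
 show ?thesis
 proof (rule union_absorb[OF 4 1])
  show "Old ` edges N \<subseteq> (\<Union>l\<in>lk D ` links N. set_link l)" by (rule image_subsetI) (rule 2)
  show "Old ` front D \<subseteq> Old ` edges N" by (intro image_mono subsetI) (rule front_D(1))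
 qed
qed

lemma state_mem:
 "Old e \<in> edges (state D) \<longleftrightarrow> e \<in> edges N"
 "New e n \<in> edges (state D) \<longleftrightarrow> e \<in> front D \<and> n \<in> nms (fm e)"
 unfolding state_edges by auto

lemma locN: "e \<in> edges N \<Longrightarrow> loc N e = Some b \<Longrightarrow> b \<in> edges N"
 using net_boxed[OF net] unfolding boxed_def by blast

lemma state_boxed: "boxed (state D)"
 unfolding boxed_def
proof (intro ballI allI impI)
 fix y b assume y: "y \<in> edges (state D)" "loc (state D) y = Some b"
 show "b \<in> edges (state D)"
 proof (cases y)
  case (Old e)
  then show ?thesis using y locN by (auto simp: state_mem)
 next
  case (New e n)
  then show ?thesis using y locN[of e] front_D(1)[of e] idloc_closed[of n "fm e"]
   by (auto simp: state_mem split: option.splits)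
 qed
qed

lemma prems_not_concl: "l \<in> links N \<Longrightarrow> p \<in> prems l \<Longrightarrow> p \<notin> concls l"
 using descent[OF net] by blast

text \<open>Formula premises become the new front as soon as their conclusion is rebuilt. The
  condition on conclusions is restricted to links with premises because of axioms, whose two
  conclusions are absorbed one at a time.\<close>

lemma front_insert:
 assumes D: "stage D" and x: "x \<in> front D" and l: "l \<in> links N" "x \<in> concls l"
  and k: "\<And>p. p \<in> prems l \<Longrightarrow> \<exists>A. lab N p = Fm A" and c: "prems l \<noteq> {} \<Longrightarrow> concls l = {x}"
 shows "stage (insert x D)" "front (insert x D) = front D - {x} \<union> prems l"
proof -
 have pr: "l' = l" if "l' \<in> links N" "x \<in> concls l'" for l'
  using producer_unique[OF net that(1) l(1) that(2) l(2)] .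
 show "stage (insert x D)"
  unfolding stage_def
 proof (intro conjI ballI allI impI)
  show "insert x D \<subseteq> edges N" using D x by (auto simp: stage_def front_def)
  fix m p assume m: "m \<in> links N" "p \<in> prems m"
  show "concls m \<subseteq> insert x D" if "p \<in> insert x D" using that m D x by (auto simp: stage_def front_def)
  fix A assume a: "lab N p = Fl A" "concls m \<subseteq> insert x D"
  have "x \<notin> concls m" using pr[OF m(1)] m(2) k[of p] a by auto
  then show "p \<in> insert x D" using a m D unfolding stage_def by blast
 qed
 show "front (insert x D) = front D - {x} \<union> prems l"
 proof (intro set_eqI iffI)
  fix e assume e: "e \<in> front (insert x D)"
  show "e \<in> front D - {x} \<union> prems l"
  proof (cases "e \<in> prems l")
   case False
   have "concls m \<subseteq> D" if "m \<in> links N" "e \<in> prems m" for m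
   proof -
    have "x \<notin> concls m" using pr[OF that(1)] that(2) False by auto
    then show ?thesis using e that by (auto simp: front_def)
   qed
   then show ?thesis using e by (auto simp: front_def)
  qed simp
 next
  fix e assume e: "e \<in> front D - {x} \<union> prems l"
  show "e \<in> front (insert x D)"
  proof (cases "e \<in> prems l")
   case True
   have "e \<notin> D" using D True l front_D(2)[OF x] by (auto simp: stage_def)
   moreover have "e \<noteq> x" using prems_not_concl[OF l(1) True] l(2) by auto
   moreover have "concls m \<subseteq> insert x D" if "m \<in> links N" "e \<in> prems m" for m
    using consumer_unique[OF net that(1) l(1) that(2) True] c True by auto
   moreover have "e \<in> edges N" using True l prems_subset by blast
   ultimately show ?thesis using k[OF True] by (auto simp: front_def)
  qed (use e in \<open>auto simp: front_def\<close>)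
 qed
qed

section \<open>Removing a redex from a state\<close>

lemma concls_empty: "concls m = {} \<longleftrightarrow> (\<exists>u. m = CutL u)"
proof -
 have "set_uprod u \<noteq> {}" for u :: "'b uprod" by (cases u) simp
 then show ?thesis by (cases m) auto
qed

lemma concls_ne: "m \<in> links N \<Longrightarrow> concls m \<noteq> {}"
 unfolding concls_empty by auto

lemma lk_ne_cut: "m \<in> links N \<Longrightarrow> lk D m \<noteq> CutL u"
 by (cases m) auto

lemma New_ne_cut: "k \<in> idl F tw' j \<Longrightarrow> map_link f k \<noteq> CutL u"
 using idl_no_cut by (auto simp: map_link_eq_iffs)

lemma lk_ne_New: assumes "m \<in> links N" shows "lk D m \<noteq> map_link (New e) k"
proof
 assume "lk D m = map_link (New e) k"
 then have "Old ` concls m = New e ` concls k" by (metis lk_concls concls_map)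
 then have "concls m = {}" by blast
 then show False using concls_ne[OF assms] by simp
qed

lemma New_eqD: assumes "k \<in> idl F tw' j" "map_link (New e) k = map_link (New e') k'"
 shows "e = e' \<and> k = k'"
proof -
 have "New e ` concls k = New e' ` concls k'" using assms(2) by (metis concls_map)
 moreover have "concls k \<noteq> {}" using assms(1) idl_no_cut concls_empty by metis
 ultimately have "e = e'" by blast
 then show ?thesis using assms(2) link.inj_map[of "New e"] by (simp add: inj_def)
qed

lemma lk_eqD: assumes "m \<in> links N" "l \<in> links N" "lk D m = lk D l" shows "m = l"
proof -
 have "Old ` concls m = Old ` concls l" using assms(3) by (metis lk_concls)
 then have "concls m = concls l" by blast
 moreover have "concls m \<noteq> {}" using concls_ne[OF assms(1)] .
 ultimately show ?thesis using producer_unique[OF net assms(1,2)] by blast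
qed

text \<open>The three links of a redex are told apart from all others by their conclusions: old
  edges for the host, new edges of a given root for a graft, none for a cut. So removing them
  affects only the graft on \<open>x\<close> and the link \<open>l\<close>.\<close>

lemma strip:
 assumes x: "x \<in> front D" and l: "l \<in> links N" and k: "k \<in> idl (fm x) tw (lv x)"
 shows "links (state D) - {CutL (Upair (Old x) (New x Neg)), lk D l, map_link (New x) k} =
  lk D ` (links N - {l}) \<union> (\<Union>e\<in>front D - {x}. graft e) \<union> map_link (New x) ` (idl (fm x) tw (lv x) - {k})"
proof -
 have 1: "lk D ` links N - {CutL (Upair (Old x) (New x Neg)), lk D l, map_link (New x) k} = lk D ` (links N - {l})"
  using lk_ne_cut[of _ D] lk_ne_New[of _ D x k] lk_eqD[OF _ l, of _ D] by (auto simp: image_iff)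
 have 2: "graft e - {CutL (Upair (Old x) (New x Neg)), lk D l, map_link (New x) k} = graft e" if "e \<noteq> x" for e
 proof -
  have "m \<notin> {CutL (Upair (Old x) (New x Neg)), lk D l, map_link (New x) k}" if m: "m \<in> graft e" for m
  proof (cases "m = CutL (Upair (Old e) (New e Neg))")
   case True
   then show ?thesis using \<open>e \<noteq> x\<close> lk_ne_cut[OF l, of D] New_ne_cut[OF k, of "New x"] by (auto dest: sym)
  next
   case False
   then obtain k' where k': "m = map_link (New e) k'" "k' \<in> idl (fm e) tw (lv e)" using m by (auto simp: graft_def)
   then show ?thesis using \<open>e \<noteq> x\<close> lk_ne_New[OF l, of D e k'] New_ne_cut[OF k'(2), of "New e"] New_eqD[OF k'(2), of e x k]
    by (auto dest: sym)
  qed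
  then show ?thesis by blast
 qed
 have 3: "graft x - {CutL (Upair (Old x) (New x Neg)), lk D l, map_link (New x) k} =
   map_link (New x) ` (idl (fm x) tw (lv x) - {k})"
  (is "_ - ?R = ?B")
 proof -
  have "map_link (New x) k' \<in> ?R \<longleftrightarrow> k' = k" if k': "k' \<in> idl (fm x) tw (lv x)" for k'
   using lk_ne_New[OF l, of D x k'] New_ne_cut[OF k', of "New x"] New_eqD[OF k', of x x k] by (auto dest: sym)
  then show ?thesis unfolding graft_def by auto
 qed
 have 4: "(\<Union>e\<in>front D. graft e) = (\<Union>e\<in>front D - {x}. graft e) \<union> graft x" using x by blast
 have 5: "(\<Union>e\<in>front D - {x}. graft e) - R = (\<Union>e\<in>front D - {x}. graft e)" if "\<And>e. e \<noteq> x \<Longrightarrow> graft e - R = graft e" for R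
  using that by blast
 have 6: "(\<Union>e\<in>front D - {x}. graft e) - {CutL (Upair (Old x) (New x Neg)), lk D l, map_link (New x) k} = (\<Union>e\<in>front D - {x}. graft e)"
  by (rule 5) (rule 2)
 show ?thesis unfolding state_simps 4 Un_Diff 1 3 6 Un_assoc ..
qed

section \<open>Advancing a stage by one link\<close>

lemma map_lk:
 assumes "\<And>p. p \<in> prems m \<Longrightarrow> h (low D' p) = low D p"
  and "\<And>c. c \<in> concls m \<Longrightarrow> h (Old c) = Old c \<and> swapped D' c = swapped D c"
 shows "map_link h (lk D' m) = lk D m"
 using assms
 by (cases m) (auto simp: uprod.map_comp fset.map_comp intro!: uprod.map_cong0 fset.map_cong0)

text \<open>The renaming from the larger state to the reduct. In the reduct the rebuilt conclusion
  is still called \<open>New x Pos\<close>, and the graft on a premise \<open>e\<close> is still the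
  subtree of the graft on \<open>x\<close> reached by the path \<open>w e\<close>.\<close>

definition hop :: "'e \<Rightarrow> 'e set \<Rightarrow> ('e \<Rightarrow> nm \<Rightarrow> nm) \<Rightarrow> 'e name \<Rightarrow> 'e name" where
 "hop x K w y = (case y of Old z \<Rightarrow> if z = x then New x Pos else Old z
   | New e n \<Rightarrow> if e \<in> K then New x (w e n) else New e n)"

lemma hop_simps [simp]:
 "hop x K w (Old z) = (if z = x then New x Pos else Old z)"
 "hop x K w (New e n) = (if e \<in> K then New x (w e n) else New e n)"
 by (simp_all add: hop_def)

text \<open>A step peels off the root of the identity on \<open>x\<close>: its positive root link
  takes the place of \<open>l\<close>, and its subtrees become the identities waiting on the
  premises of \<open>l\<close>. Of course links are excluded because their step moves edges into
  another box.\<close>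

lemma advance:
 assumes D: "stage D" and x: "x \<in> front D" and l: "l \<in> links N" "x \<in> concls l"
  and k: "\<And>p. p \<in> prems l \<Longrightarrow> \<exists>A. lab N p = Fm A" and c: "concls l = {x}" and nb: "\<And>a. l \<noteq> BangL a x"
  and w1: "\<And>e n n'. e \<in> prems l \<Longrightarrow> w e n = w e n' \<Longrightarrow> n = n'" "\<And>e n. e \<in> prems l \<Longrightarrow> w e n \<noteq> Pos"
  and w2: "\<And>e e' n n'. e \<in> prems l \<Longrightarrow> e' \<in> prems l \<Longrightarrow> w e n = w e' n' \<Longrightarrow> e = e'"
  and w3: "\<And>e n. e \<in> prems l \<Longrightarrow> idlab (fm x) (w e n) = idlab (fm e) n"
   "\<And>e n. e \<in> prems l \<Longrightarrow> idloc (fm x) (w e n) = map_option (w e) (idloc (fm e) n)"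
  and S: "links S = lk D ` (links N - {l}) \<union> (\<Union>e\<in>front D - {x}. graft e) \<union>
   insert (map_link (hop x (prems l) w) (lk (insert x D) l))
    (\<Union>e\<in>prems l. insert (CutL (Upair (Old e) (New x (w e Neg)))) (map_link (New x \<circ> w e) ` idl (fm e) tw (lv e)))"
   "lab S = lab (state D)" "loc S = loc (state D)"
 shows "net_iso (state (insert x D)) S"
proof -
 let ?D = "insert x D" and ?h = "hop x (prems l) w"
 note fr = front_insert[OF D x l k c]
 have nd: "\<not> is_door l"
 proof
  assume "is_door l"
  then obtain p y where "l = PaxL p y" using nb c by (auto simp: is_door_def)
  then show False using k[of p] net_typed[OF net l(1)] by auto
 qed
 have w4: "loc N e = loc N x" if "e \<in> prems l" for e
  by (rule loc_link[OF net l(1) nd]) (use that l in \<open>auto simp: set_link_eq\<close>)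
 \<comment> \<open>Boxes are named by conclusions of of course links, so \<open>x\<close> names none
   and its change of name does not touch \<open>loc\<close>.\<close>
 have w5: "loc N z \<noteq> Some x" if "z \<in> edges N" for z
 proof
  assume "loc N z = Some x"
  then obtain a where a: "BangL a x \<in> links N" using loc_box[OF net \<open>z \<in> edges N\<close>] by blast
  then show False using producer_unique[OF net a l(1) _ l(2)] nb by auto
 qed
 have nk: "p \<notin> front D" "p \<noteq> x" if "p \<in> prems l" for p
  using that l c front_D(2)[OF x] prems_not_concl[OF l(1) that] by (auto simp: front_def)
 have lowl: "?h (low ?D p) = low D p" if "p \<notin> prems l" for p
  using that fr(2) x nk by (auto simp: low_def)
 have lks: "map_link ?h (lk ?D m) = lk D m" if m: "m \<in> links N - {l}" for m
 proof (rule map_lk)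
  fix p assume "p \<in> prems m"
  then have "p \<notin> prems l" using m consumer_unique[OF net] l(1) by blast
  then show "?h (low ?D p) = low D p" by (rule lowl)
 next
  fix d assume "d \<in> concls m"
  then have "d \<noteq> x" using m producer_unique[OF net] l by blast
  then show "?h (Old d) = Old d \<and> swapped ?D d = swapped D d" by (simp add: swapped_def)
 qed
 have gr: "map_link ?h ` graft e = graft e" if e: "e \<in> front D - {x}" for e
 proof -
  have "e \<notin> prems l" using e nk by auto
  then have "map_link ?h (map_link (New e) m) = map_link (New e) m" for m
   unfolding map_link_comp by (intro map_link_cong) simp
  then show ?thesis using e \<open>e \<notin> prems l\<close> by (simp add: graft_def image_image)
 qed
 have gr': "map_link ?h ` graft e = insert (CutL (Upair (Old e) (New x (w e Neg)))) (map_link (New x \<circ> w e) ` idl (fm e) tw (lv e))"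
  if e: "e \<in> prems l" for e
 proof -
  have "map_link ?h (map_link (New e) m) = map_link (New x \<circ> w e) m" for m
   unfolding map_link_comp by (intro map_link_cong) (simp add: e)
  then show ?thesis using e nk[OF e] by (simp add: graft_def image_image)
 qed
 have im: "map_link ?h ` links (state ?D) = links S"
 proof -
  have 1: "lk ?D ` links N = lk ?D ` (links N - {l}) \<union> {lk ?D l}" using l by blast
  have "map_link ?h ` lk ?D ` (links N - {l}) = lk D ` (links N - {l})"
   unfolding image_image by (rule image_cong[OF refl lks])
  then have 2: "map_link ?h ` lk ?D ` links N = lk D ` (links N - {l}) \<union> {map_link ?h (lk ?D l)}"
   unfolding 1 image_Un by (simp only: image_insert image_empty)
  have "map_link ?h ` (\<Union>e\<in>front D - {x}. graft e) = (\<Union>e\<in>front D - {x}. graft e)"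
   unfolding image_UN by (rule SUP_cong[OF refl gr])
  moreover have "map_link ?h ` (\<Union>e\<in>prems l. graft e) = (\<Union>e\<in>prems l. insert (CutL (Upair (Old e) (New x (w e Neg)))) (map_link (New x \<circ> w e) ` idl (fm e) tw (lv e)))"
   unfolding image_UN by (rule SUP_cong[OF refl gr'])
  ultimately have 3: "map_link ?h ` (\<Union>e\<in>front ?D. graft e) = (\<Union>e\<in>front D - {x}. graft e) \<union>
    (\<Union>e\<in>prems l. insert (CutL (Upair (Old e) (New x (w e Neg)))) (map_link (New x \<circ> w e) ` idl (fm e) tw (lv e)))"
   by (simp only: fr(2) image_Un Union_Un_distrib)
  show ?thesis unfolding state_simps image_Un 2 3 S(1) by (rule union_shuffle)
 qed
 \<comment> \<open>Injectivity of the renaming rests on the paths \<open>w e\<close> being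
   injective, disjoint for different premises, and distinct from the root
   \<open>Pos\<close>.\<close>
 show ?thesis
 proof (rule net_isoI[OF _ im])
  show "inj_on ?h (edges (state ?D))"
  proof (rule inj_onI)
   fix y y' assume "y \<in> edges (state ?D)" "y' \<in> edges (state ?D)" "?h y = ?h y'"
   note yy = this
   have nx: "e \<noteq> x" if "New e n \<in> edges (state ?D)" for e n
    using that front_D(2)[of e ?D] by (auto simp: state_mem)
   have no: "?h (Old z) \<noteq> ?h (New e n)" if "New e n \<in> edges (state ?D)" for z e n
    using nx[OF that] w1(2)[of e n] by auto
   show "y = y'"
   proof (cases y)
    case (Old z)
    then obtain z' where z': "y' = Old z'" using yy no by (cases y') auto
    show ?thesis using yy(3) unfolding Old z' by (auto split: if_splits)
   next
    case (New e n)
    then obtain e' n' where n': "y' = New e' n'" using yy no[of e n] by (cases y') (auto dest: sym)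
    have e: "e \<noteq> x" "e' \<noteq> x" using nx yy New n' by auto
    show ?thesis
    proof (cases "e \<in> prems l \<and> e' \<in> prems l")
     case True
     then have "w e n = w e' n'" using yy(3) unfolding New n' by simp
     then show ?thesis using w2[of e e' n n'] w1(1)[of e n n'] True unfolding New n' by blast
    qed (use yy(3) e in \<open>auto simp: New n' split: if_splits\<close>)
   qed
  qed
 next
  fix y assume y: "y \<in> edges (state ?D)"
  show "lab S (?h y) = lab (state ?D) y"
  proof (cases y)
   case (Old e)
   then show ?thesis using front_D(3)[OF x] by (auto simp: S)
  next
   case (New e n)
   then show ?thesis using w3(1) by (auto simp: S)
  qed
  show "loc S (?h y) = map_option ?h (loc (state ?D) y)"
  proof (cases y)
   case (Old e)
   then have "e \<in> edges N" using y by (simp add: state_mem)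
   from w5[OF this] show ?thesis using Old by (cases "loc N e") (auto simp: S)
  next
   case (New e n)
   then have e: "e \<in> front ?D" using y by (simp add: state_mem)
   have "e \<noteq> x" using front_D(2)[OF e] by auto
   moreover have "map_option ?h (map_option Old (loc N e)) = map_option Old (loc N e)"
    using w5[OF front_D(1)[OF e]] by (cases "loc N e") auto
   ultimately show ?thesis using New w3(2)[of e n] w4[of e] by (auto simp: S split: option.splits)
  qed
 qed
qed

text \<open>Here \<open>r\<close> is the root link of the identity that faces \<open>l\<close>
  across the cut, and \<open>C\<close> are the cuts created by the step; equation \<open>C\<close>
  compares what is left of the graft with the grafts on the premises.\<close>

lemma step_iso:
 assumes D: "stage D" and x: "x \<in> front D" and l: "l \<in> links N" "x \<in> concls l"
  and k: "\<And>p. p \<in> prems l \<Longrightarrow> \<exists>A. lab N p = Fm A" and c: "concls l = {x}" and nb: "\<And>a. l \<noteq> BangL a x"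
  and w1: "\<And>e n n'. e \<in> prems l \<Longrightarrow> w e n = w e n' \<Longrightarrow> n = n'" "\<And>e n. e \<in> prems l \<Longrightarrow> w e n \<noteq> Pos"
  and w2: "\<And>e e' n n'. e \<in> prems l \<Longrightarrow> e' \<in> prems l \<Longrightarrow> w e n = w e' n' \<Longrightarrow> e = e'"
  and w3: "\<And>e n. e \<in> prems l \<Longrightarrow> idlab (fm x) (w e n) = idlab (fm e) n"
   "\<And>e n. e \<in> prems l \<Longrightarrow> idloc (fm x) (w e n) = map_option (w e) (idloc (fm e) n)"
  and r: "r \<in> idl (fm x) tw (lv x)"
  and C: "map_link (New x) ` (idl (fm x) tw (lv x) - {r}) \<union> C = insert (map_link (hop x (prems l) w) (lk (insert x D) l))
    (\<Union>e\<in>prems l. insert (CutL (Upair (Old e) (New x (w e Neg)))) (map_link (New x \<circ> w e) ` idl (fm e) tw (lv e)))"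
  and R: "R = {CutL (Upair (Old x) (New x Neg)), lk D l, map_link (New x) r}"
 shows "net_iso (state (insert x D)) (state D\<lparr>links := links (state D) - R \<union> C\<rparr>)"
proof (rule advance[OF D x l k c nb w1 w2 w3])
 show "links (state D\<lparr>links := links (state D) - R \<union> C\<rparr>) =
  lk D ` (links N - {l}) \<union> (\<Union>e\<in>front D - {x}. graft e) \<union>
   insert (map_link (hop x (prems l) w) (lk (insert x D) l))
    (\<Union>e\<in>prems l. insert (CutL (Upair (Old e) (New x (w e Neg)))) (map_link (New x \<circ> w e) ` idl (fm e) tw (lv e)))"
  unfolding R links_update strip[OF x l(1) r] C[symmetric] by (simp only: Un_assoc)
qed simp_all

lemma low_above: assumes D: "stage D" and x: "x \<in> front D" and l: "l \<in> links N" "x \<in> concls l" "p \<in> prems l" and c: "concls l = {x}"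
 shows "low D p = Old p" "p \<notin> front D"
 using front_D(2)[OF x] l c by (auto simp: low_def front_def)

lemma levD: "l \<in> links N \<Longrightarrow> \<forall>u. l \<noteq> AxL u \<Longrightarrow> indexed (\<lambda>e. int (lv e)) l"
 using lev by (auto simp: levelling_def)

section \<open>Multiplicative, paragraph and unit steps\<close>

lemma step_tensor:
 assumes D: "stage D" and x: "x \<in> front D" and l: "TensorL p q x \<in> links N"
  and R: "R = {CutL (Upair (Old x) (New x Neg)), TensorL (Old p) (Old q) (Old x), ParL (New x (Lt Neg)) (New x (Rt Neg)) (New x Neg)}"
  and C: "C = {CutL (Upair (Old p) (New x (Lt Neg))), CutL (Upair (Old q) (New x (Rt Neg)))}"
 shows "net_iso (state (insert x D)) (state D\<lparr>links := links (state D) - R \<union> C\<rparr>)"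
proof -
 obtain A B where ty: "p \<noteq> q" "lab N p = Fm A" "lab N q = Fm B" "lab N x = Fm (Tensor A B)"
  using net_typed[OF net l] by auto
 have f: "fm p = A" "fm q = B" "fm x = Tensor A B" using ty by (simp_all add: fm_def)
 have lo: "low D p = Old p" "low D q = Old q" using low_above[OF D x l] by simp_all
 have lo': "low (insert x D) p = New p Pos" "low (insert x D) q = New q Pos"
  using front_insert(2)[OF D x l] ty by (auto simp: low_def)
 have lv: "lv p = lv x" "lv q = lv x" using levD[OF l] by auto
 have nx: "x \<notin> D" using front_D(2)[OF x] .
 let ?w = "\<lambda>e. if e = p then Lt else Rt"
 let ?k = "ParL (Lt Neg) (Rt Neg) Neg"
 have rest: "idl (fm x) tw (lv x) - {?k} =
   insert (if tw (lv x) \<and> atom_pair (fm x) then TensorL (Rt Pos) (Lt Pos) Pos else TensorL (Lt Pos) (Rt Pos) Pos)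
    (map_link Lt ` idl A tw (lv x) \<union> map_link Rt ` idl B tw (lv x))"
  unfolding f by (auto simp: map_link_eq_iffs dest!: sym[of ?k])
 show ?thesis
 proof (rule step_iso[OF D x l, where w = ?w and r = ?k])
  \<comment> \<open>The surviving root link is crossed exactly when \<open>swapped\<close> holds for
    \<open>x\<close> in the larger stage: both depend on \<open>tw\<close> at the level of
    \<open>x\<close> and on the same formula.\<close>
  show "map_link (New x) ` (idl (fm x) tw (lv x) - {?k}) \<union> C = insert (map_link (hop x (prems (TensorL p q x)) ?w) (lk (insert x D) (TensorL p q x)))
    (\<Union>e\<in>prems (TensorL p q x). insert (CutL (Upair (Old e) (New x (?w e Neg)))) (map_link (New x \<circ> ?w e) ` idl (fm e) tw (lv e)))"
   unfolding rest C using ty(1) by (auto simp: lo' swapped_def f lv map_link_comp image_image image_Un)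
 qed (use ty in \<open>auto simp: f R lo swapped_def nx\<close>)
qed

lemma step_par:
 assumes D: "stage D" and x: "x \<in> front D" and l: "ParL p q x \<in> links N"
  and R: "R = {CutL (Upair (Old x) (New x Neg)), ParL (Old p) (Old q) (Old x), TensorL (New x (Lt Neg)) (New x (Rt Neg)) (New x Neg)}"
  and C: "C = {CutL (Upair (Old p) (New x (Lt Neg))), CutL (Upair (Old q) (New x (Rt Neg)))}"
 shows "net_iso (state (insert x D)) (state D\<lparr>links := links (state D) - R \<union> C\<rparr>)"
proof -
 obtain A B where ty: "p \<noteq> q" "lab N p = Fm A" "lab N q = Fm B" "lab N x = Fm (Par A B)"
  using net_typed[OF net l] by auto
 have f: "fm p = A" "fm q = B" "fm x = Par A B" using ty by (simp_all add: fm_def)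
 have lo: "low D p = Old p" "low D q = Old q" using low_above[OF D x l] by simp_all
 have lo': "low (insert x D) p = New p Pos" "low (insert x D) q = New q Pos"
  using front_insert(2)[OF D x l] ty by (auto simp: low_def)
 have lv: "lv p = lv x" "lv q = lv x" using levD[OF l] by auto
 have nx: "x \<notin> D" using front_D(2)[OF x] .
 let ?w = "\<lambda>e. if e = p then Lt else Rt"
 let ?k = "TensorL (Lt Neg) (Rt Neg) Neg"
 have rest: "idl (fm x) tw (lv x) - {?k} =
   insert (if tw (lv x) \<and> atom_pair (fm x) then ParL (Rt Pos) (Lt Pos) Pos else ParL (Lt Pos) (Rt Pos) Pos)
    (map_link Lt ` idl A tw (lv x) \<union> map_link Rt ` idl B tw (lv x))"
  unfolding f by (auto simp: map_link_eq_iffs dest!: sym[of ?k])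
 show ?thesis
 proof (rule step_iso[OF D x l, where w = ?w and r = ?k])
  show "map_link (New x) ` (idl (fm x) tw (lv x) - {?k}) \<union> C = insert (map_link (hop x (prems (ParL p q x)) ?w) (lk (insert x D) (ParL p q x)))
    (\<Union>e\<in>prems (ParL p q x). insert (CutL (Upair (Old e) (New x (?w e Neg)))) (map_link (New x \<circ> ?w e) ` idl (fm e) tw (lv e)))"
   unfolding rest C using ty(1) by (auto simp: lo' swapped_def f lv map_link_comp image_image image_Un)
 qed (use ty in \<open>auto simp: f R lo swapped_def nx\<close>)
qed

lemma step_paragraph:
 assumes D: "stage D" and x: "x \<in> front D" and l: "ParagraphL p x \<in> links N"
  and R: "R = {CutL (Upair (Old x) (New x Neg)), ParagraphL (Old p) (Old x), ParagraphL (New x (Sub Neg)) (New x Neg)}"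
  and C: "C = {CutL (Upair (Old p) (New x (Sub Neg)))}"
 shows "net_iso (state (insert x D)) (state D\<lparr>links := links (state D) - R \<union> C\<rparr>)"
proof -
 obtain A where ty: "lab N p = Fm A" "lab N x = Fm (Paragraph A)"
  using net_typed[OF net l] by auto
 have f: "fm p = A" "fm x = Paragraph A" using ty by (simp_all add: fm_def)
 have lo: "low D p = Old p" using low_above[OF D x l] by simp_all
 have lo': "low (insert x D) p = New p Pos"
  using front_insert(2)[OF D x l] ty by (auto simp: low_def)
 have lv: "lv p = Suc (lv x)" using levD[OF l] by auto
 let ?k = "ParagraphL (Sub Neg) Neg"
 have rest: "idl (fm x) tw (lv x) - {?k} = insert (ParagraphL (Sub Pos) Pos) (map_link Sub ` idl A tw (Suc (lv x)))"
  unfolding f by (auto simp: map_link_eq_iffs dest!: sym[of ?k])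
 show ?thesis
 proof (rule step_iso[OF D x l, where w = "\<lambda>_. Sub" and r = ?k])
  show "map_link (New x) ` (idl (fm x) tw (lv x) - {?k}) \<union> C = insert (map_link (hop x (prems (ParagraphL p x)) (\<lambda>_. Sub)) (lk (insert x D) (ParagraphL p x)))
    (\<Union>e\<in>prems (ParagraphL p x). insert (CutL (Upair (Old e) (New x (Sub Neg)))) (map_link (New x \<circ> Sub) ` idl (fm e) tw (lv e)))"
   unfolding rest C by (auto simp: lo' f lv map_link_comp image_image image_Un)
 qed (use ty in \<open>auto simp: f R lo\<close>)
qed

lemma step_unit:
 assumes D: "stage D" and x: "x \<in> front D"
  and l: "l = OneL x \<and> r = BotL Neg \<or> l = BotL x \<and> r = OneL Neg" "l \<in> links N"
  and R: "R = {CutL (Upair (Old x) (New x Neg)), lk D l, map_link (New x) r}"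
 shows "net_iso (state (insert x D)) (state D\<lparr>links := links (state D) - R\<rparr>)"
proof -
 have f: "fm x = (if l = OneL x then One else Bot)"
  using net_typed[OF net l(2)] l(1) by (auto simp: fm_def)
 have "net_iso (state (insert x D)) (state D\<lparr>links := links (state D) - R \<union> {}\<rparr>)"
  by (rule step_iso[OF D x l(2), where w = "\<lambda>_. Sub" and r = r]) (use l in \<open>auto simp: f R\<close>)
 then show ?thesis by simp
qed

section \<open>Axiom steps\<close>

lemma axiom_atoms:
 assumes l: "AxL (Upair x y) \<in> links N"
 shows "idl (fm x) tw j = {AxL (Upair Neg Pos)}" "\<not> atom_pair (fm x)" "lab N y = Fm (dual (fm x))" "x \<noteq> y"
  "\<And>z. z \<in> edges N \<Longrightarrow> loc N z \<noteq> Some x"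
proof -
 obtain Z where Z: "lab N x = Fm (Atom Z) \<or> lab N x = Fm (NAtom Z)" using atomic[OF l] by blast
 then have f: "fm x = Atom Z \<or> fm x = NAtom Z" by (auto simp: fm_def)
 show "idl (fm x) tw j = {AxL (Upair Neg Pos)}" "\<not> atom_pair (fm x)" using f by (auto simp: atom_pair_def)
 obtain e e' A where e: "Upair x y = Upair e e'" "lab N e = Fm A" "lab N e' = Fm (dual A)"
  using net_typed[OF net l] by auto
 then show y: "lab N y = Fm (dual (fm x))" using dual_dual by (auto simp: Upair_inject fm_def)
 show "x \<noteq> y" using y Z by (auto simp: fm_def)
 fix z assume "z \<in> edges N"
 show "loc N z \<noteq> Some x"
 proof
  assume "loc N z = Some x"
  then obtain a where a: "BangL a x \<in> links N" using loc_box[OF net \<open>z \<in> edges N\<close>] by blast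
  then show False using producer_unique[OF net a l, of x] by auto
 qed
qed

text \<open>The cut on \<open>x\<close> meets an axiom on either side, and the rule may contract
  either one: the axiom of the identity in the first part, that of the host in the second. Both
  results represent the same stage.\<close>

lemma step_axiom:
 assumes D: "stage D" and x: "x \<in> front D" and l: "AxL (Upair x y) \<in> links N"
 shows "net_iso (state (insert x D)) (state D\<lparr>links := map_link (id(New x Pos := Old x)) `
   (links (state D) - {AxL (Upair (New x Pos) (New x Neg)), CutL (Upair (New x Neg) (Old x))})\<rparr>)" (is ?A)
  and "net_iso (state (insert x D)) (state D\<lparr>links := map_link (id(Old y := New x Neg)) `
   (links (state D) - {AxL (Upair (Old y) (Old x)), CutL (Upair (Old x) (New x Neg))})\<rparr>)" (is ?B)
proof -
 let ?l = "AxL (Upair x y)" and ?D = "insert x D"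
 have l': "AxL (Upair y x) \<in> links N" using l by (simp add: Upair_swap)
 note ax = axiom_atoms[OF l] and ay = axiom_atoms[OF l']
 have fr: "front ?D = front D - {x}" using front_insert(2)[OF D x l] by simp
 let ?cut = "CutL (Upair (Old x) (New x Neg))" and ?k = "AxL (Upair (New x Neg) (New x Pos))"
 let ?a = "AxL (Upair (Old x) (Old y))"
 have kin: "AxL (Upair Neg Pos) \<in> idl (fm x) tw (lv x)" using ax(1) by simp
 have st: "links (state D) - {?cut, ?a, ?k} = lk D ` (links N - {?l}) \<union> (\<Union>e\<in>front D - {x}. graft e)"
  using strip[OF x l kin] ax(1) by simp
 have mem: "?cut \<in> links (state D)" "?a \<in> links (state D)" "?k \<in> links (state D)"
  using x l ax(1)[of "lv x"] by (force simp: graft_def)+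
 have d: "S - {k, c} = insert a (S - {c, a, k})" "S - {a, c} = insert k (S - {c, a, k})"
  if "c \<in> S" "a \<in> S" "k \<in> S" "a \<noteq> k" "a \<noteq> c" "k \<noteq> c" for S :: "'e name link set" and a c k using that by blast+
 have ne: "?a \<noteq> ?k" "?a \<noteq> ?cut" "?k \<noteq> ?cut" by simp_all
 have s1: "links (state D) - {?k, ?cut} = insert ?a (lk D ` (links N - {?l}) \<union> (\<Union>e\<in>front D - {x}. graft e))"
  unfolding d(1)[OF mem ne] st ..
 have s2: "links (state D) - {?a, ?cut} = insert ?k (lk D ` (links N - {?l}) \<union> (\<Union>e\<in>front D - {x}. graft e))"
  unfolding d(2)[OF mem ne] st ..
 have sw: "swapped D c = swapped ?D c" for c using ax(2) by (auto simp: swapped_def)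
 have lks: "lk D' ` links N = insert (lk D' ?l) (lk D' ` (links N - {?l}))" for D' using l by blast
 have gr: "map_link h ` graft e = graft e" if "\<And>n. h (New e n) = New e n" "h (Old e) = Old e" for h e
 proof -
  have "map_link h (map_link (New e) m) = map_link (New e) m" for m
   unfolding map_link_comp by (intro map_link_cong) (simp add: that)
  then show ?thesis using that by (simp add: graft_def image_image)
 qed
 show ?A
 proof (rule net_isoI[where f = id])
  let ?h = "id(New x Pos := Old x)"
  have "map_link ?h (lk D m) = lk ?D m" for m
   by (rule map_lk) (use fr sw front_D(2)[OF x] in \<open>auto simp: low_def\<close>)
  then have 1: "map_link ?h ` lk D ` M = lk ?D ` M" for M by (simp add: image_image)
  have 2: "map_link ?h ` (\<Union>e\<in>front D - {x}. graft e) = (\<Union>e\<in>front D - {x}. graft e)"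
   unfolding image_UN by (rule SUP_cong[OF refl gr]) auto
  have 3: "map_link ?h ?a = lk ?D ?l" by simp
  have "map_link ?h ` (links (state D) - {?k, ?cut}) = links (state ?D)"
   unfolding s1 image_insert image_Un 1 2 3 unfolding state_simps(1) lks[of ?D] fr by simp
  then show "map_link id ` links (state ?D) = links (state D\<lparr>links := map_link (id(New x Pos := Old x)) `
   (links (state D) - {AxL (Upair (New x Pos) (New x Neg)), CutL (Upair (New x Neg) (Old x))})\<rparr>)"
   unfolding links_update by (simp add: link.map_id0 Upair_swap[of "New x Pos"] Upair_swap[of _ "Old x"])
 qed (simp_all add: state_def option.map_id0)
 show ?B
 proof -
  \<comment> \<open>When the axiom of the host is contracted, that of the identity survives in its
    place: \<open>New x Neg\<close> stands where \<open>Old y\<close> was, and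
    \<open>New x Pos\<close> stands for \<open>Old x\<close>.\<close>
  let ?r = "id(Old y := New x Neg)" and ?h = "id(Old y := New x Neg, Old x := New x Pos)"
  have 1: "map_link ?h (lk ?D m) = map_link ?r (lk D m)" if m: "m \<in> links N - {?l}" for m
  proof -
   have "y \<notin> concls m" "x \<notin> concls m" using m producer_unique[OF net _ l] by auto
   then have c: "?h (Old c) = ?r (Old c)" if "c \<in> concls m" for c using that by auto
   have p: "?h (low ?D p) = ?r (low D p)" for p
    using x ax(4) by (auto simp: low_def fr)
   show ?thesis using c p sw
    by (cases m) (auto simp: uprod.map_comp fset.map_comp intro!: uprod.map_cong0 fset.map_cong0)
  qed
  have 2: "map_link ?h ` graft e = map_link ?r ` graft e" if "e \<in> front D - {x}" for e
  proof -
   have "map_link ?h (map_link (New e) m) = map_link ?r (map_link (New e) m)" for m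
    unfolding map_link_comp by (intro map_link_cong) (use that in auto)
   then show ?thesis using that by (simp add: graft_def image_image)
  qed
  have im: "map_link ?h ` links (state ?D) = map_link ?r ` (links (state D) - {?a, ?cut})"
  proof -
   have "map_link ?h ` lk ?D ` (links N - {?l}) = map_link ?r ` lk D ` (links N - {?l})"
    unfolding image_image by (rule image_cong[OF refl 1])
   moreover have "map_link ?h ` (\<Union>e\<in>front D - {x}. graft e) = map_link ?r ` (\<Union>e\<in>front D - {x}. graft e)"
    unfolding image_UN by (rule SUP_cong[OF refl 2])
   moreover have "map_link ?h (lk ?D ?l) = map_link ?r ?k" using ax(4) by (simp add: Upair_swap)
   ultimately show ?thesis unfolding s2 unfolding state_simps(1) lks[of ?D] fr
    by (simp only: image_insert image_Un Un_insert_left)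
  qed
  have nx: "New x n \<notin> edges (state ?D)" for n by (simp add: state_mem fr)
  show ?B
  proof (rule net_isoI[where f = ?h])
   show "inj_on ?h (edges (state ?D))" using nx ax(4) by (auto simp: inj_on_def)
   show "map_link ?h ` links (state ?D) = links (state D\<lparr>links := map_link (id(Old y := New x Neg)) `
   (links (state D) - {AxL (Upair (Old y) (Old x)), CutL (Upair (Old x) (New x Neg))})\<rparr>)"
    unfolding links_update im by (simp add: Upair_swap[of "Old y"])
   fix z assume z: "z \<in> edges (state ?D)"
   show "lab (state D\<lparr>links := map_link (id(Old y := New x Neg)) `
    (links (state D) - {AxL (Upair (Old y) (Old x)), CutL (Upair (Old x) (New x Neg))})\<rparr>) (?h z) = lab (state ?D) z"
    using ax(3) front_D(3)[OF x] by (cases z) auto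
   have "loc N y = loc N x" by (rule loc_link[OF net l]) (auto simp: is_door_def)
   moreover have "map_option ?h (map_option Old (loc N e)) = map_option Old (loc N e)" if "e \<in> edges N" for e
    using ax(5)[OF that] ay(5)[OF that] by (cases "loc N e") auto
   moreover have "e \<in> edges N" if "z = Old e \<or> z = New e n" for e n using that z front_D(1) by (auto simp: state_mem)
   ultimately show "loc (state D\<lparr>links := map_link (id(Old y := New x Neg)) `
    (links (state D) - {AxL (Upair (Old y) (Old x)), CutL (Upair (Old x) (New x Neg))})\<rparr>) (?h z) = map_option ?h (loc (state ?D) z)"
    using nx z ax(4) by (cases z) (auto split: option.splits)
  qed
 qed
qed

end

subsection \<open>The exponential steps\<close>

text \<open>Introduction rules \<open>exp_keepI\<close> to \<open>exp_whynotI\<close>, one for each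
  family of links of \<open>exp_reduct\<close>, and the matching case rule
  \<open>exp_linksE\<close>, so that its definition need not be unfolded in the comparison of
  links.\<close>

lemma exp_keepI:
 "\<lbrakk>l \<in> links N; l \<noteq> CutL (Upair b w); l \<noteq> BangL a b; l \<noteq> WhynotL P w;
  \<And>d. d \<in> fset P \<Longrightarrow> concls l \<inter> thread N d = {};
  set_link l \<inter> inside N b = {}; prems l \<inter> below N b = {}\<rbrakk> \<Longrightarrow> map_link Keep l \<in> links (exp_reduct N a b P w)"
 unfolding exp_reduct_def net.select_convs set_link_eq
 by (rule UnI1, rule UnI1, rule UnI1, rule UnI1, rule UnI1, rule imageI) blast

lemma exp_copyI:
 "\<lbrakk>l \<in> links N; set_link l \<subseteq> inside N b; d \<in> fset P\<rbrakk> \<Longrightarrow> map_link (Copy d) l \<in> links (exp_reduct N a b P w)"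
 unfolding exp_reduct_def net.select_convs set_link_eq
 by (rule UnI1, rule UnI1, rule UnI1, rule UnI1, rule UnI2) blast

lemma exp_cutI:
 "\<lbrakk>FlatL s (thread_top N d) \<in> links N; d \<in> fset P\<rbrakk> \<Longrightarrow> CutL (Upair (Keep s) (Copy d a)) \<in> links (exp_reduct N a b P w)"
 unfolding exp_reduct_def net.select_convs
 by (rule UnI1, rule UnI1, rule UnI1, rule UnI2) blast

lemma exp_strandI:
 "\<lbrakk>d \<in> fset P; (x, y) \<in> aux_doors N b; z' \<in> thread N d; PaxL z z' \<in> links N\<rbrakk> \<Longrightarrow>
  PaxL (strand N d x z) (strand N d x z') \<in> links (exp_reduct N a b P w)"
 unfolding exp_reduct_def net.select_convs
 by (rule UnI1, rule UnI1, rule UnI2) blast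

lemma exp_belowI:
 "\<lbrakk>d \<in> fset P; z \<in> below N b; PaxL z z' \<in> links N\<rbrakk> \<Longrightarrow>
  PaxL (below_copy N b d z) (below_copy N b d z') \<in> links (exp_reduct N a b P w)"
 unfolding exp_reduct_def net.select_convs
 by (rule UnI1, rule UnI2) blast

lemma exp_whynotI:
 "\<lbrakk>WhynotL Q v \<in> links N; fset Q \<inter> below N b \<noteq> {};
  fset R = Keep ` (fset Q - below N b) \<union> (\<Union>d\<in>fset P. below_copy N b d ` (fset Q \<inter> below N b))\<rbrakk> \<Longrightarrow>
  WhynotL R (Keep v) \<in> links (exp_reduct N a b P w)"
 unfolding exp_reduct_def net.select_convs
 by (rule UnI2, rule CollectI, intro exI conjI) (rule refl)

lemma exp_linksE:
 assumes "k \<in> links (exp_reduct N a b P w)"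
 obtains (keep) l where "k = map_link Keep l" "l \<in> links N" "l \<noteq> CutL (Upair b w)" "l \<noteq> BangL a b" "l \<noteq> WhynotL P w"
   "\<And>d. d \<in> fset P \<Longrightarrow> concls l \<inter> thread N d = {}" "set_link l \<inter> inside N b = {}" "prems l \<inter> below N b = {}"
 | (copy) l d where "k = map_link (Copy d) l" "l \<in> links N" "set_link l \<subseteq> inside N b" "d \<in> fset P"
 | (cut) s d where "k = CutL (Upair (Keep s) (Copy d a))" "d \<in> fset P" "FlatL s (thread_top N d) \<in> links N"
 | (strand) d x y z z' where "k = PaxL (strand N d x z) (strand N d x z')" "d \<in> fset P" "(x, y) \<in> aux_doors N b"
   "z' \<in> thread N d" "PaxL z z' \<in> links N"
 | (below) d z z' where "k = PaxL (below_copy N b d z) (below_copy N b d z')" "d \<in> fset P" "z \<in> below N b" "PaxL z z' \<in> links N"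
 | (whynot) R Q v where "k = WhynotL R (Keep v)" "WhynotL Q v \<in> links N" "fset Q \<inter> below N b \<noteq> {}"
   "fset R = Keep ` (fset Q - below N b) \<union> (\<Union>d\<in>fset P. below_copy N b d ` (fset Q \<inter> below N b))"
 using assms unfolding exp_reduct_def net.select_convs
 apply (elim UnE)
 subgoal premises p
 proof -
  from p(7) obtain l where l: "k = map_link Keep l" "l \<in> links N" "l \<noteq> CutL (Upair b w)" "l \<noteq> BangL a b" "l \<noteq> WhynotL P w"
   "concls l \<inter> (\<Union>d\<in>fset P. thread N d) = {}" "(prems l \<union> concls l) \<inter> inside N b = {}" "prems l \<inter> below N b = {}"
   by (elim imageE CollectE conjE) blast
  show ?thesis by (rule p(1)[OF l(1-5)]) (use l(6-8) in \<open>unfold set_link_eq, blast+\<close>)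
 qed
 subgoal premises p using p(7) by (elim UN_E imageE CollectE conjE) (rule p(2), auto simp: set_link_eq)
 subgoal premises p using p(7) by (elim CollectE exE conjE) (rule p(3))
 subgoal premises p using p(7) by (elim CollectE exE conjE) (rule p(4))
 subgoal premises p using p(7) by (elim CollectE exE conjE) (rule p(5))
 subgoal premises p using p(7) by (elim CollectE exE conjE) (rule p(6))
 done

text \<open>The host edge that decides which boxes of the host contain a given edge of a
  state.\<close>

primrec root :: "'e name \<Rightarrow> 'e" where
 "root (Old e) = e"
| "root (New e n) = e"

text \<open>Each pax link leaves one more box, so below an auxiliary door of \<open>b\<close> the
  nesting never exceeds that of \<open>b\<close>, and labels stay flat. Hence these edges are
  neither inside \<open>b\<close> nor on any front.\<close>

lemma below_Fl:
 assumes N: "is_net N" and z: "z \<in> below N b"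
 shows "\<exists>A. lab N z = Fl A" "nesting N z \<le> nesting N b" "z \<in> edges N" "\<exists>u. PaxL u z \<in> links N"
proof -
 obtain x y where xy: "PaxL x y \<in> links N" "loc N x = Some b" and r: "(pax_rel N)\<^sup>*\<^sup>* y z"
  using z by (auto simp: below_def aux_doors_def)
 have ed: "x \<in> edges N" "y \<in> edges N" using xy(1) pax_edges[of N x y] by (auto simp: pax_rel_def)
 have y: "nesting N y \<le> nesting N b" using nesting_pax[OF N xy(1)] nesting_Some[OF N ed(1) xy(2)] by simp
 from r have "(\<exists>A. lab N z = Fl A) \<and> nesting N z \<le> nesting N b \<and> (\<exists>u. PaxL u z \<in> links N)"
 proof (induction rule: rtranclp_induct)
  case base
  then show ?case using net_typed[OF N xy(1)] y xy(1) by auto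
 next
  case (step u v)
  then have p: "PaxL u v \<in> links N" by (simp add: pax_rel_def)
  then show ?case using net_typed[OF N p] nesting_pax[OF N p] step.IH by auto
 qed
 then show "\<exists>A. lab N z = Fl A" "nesting N z \<le> nesting N b" "\<exists>u. PaxL u z \<in> links N" by auto
 show "z \<in> edges N" by (rule subsetD[OF below_edges z])
qed

lemma inside_nesting:
 assumes N: "is_net N" and z: "z \<in> inside N b" shows "nesting N b < nesting N z"
proof -
 have "(\<lambda>x y. loc N x = Some y)\<^sup>+\<^sup>+ z b" "z \<in> edges N" using z by (auto simp: inside_def)
 then show ?thesis
 proof (induction rule: converse_tranclp_induct)
  case (base y)
  then show ?case using nesting_Some[OF N] by simp
 next
  case (step y z)
  then have "z \<in> edges N" using net_boxed[OF N] by (auto simp: boxed_def)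
  then show ?case using step nesting_Some[OF N] by fastforce
 qed
qed

lemma inside_loc:
 assumes N: "is_net N" and z: "z \<in> edges N"
 shows "z \<in> inside N b \<longleftrightarrow> (\<exists>c. loc N z = Some c \<and> (c = b \<or> c \<in> inside N b))"
proof
 assume "z \<in> inside N b"
 then have "(\<lambda>x y. loc N x = Some y)\<^sup>+\<^sup>+ z b" by (auto simp: inside_def)
 then show "\<exists>c. loc N z = Some c \<and> (c = b \<or> c \<in> inside N b)"
 proof (cases rule: converse_tranclpE[consumes 1, case_names base step])
  case (step c)
  moreover have "c \<in> edges N" using step(1) z net_boxed[OF N] by (auto simp: boxed_def)
  ultimately show ?thesis by (auto simp: inside_def)
 qed auto
next
 assume "\<exists>c. loc N z = Some c \<and> (c = b \<or> c \<in> inside N b)"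
 then show "z \<in> inside N b" using z by (auto simp: inside_def intro: tranclp_into_tranclp2)
qed

section \<open>Boxes, doors and pax links of a state\<close>

context host
begin

text \<open>The premise of a pax link is a flat formula, hence never on the front, and
  \<open>low\<close> leaves it alone. So host and grafts contribute their pax links
  separately.\<close>

lemma state_pax:
 assumes "stage D"
 shows "PaxL y z \<in> links (state D) \<longleftrightarrow> (\<exists>u v. y = Old u \<and> z = Old v \<and> PaxL u v \<in> links N) \<or>
  (\<exists>e\<in>front D. \<exists>n m. y = New e n \<and> z = New e m \<and> PaxL n m \<in> idl (fm e) tw (lv e))"
proof -
 have "lk D l = PaxL y z \<longleftrightarrow> (\<exists>u v. y = Old u \<and> z = Old v \<and> l = PaxL u v)" if l: "l \<in> links N" for l
 proof (cases l)
  case (PaxL u v)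
  then have "low D u = Old u" using net_typed[OF net l] by (auto simp: low_def front_def)
  then show ?thesis using PaxL by auto
 qed auto
 then have "PaxL y z \<in> lk D ` links N \<longleftrightarrow> (\<exists>u v. y = Old u \<and> z = Old v \<and> PaxL u v \<in> links N)"
 proof -
  have "PaxL y z \<in> lk D ` links N \<longleftrightarrow> (\<exists>l\<in>links N. lk D l = PaxL y z)"
   unfolding image_iff by (simp add: eq_commute)
  also have "\<dots> \<longleftrightarrow> (\<exists>l\<in>links N. \<exists>u v. y = Old u \<and> z = Old v \<and> l = PaxL u v)"
   by (rule bex_cong[OF refl]) (rule \<open>\<And>l. l \<in> links N \<Longrightarrow> _\<close>)
  finally show ?thesis by blast
 qed
 moreover have "PaxL y z \<in> graft e \<longleftrightarrow> (\<exists>n m. y = New e n \<and> z = New e m \<and> PaxL n m \<in> idl (fm e) tw (lv e))" for e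
  by (auto simp: graft_def mem_map_link_iffs)
 ultimately show ?thesis by simp
qed

lemma state_pax_unique: assumes D: "stage D" shows "pax_unique (state D)"
 unfolding pax_unique_def state_pax[OF D]
proof (intro allI impI)
 fix y y' z
 assume 1: "(\<exists>u v. y = Old u \<and> z = Old v \<and> PaxL u v \<in> links N) \<or>
   (\<exists>e\<in>front D. \<exists>n m. y = New e n \<and> z = New e m \<and> PaxL n m \<in> idl (fm e) tw (lv e))"
  and 2: "(\<exists>u v. y' = Old u \<and> z = Old v \<and> PaxL u v \<in> links N) \<or>
   (\<exists>e\<in>front D. \<exists>n m. y' = New e n \<and> z = New e m \<and> PaxL n m \<in> idl (fm e) tw (lv e))"
 show "y = y'"
 proof (cases z)
  case (Old v)
  then obtain u u' where "y = Old u" "y' = Old u'" "PaxL u v \<in> links N" "PaxL u' v \<in> links N" using 1 2 by auto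
  then show ?thesis using net_pax_unique[OF net] by (auto simp: pax_unique_def)
 next
  case (New e m)
  then obtain n n' where "y = New e n" "y' = New e n'" "PaxL n m \<in> idl (fm e) tw (lv e)" "PaxL n' m \<in> idl (fm e) tw (lv e)"
   using 1 2 by auto
  then show ?thesis using idl_pax_unique by blast
 qed
qed

text \<open>A graft lies in the box of the edge it is cut with, and its own boxes are nested there.
  So only the root of a name matters for a box of the host; \<open>idloc_chain\<close> leads from
  any edge of a graft out to the box of its root.\<close>

lemma state_inside:
 assumes b: "b \<in> edges N"
 shows "inside (state D) (Old b) = {y \<in> edges (state D). root y \<in> inside N b}"
proof -
 let ?r = "\<lambda>y z. loc (state D) y = Some z" and ?rN = "\<lambda>y z. loc N y = Some z"
 have 1: "?r\<^sup>+\<^sup>+ y z \<Longrightarrow> z = Old b \<Longrightarrow> ?rN\<^sup>+\<^sup>+ (root y) b" for y z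
 proof (induction rule: converse_tranclp_induct)
  case (base y)
  then show ?case by (cases y) (auto split: option.splits)
 next
  case (step y z)
  then have IH: "?rN\<^sup>+\<^sup>+ (root z) b" by simp
  show ?case
  proof (cases y)
   case (Old u)
   then obtain v where "z = Old v" "loc N u = Some v" using step(1) by auto
   then show ?thesis using IH Old by (auto intro: tranclp_into_tranclp2)
  next
   case (New e n)
   then consider v where "z = Old v" "loc N e = Some v" | m where "z = New e m"
    using step(1) by (auto split: option.splits)
   then show ?thesis
   proof cases
    case 1 then show ?thesis using IH New by (auto intro: tranclp_into_tranclp2)
   next
    case 2 then show ?thesis using IH New by simp
   qed
  qed
 qed
 have 2: "?rN\<^sup>+\<^sup>+ u b \<Longrightarrow> ?r\<^sup>+\<^sup>+ (Old u) (Old b)" for u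
 proof (induction rule: converse_tranclp_induct)
  case (step y z)
  then have "loc (state D) (Old y) = Some (Old z)" by simp
  then show ?case using step.IH by (rule tranclp_into_tranclp2)
 qed auto
 have 3: "?r\<^sup>+\<^sup>+ (New e n) (Old b)" if n: "n \<in> nms (fm e)" and e: "?rN\<^sup>+\<^sup>+ e b" for e n
 proof -
  obtain m where m: "(\<lambda>x y. idloc (fm e) x = Some y)\<^sup>*\<^sup>* n m" "idloc (fm e) m = None" using idloc_chain[OF n] by blast
  have ch: "?r\<^sup>*\<^sup>* (New e n) (New e m)" using m(1)
  proof (induction rule: rtranclp_induct)
   case (step y z)
   then have "loc (state D) (New e y) = Some (New e z)" by simp
   then show ?case using step.IH by (metis (mono_tags, lifting) rtranclp.rtrancl_into_rtrancl)
  qed simp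
  from 2[OF e] have "?r\<^sup>+\<^sup>+ (New e m) (Old b)"
  proof (cases rule: converse_tranclpE[consumes 1, case_names base step])
   case base
   then show ?thesis using m(2) by (intro tranclp.r_into_trancl) simp
  next
   case (step c)
   then have "loc (state D) (New e m) = Some c" using m(2) by simp
   then show ?thesis using step(2) by (rule tranclp_into_tranclp2)
  qed
  then show ?thesis by (rule rtranclp_tranclp_tranclp[OF ch])
 qed
 show ?thesis
 proof (intro set_eqI iffI)
  fix y assume "y \<in> inside (state D) (Old b)"
  then have y: "y \<in> edges (state D)" "?r\<^sup>+\<^sup>+ y (Old b)" by (auto simp: inside_def)
  have "root y \<in> edges N" using y(1) front_D(1) by (cases y) (auto simp: state_mem)
  then show "y \<in> {y \<in> edges (state D). root y \<in> inside N b}" using y(1) 1[OF y(2) refl] by (simp add: inside_def)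
 next
  fix y assume "y \<in> {y \<in> edges (state D). root y \<in> inside N b}"
  then have y: "y \<in> edges (state D)" "?rN\<^sup>+\<^sup>+ (root y) b" by (auto simp: inside_def)
  then show "y \<in> inside (state D) (Old b)" using 2 3 by (cases y) (auto simp: inside_def state_mem)
 qed
qed

end

context host
begin

declare state_simps(1) [simp del]

lemma map_lk_gen:
 assumes "\<And>p. p \<in> prems m \<Longrightarrow> h (low D' p) = g (low D p)"
  and "\<And>c. c \<in> concls m \<Longrightarrow> h (Old c) = g (Old c)"
  and "\<And>c. c \<in> concls m \<Longrightarrow> swapped D' c = swapped D c"
 shows "map_link h (lk D' m) = map_link g (lk D m)"
 using assms
 by (cases m) (auto simp: uprod.map_comp fset.map_comp intro!: uprod.map_cong0 fset.map_cong0)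

lemma low_root [simp]: "root (low D p) = p"
 by (simp add: low_def)

lemma low_edge: "p \<in> edges N \<Longrightarrow> low D p \<in> edges (state D)"
 by (simp add: low_def state_mem)

lemma low_Fl: "lab N p = Fl A \<Longrightarrow> low D p = Old p"
 by (simp add: low_def front_def)

lemma lk_set_link: "set_link (lk D m) = low D ` prems m \<union> Old ` concls m"
 by (simp add: set_link_eq)

lemma state_flat:
 "FlatL s (Old t) \<in> links (state D) \<longleftrightarrow> (\<exists>u. s = low D u \<and> FlatL u t \<in> links N)"
 "FlatL s (New e n) \<in> links (state D) \<longleftrightarrow> e \<in> front D \<and> (\<exists>m. s = New e m \<and> FlatL m n \<in> idl (fm e) tw (lv e))"
proof -
 have 1: "lk D l = FlatL s y \<longleftrightarrow> (\<exists>u v. s = low D u \<and> y = Old v \<and> l = FlatL u v)" for l y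
  by (cases l) auto
 have 2: "FlatL s y \<in> lk D ` links N \<longleftrightarrow> (\<exists>u v. s = low D u \<and> y = Old v \<and> FlatL u v \<in> links N)" for y
 proof -
  have "FlatL s y \<in> lk D ` links N \<longleftrightarrow> (\<exists>l\<in>links N. lk D l = FlatL s y)"
   unfolding image_iff by (simp add: eq_commute)
  then show ?thesis unfolding 1 by blast
 qed
 have 3: "FlatL s y \<in> graft e \<longleftrightarrow> (\<exists>n m. s = New e n \<and> y = New e m \<and> FlatL n m \<in> idl (fm e) tw (lv e))" for e y
  by (auto simp: graft_def mem_map_link_iffs)
 show "FlatL s (Old t) \<in> links (state D) \<longleftrightarrow> (\<exists>u. s = low D u \<and> FlatL u t \<in> links N)"
  "FlatL s (New e n) \<in> links (state D) \<longleftrightarrow> e \<in> front D \<and> (\<exists>m. s = New e m \<and> FlatL m n \<in> idl (fm e) tw (lv e))"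
  unfolding state_simps Un_iff UN_iff 2 3 by auto
qed

lemma state_whynot:
 "WhynotL Q y \<in> links (state D) \<longleftrightarrow> (\<exists>P c. Q = low D |`| P \<and> y = Old c \<and> WhynotL P c \<in> links N) \<or>
  (\<exists>e\<in>front D. \<exists>P n. Q = New e |`| P \<and> y = New e n \<and> WhynotL P n \<in> idl (fm e) tw (lv e))"
proof -
 have 1: "lk D l = WhynotL Q y \<longleftrightarrow> (\<exists>P c. Q = low D |`| P \<and> y = Old c \<and> l = WhynotL P c)" for l
  by (cases l) auto
 have 2: "WhynotL Q y \<in> lk D ` links N \<longleftrightarrow> (\<exists>P c. Q = low D |`| P \<and> y = Old c \<and> WhynotL P c \<in> links N)"
 proof -
  have "WhynotL Q y \<in> lk D ` links N \<longleftrightarrow> (\<exists>l\<in>links N. lk D l = WhynotL Q y)"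
   unfolding image_iff by (simp add: eq_commute)
  then show ?thesis unfolding 1 by blast
 qed
 have 3: "WhynotL Q y \<in> graft e \<longleftrightarrow> (\<exists>P n. Q = New e |`| P \<and> y = New e n \<and> WhynotL P n \<in> idl (fm e) tw (lv e))" for e
  by (auto simp: graft_def mem_map_link_iffs)
 show ?thesis unfolding state_simps Un_iff UN_iff 2 3 by auto
qed

lemma whynot_prems: "WhynotL P c \<in> links N \<Longrightarrow> low D |`| P = Old |`| P"
 using net_typed[OF net, of "WhynotL P c"] by (intro fset.map_cong0) (auto intro: low_Fl)

text \<open>No pax link joins the host to a graft, so a chain of pax links stays on the side on
  which it starts.\<close>

lemma state_pax_rel:
 assumes D: "stage D"
 shows "(pax_rel (state D))\<^sup>*\<^sup>* (Old u) z \<longleftrightarrow> (\<exists>v. z = Old v \<and> (pax_rel N)\<^sup>*\<^sup>* u v)"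
  "(pax_rel (state D))\<^sup>*\<^sup>* y (Old v) \<longleftrightarrow> (\<exists>u. y = Old u \<and> (pax_rel N)\<^sup>*\<^sup>* u v)"
proof -
 have s: "pax_rel (state D) (Old u) (Old v)" if "pax_rel N u v" for u v
  using that by (simp only: pax_rel_def state_pax[OF D]) blast
 have i: "(pax_rel N)\<^sup>*\<^sup>* u v \<Longrightarrow> (pax_rel (state D))\<^sup>*\<^sup>* (Old u) (Old v)" for u v
  by (induction rule: rtranclp_induct) (auto intro: rtranclp.rtrancl_into_rtrancl s)
 have f: "pax_rel (state D) (Old u) z \<Longrightarrow> \<exists>v. z = Old v \<and> pax_rel N u v"
  and b: "pax_rel (state D) z (Old u) \<Longrightarrow> \<exists>v. z = Old v \<and> pax_rel N v u" for u z
  by (auto simp only: pax_rel_def state_pax[OF D])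
 have "(pax_rel (state D))\<^sup>*\<^sup>* y z \<Longrightarrow> y = Old u \<Longrightarrow> \<exists>v. z = Old v \<and> (pax_rel N)\<^sup>*\<^sup>* u v" for y
 proof (induction rule: rtranclp_induct)
  case (step y' z)
  then obtain w where w: "y' = Old w" "(pax_rel N)\<^sup>*\<^sup>* u w" by blast
  then obtain v where "z = Old v" "pax_rel N w v" using f step(2) by blast
  then show ?case using w(2) by (auto intro: rtranclp.rtrancl_into_rtrancl)
 qed simp
 note fw = this[OF _ refl]
 show "(pax_rel (state D))\<^sup>*\<^sup>* (Old u) z \<longleftrightarrow> (\<exists>v. z = Old v \<and> (pax_rel N)\<^sup>*\<^sup>* u v)"
 proof
  assume "\<exists>v. z = Old v \<and> (pax_rel N)\<^sup>*\<^sup>* u v"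
  then show "(pax_rel (state D))\<^sup>*\<^sup>* (Old u) z" by (elim exE conjE) (simp only: i)
 qed (rule fw)
 have "(pax_rel (state D))\<^sup>*\<^sup>* y z \<Longrightarrow> z = Old v \<Longrightarrow> \<exists>u. y = Old u \<and> (pax_rel N)\<^sup>*\<^sup>* u v" for z
 proof (induction rule: converse_rtranclp_induct)
  case (step y z')
  then obtain w where w: "z' = Old w" "(pax_rel N)\<^sup>*\<^sup>* w v" by blast
  then obtain u where "y = Old u" "pax_rel N u w" using b step(1) by blast
  then show ?case using w(2) by (auto intro: converse_rtranclp_into_rtranclp)
 qed simp
 note bw = this[OF _ refl]
 show "(pax_rel (state D))\<^sup>*\<^sup>* y (Old v) \<longleftrightarrow> (\<exists>u. y = Old u \<and> (pax_rel N)\<^sup>*\<^sup>* u v)"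
 proof
  assume "\<exists>u. y = Old u \<and> (pax_rel N)\<^sup>*\<^sup>* u v"
  then show "(pax_rel (state D))\<^sup>*\<^sup>* y (Old v)" by (elim exE conjE) (simp only: i)
 qed (rule bw)
qed

lemma state_thread_Old: "stage D \<Longrightarrow> thread (state D) (Old d) = Old ` thread N d"
 unfolding thread_def by (auto simp only: state_pax_rel mem_Collect_eq)

text \<open>The why not link of the identity has a single premise, which leaves a single box. When
  the host has an of course link at \<open>x\<close>, that is the link facing it, so the box of the
  host is copied exactly once.\<close>

lemma state_thread_New:
 assumes D: "stage D" and x: "x \<in> front D" and f: "fm x = Bang A \<or> fm x = Whynot A"
 shows "thread (state D) (New x Aux) = {New x Flt, New x Aux}"
  "threads_ok (state D) {|New x Aux|}" "thread_top (state D) (New x Aux) = New x Flt"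
proof -
 have 1: "pax_rel (state D) y (New x Aux) \<longleftrightarrow> y = New x Flt" for y
  unfolding pax_rel_def state_pax[OF D] using x f by (auto simp: mem_map_link_iffs)
 have 2: "\<not> pax_rel (state D) y (New x Flt)" for y
  unfolding pax_rel_def state_pax[OF D] using idl_pax_flt by fastforce
 show t: "thread (state D) (New x Aux) = {New x Flt, New x Aux}"
 proof -
  have "(pax_rel (state D))\<^sup>*\<^sup>* z (New x Aux) \<longleftrightarrow> z = New x Flt \<or> z = New x Aux" for z
  proof
   assume "(pax_rel (state D))\<^sup>*\<^sup>* z (New x Aux)"
   then show "z = New x Flt \<or> z = New x Aux"
   proof (cases rule: rtranclp.cases)
    case (rtrancl_into_rtrancl b)
    then have b: "(pax_rel (state D))\<^sup>*\<^sup>* z (New x Flt)" using 1 by auto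
    then have "z = New x Flt" by (cases rule: rtranclp.cases) (use 2 in auto)
    then show ?thesis by simp
   qed simp
  qed (use 1 in auto)
  then show ?thesis by (auto simp: thread_def)
 qed
 have fl: "FlatL s (New x Aux) \<notin> links (state D)" for s
  unfolding state_flat using f by (auto simp: mem_map_link_iffs)
 have ff: "\<exists>s. FlatL s (New x Flt) \<in> links (state D)"
  unfolding state_flat using f x by auto
 show ok: "threads_ok (state D) {|New x Aux|}"
  unfolding threads_ok_def using t fl ff by auto
 show "thread_top (state D) (New x Aux) = New x Flt"
  using thread_top_props(3)[OF ok, of "New x Aux" "New x Flt"] t ff by auto
qed

lemma state_threads_Old:
 assumes D: "stage D" and w: "WhynotL P c \<in> links N"
 shows "threads_ok (state D) (Old |`| P)" "\<And>d. d \<in> fset P \<Longrightarrow> thread_top (state D) (Old d) = Old (thread_top N d)"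
proof -
 have ex: "\<exists>!z. z \<in> thread N d \<and> (\<exists>s. FlatL s z \<in> links N)" if "d \<in> fset P" for d
  using net_threads_ok[OF net w] that by (auto simp: threads_ok_def)
 have m: "z \<in> thread (state D) (Old d) \<and> (\<exists>s. FlatL s z \<in> links (state D)) \<longleftrightarrow>
   (\<exists>y. z = Old y \<and> y \<in> thread N d \<and> (\<exists>s. FlatL s y \<in> links N))" for z d
  unfolding state_thread_Old[OF D] using state_flat(1) by auto
 show ok: "threads_ok (state D) (Old |`| P)"
  unfolding threads_ok_def
 proof
  fix d' assume "d' \<in> fset (Old |`| P)"
  then obtain d where d: "d' = Old d" "d \<in> fset P" by auto
  show "\<exists>!z. z \<in> thread (state D) d' \<and> (\<exists>s. FlatL s z \<in> links (state D))"
   unfolding d(1) m using ex[OF d(2)] by blast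
 qed
 fix d assume d: "d \<in> fset P"
 note t = thread_top_props(1,2)[OF net_threads_ok[OF net w] d]
 then obtain s where "FlatL s (thread_top N d) \<in> links N" by blast
 then have "FlatL (low D s) (Old (thread_top N d)) \<in> links (state D)" using state_flat(1) by blast
 then show "thread_top (state D) (Old d) = Old (thread_top N d)"
  using t d by (intro thread_top_props(3)[OF ok]) (auto simp: state_thread_Old[OF D])
qed

lemma state_aux_doors:
 assumes D: "stage D"
 shows "aux_doors (state D) (Old b) = {(Old u, Old v) | u v. (u, v) \<in> aux_doors N b}"
 unfolding aux_doors_def state_pax[OF D] using idl_pax_loc by (fastforce split: option.splits)

lemma state_below: "stage D \<Longrightarrow> below (state D) (Old b) = Old ` below N b"
 unfolding below_def by (force simp: state_aux_doors state_pax_rel(1))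

lemma inside_self: "b \<notin> inside N b"
 using inside_nesting[OF net, of b b] by auto

lemma below_not: assumes "z \<in> below N b" shows "z \<notin> inside N b" "lab N z \<noteq> Fm A" "\<And>D. z \<notin> front D"
 using below_Fl[OF net assms] inside_nesting[OF net, of z b] by (auto simp: front_def)

lemma box_Fm: assumes "e \<in> edges N" "loc N e = Some b" shows "\<exists>A. lab N b = Fm A"
 using loc_box[OF net assms] net_typed[OF net] by fastforce

text \<open>The position of a link with respect to the box \<open>x\<close>. Apart from
  \<open>root\<close>, which the step consumes, the cases match the families of
  \<open>exp_reduct\<close>: \<open>outer\<close> is kept, \<open>inner\<close> copied,
  \<open>door\<close> replaced by a strand, \<open>lower\<close> copied below the doors, and
  \<open>contraction\<close> receives new premises.\<close>

lemma bang_cases: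
 assumes m: "m \<in> links N" and x: "BangL a x \<in> links N"
 obtains (root) "m = BangL a x"
 | (outer) "m \<noteq> BangL a x" "set_link m \<inter> inside N x = {}" "prems m \<inter> below N x = {}"
 | (inner) "m \<noteq> BangL a x" "set_link m \<subseteq> inside N x"
 | (door) u v where "m = PaxL u v" "(u, v) \<in> aux_doors N x"
 | (lower) u v where "m = PaxL u v" "u \<in> below N x"
 | (contraction) Q c where "m = WhynotL Q c" "fset Q \<inter> below N x \<noteq> {}"
proof (cases "prems m \<inter> below N x = {}")
 case False
 then obtain p where p: "p \<in> prems m" "p \<in> below N x" by auto
 obtain B where "lab N p = Fl B" using below_Fl(1)[OF net p(2)] by auto
 then show ?thesis using net_typed[OF net m] p m that by (cases m) auto
next
 case bel: True
 have ed: "set_link m \<subseteq> edges N" using m by (rule set_link_subset)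
 have I: "z \<in> inside N x \<longleftrightarrow> (\<exists>c. loc N z = Some c \<and> (c = x \<or> c \<in> inside N x))" if "z \<in> edges N" for z
  using inside_loc[OF net that] .
 show ?thesis
 proof (cases "m = BangL a x")
  case ne: False
  show ?thesis
  proof (cases "set_link m \<inter> inside N x = {}")
   case False
   then obtain z where z: "z \<in> set_link m" "z \<in> inside N x" by auto
   show ?thesis
   proof (cases "is_door m")
    case False
    have "set_link m \<subseteq> inside N x"
    proof
     fix y assume y: "y \<in> set_link m"
     have "loc N y = loc N z" using y loc_link[OF net m False] z(1) by blast
     moreover have "y \<in> edges N" "z \<in> edges N" using y z(1) ed by auto
     ultimately show "y \<in> inside N x" using z(2) I[of y] I[of z] by simp
    qed
    then show ?thesis using inner ne by blast
   next
    case True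
    then consider p c where "m = BangL p c" | u v where "m = PaxL u v" by (auto simp: is_door_def)
    then show ?thesis
    proof cases
     case 1
     have lp: "loc N p = Some c" using loc_bang[OF net] m 1 by simp
     have "c \<noteq> x"
      using producer_unique[OF net x m, of x] ne 1 by auto
     then have "c \<in> inside N x \<and> p \<in> inside N x" using z ed I lp 1 by auto
     then show ?thesis using inner[OF ne] 1 by simp
    next
     case 2
     obtain b where b: "loc N u = Some b" "loc N v = loc N b" using loc_pax[OF net] m 2 by blast
     have e: "u \<in> edges N" "v \<in> edges N" using ed 2 by auto
     have bE: "b \<in> edges N" using locN[OF e(1) b(1)] .
     show ?thesis
     proof (cases "b = x")
      case True
      then show ?thesis using door[OF 2] m 2 b by (simp add: aux_doors_def)
     next
      case False
      have "v \<in> inside N x \<longleftrightarrow> b \<in> inside N x" using I[OF e(2)] I[OF bE] b by simp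
      moreover have "u \<in> inside N x \<longleftrightarrow> b \<in> inside N x" using I[OF e(1)] b False by simp
      ultimately show ?thesis using inner[OF ne] z 2 by auto
     qed
    qed
   qed
  qed (use outer ne bel in blast)
 qed (use root in blast)
qed

end

section \<open>An of course link of the host against the identity\<close>

context host
begin

text \<open>The content of the box \<open>x\<close> moves into the box of the identity, cut against
  its premise. That box takes over the role of \<open>x\<close>, the pax link of the identity is
  repeated once for each auxiliary door, and the cut inside is the one of the graft on
  \<open>a\<close>: the shape is that of the host with \<open>x\<close> rebuilt.\<close>

lemma step_bang:
 assumes D: "stage D" and x: "x \<in> front D" and l: "BangL a x \<in> links N"
 shows "net_iso (state (insert x D)) (exp_reduct (state D) (Old a) (Old x) {|New x Aux|} (New x Neg))"
proof -
 let ?S = "state D" and ?D = "insert x D" and ?d = "New x Aux" and ?I = "inside N x" and ?B = "below N x"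
 let ?X = "exp_reduct ?S (Old a) (Old x) {|New x Aux|} (New x Neg)"
 obtain A where ty: "lab N a = Fm A" "lab N x = Fm (Bang A)" using net_typed[OF net l] by auto
 have f: "fm a = A" "fm x = Bang A" using ty by (simp_all add: fm_def)
 have lva: "lv a = Suc (lv x)" using levD[OF l] by simp
 have xE: "x \<in> edges N" and aE: "a \<in> edges N" using l by (force simp: edges_def)+
 have la: "loc N a = Some x" by (rule loc_bang[OF net l])
 have ain: "a \<in> ?I" using la aE by (auto simp: inside_def)
 have xin: "x \<notin> ?I" by (rule inside_self)
 have ax: "a \<noteq> x" using ain xin by auto
 have fr: "front ?D = front D - {x} \<union> {a}" using front_insert(2)[OF D x l] ty by simp
 have lowa: "low D a = Old a" and af: "a \<notin> front D" using low_above[OF D x l] by simp_all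
 have nxD: "x \<notin> D" by (rule front_D(2)[OF x])
 note thr = state_thread_New[OF D x disjI1[OF f(2)]]
 have ins: "y \<in> inside ?S (Old x) \<longleftrightarrow> y \<in> edges ?S \<and> root y \<in> ?I" for y
  by (simp add: state_inside[OF xE])
 have bel: "below ?S (Old x) = Old ` ?B" by (rule state_below[OF D])
 have auxS: "aux_doors ?S (Old x) = {(Old u, Old v) | u v. (u, v) \<in> aux_doors N x}" by (rule state_aux_doors[OF D])
 have auxu: "u' = u" if "(u, v) \<in> aux_doors N x" "(u', v) \<in> aux_doors N x" for u u' v
  using that net_pax_unique[OF net] by (auto simp: aux_doors_def pax_unique_def)
 \<comment> \<open>The thread of the identity has only one edge besides its top, namely
   \<open>?d\<close>. So the conclusion of a door becomes the bottom of a strand of length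
   one.\<close>
 have bc1: "below_copy ?S (Old x) ?d (Old v) = Strand ?d (Old u) ?d" if uv: "(u, v) \<in> aux_doors N x" for u v
 proof -
  have e: "\<exists>y. (y, Old v) \<in> aux_doors ?S (Old x)" using uv auxS by auto
  have "(THE y. (y, Old v) \<in> aux_doors ?S (Old x)) = Old u"
   using uv auxu unfolding auxS by (intro the_equality) auto
  then show ?thesis unfolding below_copy_def strand_def thr(3) using e by simp
 qed
 have bc2: "below_copy ?S (Old x) ?d (Old v) = Copy ?d (Old v)" if "\<And>u. (u, v) \<notin> aux_doors N x" for v
  unfolding below_copy_def auxS using that by simp
 \<comment> \<open>Old \<open>x\<close> becomes the conclusion of the box of the identity, the
   content of \<open>x\<close> and the edges below its doors become their unique copies, and the
   graft on \<open>a\<close> is the subtree under \<open>Sub\<close> of the graft on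
   \<open>x\<close>.\<close>
 define h where "h y = (case y of
   Old z \<Rightarrow> if z = x then Keep (New x Pos) else if z \<in> ?I then Copy ?d (Old z)
    else if z \<in> ?B then below_copy ?S (Old x) ?d (Old z) else Keep (Old z)
  | New e n \<Rightarrow> if e = a then Keep (New x (Sub n)) else if e \<in> ?I then Copy ?d (New e n) else Keep (New e n))" for y
 have hO: "h (Old z) = (if z = x then Keep (New x Pos) else if z \<in> ?I then Copy ?d (Old z)
    else if z \<in> ?B then below_copy ?S (Old x) ?d (Old z) else Keep (Old z))"
  and hN: "h (New e n) = (if e = a then Keep (New x (Sub n)) else if e \<in> ?I then Copy ?d (New e n) else Keep (New e n))" for z e n
  by (simp_all add: h_def)
 have Bx: "z \<noteq> x" "z \<notin> ?I" if "z \<in> ?B" for z using that below_not ty by auto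
 have hB: "h (Old z) = below_copy ?S (Old x) ?d (Old z)" if "z \<in> ?B" for z
  using Bx[OF that] that by (simp add: hO)
 have sw: "swapped ?D c = swapped D c" for c using f by (auto simp: swapped_def atom_pair_def)
 have hlow_keep: "h (low ?D p) = Keep (low D p)" if "p \<notin> ?I" "p \<notin> ?B" for p
 proof -
  have "p \<noteq> a" using that ain by auto
  then show ?thesis using that x ax by (auto simp: low_def fr hO hN)
 qed
 have hlow_copy: "h (low ?D p) = Copy ?d (low D p)" if "p \<in> ?I" "p \<noteq> a" for p
  using that xin by (auto simp: low_def fr hO hN)
 have hold_keep: "h (Old c) = Keep (Old c)" if "c \<notin> ?I" "c \<notin> ?B" "c \<noteq> x" for c using that by (simp add: hO)
 have hold_copy: "h (Old c) = Copy ?d (Old c)" if "c \<in> ?I" for c using that xin by (auto simp: hO)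
 have prA: "m = BangL a x" if "m \<in> links N" "a \<in> prems m" for m
  using consumer_unique[OF net that(1) l that(2)] by simp
 have coX: "m = BangL a x" if "m \<in> links N" "x \<in> concls m" for m
  using producer_unique[OF net that(1) l that(2)] by simp
 have h_outer: "map_link h (lk ?D m) = map_link Keep (lk D m)"
  if m: "m \<in> links N" "m \<noteq> BangL a x" "set_link m \<inter> ?I = {}" "prems m \<inter> ?B = {}" for m
 proof (rule map_lk_gen)
  show "h (low ?D p) = Keep (low D p)" if "p \<in> prems m" for p
   by (rule hlow_keep) (use that m in \<open>auto simp: set_link_eq\<close>)
  fix c assume c: "c \<in> concls m"
  show "h (Old c) = Keep (Old c)"
  proof (rule hold_keep)
   show "c \<noteq> x" using c m coX by auto
   show cI: "c \<notin> ?I" using c m by (auto simp: set_link_eq)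
   \<comment> \<open>An edge below a door of \<open>x\<close> concludes a pax link which is such a
     door or has its premise again below one; \<open>m\<close> is neither.\<close>
   show "c \<notin> ?B"
   proof
    assume cB: "c \<in> ?B"
    then obtain u v where uv: "(u, v) \<in> aux_doors N x" "(pax_rel N)\<^sup>*\<^sup>* v c" by (auto simp: below_def)
    from uv(2) show False
    proof (cases rule: rtranclp.cases)
     case rtrancl_refl
     then have p: "PaxL u c \<in> links N" "loc N u = Some x" using uv by (auto simp: aux_doors_def)
     then have "m = PaxL u c" using producer_unique[OF net m(1) p(1) c] by simp
     moreover have "u \<in> ?I" using p by (force simp: inside_def edges_def)
     ultimately show False using m(3) by auto
    next
     case (rtrancl_into_rtrancl y)
     then have p: "PaxL y c \<in> links N" by (simp add: pax_rel_def)
     then have "m = PaxL y c" using producer_unique[OF net m(1) p c] by simp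
     moreover have "y \<in> ?B" using uv(1) rtrancl_into_rtrancl by (auto simp: below_def)
     ultimately show False using m(4) by auto
    qed
   qed
  qed
  show "swapped ?D c = swapped D c" by (rule sw)
 qed
 have h_inner: "map_link h (lk ?D m) = map_link (Copy ?d) (lk D m)"
  if m: "m \<in> links N" "m \<noteq> BangL a x" "set_link m \<subseteq> ?I" for m
 proof (rule map_lk_gen)
  show "h (low ?D p) = Copy ?d (low D p)" if "p \<in> prems m" for p
   by (rule hlow_copy) (use that m prA in \<open>auto simp: set_link_eq\<close>)
  show "h (Old c) = Copy ?d (Old c)" if "c \<in> concls m" for c
   by (rule hold_copy) (use that m in \<open>auto simp: set_link_eq\<close>)
 qed (rule sw)
 have rootl: "map_link h (lk ?D (BangL a x)) = BangL (Keep (New x (Sub Pos))) (Keep (New x Pos))"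
  by (simp add: low_def fr hO hN)
 \<comment> \<open>The door of the host corresponds to the pax link of the strand, which crosses the
   border of the box of the identity instead of that of \<open>x\<close>.\<close>
 have h_door: "map_link h (lk ?D (PaxL u v)) = PaxL (Copy ?d (Old u)) (Strand ?d (Old u) ?d)"
  if uv: "(u, v) \<in> aux_doors N x" for u v
 proof -
  have p: "PaxL u v \<in> links N" "loc N u = Some x" using uv by (auto simp: aux_doors_def)
  then obtain B where "lab N u = Fl B" using net_typed[OF net p(1)] by auto
  then have "low ?D u = Old u" by (rule low_Fl)
  moreover have "u \<in> ?I" using p by (force simp: inside_def edges_def)
  moreover have "v \<in> ?B" using uv by (auto simp: below_def)
  ultimately show ?thesis using hB bc1[OF uv] hold_copy by simp
 qed
 have h_lower: "map_link h (lk ?D (PaxL u v)) = PaxL (below_copy ?S (Old x) ?d (Old u)) (below_copy ?S (Old x) ?d (Old v))"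
  if p: "PaxL u v \<in> links N" "u \<in> ?B" for u v
 proof -
  have "low ?D u = Old u" using below_not(3)[OF p(2)] by (simp add: low_def)
  moreover have "v \<in> ?B"
  proof -
   obtain y z where yz: "(y, z) \<in> aux_doors N x" "(pax_rel N)\<^sup>*\<^sup>* z u" using p(2) by (auto simp: below_def)
   moreover have "pax_rel N u v" using p(1) by (simp add: pax_rel_def)
   ultimately have "(pax_rel N)\<^sup>*\<^sup>* z v" by (rule_tac rtranclp.rtrancl_into_rtrancl)
   then show ?thesis using yz(1) by (auto simp: below_def)
  qed
  ultimately show ?thesis using hB p(2) by simp
 qed
 let ?R = "\<lambda>Q. h |`| Old |`| Q"
 have h_contraction: "map_link h (lk ?D (WhynotL Q c)) = WhynotL (?R Q) (Keep (Old c)) \<and>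
   fset (?R Q) = Keep ` (fset (Old |`| Q) - below ?S (Old x)) \<union>
    (\<Union>d\<in>fset {|?d|}. below_copy ?S (Old x) d ` (fset (Old |`| Q) \<inter> below ?S (Old x)))"
  if w: "WhynotL Q c \<in> links N" "fset Q \<inter> ?B \<noteq> {}" for Q c
 proof -
  obtain q where q: "q \<in> fset Q" "q \<in> ?B" using w by auto
  have qE: "q \<in> edges N" "c \<in> edges N" "fset Q \<subseteq> edges N" using w(1) q by (auto simp: edges_def intro!: bexI[of _ "WhynotL Q c"])
  have lq: "loc N y = loc N q" if "y \<in> set_link (WhynotL Q c)" for y
   by (rule loc_link[OF net w(1) _ that]) (use q in \<open>auto simp: is_door_def\<close>)
  have "q \<notin> ?I" by (rule Bx(2)[OF q(2)])
  then have nI: "y \<notin> ?I" if "y \<in> set_link (WhynotL Q c)" for y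
   using lq[OF that] inside_loc[OF net qE(1), of x] inside_loc[OF net, of y x] that qE(2,3) by auto
  have cx: "c \<noteq> x" using coX[OF w(1)] by auto
  have cB: "c \<notin> ?B" using below_not(2)[of c] net_typed[OF net w(1)] by auto
  have "h (Old c) = Keep (Old c)" using hold_keep nI cx cB by simp
  moreover have "h (Old y) = (if y \<in> ?B then below_copy ?S (Old x) ?d (Old y) else Keep (Old y))" if "y \<in> fset Q" for y
  proof -
   have "y \<noteq> x" using ty net_typed[OF net w(1)] that by auto
   then show ?thesis using nI[of y] that by (simp add: hO)
  qed
  ultimately show ?thesis unfolding bel lk.simps whynot_prems[OF w(1)] by auto
 qed
 have gkeep: "map_link h (map_link (New e) k) = map_link Keep (map_link (New e) k)" if "e \<noteq> a" "e \<notin> ?I" for e k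
  unfolding map_link_comp by (rule map_link_cong) (simp add: that hN)
 have gcopy: "map_link h (map_link (New e) k) = map_link (Copy ?d) (map_link (New e) k)" if "e \<noteq> a" "e \<in> ?I" for e k
  unfolding map_link_comp by (rule map_link_cong) (simp add: that hN)
 have ga: "map_link h (map_link (New a) k) = map_link Keep (map_link (New x) (map_link Sub k))" for k
  unfolding map_link_comp by (rule map_link_cong) (simp add: hN)
 have frN: "e \<noteq> x" "e \<noteq> a" "e \<notin> ?B" if "e \<in> front D - {x}" for e using that af below_not(3) by auto
 have gck: "map_link h k = map_link Keep k" if "k \<in> graft e" "e \<in> front D - {x}" "e \<notin> ?I" for k e
  using that gkeep[OF frN(2)[OF that(2)] that(3)] frN[OF that(2)] by (auto simp: graft_def hO hN)
 have gcc: "map_link h k = map_link (Copy ?d) k" if "k \<in> graft e" "e \<in> front D - {x}" "e \<in> ?I" for k e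
  using that gcopy[OF frN(2)[OF that(2)] that(3)] frN[OF that(2)] by (auto simp: graft_def hO hN)
 have gsl: "set_link k \<subseteq> insert (Old e) (New e ` nms (fm e))" if "k \<in> graft e" for k e
  using that graft_set_link by blast
 \<comment> \<open>Of the links of the graft on \<open>x\<close>, the step consumes the cut, the why
   not link and the flat and pax links of its thread; the others survive.\<close>
 have sub_keep: "map_link Keep k \<in> links ?X" if k: "k \<in> links ?S" "set_link k \<subseteq> range (New x)" "\<And>u. k \<noteq> CutL u"
   "\<And>Q. k \<noteq> WhynotL Q (New x Neg)" "New x Flt \<notin> concls k" "New x Aux \<notin> concls k" for k
 proof (rule exp_keepI[OF k(1)])
  show "k \<noteq> CutL (Upair (Old x) (New x Neg))" "k \<noteq> WhynotL {|New x Aux|} (New x Neg)" using k by auto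
  show "k \<noteq> BangL (Old a) (Old x)" using k(2) by auto
  show "concls k \<inter> thread ?S d = {}" if "d \<in> fset {|New x Aux|}" for d using that k(5,6) thr(1) by auto
  show "set_link k \<inter> inside ?S (Old x) = {}" using k(2) xin by (auto simp: ins)
  show "prems k \<inter> below ?S (Old x) = {}" using k(2) by (auto simp: bel set_link_eq)
 qed
 have memL: "map_link h (lk ?D m) \<in> map_link h ` links (state ?D)" if "m \<in> links N" for m
  unfolding state_simps(1) by (rule imageI, rule UnI1, rule imageI) (rule that)
 have memG: "map_link h k \<in> map_link h ` links (state ?D)" if "k \<in> graft e" "e \<in> front D - {x} \<union> {a}" for k e
  unfolding state_simps(1) fr by (rule imageI, rule UnI2, rule UN_I) (rule that)+
 have im: "map_link h ` links (state ?D) = links ?X"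
 proof (intro equalityI subsetI)
  fix k assume "k \<in> map_link h ` links (state ?D)"
  then obtain k' where k': "k = map_link h k'" "k' \<in> links (state ?D)" by auto
  then consider m where "k' = lk ?D m" "m \<in> links N" | e where "k' \<in> graft e" "e \<in> front D - {x}" | "k' \<in> graft a"
   unfolding state_simps(1) fr by blast
  then show "k \<in> links ?X"
  proof cases
   case 1
   from 1(2) l show ?thesis
   proof (cases rule: bang_cases)
    case root
    have "BangL (New x (Sub Pos)) (New x Pos) \<in> links ?S" using x by (force simp: state_simps(1) graft_def f)
    from sub_keep[OF this] show ?thesis unfolding k' 1 root rootl by simp
   next
    case outer
    have "map_link Keep (lk D m) \<in> links ?X"
    proof (rule exp_keepI)
     show "lk D m \<in> links ?S" using 1 by (simp add: state_simps(1))
     show "lk D m \<noteq> CutL (Upair (Old x) (New x Neg))" using lk_ne_cut[OF 1(2)] .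
     show "lk D m \<noteq> BangL (Old a) (Old x)" using lk_eqD[OF 1(2) l, of D] outer(1) lowa by auto
     show "lk D m \<noteq> WhynotL {|New x Aux|} (New x Neg)"
     proof
      assume "lk D m = WhynotL {|New x Aux|} (New x Neg)"
      from arg_cong[OF this, of concls] show False by auto
     qed
     show "concls (lk D m) \<inter> thread ?S d = {}" if "d \<in> fset {|New x Aux|}" for d using that thr(1) by auto
     show "set_link (lk D m) \<inter> inside ?S (Old x) = {}" using outer(2) by (auto simp: ins lk_set_link set_link_eq)
     show "prems (lk D m) \<inter> below ?S (Old x) = {}"
     proof -
      have "low D p \<notin> Old ` ?B" if "p \<in> prems m" for p using outer(3) that by (auto simp: low_def)
      then show ?thesis by (auto simp: bel)
     qed
    qed
    then show ?thesis unfolding k' 1 h_outer[OF 1(2) outer] .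
   next
    case inner
    have "map_link (Copy ?d) (lk D m) \<in> links ?X"
    proof (rule exp_copyI)
     show "lk D m \<in> links ?S" using 1 by (simp add: state_simps(1))
     show "set_link (lk D m) \<subseteq> inside ?S (Old x)"
      using inner(2) low_edge prems_subset[OF 1(2)] concls_subset[OF 1(2)]
      by (auto simp: ins lk_set_link set_link_eq state_mem subset_eq)
    qed simp
    then show ?thesis unfolding k' 1 h_inner[OF 1(2) inner] .
   next
    case (door u v)
    have "PaxL (strand ?S ?d (Old u) (New x Flt)) (strand ?S ?d (Old u) ?d) \<in> links ?X"
    proof (rule exp_strandI)
     show "(Old u, Old v) \<in> aux_doors ?S (Old x)" using door auxS by auto
     show "PaxL (New x Flt) ?d \<in> links ?S" using x by (force simp: state_simps(1) graft_def f)
    qed (simp_all add: thr)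
    then show ?thesis unfolding k' 1 door(1) h_door[OF door(2)]
     by (simp add: strand_def thr)
   next
    case (lower u v)
    have "PaxL (below_copy ?S (Old x) ?d (Old u)) (below_copy ?S (Old x) ?d (Old v)) \<in> links ?X"
     by (rule exp_belowI) (use lower 1 in \<open>auto simp: bel state_pax[OF D]\<close>)
    then show ?thesis unfolding k' 1 lower(1) using h_lower[of u v] lower 1 by simp
   next
    case (contraction Q c)
    have w: "WhynotL Q c \<in> links N" using contraction 1 by simp
    note c = h_contraction[OF w contraction(2)]
    have "WhynotL (?R Q) (Keep (Old c)) \<in> links ?X"
    proof (rule exp_whynotI)
     show "WhynotL (Old |`| Q) (Old c) \<in> links ?S" 
      unfolding state_whynot by (rule disjI1, intro exI conjI, rule whynot_prems[OF w, symmetric], rule refl, rule w)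
     show "fset (Old |`| Q) \<inter> below ?S (Old x) \<noteq> {}" using contraction(2) bel by auto
    qed (rule conjunct2[OF c])
    then show ?thesis unfolding k' 1 contraction(1) conjunct1[OF c] .
   qed
  next
   case (2 e)
   have kS: "k' \<in> links ?S" using 2 by (auto simp: state_simps(1))
   show ?thesis
   proof (cases "e \<in> ?I")
    case True
    have "set_link k' \<subseteq> inside ?S (Old x)"
     using gsl[OF 2(1)] True 2(2) front_D(1) by (auto simp: ins state_mem)
    then show ?thesis unfolding k' gcc[OF 2 True] using kS by (intro exp_copyI) auto
   next
    case False
    have r: "set_link k' \<subseteq> insert (Old e) (range (New e))" using gsl[OF 2(1)] by auto
    have "map_link Keep k' \<in> links ?X"
    proof (rule exp_keepI[OF kS])
     show "k' \<noteq> BangL (Old a) (Old x)" using r 2(2) by auto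
     show "k' \<noteq> WhynotL {|New x Aux|} (New x Neg)" using r 2(2) by auto
     show "k' \<noteq> CutL (Upair (Old x) (New x Neg))" using r 2(2) by auto
     show "concls k' \<inter> thread ?S d = {}" if "d \<in> fset {|New x Aux|}" for d
      using that thr(1) r 2(2) by (auto simp: set_link_eq)
     show "set_link k' \<inter> inside ?S (Old x) = {}" using r False by (auto simp: ins)
     show "prems k' \<inter> below ?S (Old x) = {}" using r frN(3)[OF 2(2)] by (auto simp: bel set_link_eq)
    qed
    then show ?thesis unfolding k' gck[OF 2 False] .
   qed
  next
   case 3
   show ?thesis
   proof (cases "k' = CutL (Upair (Old a) (New a Neg))")
    case True
    \<comment> \<open>The flat link at the top of the thread has premise \<open>Sub Neg\<close>. The
      cut created by the step is therefore the one that the graft on \<open>a\<close> is waiting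
      in.\<close>
    have "FlatL (New x (Sub Neg)) (thread_top ?S ?d) \<in> links ?S" unfolding thr(3) state_flat(2) using x f by auto
    then have "CutL (Upair (Keep (New x (Sub Neg))) (Copy ?d (Old a))) \<in> links ?X" by (rule exp_cutI) simp
    then show ?thesis unfolding k' True using hold_copy[OF ain] by (simp add: hN Upair_swap)
   next
    case False
    then obtain k0 where k0: "k' = map_link (New a) k0" "k0 \<in> idl A tw (Suc (lv x))"
     using 3 by (auto simp: graft_def f lva)
    have "map_link (New x) (map_link Sub k0) \<in> links ?S"
     using k0(2) x by (force simp: state_simps(1) graft_def f)
    moreover have "map_link (New x) (map_link Sub k0) \<noteq> CutL u" for u
     using New_ne_cut[OF k0(2), of "New x \<circ> Sub"] by (simp add: map_link_comp)
    ultimately show ?thesis unfolding k' k0(1) ga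
     by (intro sub_keep) (auto simp: link.set_map map_link_eq_iffs)
   qed
  qed
 next
  fix k assume "k \<in> links ?X"
  then show "k \<in> map_link h ` links (state ?D)"
  proof (cases rule: exp_linksE)
   case (keep l')
   have nin: "root y \<notin> ?I" if "y \<in> set_link l'" for y
   proof -
    have "y \<notin> inside ?S (Old x)" using keep(7) that by blast
    then show ?thesis using that set_link_subset[OF keep(2)] ins[of y] by blast
   qed
   from keep(2) consider m where "l' = lk D m" "m \<in> links N" | e where "l' \<in> graft e" "e \<in> front D - {x}" | "l' \<in> graft x"
    unfolding state_simps(1) by blast
   then show ?thesis
   proof cases
    case 1
    have "m \<noteq> BangL a x" using keep(4) 1 lowa by auto
    moreover have "set_link m \<inter> ?I = {}"
    proof -
     have "c \<notin> ?I" if "c \<in> set_link m" for c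
      using that nin[of "low D c"] nin[of "Old c"] by (auto simp: 1 lk_set_link set_link_eq[of m])
     then show ?thesis by auto
    qed
    moreover have "prems m \<inter> ?B = {}"
    proof -
     have "p \<notin> ?B" if "p \<in> prems m" for p
      using keep(8) that below_not(3)[of p x D] by (auto simp: 1 bel low_def)
     then show ?thesis by auto
    qed
    ultimately have "k = map_link h (lk ?D m)" using h_outer[OF 1(2)] keep(1) 1 by simp
    then show ?thesis by (simp only: memL[OF 1(2)])
   next
    case (2 e)
    have "e \<notin> ?I"
    proof (cases "l' = CutL (Upair (Old e) (New e Neg))")
     case True then show ?thesis using nin[of "Old e"] by simp
    next
     case False
     then obtain k0 where k0: "l' = map_link (New e) k0" "k0 \<in> idl (fm e) tw (lv e)" using 2 by (auto simp: graft_def)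
     then obtain c where "c \<in> concls k0" using idl_no_cut concls_empty by (metis ex_in_conv)
     then show ?thesis using nin[of "New e c"] k0 by (auto simp: set_link_eq)
    qed
    then have "k = map_link h l'" using gck[OF 2] keep(1) by simp
    then show ?thesis by (simp only: memG[OF 2(1) UnI1[OF 2(2)]])
   next
    case 3
    then obtain k0 where k0: "l' = map_link (New x) k0" "k0 \<in> idl (Bang A) tw (lv x)"
     using keep(3) unfolding graft_def f by blast
    have c: "Flt \<notin> concls k0" "Aux \<notin> concls k0" using keep(6)[of ?d] k0(1) by (auto simp: thr)
    have nw: "k0 \<noteq> WhynotL {|Aux|} Neg" using keep(5) k0(1) by auto
    from k0(2) c nw consider "k0 = BangL (Sub Pos) Pos" | k1 where "k0 = map_link Sub k1" "k1 \<in> idl A tw (Suc (lv x))"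
     by auto
    then show ?thesis
    proof cases
     case 1
     then have "k = map_link h (lk ?D (BangL a x))" unfolding rootl keep(1) k0(1) by simp
     then show ?thesis by (simp only: memL[OF l])
    next
     case 2
     then have "k = map_link h (map_link (New a) k1)" unfolding ga keep(1) k0(1) by simp
     moreover have "map_link (New a) k1 \<in> graft a" using 2 by (auto simp: graft_def f lva)
     ultimately show ?thesis using memG by blast
    qed
   qed
  next
   case (copy l' d)
   have d: "d = ?d" using copy by simp
   have nin: "root y \<in> ?I" if "y \<in> set_link l'" for y
    using subsetD[OF copy(3) that] ins[of y] by simp
   from copy(2) consider m where "l' = lk D m" "m \<in> links N" | e where "l' \<in> graft e" "e \<in> front D - {x}" | "l' \<in> graft x"
    unfolding state_simps(1) by blast
   then show ?thesis
   proof cases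
    case 1
    have sI: "set_link m \<subseteq> ?I"
    proof
     fix c assume "c \<in> set_link m"
     then show "c \<in> ?I"
      using nin[of "low D c"] nin[of "Old c"] by (auto simp: 1 lk_set_link set_link_eq[of m])
    qed
    moreover have "m \<noteq> BangL a x" using sI xin by auto
    ultimately have "k = map_link h (lk ?D m)" using h_inner[OF 1(2)] copy(1) 1 d by simp
    then show ?thesis by (simp only: memL[OF 1(2)])
   next
    case (2 e)
    have "e \<in> ?I"
    proof (cases "l' = CutL (Upair (Old e) (New e Neg))")
     case True then show ?thesis using nin[of "Old e"] by simp
    next
     case False
     then obtain k0 where k0: "l' = map_link (New e) k0" "k0 \<in> idl (fm e) tw (lv e)" using 2 by (auto simp: graft_def)
     then obtain c where "c \<in> concls k0" using idl_no_cut concls_empty by (metis ex_in_conv)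
     then show ?thesis using nin[of "New e c"] k0 by (auto simp: set_link_eq)
    qed
    then have "k = map_link h l'" using gcc[OF 2] copy(1) d by simp
    then show ?thesis by (simp only: memG[OF 2(1) UnI1[OF 2(2)]])
   next
    case 3
    have "set_link l' \<noteq> {}"
    proof (cases "l' = CutL (Upair (Old x) (New x Neg))")
     case False
     then obtain k0 where k0: "l' = map_link (New x) k0" "k0 \<in> idl (fm x) tw (lv x)" using 3 by (auto simp: graft_def)
     then have "concls k0 \<noteq> {}" using idl_no_cut concls_empty by metis
     then show ?thesis using k0 by (auto simp: set_link_eq)
    qed auto
    then obtain y where y: "y \<in> set_link l'" by auto
    then have "root y = x" using gsl[OF 3] by auto
    then show ?thesis using nin[OF y] xin by simp
   qed
  next
   case (cut s d)
   then have d: "d = ?d" by simp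
   have "s = New x (Sub Neg)" using cut(3) unfolding d thr(3) state_flat(2) f by (auto simp: mem_map_link_iffs)
   then have "k = map_link h (CutL (Upair (Old a) (New a Neg)))"
    unfolding cut(1) d using hold_copy[OF ain] by (simp add: hN Upair_swap)
   moreover have "CutL (Upair (Old a) (New a Neg)) \<in> graft a" by (simp add: graft_def)
   ultimately show ?thesis using memG by blast
  next
   case (strand d y y' z z')
   then have d: "d = ?d" by simp
   obtain u v where uv: "y = Old u" "(u, v) \<in> aux_doors N x" using strand(3) auxS by auto
   have "z' = New x Flt \<or> z' = New x Aux" using strand(4) unfolding d thr(1) by simp
   then have "z = New x Flt \<and> z' = New x Aux" using strand(5) idl_pax_flt[of _ _ "fm x" tw "lv x"] f
    unfolding state_pax[OF D] by (auto simp: mem_map_link_iffs)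
   then have "k = map_link h (lk ?D (PaxL u v))"
    unfolding h_door[OF uv(2)] strand(1) d uv by (simp add: strand_def thr)
   moreover have "PaxL u v \<in> links N" using uv by (simp add: aux_doors_def)
   ultimately show ?thesis using memL by blast
  next
   case (below d z z')
   then have d: "d = ?d" by simp
   obtain u where u: "z = Old u" "u \<in> ?B" using below(3) bel by auto
   obtain v where v: "z' = Old v" "PaxL u v \<in> links N" using below(4) u unfolding state_pax[OF D] by auto
   have "k = map_link h (lk ?D (PaxL u v))" unfolding h_lower[OF v(2) u(2)] below(1) d u v ..
   then show ?thesis by (simp only: memL[OF v(2)])
  next
   case (whynot R Q v)
   obtain q where q: "q \<in> fset Q" "q \<in> Old ` ?B" using whynot(3) unfolding bel by auto
   then obtain Q0 c where Q: "Q = Old |`| Q0" "v = Old c" "WhynotL Q0 c \<in> links N"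
    using whynot(2) unfolding state_whynot by (auto simp: whynot_prems)
   have ne: "fset Q0 \<inter> ?B \<noteq> {}" using q unfolding Q by auto
   note c = h_contraction[OF Q(3) ne]
   have "R = ?R Q0" using whynot(4) c unfolding Q fset_inject[symmetric] by (simp only:)
   then have "k = map_link h (lk ?D (WhynotL Q0 c))" unfolding whynot(1) Q(2) using conjunct1[OF c] by simp
   then show ?thesis by (simp only: memL[OF Q(3)])
  qed
 qed
 have auxv: "v' = v" if "(u, v) \<in> aux_doors N x" "(u, v') \<in> aux_doors N x" for u v v'
  using consumer_unique[OF net, of "PaxL u v" "PaxL u v'" u] that by (auto simp: aux_doors_def)
 \<comment> \<open>A left inverse of \<open>h\<close>, from which injectivity follows. A strand
   remembers only the premise of a door; its conclusion is recovered because that premise has a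
   single consumer.\<close>
 define g where "g k = (case k of
   Keep y \<Rightarrow> (case y of Old z \<Rightarrow> Old z
    | New e n \<Rightarrow> if e = x then (case n of Sub m \<Rightarrow> New a m | _ \<Rightarrow> Old x) else New e n)
  | Copy _ y \<Rightarrow> y
  | Strand _ y _ \<Rightarrow> Old (THE v. (root y, v) \<in> aux_doors N x))" for k :: "'e name redname"
 have gS: "g (Strand ?d (Old u) ?d) = Old v" if uv: "(u, v) \<in> aux_doors N x" for u v
 proof -
  have "(THE v. (u, v) \<in> aux_doors N x) = v" using uv auxv by (intro the_equality) auto
  then show ?thesis by (simp add: g_def)
 qed
 \<comment> \<open>The possible values of \<open>h\<close>, arranged once for the three remaining
   checks: left inverse, labels and boxes.\<close>
 have hcases: thesis if y: "y \<in> edges (state ?D)"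
  and 1: "y = Old x \<Longrightarrow> h y = Keep (New x Pos) \<Longrightarrow> thesis"
  and 2: "\<And>z. y = Old z \<Longrightarrow> z \<in> edges N \<Longrightarrow> z \<noteq> x \<Longrightarrow> z \<in> ?I \<Longrightarrow> h y = Copy ?d (Old z) \<Longrightarrow> thesis"
  and 3: "\<And>u z. y = Old z \<Longrightarrow> z \<in> edges N \<Longrightarrow> z \<in> ?B \<Longrightarrow> (u, z) \<in> aux_doors N x \<Longrightarrow> h y = Strand ?d (Old u) ?d \<Longrightarrow> thesis"
  and 4: "\<And>z. y = Old z \<Longrightarrow> z \<in> edges N \<Longrightarrow> z \<in> ?B \<Longrightarrow> h y = Copy ?d (Old z) \<Longrightarrow> thesis"
  and 5: "\<And>z. y = Old z \<Longrightarrow> z \<in> edges N \<Longrightarrow> z \<noteq> x \<Longrightarrow> z \<notin> ?I \<Longrightarrow> h y = Keep (Old z) \<Longrightarrow> thesis"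
  and 6: "\<And>n. y = New a n \<Longrightarrow> n \<in> nms A \<Longrightarrow> h y = Keep (New x (Sub n)) \<Longrightarrow> thesis"
  and 7: "\<And>e n. y = New e n \<Longrightarrow> e \<in> front D \<Longrightarrow> e \<noteq> x \<Longrightarrow> e \<noteq> a \<Longrightarrow> e \<in> ?I \<Longrightarrow> n \<in> nms (fm e) \<Longrightarrow> h y = Copy ?d (New e n) \<Longrightarrow> thesis"
  and 8: "\<And>e n. y = New e n \<Longrightarrow> e \<in> front D \<Longrightarrow> e \<noteq> x \<Longrightarrow> e \<noteq> a \<Longrightarrow> e \<notin> ?I \<Longrightarrow> n \<in> nms (fm e) \<Longrightarrow> h y = Keep (New e n) \<Longrightarrow> thesis"
  for y thesis
 proof (cases y)
  case (Old z)
  then have zE: "z \<in> edges N" using y by (simp add: state_mem)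
  consider "z = x" | "z \<noteq> x" "z \<in> ?I" | u where "z \<in> ?B" "(u, z) \<in> aux_doors N x"
   | "z \<in> ?B" "\<And>u. (u, z) \<notin> aux_doors N x" | "z \<noteq> x" "z \<notin> ?I" "z \<notin> ?B" by blast
  then show thesis
  proof cases
   case (3 u)
   show ?thesis by (rule that(4)[OF Old zE 3]) (simp add: Old hB[OF 3(1)] bc1[OF 3(2)])
  next
   case 4
   show ?thesis by (rule that(5)[OF Old zE 4(1)]) (simp add: Old hB[OF 4(1)] bc2[OF 4(2)])
  qed (use Old zE that(2,3,6) in \<open>auto simp: hO\<close>)
 next
  case (New e n)
  then have e: "e \<in> front ?D" "n \<in> nms (fm e)" using y by (auto simp: state_mem)
  show thesis
  proof (cases "e = a")
   case True
   then show ?thesis using that(7)[of n] New e f by (simp add: hN)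
  next
   case False
   then have "e \<in> front D" "e \<noteq> x" using e fr by auto
   then show ?thesis using that(8,9)[of e n] New e False by (cases "e \<in> ?I") (auto simp: hN)
  qed
 qed
 have gh: "g (h y) = y" if "y \<in> edges (state ?D)" for y
  using that by (rule hcases) (auto simp: gS, auto simp: g_def)
 \<comment> \<open>How \<open>h\<close> acts on box names. The box \<open>x\<close> turns into the
   box of the identity, boxes inside \<open>x\<close> into their copies, and all others are kept. No
   box lies below a door, as a box carries a formula and not a flat formula.\<close>
 have boxO: "map_option h (map_option Old (loc N z)) =
   (if loc N z = Some x then Some (Keep (New x Pos)) else if z \<in> ?I then map_option (Copy ?d) (map_option Old (loc N z))
    else map_option Keep (map_option Old (loc N z)))" if z: "z \<in> edges N" for z
 proof (cases "loc N z")
  case (Some b)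
  have bB: "b \<notin> ?B" using box_Fm[OF z Some] below_not(2)[of b x] by auto
  have "z \<in> ?I \<longleftrightarrow> b = x \<or> b \<in> ?I" using inside_loc[OF net z, of x] Some by simp
  then show ?thesis using Some bB xin by (auto simp: hO)
 qed simp
 have locI: "z \<in> ?I" if "z \<in> edges N" "loc N z = Some x" for z using that by (auto simp: inside_def)
 have locxx: "loc N x \<noteq> Some x" using locI[OF xE] xin by auto
 have Bloc: "loc N z \<noteq> Some x" if "z \<in> ?B" for z
  using locI[of z] Bx[OF that] below_Fl(3)[OF net that] by auto
 show ?thesis
 proof (rule net_isoI[where f = h])
  show "inj_on h (edges (state ?D))" by (rule inj_on_inverseI[where g = g]) (rule gh)
  show "map_link h ` links (state ?D) = links ?X" by (rule im)
  fix y assume y: "y \<in> edges (state ?D)"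
  from y show "lab ?X (h y) = lab (state ?D) y"
  proof (rule hcases)
   fix u z assume uz: "y = Old z" "(u, z) \<in> aux_doors N x" "h y = Strand ?d (Old u) ?d"
   then have "PaxL u z \<in> links N" by (simp add: aux_doors_def)
   then have "lab N u = lab N z" using net_typed[OF net] by fastforce
   then show ?thesis unfolding uz(3) exp_reduct_lab by (simp add: uz(1))
  qed (simp_all add: exp_reduct_lab ty f)
  from y show "loc ?X (h y) = map_option h (loc (state ?D) y)"
  proof (rule hcases)
   assume "y = Old x" "h y = Keep (New x Pos)"
   then show ?thesis using boxO[OF xE] xin locxx by (simp add: exp_reduct_loc)
  next
   fix z assume z: "y = Old z" "z \<in> edges N" "z \<noteq> x" "z \<in> ?I" "h y = Copy ?d (Old z)"
   have i: "Old z \<in> inside ?S (Old x)" using z by (simp add: ins state_mem)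
   have "loc ?S (Old z) = Some (Old x) \<longleftrightarrow> loc N z = Some x" by auto
   then show ?thesis unfolding z(5) exp_reduct_loc thr(3) using i boxO[OF z(2)] z by (simp add: f)
  next
   fix u z assume z: "y = Old z" "z \<in> edges N" "z \<in> ?B" "(u, z) \<in> aux_doors N x" "h y = Strand ?d (Old u) ?d"
   then have "PaxL u z \<in> links N" "loc N u = Some x" by (simp_all add: aux_doors_def)
   then have "loc N z = loc N x" using loc_pax[OF net] by fastforce
   then show ?thesis unfolding z(5) exp_reduct_loc using boxO[OF z(2)] Bx[OF z(3)] locxx z(1) by (simp add: f)
  next
   fix z assume z: "y = Old z" "z \<in> edges N" "z \<in> ?B" "h y = Copy ?d (Old z)"
   have i: "Old z \<notin> inside ?S (Old x)" using Bx[OF z(3)] by (simp add: ins)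
   then show ?thesis unfolding z(4) exp_reduct_loc using boxO[OF z(2)] Bx[OF z(3)] Bloc[OF z(3)] z(1) by simp
  next
   fix z assume z: "y = Old z" "z \<in> edges N" "z \<noteq> x" "z \<notin> ?I" "h y = Keep (Old z)"
   then show ?thesis unfolding z(5) exp_reduct_loc using boxO[OF z(2)] locI[OF z(2)] by auto
  next
   fix n assume n: "y = New a n" "n \<in> nms A" "h y = Keep (New x (Sub n))"
   show ?thesis unfolding n(3) exp_reduct_loc using n(1) la
    by (auto simp: f hO hN split: option.splits)
  next
   fix e n assume e: "y = New e n" "e \<in> front D" "e \<noteq> x" "e \<noteq> a" "e \<in> ?I" "n \<in> nms (fm e)" "h y = Copy ?d (New e n)"
   have i: "New e n \<in> inside ?S (Old x)" using e by (simp add: ins state_mem)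
   show ?thesis
   proof (cases "idloc (fm e) n")
    case None
    then show ?thesis unfolding e(7) exp_reduct_loc thr(3) using i boxO[OF front_D(1)[OF e(2)]] e by (auto simp: f)
   next
    case (Some m)
    then show ?thesis unfolding e(7) exp_reduct_loc using i e by (simp add: hN)
   qed
  next
   fix e n assume e: "y = New e n" "e \<in> front D" "e \<noteq> x" "e \<noteq> a" "e \<notin> ?I" "n \<in> nms (fm e)" "h y = Keep (New e n)"
   show ?thesis
   proof (cases "idloc (fm e) n")
    case None
    then show ?thesis unfolding e(7) exp_reduct_loc using boxO[OF front_D(1)[OF e(2)]] locI[OF front_D(1)[OF e(2)]] e by auto
   next
    case (Some m)
    then show ?thesis unfolding e(7) exp_reduct_loc using e by (simp add: hN)
   qed
  qed
 qed
qed

end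

section \<open>A why not link of the host against the box of the identity\<close>

context host
begin

definition threads :: "'e fset \<Rightarrow> 'e set" where
 "threads P = (\<Union>d\<in>fset P. thread N d)"

text \<open>The edges on which identities wait after a why not step: each copy of the box of the
  identity is cut against one of them.\<close>

definition tops :: "'e fset \<Rightarrow> 'e set" where
 "tops P = {s. \<exists>d\<in>fset P. FlatL s (thread_top N d) \<in> links N}"

lemma whynot_Fl: assumes "WhynotL P x \<in> links N" obtains A where "\<And>d. d \<in> fset P \<Longrightarrow> lab N d = Fl A" "lab N x = Fm (Whynot A)"
 using net_typed[OF net assms] by auto

lemma threads_props:
 assumes l: "WhynotL P x \<in> links N" and x: "lab N x = Fm (Whynot A)" and z: "z \<in> threads P"
 shows "lab N z = Fl A" "z \<in> edges N" "lv z = Suc (lv x)" "\<And>D. z \<notin> front D" "\<And>D. low D z = Old z"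
proof -
 obtain d where d: "d \<in> fset P" "z \<in> thread N d" using z by (auto simp: threads_def)
 have dE: "d \<in> edges N" using prems_subset[OF l] d by auto
 have ld: "lab N d = Fl A" using net_typed[OF net l] d x by auto
 show lz: "lab N z = Fl A" and "z \<in> edges N" using net_thread[OF net dE ld d(2)] by auto
 then show "\<And>D. z \<notin> front D" "\<And>D. low D z = Old z" by (auto simp: front_def low_def)
 have "(pax_rel N)\<^sup>*\<^sup>* z d" using d by (simp add: thread_def)
 then have "lv z = lv d"
 proof (induction rule: converse_rtranclp_induct)
  case (step y w)
  then have "PaxL y w \<in> links N" by (simp add: pax_rel_def)
  from levD[OF this] show ?case using step.IH by simp
 qed simp
 moreover have "lv d = Suc (lv x)" using levD[OF l] d by auto
 ultimately show "lv z = Suc (lv x)" by simp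
qed

lemma threads_pax:
 assumes p: "PaxL y z \<in> links N" "z \<in> threads P" shows "y \<in> threads P"
 using assms unfolding threads_def thread_def pax_rel_def
 by (auto intro: converse_rtranclp_into_rtranclp)

lemma threads_consumer:
 assumes l: "WhynotL P x \<in> links N" and z: "z \<in> threads P" and m: "m \<in> links N" "z \<in> prems m"
 shows "m = WhynotL P x \<or> (\<exists>y. m = PaxL z y \<and> y \<in> threads P)"
proof -
 obtain d where d: "d \<in> fset P" "(pax_rel N)\<^sup>*\<^sup>* z d" using z by (auto simp: threads_def thread_def)
 from d(2) show ?thesis
 proof (cases rule: converse_rtranclpE[consumes 1, case_names base step])
  case base
  then show ?thesis using consumer_unique[OF net m(1) l m(2)] d by auto
 next
  case (step y)
  then have p: "PaxL z y \<in> links N" by (simp add: pax_rel_def)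
  then have "m = PaxL z y" using consumer_unique[OF net m(1) p m(2)] by simp
  moreover have "y \<in> threads P" using d step by (auto simp: threads_def thread_def)
  ultimately show ?thesis by blast
 qed
qed

lemma threads_producer:
 assumes l: "WhynotL P x \<in> links N" and z: "z \<in> threads P" and m: "m \<in> links N" "z \<in> concls m"
 shows "(\<exists>y. m = PaxL y z \<and> y \<in> threads P) \<or> (\<exists>s d. m = FlatL s z \<and> d \<in> fset P \<and> z = thread_top N d \<and> s \<in> tops P)"
proof -
 obtain A where A: "lab N x = Fm (Whynot A)" using whynot_Fl[OF l] by blast
 obtain d where d: "d \<in> fset P" "z \<in> thread N d" using z by (auto simp: threads_def)
 consider s where "m = FlatL s z" | y where "m = PaxL y z"
  using net_typed[OF net m(1)] m(2) threads_props(1)[OF l A z] by (cases m) auto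
 then show ?thesis
 proof cases
  case (1 s)
  have "thread_top N d = z" using thread_top_props(3)[OF net_threads_ok[OF net l] d] m 1 by blast
  then show ?thesis using 1 d m by (auto simp: tops_def)
 next
  case (2 y)
  then show ?thesis using threads_pax m z by blast
 qed
qed

text \<open>That a top belongs to one premise only combines unique consumers, which fix the flat
  link below it, with the disjointness of threads. It is what allows naming a copy by the top
  instead of the premise.\<close>

lemma tops_props:
 assumes l: "WhynotL P x \<in> links N" and x: "lab N x = Fm (Whynot A)" and s: "s \<in> tops P"
 shows "lab N s = Fm A" "s \<in> edges N" "fm s = A" "lv s = Suc (lv x)"
  "\<exists>!d. d \<in> fset P \<and> FlatL s (thread_top N d) \<in> links N"
  "\<And>d. d \<in> fset P \<Longrightarrow> FlatL s (thread_top N d) \<in> links N \<Longrightarrow> loc N s = loc N (thread_top N d)"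
proof -
 obtain d where d: "d \<in> fset P" "FlatL s (thread_top N d) \<in> links N" using s by (auto simp: tops_def)
 have tt: "thread_top N d' \<in> thread N d'" if "d' \<in> fset P" for d'
  by (rule thread_top_props(1)[OF net_threads_ok[OF net l] that])
 then have t: "thread_top N d \<in> threads P" using d by (auto simp: threads_def)
 note tp = threads_props[OF l x t]
 show ls: "lab N s = Fm A" using net_typed[OF net d(2)] tp(1) by auto
 then show "fm s = A" by (simp add: fm_def)
 show "s \<in> edges N" using prems_subset[OF d(2)] by simp
 show "lv s = Suc (lv x)" using levD[OF d(2)] tp(3) by simp
 show "\<exists>!d. d \<in> fset P \<and> FlatL s (thread_top N d) \<in> links N"
 proof (rule ex1I[of _ d])
  fix d' assume d': "d' \<in> fset P \<and> FlatL s (thread_top N d') \<in> links N"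
  then have "FlatL s (thread_top N d') = FlatL s (thread_top N d)"
   by (intro consumer_unique[OF net _ d(2), of _ s]) auto
  then have e: "thread_top N d' = thread_top N d" by simp
  show "d' = d" by (rule thread_disjoint[OF net l l _ d(1) tt]) (use tt[OF d(1)] d' e in auto)
 qed (use d in simp)
 fix d' assume "d' \<in> fset P" "FlatL s (thread_top N d') \<in> links N"
 then show "loc N s = loc N (thread_top N d')"
  by (intro loc_link[OF net]) (auto simp: is_door_def)
qed

text \<open>One step rebuilds \<open>x\<close> and all pax and flat links above it at once. Going up
  a thread from \<open>x\<close>, the first formula met is the premise of the flat link, so the new
  front is made of these.\<close>

lemma front_threads:
 assumes D: "stage D" and x: "x \<in> front D" and l: "WhynotL P x \<in> links N"
 shows "stage (insert x (D \<union> threads P))" "front (insert x (D \<union> threads P)) = front D - {x} \<union> tops P"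
  "tops P \<inter> front D = {}" "tops P \<inter> D = {}" "threads P \<inter> D = {}" "x \<notin> threads P" "x \<notin> tops P"
proof -
 let ?T = "threads P"
 obtain A where A: "lab N x = Fm (Whynot A)" using whynot_Fl[OF l] by blast
 note tp = threads_props[OF l A] and sp = tops_props[OF l A]
 have xD: "x \<notin> D" by (rule front_D(2)[OF x])
 show TD: "?T \<inter> D = {}"
 proof -
  have "z \<notin> D" if "z \<in> thread N d" "d \<in> fset P" for z d
  proof -
   have "(pax_rel N)\<^sup>*\<^sup>* z d" using that by (simp add: thread_def)
   then show ?thesis
   proof (induction rule: converse_rtranclp_induct)
    case base
    then show ?case using D l that(2) xD by (force simp: stage_def)
   next
    case (step y w)
    then show ?case using D by (force simp: stage_def pax_rel_def)
   qed
  qed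
  then show ?thesis by (auto simp: threads_def)
 qed
 show xT: "x \<notin> ?T" using tp(1) A by auto
 have top: "\<exists>t. FlatL s t \<in> links N \<and> t \<in> ?T" if "s \<in> tops P" for s
  using that thread_top_props(1)[OF net_threads_ok[OF net l]] by (auto simp: tops_def threads_def)
 show sD: "tops P \<inter> D = {}"
 proof -
  have "s \<notin> D" if "s \<in> tops P" for s
   using top[OF that] TD D by (force simp: stage_def)
  then show ?thesis by auto
 qed
 show sF: "tops P \<inter> front D = {}"
 proof -
  have "s \<notin> front D" if s: "s \<in> tops P" for s
  proof -
   obtain t where t: "FlatL s t \<in> links N" "t \<in> ?T" using top[OF s] by auto
   then have "t \<notin> D" using TD by auto
   then show ?thesis using t(1) by (force simp: front_def)
  qed
  then show ?thesis by auto
 qed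
 show xs: "x \<notin> tops P" using sF x by auto
 have pr: "l' = WhynotL P x" if "l' \<in> links N" "x \<in> concls l'" for l'
  using producer_unique[OF net that(1) l that(2)] by simp
 show "stage (insert x (D \<union> ?T))"
  unfolding stage_def
 proof (intro conjI ballI allI impI)
  show "insert x (D \<union> ?T) \<subseteq> edges N" using D x tp(2) by (auto simp: stage_def front_def)
  fix m p assume m: "m \<in> links N" "p \<in> prems m"
  show "concls m \<subseteq> insert x (D \<union> ?T)" if "p \<in> insert x (D \<union> ?T)"
  proof (cases "p \<in> ?T")
   case True
   then show ?thesis using threads_consumer[OF l True m] by auto
  next
   case False
   then show ?thesis using that m D x by (auto simp: stage_def front_def)
  qed
  fix B assume a: "lab N p = Fl B" "concls m \<subseteq> insert x (D \<union> ?T)"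
  show "p \<in> insert x (D \<union> ?T)"
  proof (cases "concls m \<subseteq> D")
   case True
   then show ?thesis using a m D unfolding stage_def by blast
  next
   case False
   then obtain c where c: "c \<in> concls m" "c \<in> insert x ?T" using a by auto
   show ?thesis
   proof (cases "c = x")
    case True
    then have "p \<in> fset P" using pr[OF m(1)] c m by auto
    then show ?thesis by (auto simp: threads_def thread_def)
   next
    case False
    then have cT: "c \<in> ?T" using c by auto
    from threads_producer[OF l cT m(1) c(1)] show ?thesis
    proof (elim disjE exE conjE)
     fix s d assume "m = FlatL s c" "s \<in> tops P"
     then show ?thesis using m(2) a sp(1)[of s] by auto
    qed (use m in auto)
   qed
  qed
 qed
 show "front (insert x (D \<union> ?T)) = front D - {x} \<union> tops P"
 proof (intro set_eqI iffI)
  fix e assume e: "e \<in> front (insert x (D \<union> ?T))"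
  show "e \<in> front D - {x} \<union> tops P"
  proof (cases "e \<in> tops P")
   case False
   have "concls m \<subseteq> D" if m: "m \<in> links N" "e \<in> prems m" for m
   proof -
    have "c \<in> D" if c: "c \<in> concls m" for c
    proof (rule ccontr)
     assume "c \<notin> D"
     then have "c = x \<or> c \<in> ?T" using e m c by (auto simp: front_def)
     then show False
     proof
      assume "c = x"
      then have "e \<in> fset P" using pr[OF m(1)] c m by auto
      then have "e \<in> ?T" by (auto simp: threads_def thread_def)
      then show False using e by (auto simp: front_def)
     next
      assume cT: "c \<in> ?T"
      from threads_producer[OF l cT m(1) c] show False
       using m(2) False e by (auto simp: front_def)
     qed
    qed
    then show ?thesis by auto
   qed
   then show ?thesis using e by (auto simp: front_def)
  qed simp
 next
  fix e assume e: "e \<in> front D - {x} \<union> tops P"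
  show "e \<in> front (insert x (D \<union> ?T))"
  proof (cases "e \<in> tops P")
   case True
   have "e \<notin> ?T" using sp(1)[OF True] tp(1)[of e] by auto
   moreover have "e \<notin> D" "e \<noteq> x" using True sD xs by auto
   moreover have "concls m \<subseteq> ?T" if "m \<in> links N" "e \<in> prems m" for m
   proof -
    obtain t where t: "FlatL e t \<in> links N" "t \<in> ?T" using top[OF True] by auto
    then have "m = FlatL e t" using consumer_unique[OF net that(1) t(1) that(2)] by simp
    then show ?thesis using t by simp
   qed
   ultimately show ?thesis using sp(1,2)[OF True] by (auto simp: front_def)
  next
   case False
   then have "e \<in> front D" "e \<noteq> x" using e by auto
   moreover have "e \<notin> ?T" using tp(4)[of e D] \<open>e \<in> front D\<close> by auto
   ultimately show ?thesis by (auto simp: front_def)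
  qed
 qed
qed

text \<open>Here it is the box of the identity that is copied, once per premise of \<open>P\<close>.
  A copy becomes the graft on the premise of the flat link it is cut with, and the strands through
  its only auxiliary door reproduce the thread. If \<open>P\<close> is empty, the box is erased and
  the front only loses \<open>x\<close>.\<close>

lemma step_whynot:
 assumes D: "stage D" and x: "x \<in> front D" and l: "WhynotL P x \<in> links N"
 shows "net_iso (state (insert x (D \<union> threads P)))
  (exp_reduct (state D) (New x (Sub Neg)) (New x Neg) (Old |`| P) (Old x))"
proof -
 let ?S = "state D" and ?D = "insert x (D \<union> threads P)" and ?T = "threads P" and ?K = "tops P"
 let ?b = "New x Neg" and ?a = "New x (Sub Neg)" and ?P = "Old |`| P"
 let ?X = "exp_reduct ?S ?a ?b ?P (Old x)"
 obtain A where A: "lab N x = Fm (Whynot A)" using whynot_Fl[OF l] by blast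
 have f: "fm x = Whynot A" using A by (simp add: fm_def)
 note tp = threads_props[OF l A] and sp = tops_props[OF l A] and fr = front_threads[OF D x l]
 note sth = state_threads_Old[OF D l]
 have xE: "x \<in> edges N" by (rule front_D(1)[OF x])
 have xx: "New x n \<in> edges ?S \<longleftrightarrow> n \<in> nms (Whynot A)" for n using x f by (simp add: state_mem)
 have ttop: "thread_top N d \<in> thread N d" if "d \<in> fset P" for d
  by (rule thread_top_props(1)[OF net_threads_ok[OF net l] that])
 have dT: "d \<in> thread N d" for d by (simp add: thread_def)
 have disj: "d = d'" if "z \<in> thread N d" "z \<in> thread N d'" "d \<in> fset P" "d' \<in> fset P" for z d d'
  using thread_disjoint[OF net l l] that by blast
 \<comment> \<open>The content of the copied box is the whole subtree for \<open>A\<close> together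
   with the conclusion of its flat link; nothing of the host is copied.\<close>
 have insE: "inside ?S ?b = New x ` (insert Flt (Sub ` nms A))"
 proof (intro set_eqI iffI)
  fix y assume y: "y \<in> inside ?S ?b"
  then have r: "(\<lambda>y z. loc ?S y = Some z)\<^sup>+\<^sup>+ y ?b" and yE: "y \<in> edges ?S" by (auto simp: inside_def)
  from r have "\<exists>n. y = New x n \<and> n \<noteq> Neg \<and> n \<noteq> Pos \<and> n \<noteq> Aux"
  proof (induction rule: converse_tranclp_induct)
   case (base y)
   then show ?case by (cases y) (auto simp: f split: option.splits)
  next
   case (step y z)
   then obtain n where n: "z = New x n" "n \<noteq> Neg" "n \<noteq> Pos" "n \<noteq> Aux" by auto
   then show ?case using step(1) by (cases y) (auto simp: f split: option.splits nm.splits)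
  qed
  then obtain n where n: "y = New x n" "n \<noteq> Neg" "n \<noteq> Pos" "n \<noteq> Aux" by auto
  then show "y \<in> New x ` (insert Flt (Sub ` nms A))" using yE by (auto simp: xx)
 next
  fix y assume "y \<in> New x ` (insert Flt (Sub ` nms A))"
  then consider "y = New x Flt" | n where "y = New x (Sub n)" "n \<in> nms A" by auto
  then show "y \<in> inside ?S ?b"
  proof cases
   case 1
   then show ?thesis by (auto simp: inside_def xx f)
  next
   case 2
   obtain m where m: "(\<lambda>x y. idloc A x = Some y)\<^sup>*\<^sup>* n m" "idloc A m = None" using idloc_chain[OF 2(2)] by blast
   have ch: "(\<lambda>y z. loc ?S y = Some z)\<^sup>*\<^sup>* (New x (Sub n)) (New x (Sub m))" using m(1)
   proof (induction rule: rtranclp_induct)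
    case (step y z)
    then have "loc ?S (New x (Sub y)) = Some (New x (Sub z))" by (simp add: f)
    then show ?case using step.IH by (metis (mono_tags, lifting) rtranclp.rtrancl_into_rtrancl)
   qed simp
   have "loc ?S (New x (Sub m)) = Some ?b" using m(2) by (simp add: f)
   then have "(\<lambda>y z. loc ?S y = Some z)\<^sup>+\<^sup>+ (New x (Sub n)) ?b" by (rule rtranclp_into_tranclp1[OF ch])
   then show ?thesis using 2 by (simp add: inside_def xx)
  qed
 qed
 have auxS: "aux_doors ?S ?b = {(New x Flt, New x Aux)}"
 proof -
  have "loc ?S y = Some ?b \<and> PaxL y z \<in> links ?S \<longleftrightarrow> y = New x Flt \<and> z = New x Aux" for y z
  proof
   assume h: "loc ?S y = Some ?b \<and> PaxL y z \<in> links ?S"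
   then obtain n where n: "y = New x n" "idloc (Whynot A) n = Some Neg"
    by (cases y) (auto simp: f split: option.splits)
   with h obtain m where m: "z = New x m" "PaxL n m \<in> idl (Whynot A) tw (lv x)" unfolding state_pax[OF D] by (auto simp: f)
   have "PaxL k k' \<notin> idl A tw (Suc (lv x))" if "idloc A k = None" for k k' using idl_pax_loc that by metis
   with m n show "y = New x Flt \<and> z = New x Aux"
    by (auto simp: mem_map_link_iffs split: option.splits)
  next
   assume "y = New x Flt \<and> z = New x Aux"
   then show "loc ?S y = Some ?b \<and> PaxL y z \<in> links ?S" using x by (auto simp: state_pax[OF D] f)
  qed
  then show ?thesis by (auto simp: aux_doors_def)
 qed
 have noAux: "\<not> pax_rel ?S (New x Aux) z" for z
  unfolding pax_rel_def state_pax[OF D] using f by (auto simp: mem_map_link_iffs)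
 have bel: "below ?S ?b = {New x Aux}"
  unfolding below_def auxS using noAux by (auto elim: converse_rtranclpE)
 have str: "strand ?S (Old d) y (Old z) = (if z = thread_top N d then Copy (Old d) y else Strand (Old d) y (Old z))"
  if "d \<in> fset P" for d y z
  using sth(2)[OF that] by (simp add: strand_def)
 have bcA: "below_copy ?S ?b (Old d) (New x Aux) = strand ?S (Old d) (New x Flt) (Old d)" for d
  by (simp add: below_copy_def auxS)
 \<comment> \<open>The premise of \<open>P\<close> whose thread contains \<open>z\<close>, and below
   it, as \<open>dk\<close>, the premise whose thread starts at the flat link under
   \<open>s\<close>. Both are well defined because threads are disjoint.\<close>
 define dof where "dof z = (THE d. d \<in> fset P \<and> z \<in> thread N d)" for z
 have dof: "dof z = d" if "d \<in> fset P" "z \<in> thread N d" for z d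
  unfolding dof_def using that disj by blast
 define dk where "dk s = (THE d. d \<in> fset P \<and> FlatL s (thread_top N d) \<in> links N)" for s
 have dk: "dk s \<in> fset P" "FlatL s (thread_top N (dk s)) \<in> links N" if "s \<in> ?K" for s
  using theI'[OF sp(5)[OF that]] by (auto simp: dk_def)
 have dk': "dk s = d" if "d \<in> fset P" "FlatL s (thread_top N d) \<in> links N" for s d
 proof -
  have s: "s \<in> ?K" using that by (auto simp: tops_def)
  from sp(5)[OF s] dk[OF s] that show ?thesis by blast
 qed
 \<comment> \<open>Threads of the host are named by strands of the same thread through the door of
   the identity, and the graft on a top by the copy of the subtree attached to it; \<open>x\<close>
   becomes the positive root of the identity.\<close>
 define h where "h y = (case y of
   Old z \<Rightarrow> if z = x then Keep (New x Pos) else if z \<in> ?T then strand ?S (Old (dof z)) (New x Flt) (Old z) else Keep (Old z)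
  | New e n \<Rightarrow> if e \<in> ?K then Copy (Old (dk e)) (New x (Sub n)) else Keep (New e n))" for y
 have hO: "h (Old z) = (if z = x then Keep (New x Pos) else if z \<in> ?T then strand ?S (Old (dof z)) (New x Flt) (Old z) else Keep (Old z))"
  and hN: "h (New e n) = (if e \<in> ?K then Copy (Old (dk e)) (New x (Sub n)) else Keep (New e n))" for z e n
  by (simp_all add: h_def)
 have hT: "h (Old z) = strand ?S (Old d) (New x Flt) (Old z)" if "d \<in> fset P" "z \<in> thread N d" for d z
 proof -
  have "z \<in> ?T" using that by (auto simp: threads_def)
  then show ?thesis using fr(6) dof[OF that] by (auto simp: hO)
 qed
 have sw: "swapped ?D c = swapped D c" if "c \<notin> ?T" for c
  using that f by (auto simp: swapped_def atom_pair_def)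
 have lowx: "h (low ?D p) = Keep (low D p)" if "p \<notin> ?T" "p \<notin> ?K" for p
  using that x fr(2,7) by (auto simp: low_def hO hN)
 have lowK: "low ?D s = New s Pos" "low D s = Old s" if "s \<in> ?K" for s
  using that fr(2,3) by (auto simp: low_def)
 have lwn: "lk D (WhynotL P x) = WhynotL ?P (Old x)" "lk ?D (WhynotL P x) = WhynotL ?P (Old x)"
  by (simp_all add: whynot_prems[OF l])
 have h_whynot: "map_link h (lk ?D (WhynotL P x)) = WhynotL (h |`| ?P) (Keep (New x Pos))"
  unfolding lwn(2) by (simp add: hO)
 have fR: "fset (h |`| ?P) = (\<lambda>d. strand ?S (Old d) (New x Flt) (Old d)) ` fset P"
  using hT[OF _ dT] by (auto simp: image_image)
 have h_flat: "map_link h (lk ?D (FlatL s (thread_top N d))) = map_link (Copy (Old d)) (FlatL (New x (Sub Pos)) (New x Flt))"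
  if d: "d \<in> fset P" "FlatL s (thread_top N d) \<in> links N" for s d
 proof -
  have s: "s \<in> ?K" using d by (auto simp: tops_def)
  then show ?thesis using lowK(1)[OF s] dk'[OF d] hT[OF d(1) ttop[OF d(1)]] str[OF d(1)] by (simp add: hN)
 qed
 have h_pax: "map_link h (lk ?D (PaxL y z)) = PaxL (strand ?S (Old d) (New x Flt) (Old y)) (strand ?S (Old d) (New x Flt) (Old z))"
  if d: "d \<in> fset P" "z \<in> thread N d" and p: "PaxL y z \<in> links N" for y z d
 proof -
  have y: "y \<in> thread N d" using d(2) p by (auto simp: thread_def pax_rel_def intro: converse_rtranclp_into_rtranclp)
  then have "y \<in> ?T" using d by (auto simp: threads_def)
  then show ?thesis using hT[OF d] hT[OF d(1) y] tp(5) by simp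
 qed
 have h_other: "map_link h (lk ?D m) = map_link Keep (lk D m)"
  if m: "m \<in> links N" "m \<noteq> WhynotL P x" "concls m \<inter> ?T = {}" for m
 proof (rule map_lk_gen)
  fix p assume p: "p \<in> prems m"
  show "h (low ?D p) = Keep (low D p)"
  proof (rule lowx)
   show "p \<notin> ?T" using threads_consumer[OF l _ m(1) p] m by auto
   show "p \<notin> ?K"
   proof
    assume s: "p \<in> ?K"
    have "m = FlatL p (thread_top N (dk p))" by (rule consumer_unique[OF net m(1) dk(2)[OF s] p]) simp
    moreover have "thread_top N (dk p) \<in> ?T" using dk(1)[OF s] ttop by (auto simp: threads_def)
    ultimately show False using m(3) by simp
   qed
  qed
 next
  fix c assume c: "c \<in> concls m"
  have "c \<noteq> x" using producer_unique[OF net m(1) l c] m(2) by auto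
  then show "h (Old c) = Keep (Old c)" using c m(3) by (auto simp: hO)
  show "swapped ?D c = swapped D c" using c m(3) by (intro sw) auto
 qed
 have gO: "e \<noteq> x" "e \<notin> ?T" "e \<notin> ?K" if "e \<in> front D - {x}" for e using that fr(3) tp(4) by auto
 have gN: "map_link h (map_link (New e) k) = map_link Keep (map_link (New e) k)" if "e \<notin> ?K" for e k
  unfolding map_link_comp by (rule map_link_cong) (simp add: that hN)
 have gk: "map_link h k = map_link Keep k" if "k \<in> graft e" "e \<in> front D - {x}" for k e
  using that gN[OF gO(3)[OF that(2)]] gO[OF that(2)] by (auto simp: graft_def hO hN)
 have gs: "map_link h (map_link (New s) k) = map_link (Copy (Old (dk s))) (map_link (New x) (map_link Sub k))" if "s \<in> ?K" for s k
  unfolding map_link_comp by (rule map_link_cong) (simp add: that hN)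
 have gc: "map_link h (CutL (Upair (Old s) (New s Neg))) = CutL (Upair (Keep (Old s)) (Copy (Old (dk s)) ?a))" if s: "s \<in> ?K" for s
 proof -
  have "s \<notin> ?T" using sp(1)[OF s] tp(1)[of s] by auto
  then show ?thesis using s fr(7) by (auto simp: hO hN)
 qed
 have gK: "graft s = insert (CutL (Upair (Old s) (New s Neg))) (map_link (New s) ` idl A tw (Suc (lv x)))" if "s \<in> ?K" for s
  unfolding graft_def sp(3)[OF that] sp(4)[OF that] ..
 have gsl: "set_link k \<subseteq> insert (Old e) (New e ` nms (fm e))" if "k \<in> graft e" for k e
  using that graft_set_link by blast
 have gne: "set_link k \<noteq> {}" if kg: "k \<in> graft e" for k e
 proof (cases "k = CutL (Upair (Old e) (New e Neg))")
  case False
  then obtain k0 where k0: "k = map_link (New e) k0" "k0 \<in> idl (fm e) tw (lv e)" using kg by (auto simp: graft_def)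
  then have "concls k0 \<noteq> {}" using idl_no_cut concls_empty by metis
  then show ?thesis using k0 by (auto simp: set_link_eq)
 qed auto
 have gx: "map_link (New x) k \<in> links ?S" if "k \<in> idl (Whynot A) tw (lv x)" for k
  using that x unfolding state_simps(1) graft_def f[symmetric] by blast
 have insl: "low D p \<notin> inside ?S ?b" "Old c \<notin> inside ?S ?b" for p c
  unfolding insE by (auto simp: low_def)
 have memL: "map_link h (lk ?D m) \<in> map_link h ` links (state ?D)" if "m \<in> links N" for m
  unfolding state_simps(1) by (rule imageI, rule UnI1, rule imageI) (rule that)
 have memG: "map_link h k \<in> map_link h ` links (state ?D)" if "k \<in> graft e" "e \<in> front D - {x} \<union> ?K" for k e
  unfolding state_simps(1) fr(2) by (rule imageI, rule UnI2, rule UN_I) (rule that)+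
 have im: "map_link h ` links (state ?D) = links ?X"
 proof (intro equalityI subsetI)
  fix k assume "k \<in> map_link h ` links (state ?D)"
  then obtain k' where k': "k = map_link h k'" "k' \<in> links (state ?D)" by auto
  then consider m where "k' = lk ?D m" "m \<in> links N" | e where "k' \<in> graft e" "e \<in> front D - {x}"
   | s where "k' \<in> graft s" "s \<in> ?K"
   unfolding state_simps(1) fr(2) by blast
  then show "k \<in> links ?X"
  proof cases
   case (1 m)
   show ?thesis
   proof (cases "m = WhynotL P x")
    case True
    have "WhynotL (h |`| ?P) (Keep (New x Pos)) \<in> links ?X"
    proof (rule exp_whynotI)
     show "WhynotL {|New x Aux|} (New x Pos) \<in> links ?S" using gx[of "WhynotL {|Aux|} Pos"] by simp
     show "fset {|New x Aux|} \<inter> below ?S ?b \<noteq> {}" by (simp add: bel)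
     show "fset (h |`| ?P) = Keep ` (fset {|New x Aux|} - below ?S ?b) \<union>
       (\<Union>d\<in>fset ?P. below_copy ?S ?b d ` (fset {|New x Aux|} \<inter> below ?S ?b))"
      unfolding fR by (auto simp: bel bcA)
    qed
    then show ?thesis unfolding k' 1 True h_whynot .
   next
    case nw: False
    show ?thesis
    proof (cases "concls m \<inter> ?T = {}")
     case True
     have "map_link Keep (lk D m) \<in> links ?X"
     proof (rule exp_keepI)
      show "lk D m \<in> links ?S" using 1 by (simp add: state_simps(1))
      show "lk D m \<noteq> CutL (Upair ?b (Old x))" using lk_ne_cut[OF 1(2)] .
      show "lk D m \<noteq> BangL ?a ?b"
      proof
       assume "lk D m = BangL ?a ?b"
       from arg_cong[OF this, of concls] show False by auto
      qed
      show "lk D m \<noteq> WhynotL ?P (Old x)" using lk_eqD[OF 1(2) l, of D] nw lwn(1) by auto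
      show "concls (lk D m) \<inter> thread ?S d = {}" if d: "d \<in> fset ?P" for d
      proof -
       obtain d0 where d0: "d = Old d0" "d0 \<in> fset P" using d by auto
       have "concls m \<inter> thread N d0 = {}" using True d0(2) unfolding threads_def by blast
       then show ?thesis unfolding d0(1) state_thread_Old[OF D] by auto
      qed
      show "set_link (lk D m) \<inter> inside ?S ?b = {}" using insl by (auto simp: lk_set_link)
      show "prems (lk D m) \<inter> below ?S ?b = {}" by (auto simp: bel low_def)
     qed
     then show ?thesis unfolding k' 1 h_other[OF 1(2) nw True] .
    next
     case False
     then obtain c where c: "c \<in> concls m" "c \<in> ?T" by auto
     from threads_producer[OF l c(2) 1(2) c(1)] show ?thesis
     proof (elim disjE exE conjE)
      fix y assume y: "m = PaxL y c" "y \<in> ?T"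
      obtain d where d: "d \<in> fset P" "c \<in> thread N d" using c(2) by (auto simp: threads_def)
      have p: "PaxL y c \<in> links N" using y 1 by simp
      have "PaxL (strand ?S (Old d) (New x Flt) (Old y)) (strand ?S (Old d) (New x Flt) (Old c)) \<in> links ?X"
      proof (rule exp_strandI)
       show "(New x Flt, New x Aux) \<in> aux_doors ?S ?b" by (simp add: auxS)
       show "Old c \<in> thread ?S (Old d)" using d by (simp add: state_thread_Old[OF D])
       show "PaxL (Old y) (Old c) \<in> links ?S" using p by (simp add: state_pax[OF D])
      qed (use d in simp)
      then show ?thesis unfolding k' 1 y(1) h_pax[OF d p] .
     next
      fix s d assume s: "m = FlatL s c" "d \<in> fset P" "c = thread_top N d"
      have "map_link (Copy (Old d)) (FlatL (New x (Sub Pos)) (New x Flt)) \<in> links ?X"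
      proof (rule exp_copyI)
       show "FlatL (New x (Sub Pos)) (New x Flt) \<in> links ?S" using gx[of "FlatL (Sub Pos) Flt"] by simp
      qed (use s in \<open>auto simp: insE\<close>)
      moreover have "FlatL s (thread_top N d) \<in> links N" using s 1 by simp
      ultimately show ?thesis unfolding k' 1 s(1) using h_flat[OF s(2)] s(3) by simp
     qed
    qed
   qed
  next
   case (2 e)
   have r: "set_link k' \<subseteq> insert (Old e) (range (New e))" using gsl[OF 2(1)] by auto
   have nc: "Old c \<notin> concls k'" for c using 2(1) by (auto simp: graft_def)
   have "map_link Keep k' \<in> links ?X"
   proof (rule exp_keepI)
    show "k' \<in> links ?S" using 2 by (auto simp: state_simps(1))
    show "k' \<noteq> CutL (Upair ?b (Old x))" "k' \<noteq> BangL ?a ?b" "k' \<noteq> WhynotL ?P (Old x)" using r 2(2) by auto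
    show "concls k' \<inter> thread ?S d = {}" if "d \<in> fset ?P" for d
     using that nc by (auto simp: state_thread_Old[OF D])
    show "set_link k' \<inter> inside ?S ?b = {}" using r 2(2) by (auto simp: insE)
    show "prems k' \<inter> below ?S ?b = {}" using r 2(2) by (auto simp: bel set_link_eq)
   qed
   then show ?thesis unfolding k' gk[OF 2] .
  next
   case (3 s)
   show ?thesis
   proof (cases "k' = CutL (Upair (Old s) (New s Neg))")
    case True
    have "FlatL (Old s) (thread_top ?S (Old (dk s))) \<in> links ?S"
     unfolding sth(2)[OF dk(1)[OF 3(2)]] state_flat(1) using dk(2)[OF 3(2)] lowK(2)[OF 3(2)] by metis
    then show ?thesis unfolding k' True gc[OF 3(2)] by (rule exp_cutI) (use dk(1)[OF 3(2)] in simp)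
   next
    case False
    then obtain k0 where k0: "k' = map_link (New s) k0" "k0 \<in> idl A tw (Suc (lv x))" using 3 gK by auto
    have "map_link (Copy (Old (dk s))) (map_link (New x) (map_link Sub k0)) \<in> links ?X"
    proof (rule exp_copyI)
     show "map_link (New x) (map_link Sub k0) \<in> links ?S" using k0(2) by (intro gx) simp
     show "set_link (map_link (New x) (map_link Sub k0)) \<subseteq> inside ?S ?b"
      using idl_set_link[OF k0(2)] by (auto simp: insE link.set_map)
    qed (use dk(1)[OF 3(2)] in simp)
    then show ?thesis unfolding k' k0(1) gs[OF 3(2)] .
   qed
  qed
 next
  fix k assume "k \<in> links ?X"
  then show "k \<in> map_link h ` links (state ?D)"
  proof (cases rule: exp_linksE)
   case (keep l')
   from keep(2) consider m where "l' = lk D m" "m \<in> links N" | e where "l' \<in> graft e" "e \<in> front D - {x}" | "l' \<in> graft x"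
    unfolding state_simps(1) by blast
   then show ?thesis
   proof cases
    case (1 m)
    have nw: "m \<noteq> WhynotL P x" using keep(5) lwn(1) 1 by auto
    have "concls m \<inter> ?T = {}"
    proof -
     have "Old ` concls m \<inter> Old ` thread N d = {}" if "d \<in> fset P" for d
      using keep(6)[of "Old d"] that 1 by (simp add: state_thread_Old[OF D])
     then show ?thesis by (fastforce simp: threads_def)
    qed
    from h_other[OF 1(2) nw this] have "k = map_link h (lk ?D m)" using keep(1) 1 by simp
    then show ?thesis by (simp only: memL[OF 1(2)])
   next
    case (2 e)
    from gk[OF 2] have "k = map_link h l'" using keep(1) by simp
    then show ?thesis by (simp only: memG[OF 2(1) UnI1[OF 2(2)]])
   next
    case 3
    then obtain k0 where k0: "l' = map_link (New x) k0" "k0 \<in> idl (Whynot A) tw (lv x)"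
     using keep(3) unfolding graft_def f by (auto simp only: Upair_swap insert_iff image_iff)
    have nb: "k0 \<noteq> BangL (Sub Neg) Neg" using keep(4) k0(1) by auto
    have ni: "n \<noteq> Flt \<and> n \<notin> Sub ` nms A" if "n \<in> set_link k0" for n
     using keep(7) that k0(1) by (auto simp: insE link.set_map)
    have np: "Aux \<notin> prems k0" using keep(8) k0(1) by (auto simp: bel)
    \<comment> \<open>No link of the graft on \<open>x\<close> is kept unchanged: each is part of
      the box, one of its doors, or the why not link fed by \<open>Aux\<close>, which gets new
      premises.\<close>
    have False
    proof -
     have "Flt \<notin> set_link k0" using ni by blast
     with k0(2) nb np have "k0 \<in> map_link Sub ` idl A tw (Suc (lv x))" by auto
     then obtain k1 where k1: "k0 = map_link Sub k1" "k1 \<in> idl A tw (Suc (lv x))" by auto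
     have "concls k1 \<noteq> {}" using k1(2) idl_no_cut concls_empty by metis
     then obtain n where "n \<in> set_link k1" by (auto simp: set_link_eq)
     then show False using ni[of "Sub n"] k1 idl_set_link[OF k1(2)] by (auto simp: link.set_map)
    qed
    then show ?thesis ..
   qed
  next
   case (copy l' d')
   then obtain d where d: "d' = Old d" "d \<in> fset P" by auto
   from copy(2) consider m where "l' = lk D m" "m \<in> links N" | e where "l' \<in> graft e" "e \<in> front D - {x}" | "l' \<in> graft x"
    unfolding state_simps(1) by blast
   then show ?thesis
   proof cases
    case (1 m)
    obtain c where "c \<in> concls m" using concls_ne[OF 1(2)] by auto
    then have "Old c \<in> set_link l'" unfolding 1 lk_set_link by blast
    then show ?thesis using copy(3) insl(2) by blast
   next
    case (2 e)
    obtain y where y: "y \<in> set_link l'" using gne[OF 2(1)] by auto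
    then have "root y = e" using gsl[OF 2(1)] by auto
    moreover have "root y = x" using copy(3) y by (auto simp: insE)
    ultimately show ?thesis using 2(2) by simp
   next
    case 3
    have "l' \<noteq> CutL (Upair (Old x) (New x Neg))" using copy(3) by (auto simp: insE)
    then obtain k0 where k0: "l' = map_link (New x) k0" "k0 \<in> idl (Whynot A) tw (lv x)"
     using 3 unfolding graft_def f by blast
    have ni: "n = Flt \<or> n \<in> Sub ` nms A" if "n \<in> set_link k0" for n
     using subsetD[OF copy(3), of "New x n"] that k0(1) by (auto simp: insE link.set_map)
    have "Neg \<notin> set_link k0" "Pos \<notin> set_link k0" "Aux \<notin> set_link k0" using ni by blast+
    then have "k0 = FlatL (Sub Pos) Flt \<or> k0 \<in> map_link Sub ` idl A tw (Suc (lv x))" using k0(2) by auto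
    moreover obtain s where s: "FlatL s (thread_top N d) \<in> links N"
     using thread_top_props(2)[OF net_threads_ok[OF net l] d(2)] by blast
    moreover have sK: "s \<in> ?K" using s d by (auto simp: tops_def)
    ultimately show ?thesis
    proof (elim disjE)
     assume "k0 = FlatL (Sub Pos) Flt"
     then have "k = map_link h (lk ?D (FlatL s (thread_top N d)))"
      unfolding h_flat[OF d(2) s] copy(1) k0(1) d(1) by simp
     then show ?thesis by (simp only: memL[OF s])
    next
     assume "k0 \<in> map_link Sub ` idl A tw (Suc (lv x))"
     then obtain k1 where k1: "k0 = map_link Sub k1" "k1 \<in> idl A tw (Suc (lv x))" by auto
     have "k = map_link h (map_link (New s) k1)"
      unfolding gs[OF sK] dk'[OF d(2) s] copy(1) k0(1) k1(1) d(1) ..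
     moreover have "map_link (New s) k1 \<in> graft s" unfolding gK[OF sK] using k1 by blast
     ultimately show ?thesis using memG sK by blast
    qed
   qed
  next
   case (cut s' d')
   then obtain d where d: "d' = Old d" "d \<in> fset P" by auto
   then obtain s where s: "s' = low D s" "FlatL s (thread_top N d) \<in> links N"
    using cut(3) sth(2) state_flat(1) by metis
   have sK: "s \<in> ?K" using s d by (auto simp: tops_def)
   have "k = map_link h (CutL (Upair (Old s) (New s Neg)))"
    unfolding gc[OF sK] cut(1) dk'[OF d(2) s(2)] s(1) lowK(2)[OF sK] d(1) ..
   moreover have "CutL (Upair (Old s) (New s Neg)) \<in> graft s" unfolding gK[OF sK] by blast
   ultimately show ?thesis using memG sK by blast
  next
   case (strand d' y y' z z')
   then obtain d where d: "d' = Old d" "d \<in> fset P" by auto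
   obtain z0 where z0: "z' = Old z0" "z0 \<in> thread N d" using strand(4) unfolding d(1) state_thread_Old[OF D] by auto
   obtain y0 where y0: "z = Old y0" "PaxL y0 z0 \<in> links N" using strand(5) unfolding z0(1) state_pax[OF D] by auto
   have "y = New x Flt" using strand(3) auxS by simp
   then have "k = map_link h (lk ?D (PaxL y0 z0))"
    unfolding h_pax[OF d(2) z0(2) y0(2)] strand(1) d(1) z0(1) y0(1) by simp
   then show ?thesis by (simp only: memL[OF y0(2)])
  next
   case (below d' z z')
   then show ?thesis using noAux[of z'] unfolding bel pax_rel_def by simp
  next
   case (whynot R Q v)
   have aQ: "New x Aux \<in> fset Q" using whynot(3) unfolding bel by auto
   from whynot(2) have "Q = {|New x Aux|} \<and> v = New x Pos"
    unfolding state_whynot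
   proof (elim disjE exE conjE bexE)
    fix P' c assume "Q = low D |`| P'"
    then show ?thesis using aQ by (auto simp: low_def split: if_splits)
   next
    fix e P' n assume e: "Q = New e |`| P'" "v = New e n" "WhynotL P' n \<in> idl (fm e) tw (lv e)"
    then have "e = x" "Aux \<in> fset P'" using aQ by auto
    then show ?thesis using e by (auto simp: f mem_map_link_iffs)
   qed
   then have "fset R = fset (h |`| ?P)" "v = New x Pos"
    using whynot(4) unfolding fR by (auto simp: bel bcA)
   then have "k = map_link h (lk ?D (WhynotL P x))" unfolding whynot(1) h_whynot fset_inject by simp
   then show ?thesis by (simp only: memL[OF l])
  qed
 qed
 \<comment> \<open>A left inverse of \<open>h\<close>. From a copy the top is recovered as the
   premise of the unique flat link whose conclusion is the top of the thread.\<close>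
 define g where "g k = (case k of
   Keep y \<Rightarrow> (case y of Old z \<Rightarrow> Old z | New e n \<Rightarrow> if e = x then Old x else New e n)
  | Copy d y \<Rightarrow> (case y of New e n \<Rightarrow> (case n of Sub m \<Rightarrow> New (THE s. FlatL s (thread_top N (root d)) \<in> links N) m
     | _ \<Rightarrow> Old (thread_top N (root d))) | _ \<Rightarrow> y)
  | Strand _ _ y \<Rightarrow> y)" for k :: "'e name redname"
 have gS: "(THE s'. FlatL s' (thread_top N (dk s)) \<in> links N) = s" if s: "s \<in> ?K" for s
 proof (rule the_equality)
  fix s' assume "FlatL s' (thread_top N (dk s)) \<in> links N"
  then have "FlatL s' (thread_top N (dk s)) = FlatL s (thread_top N (dk s))"
   by (intro producer_unique[OF net _ dk(2)[OF s], of _ "thread_top N (dk s)"]) auto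
  then show "s' = s" by simp
 qed (rule dk(2)[OF s])
 have hcases: thesis if y: "y \<in> edges (state ?D)"
  and 1: "y = Old x \<Longrightarrow> h y = Keep (New x Pos) \<Longrightarrow> thesis"
  and 2: "\<And>d. y = Old (thread_top N d) \<Longrightarrow> d \<in> fset P \<Longrightarrow> thread_top N d \<in> edges N \<Longrightarrow> thread_top N d \<in> ?T \<Longrightarrow> h y = Copy (Old d) (New x Flt) \<Longrightarrow> thesis"
  and 3: "\<And>z d. y = Old z \<Longrightarrow> z \<in> edges N \<Longrightarrow> d \<in> fset P \<Longrightarrow> z \<in> ?T \<Longrightarrow> h y = Strand (Old d) (New x Flt) (Old z) \<Longrightarrow> thesis"
  and 4: "\<And>z. y = Old z \<Longrightarrow> z \<in> edges N \<Longrightarrow> z \<noteq> x \<Longrightarrow> z \<notin> ?T \<Longrightarrow> h y = Keep (Old z) \<Longrightarrow> thesis"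
  and 5: "\<And>s n. y = New s n \<Longrightarrow> s \<in> ?K \<Longrightarrow> n \<in> nms A \<Longrightarrow> h y = Copy (Old (dk s)) (New x (Sub n)) \<Longrightarrow> thesis"
  and 6: "\<And>e n. y = New e n \<Longrightarrow> e \<in> front D \<Longrightarrow> e \<noteq> x \<Longrightarrow> e \<notin> ?K \<Longrightarrow> h y = Keep (New e n) \<Longrightarrow> thesis"
  for y thesis
 proof (cases y)
  case (Old z)
  then have zE: "z \<in> edges N" using y by (simp add: state_mem)
  show thesis
  proof (cases "z \<in> ?T")
   case True
   then obtain d where d: "d \<in> fset P" "z \<in> thread N d" by (auto simp: threads_def)
   show ?thesis
   proof (cases "z = thread_top N d")
    case True
    show ?thesis by (rule that(3)[of d]) (use Old True zE d hT[OF d] str[OF d(1)] \<open>z \<in> ?T\<close> in simp_all)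
   next
    case False
    show ?thesis by (rule that(4)[OF Old zE d(1) True]) (use Old False hT[OF d] str[OF d(1)] in simp)
   qed
  next
   case False
   then show ?thesis using that(2,5) Old zE by (cases "z = x") (auto simp: hO)
  qed
 next
  case (New e n)
  then have e: "e \<in> front ?D" "n \<in> nms (fm e)" using y by (auto simp: state_mem)
  show thesis
  proof (cases "e \<in> ?K")
   case True
   show ?thesis by (rule that(6)[OF New True]) (use True e sp(3)[OF True] New in \<open>auto simp: hN\<close>)
  next
   case False
   show ?thesis by (rule that(7)[OF New]) (use False e fr(2) New in \<open>auto simp: hN\<close>)
  qed
 qed
 have gh: "g (h y) = y" if "y \<in> edges (state ?D)" for y
  using that by (rule hcases) (simp_all add: g_def gS)
 \<comment> \<open>The boxes of the host keep their names: \<open>x\<close> concludes a why not link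
   and the threads carry flat formulas, so neither contains the name of a box.\<close>
 have boxO: "map_option h (map_option Old (loc N z)) = map_option Keep (map_option Old (loc N z))" if z: "z \<in> edges N" for z
 proof (cases "loc N z")
  case (Some b)
  obtain a' where a': "BangL a' b \<in> links N" using loc_box[OF net z Some] by blast
  have "b \<noteq> x" using producer_unique[OF net a' l, of b] by auto
  moreover have "b \<notin> ?T" using box_Fm[OF z Some] tp(1)[of b] by auto
  ultimately show ?thesis using Some by (simp add: hO)
 qed simp
 show ?thesis
 proof (rule net_isoI[where f = h])
  show "inj_on h (edges (state ?D))" by (rule inj_on_inverseI[where g = g]) (rule gh)
  show "map_link h ` links (state ?D) = links ?X" by (rule im)
  fix y assume y: "y \<in> edges (state ?D)"
  from y show "lab ?X (h y) = lab (state ?D) y"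
   by (rule hcases) (use sp(3) tp(1) A in \<open>simp_all add: exp_reduct_lab f\<close>)
  from y show "loc ?X (h y) = map_option h (loc (state ?D) y)"
  proof (rule hcases)
   assume "y = Old x" "h y = Keep (New x Pos)"
   then show ?thesis using boxO[OF xE] by (simp add: exp_reduct_loc)
  next
   fix d assume d: "y = Old (thread_top N d)" "d \<in> fset P" "thread_top N d \<in> edges N" "h y = Copy (Old d) (New x Flt)"
   have "New x Flt \<in> inside ?S ?b" by (simp add: insE)
   then show ?thesis unfolding d(4) exp_reduct_loc sth(2)[OF d(2)] using boxO[OF d(3)] d(1) by (simp add: f)
  next
   fix z d assume z: "y = Old z" "z \<in> edges N" "h y = Strand (Old d) (New x Flt) (Old z)"
   show ?thesis unfolding z(3) exp_reduct_loc using boxO[OF z(2)] z(1) by simp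
  next
   fix z assume z: "y = Old z" "z \<in> edges N" "h y = Keep (Old z)"
   show ?thesis unfolding z(3) exp_reduct_loc using boxO[OF z(2)] z(1) by simp
  next
   fix s n assume s: "y = New s n" "s \<in> ?K" "n \<in> nms A" "h y = Copy (Old (dk s)) (New x (Sub n))"
   have i: "New x (Sub n) \<in> inside ?S ?b" using s(3) by (simp add: insE)
   note d = dk[OF s(2)]
   show ?thesis
   proof (cases "idloc A n")
    case None
    then show ?thesis unfolding s(4) exp_reduct_loc sth(2)[OF d(1)]
     using i boxO[OF sp(2)[OF s(2)]] sp(3,6)[OF s(2)] d s(1) by (simp add: f)
   next
    case (Some m)
    then show ?thesis unfolding s(4) exp_reduct_loc using i s sp(3)[OF s(2)] by (simp add: f hN)
   qed
  next
   fix e n assume e: "y = New e n" "e \<in> front D" "e \<noteq> x" "e \<notin> ?K" "h y = Keep (New e n)"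
   show ?thesis unfolding e(5) exp_reduct_loc
    using boxO[OF front_D(1)[OF e(2)]] e(1,4) by (simp add: hN split: option.splits)
  qed
 qed
qed

end

subsection \<open>The stages are the reducts\<close>

lemma idl_axiom_root:
 "AxL v \<in> idl F tw j \<Longrightarrow> Neg \<in> set_uprod v \<Longrightarrow> v = Upair Neg Pos \<and> (\<exists>Z. F = Atom Z \<or> F = NAtom Z)"
 by (cases F) (auto simp: mem_map_link_iffs uprod.set_map split: if_splits)

lemma uprod_other: assumes "x \<in> set_uprod u" shows "\<exists>y. u = Upair x y"
proof (cases u)
 case (Upair a b)
 then show ?thesis using assms Upair_swap[of a b] by auto
qed

context host
begin

lemma state_cut:
 "CutL (Upair e g) \<in> links (state D) \<longleftrightarrow>
   (\<exists>x\<in>front D. e = Old x \<and> g = New x Neg \<or> e = New x Neg \<and> g = Old x)"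
proof -
 have "CutL (Upair e g) \<notin> lk D ` links N" using lk_ne_cut by (metis imageE)
 moreover have "CutL (Upair e g) \<in> graft x \<longleftrightarrow> e = Old x \<and> g = New x Neg \<or> e = New x Neg \<and> g = Old x" for x
  using idl_no_cut by (auto simp: graft_def mem_map_link_iffs Upair_inject)
 ultimately show ?thesis unfolding state_simps(1) by blast
qed

lemma state_concl_Old:
 assumes "k \<in> links (state D)" "Old x \<in> concls k"
 obtains l where "l \<in> links N" "x \<in> concls l" "k = lk D l"
proof -
 have "k \<notin> graft e" for e using assms(2) by (auto simp: graft_def)
 then obtain l where "l \<in> links N" "k = lk D l" using assms(1) unfolding state_simps(1) by blast
 then show ?thesis using that assms(2) by auto
qed

lemma state_concl_New:
 assumes "k \<in> links (state D)" "New x n \<in> concls k"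
 obtains k0 where "x \<in> front D" "k0 \<in> idl (fm x) tw (lv x)" "n \<in> concls k0" "k = map_link (New x) k0"
proof -
 have "k \<notin> lk D ` links N" using assms(2) by auto
 then obtain e where e: "k \<in> graft e" "e \<in> front D" using assms(1) unfolding state_simps(1) by blast
 then obtain k0 where "k = map_link (New e) k0" "k0 \<in> idl (fm e) tw (lv e)" using assms(2) unfolding graft_def by auto
 then show ?thesis using that assms(2) e(2) by auto
qed

lemma not_swapped: "x \<in> front D \<Longrightarrow> \<not> swapped D x"
 using front_D(2) by (auto simp: swapped_def)

text \<open>Every cut of a state joins an edge of the host to the negative root of its identity. So
  an exponential redex has its box on exactly one of these sides, and the producers of both edges
  fix all its data.\<close>

lemma cut_exponential:
 assumes D: "stage D" and c: "CutL (Upair b w) \<in> links (state D)" "BangL a b \<in> links (state D)" "WhynotL P w \<in> links (state D)"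
 obtains (bang) x a0 where "x \<in> front D" "BangL a0 x \<in> links N" "a = Old a0" "b = Old x" "P = {|New x Aux|}" "w = New x Neg"
 | (whynot) x P0 where "x \<in> front D" "WhynotL P0 x \<in> links N" "a = New x (Sub Neg)" "b = New x Neg" "P = Old |`| P0" "w = Old x"
proof -
 obtain x where x: "x \<in> front D" "b = Old x \<and> w = New x Neg \<or> b = New x Neg \<and> w = Old x"
  using c(1) unfolding state_cut by blast
 from x(2) show ?thesis
 proof
  assume bw: "b = Old x \<and> w = New x Neg"
  obtain l where l: "l \<in> links N" "x \<in> concls l" "BangL a b = lk D l" using state_concl_Old[OF c(2), of x] bw by auto
  then obtain a0 where a0: "l = BangL a0 x" "a = low D a0" by (cases l) (auto split: if_splits)
  have "a = Old a0" using a0 low_above(1)[OF D x(1) l(1)] by simp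
  moreover obtain A where "fm x = Bang A" using net_typed[OF net l(1)] a0 by (auto simp: fm_def)
  moreover obtain k0 where "k0 \<in> idl (fm x) tw (lv x)" "Neg \<in> concls k0" "WhynotL P w = map_link (New x) k0"
   using state_concl_New[OF c(3), of x Neg] bw by auto
  ultimately have "P = {|New x Aux|}" by auto
  then show ?thesis using bang x(1) l(1) a0 bw \<open>a = Old a0\<close> by blast
 next
  assume bw: "b = New x Neg \<and> w = Old x"
  obtain l where l: "l \<in> links N" "x \<in> concls l" "WhynotL P w = lk D l" using state_concl_Old[OF c(3), of x] bw by auto
  then obtain P0 where P0: "l = WhynotL P0 x" "P = low D |`| P0" by (cases l) (auto split: if_splits)
  have "P = Old |`| P0" using P0 whynot_prems l(1) by simp
  moreover obtain A where "fm x = Whynot A" using net_typed[OF net l(1)] P0 by (auto simp: fm_def)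
  moreover obtain k0 where "k0 \<in> idl (fm x) tw (lv x)" "Neg \<in> concls k0" "BangL a b = map_link (New x) k0"
   using state_concl_New[OF c(2), of x Neg] bw by auto
  ultimately have "a = New x (Sub Neg)" by auto
  then show ?thesis using whynot x(1) l(1) P0 bw \<open>P = Old |`| P0\<close> by blast
 qed
qed

lemma cut_threads_ok:
 assumes D: "stage D" and c: "CutL (Upair b w) \<in> links (state D)" "BangL a b \<in> links (state D)" "WhynotL P w \<in> links (state D)"
 shows "threads_ok (state D) P"
 using D c
proof (cases rule: cut_exponential)
 case (bang x a0)
 obtain A where "fm x = Bang A" using net_typed[OF net bang(2)] by (auto simp: fm_def)
 then show ?thesis using state_thread_New(2)[OF D bang(1)] bang by blast
next
 case (whynot x P0)
 then show ?thesis using state_threads_Old(1)[OF D whynot(2)] by simp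
qed

lemma stage_insert:
 assumes "stage D" "x \<in> front D" "l \<in> links N" "x \<in> concls l"
  "\<And>p. p \<in> prems l \<Longrightarrow> \<exists>A. lab N p = Fm A" "prems l \<noteq> {} \<Longrightarrow> concls l = {x}"
 shows "stage (insert x D) \<and> D \<subset> insert x D"
 using front_insert(1)[OF assms] front_D(2)[OF assms(2)] by auto

lemma stage_whynot: "stage D \<Longrightarrow> x \<in> front D \<Longrightarrow> WhynotL P x \<in> links N \<Longrightarrow>
  stage (insert x (D \<union> threads P)) \<and> D \<subset> insert x (D \<union> threads P)"
 using front_threads(1) front_D(2) by blast

text \<open>The redex determines an edge \<open>x\<close> of the front, and the producer of
  \<open>x\<close> in the host must be dual to the root link of the identity. Each rule thus falls
  under one of the step lemmas above, in one of two orientations.\<close>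

lemma state_beta:
 assumes D: "stage D" and b: "beta (state D) S"
 shows "\<exists>D'. stage D' \<and> D \<subset> D' \<and> net_iso (state D') S"
 using b
proof cases
 case (axiom e k g)
 obtain x where x: "x \<in> front D" "k = Old x \<and> g = New x Neg \<or> k = New x Neg \<and> g = Old x"
  using axiom(3) unfolding state_cut by blast
 from x(2) show ?thesis
 proof
  assume kg: "k = Old x \<and> g = New x Neg"
  obtain l where l: "l \<in> links N" "x \<in> concls l" "AxL (Upair e k) = lk D l"
   using state_concl_Old[OF axiom(2), of x] kg by auto
  then obtain v where v: "l = AxL v" "Upair e k = map_uprod Old v" by (cases l) (auto split: if_splits)
  then obtain y where y: "v = Upair y x" "e = Old y"
   using kg map_uprod_eq_Upair[of Old v e k] by auto
  have ax: "AxL (Upair x y) \<in> links N" using l v y by (simp add: Upair_swap)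
  have "net_iso (state (insert x D)) S" using step_axiom(2)[OF D x(1) ax] axiom(1) kg y by simp
  then show ?thesis using stage_insert[OF D x(1) ax] by auto
 next
  assume kg: "k = New x Neg \<and> g = Old x"
  obtain k0 where k0: "k0 \<in> idl (fm x) tw (lv x)" "Neg \<in> concls k0" "AxL (Upair e k) = map_link (New x) k0"
   using state_concl_New[OF axiom(2), of x Neg] kg by auto
  then obtain v where v: "k0 = AxL v" using map_link_eq_iffs(1) by metis
  then have k0': "k0 = AxL (Upair Neg Pos)" and at: "\<exists>Z. fm x = Atom Z \<or> fm x = NAtom Z"
   using idl_axiom_root k0(1,2) by auto
  have e: "e = New x Pos" using k0(3) kg unfolding k0' by (auto simp: Upair_inject)
  obtain l where l: "l \<in> links N" "x \<in> concls l" using producer_ex[OF net front_D(1)[OF x(1)]] by auto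
  \<comment> \<open>The identity is an axiom only on an atom, and an edge labelled by an atom can
    only be produced by an axiom.\<close>
  have "\<exists>u. l = AxL u" using net_typed[OF net l(1)] l(2) front_D(3)[OF x(1)] at by (cases l) auto
  then obtain y where "l = AxL (Upair x y)" using l(2) uprod_other by fastforce
  then have ax: "AxL (Upair x y) \<in> links N" using l by simp
  have "net_iso (state (insert x D)) S" using step_axiom(1)[OF D x(1) ax] axiom(1) kg e by simp
  then show ?thesis using stage_insert[OF D x(1) ax] by auto
 qed
next
 case (unit e k)
 obtain x where x: "x \<in> front D" "e = Old x \<and> k = New x Neg \<or> e = New x Neg \<and> k = Old x"
  using unit(2) unfolding state_cut by blast
 from x(2) obtain l r where lr: "l = OneL x \<and> r = BotL Neg \<or> l = BotL x \<and> r = OneL Neg" "l \<in> links N"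
  and R: "{CutL (Upair e k), OneL e, BotL k} = {CutL (Upair (Old x) (New x Neg)), lk D l, map_link (New x) r}"
 proof
  assume ek: "e = Old x \<and> k = New x Neg"
  obtain l where l: "l \<in> links N" "x \<in> concls l" "OneL e = lk D l" using state_concl_Old[OF unit(3), of x] ek by auto
  then have "l = OneL x" by (cases l) (auto split: if_splits)
  then show ?thesis using that[of "OneL x" "BotL Neg"] l ek by simp
 next
  assume ek: "e = New x Neg \<and> k = Old x"
  obtain l where l: "l \<in> links N" "x \<in> concls l" "BotL k = lk D l" using state_concl_Old[OF unit(4), of x] ek by auto
  then have "l = BotL x" by (cases l) (auto split: if_splits)
  then show ?thesis using that[of "BotL x" "OneL Neg"] l ek by (auto simp: Upair_swap)
 qed
 have "net_iso (state (insert x D)) S" using step_unit[OF D x(1) lr R] unit(1) by simp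
 moreover have "stage (insert x D) \<and> D \<subset> insert x D" by (rule stage_insert[OF D x(1) lr(2)]) (use lr in auto)
 ultimately show ?thesis by blast
next
 case (mult e k p q r s)
 obtain x where x: "x \<in> front D" "e = Old x \<and> k = New x Neg \<or> e = New x Neg \<and> k = Old x"
  using mult(2) unfolding state_cut by blast
 note ns = not_swapped[OF x(1)]
 from x(2) show ?thesis
 proof
  assume ek: "e = Old x \<and> k = New x Neg"
  obtain l where l: "l \<in> links N" "x \<in> concls l" "TensorL p q e = lk D l" using state_concl_Old[OF mult(3), of x] ek by auto
  then obtain p0 q0 where l0: "l = TensorL p0 q0 x" "p = low D p0" "q = low D q0" using ns by (cases l) (auto split: if_splits)
  have lN: "TensorL p0 q0 x \<in> links N" using l l0 by simp
  have pq: "p = Old p0" "q = Old q0" using l0 low_above(1)[OF D x(1) lN] by simp_all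
  obtain A B where "lab N p0 = Fm A" "lab N q0 = Fm B" "fm x = Tensor A B" using net_typed[OF net lN] by (auto simp: fm_def)
  moreover obtain k0 where "k0 \<in> idl (fm x) tw (lv x)" "Neg \<in> concls k0" "ParL r s k = map_link (New x) k0"
   using state_concl_New[OF mult(4), of x Neg] ek by auto
  ultimately have rs: "r = New x (Lt Neg)" "s = New x (Rt Neg)" by (auto split: if_splits)
  have "net_iso (state (insert x D)) S" unfolding mult(1)
   by (rule step_tensor[OF D x(1) lN]) (simp_all add: ek pq rs)
  moreover have "stage (insert x D) \<and> D \<subset> insert x D"
   by (rule stage_insert[OF D x(1) lN]) (use \<open>lab N p0 = Fm A\<close> \<open>lab N q0 = Fm B\<close> in auto)
  ultimately show ?thesis by blast
 next
  assume ek: "e = New x Neg \<and> k = Old x"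
  obtain l where l: "l \<in> links N" "x \<in> concls l" "ParL r s k = lk D l" using state_concl_Old[OF mult(4), of x] ek by auto
  then obtain p0 q0 where l0: "l = ParL p0 q0 x" "r = low D p0" "s = low D q0" using ns by (cases l) (auto split: if_splits)
  have lN: "ParL p0 q0 x \<in> links N" using l l0 by simp
  have pq: "r = Old p0" "s = Old q0" using l0 low_above(1)[OF D x(1) lN] by simp_all
  obtain A B where "lab N p0 = Fm A" "lab N q0 = Fm B" "fm x = Par A B" using net_typed[OF net lN] by (auto simp: fm_def)
  moreover obtain k0 where "k0 \<in> idl (fm x) tw (lv x)" "Neg \<in> concls k0" "TensorL p q e = map_link (New x) k0"
   using state_concl_New[OF mult(3), of x Neg] ek by auto
  ultimately have rs: "p = New x (Lt Neg)" "q = New x (Rt Neg)" by (auto split: if_splits)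
  have "net_iso (state (insert x D)) S" unfolding mult(1)
   by (rule step_par[OF D x(1) lN]) (auto simp: ek pq rs Upair_swap)
  moreover have "stage (insert x D) \<and> D \<subset> insert x D"
   by (rule stage_insert[OF D x(1) lN]) (use \<open>lab N p0 = Fm A\<close> \<open>lab N q0 = Fm B\<close> in auto)
  ultimately show ?thesis by blast
 qed
next
 case (para e k p q)
 obtain x where x: "x \<in> front D" "e = Old x \<and> k = New x Neg \<or> e = New x Neg \<and> k = Old x"
  using para(2) unfolding state_cut by blast
 \<comment> \<open>The paragraph rule is symmetric in the two sides of the cut, so host and identity
   may be put in a fixed order.\<close>
 have gen: ?thesis if y: "ParagraphL y (Old x) \<in> links (state D)" and z: "ParagraphL z (New x Neg) \<in> links (state D)"
  and R: "{CutL (Upair e k), ParagraphL p e, ParagraphL q k} = {CutL (Upair (Old x) (New x Neg)), ParagraphL y (Old x), ParagraphL z (New x Neg)}"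
  and C: "Upair p q = Upair y z" for y z
 proof -
  obtain l where l: "l \<in> links N" "x \<in> concls l" "ParagraphL y (Old x) = lk D l" using state_concl_Old[OF y, of x] by auto
  then obtain p0 where l0: "l = ParagraphL p0 x" "y = low D p0" by (cases l) (auto split: if_splits)
  have lN: "ParagraphL p0 x \<in> links N" using l l0 by simp
  have y0: "y = Old p0" using l0 low_above(1)[OF D x(1) lN] by simp
  obtain A where "lab N p0 = Fm A" "fm x = Paragraph A" using net_typed[OF net lN] by (auto simp: fm_def)
  moreover obtain k0 where "k0 \<in> idl (fm x) tw (lv x)" "Neg \<in> concls k0" "ParagraphL z (New x Neg) = map_link (New x) k0"
   using state_concl_New[OF z, of x Neg] by auto
  ultimately have z0: "z = New x (Sub Neg)" by auto
  have "net_iso (state (insert x D)) S" unfolding para(1) R C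
   by (rule step_paragraph[OF D x(1) lN]) (simp_all add: y0 z0)
  moreover have "stage (insert x D) \<and> D \<subset> insert x D"
   by (rule stage_insert[OF D x(1) lN]) (use \<open>lab N p0 = Fm A\<close> in auto)
  ultimately show ?thesis by blast
 qed
 from x(2) show ?thesis
 proof
  assume ek: "e = Old x \<and> k = New x Neg"
  show ?thesis by (rule gen[of p q]) (use ek para in auto)
 next
  assume ek: "e = New x Neg \<and> k = Old x"
  show ?thesis by (rule gen[of q p]) (use ek para in \<open>auto simp: Upair_swap\<close>)
 qed
next
 case (expo b w a P)
 from D expo(1-3) show ?thesis
 proof (cases rule: cut_exponential)
  case (bang x a0)
  have "net_iso (state (insert x D)) S"
   using net_iso_trans[OF step_bang[OF D bang(1,2)]] expo(4) bang by simp
  moreover have "stage (insert x D) \<and> D \<subset> insert x D"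
   by (rule stage_insert[OF D bang(1,2)]) (use net_typed[OF net bang(2)] in auto)
  ultimately show ?thesis by blast
 next
  case (whynot x P0)
  have "net_iso (state (insert x (D \<union> threads P0))) S"
   using net_iso_trans[OF step_whynot[OF D whynot(1,2)]] expo(4) whynot by simp
  then show ?thesis using stage_whynot[OF D whynot(1,2)] by blast
 qed
qed

text \<open>By typing, the producer of a front edge and the root of its identity are always dual, so
  no cut of a state is stuck.\<close>

lemma state_progress:
 assumes D: "stage D" and x: "x \<in> front D" shows "\<exists>S. beta (state D) S"
proof -
 obtain l where l: "l \<in> links N" "x \<in> concls l" using producer_ex[OF net front_D(1)[OF x]] by auto
 have lS: "lk D l \<in> links (state D)" using l by (simp add: state_simps(1))
 have cut: "CutL (Upair (Old x) (New x Neg)) \<in> links (state D)" "CutL (Upair (New x Neg) (Old x)) \<in> links (state D)"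
  using x unfolding state_cut by blast+
 have gx: "map_link (New x) k \<in> links (state D)" if "k \<in> idl (fm x) tw (lv x)" for k
  using that x unfolding state_simps(1) graft_def by blast
 note ns = not_swapped[OF x]
 have lab: "lab N x = Fm (fm x)" by (rule front_D(3)[OF x])
 show ?thesis
 proof (cases l)
  case (AxL u)
  then obtain y where "u = Upair x y" using l(2) uprod_other by fastforce
  then have ax: "AxL (Upair x y) \<in> links N" using l AxL by simp
  have "AxL (Upair (New x Pos) (New x Neg)) \<in> links (state D)"
   using gx[of "AxL (Upair Neg Pos)"] axiom_atoms(1)[OF ax] by (simp add: Upair_swap)
  then show ?thesis using beta.axiom[OF _ cut(2)] by blast
 next
  case (OneL c)
  then have "fm x = One" using net_typed[OF net l(1)] l(2) by (simp add: fm_def)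
  then have "OneL (Old x) \<in> links (state D)" "BotL (New x Neg) \<in> links (state D)"
   using lS gx[of "BotL Neg"] OneL l(2) by auto
  then show ?thesis using beta.unit[OF cut(1)] by blast
 next
  case (BotL c)
  then have "fm x = Bot" using net_typed[OF net l(1)] l(2) by (simp add: fm_def)
  then have "OneL (New x Neg) \<in> links (state D)" "BotL (Old x) \<in> links (state D)"
   using lS gx[of "OneL Neg"] BotL l(2) by auto
  then show ?thesis using beta.unit[OF cut(2)] by blast
 next
  case (TensorL p q c)
  then obtain A B where "fm x = Tensor A B" using net_typed[OF net l(1)] l(2) by (auto simp: fm_def)
  then have "ParL (New x (Lt Neg)) (New x (Rt Neg)) (New x Neg) \<in> links (state D)"
   using gx[of "ParL (Lt Neg) (Rt Neg) Neg"] by simp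
  moreover have "TensorL (low D p) (low D q) (Old x) \<in> links (state D)" using lS TensorL l(2) ns by auto
  ultimately show ?thesis using beta.mult[OF cut(1)] by blast
 next
  case (ParL p q c)
  then obtain A B where "fm x = Par A B" using net_typed[OF net l(1)] l(2) by (auto simp: fm_def)
  then have "TensorL (New x (Lt Neg)) (New x (Rt Neg)) (New x Neg) \<in> links (state D)"
   using gx[of "TensorL (Lt Neg) (Rt Neg) Neg"] by simp
  moreover have "ParL (low D p) (low D q) (Old x) \<in> links (state D)" using lS ParL l(2) ns by auto
  ultimately show ?thesis using beta.mult[OF cut(2)] by blast
 next
  case (ParagraphL p c)
  then obtain A where "fm x = Paragraph A" using net_typed[OF net l(1)] l(2) by (auto simp: fm_def)
  then have "ParagraphL (New x (Sub Neg)) (New x Neg) \<in> links (state D)"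
   using gx[of "ParagraphL (Sub Neg) Neg"] by simp
  moreover have "ParagraphL (low D p) (Old x) \<in> links (state D)" using lS ParagraphL l(2) by auto
  ultimately show ?thesis using beta.para[OF cut(1)] by blast
 next
  case (BangL p c)
  then obtain A where "fm x = Bang A" using net_typed[OF net l(1)] l(2) by (auto simp: fm_def)
  then have "WhynotL {|New x Aux|} (New x Neg) \<in> links (state D)" using gx[of "WhynotL {|Aux|} Neg"] by simp
  moreover have "BangL (low D p) (Old x) \<in> links (state D)" using lS BangL l(2) by simp
  moreover have lN: "BangL p x \<in> links N" using l BangL by simp
  moreover have "low D p = Old p" using low_above(1)[OF D x lN] by simp
  \<comment> \<open>\<open>step_bang\<close> gives an isomorphism from the larger state to the
    reduct, whereas \<open>beta.expo\<close> asks for the opposite direction; it can be reversed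
    because states are \<open>boxed\<close>.\<close>
  ultimately have "beta (state D) (state (insert x D))"
   using siso_net_iso[OF siso_sym[OF net_iso_siso[OF step_bang[OF D x lN] state_boxed]]]
   by (intro beta.expo[OF cut(1)]) simp_all
  then show ?thesis by blast
 next
  case (WhynotL P c)
  then obtain A where "fm x = Whynot A" using net_typed[OF net l(1)] l(2) by (auto simp: fm_def)
  then have "BangL (New x (Sub Neg)) (New x Neg) \<in> links (state D)" using gx[of "BangL (Sub Neg) Neg"] by simp
  moreover have lN: "WhynotL P x \<in> links N" using l WhynotL by simp
  moreover have "WhynotL (Old |`| P) (Old x) \<in> links (state D)"
   using lS WhynotL l(2) by (simp add: whynot_prems[OF lN])
  ultimately have "beta (state D) (state (insert x (D \<union> threads P)))"
   using siso_net_iso[OF siso_sym[OF net_iso_siso[OF step_whynot[OF D x lN] state_boxed]]]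
   by (intro beta.expo[OF cut(2)]) simp_all
  then show ?thesis by blast
 qed (use lab net_typed[OF net l(1)] l(2) in auto)
qed

text \<open>Steps of \<open>M\<close> are simulated on a state over other names, hence the backward
  transport. The stage reached is not prescribed: whatever order of steps is chosen, the reduct is
  some state.\<close>

lemma state_reducts:
 assumes "beta\<^sup>*\<^sup>* M M'" and "siso (state D) M" and "stage D" and "inj (i :: 'f \<Rightarrow> 'e name)"
 shows "\<exists>D'. stage D' \<and> siso (state D') (M' :: 'f net)"
 using assms(1)
proof (induction rule: rtranclp_induct)
 case (step M1 M2)
 then obtain D1 where D1: "stage D1" "siso (state D1) M1" by blast
 have "\<exists>S. beta (state D1) S \<and> siso S M2"
  by (rule beta_iso_backward[OF D1(2) assms(4) step(2) state_boxed state_pax_unique[OF D1(1)]])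
   (rule cut_threads_ok[OF D1(1)])
 then obtain S where S: "beta (state D1) S" "siso S M2" by blast
 obtain D2 where "stage D2" "net_iso (state D2) S" using state_beta[OF D1(1) S(1)] by blast
 then show ?case using siso_trans[OF net_iso_siso[OF _ state_boxed] S(2)] by blast
qed (use assms in blast)

text \<open>A step exists while the front is inhabited, and it strictly shrinks the set of edges
  outside the stage.\<close>

lemma state_normalizes:
 assumes "siso (state D) (M :: 'f net)" and "stage D" and i: "inj (i :: 'e name \<Rightarrow> 'f)"
 shows "\<exists>M' D'. beta\<^sup>*\<^sup>* M M' \<and> stage D' \<and> siso (state D') M' \<and> front D' = {}"
 using assms(1,2)
proof (induction "card (edges N - D)" arbitrary: D M rule: less_induct)
 case less
 show ?case
 proof (cases "front D = {}")
  case True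
  then show ?thesis using less.prems by blast
 next
  case False
  then obtain S where S: "beta (state D) S" using state_progress[OF less.prems(2)] by blast
  obtain D' where D': "stage D'" "D \<subset> D'" "net_iso (state D') S" using state_beta[OF less.prems(2) S] by blast
  have "\<exists>M'. beta M M' \<and> siso S M'"
   by (rule beta_iso_forward[OF less.prems(1) i S state_boxed state_pax_unique[OF less.prems(2)]])
    (rule cut_threads_ok[OF less.prems(2)])
  then obtain M' where M': "beta M M'" "siso S M'" by blast
  have s: "siso (state D') M'" by (rule siso_trans[OF net_iso_siso[OF D'(3) state_boxed] M'(2)])
  have "edges N - D' \<subset> edges N - D" using D' by (auto simp: stage_def)
  then have "card (edges N - D') < card (edges N - D)" using net_finite[OF net] by (intro psubset_card_mono) auto
  from less.hyps[OF this s D'(1)] obtain M'' D'' where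
   "beta\<^sup>*\<^sup>* M' M''" "stage D''" "siso (state D'') M''" "front D'' = {}" by blast
  then show ?thesis using M'(1) by (meson converse_rtranclp_into_rtranclp)
 qed
qed

text \<open>Going up from the conclusions, a formula edge whose consumer is rebuilt would be on the
  front if it were missing, and a flat one belongs to the stage by its last clause.\<close>

lemma front_empty: assumes D: "stage D" and f: "front D = {}" shows "D = edges N"
proof -
 have "e \<in> D" if "e \<in> edges N" for e
  using net cf that
 proof (induction e rule: down_induct)
  case (conclusion c)
  then have "c \<notin> D \<Longrightarrow> c \<in> front D" using concl_Fm by (auto simp: front_def conclusions_def)
  then show ?case using f by blast
 next
  case (premise l p c)
  have cD: "concls l \<subseteq> D"
   using one_conclusion[OF premise.hyps(2) _ premise.hyps(3)] premise.IH by (intro subsetI) simp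
  show ?case
  proof (cases "lab N p")
   case (Fm A)
   have "concls m \<subseteq> D" if "m \<in> links N" "p \<in> prems m" for m
    using consumer_unique[OF net that(1) premise(1) that(2) premise(2)] cD by simp
   moreover have "p \<in> edges N" using premise(1,2) prems_subset by blast
   ultimately have "p \<notin> D \<Longrightarrow> p \<in> front D" using Fm by (auto simp: front_def)
   then show ?thesis using f by blast
  next
   case (Fl A)
   then show ?thesis using D cD premise(1,2) unfolding stage_def by blast
  qed
 qed
 then show ?thesis using D by (auto simp: stage_def)
qed

lemma stage_empty: "stage {}"
 using concls_ne by (auto simp: stage_def)

lemma front_init: "front {} = conclusions N"
 using concls_ne concl_Fm by (auto simp: front_def conclusions_def)

lemma low_final: "low (edges N) e = Old e"
 by (simp add: low_def front_def)

lemma links_final: "links (state (edges N)) = lk (edges N) ` links N"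
 by (auto simp: state_simps(1) front_def)

end

subsection \<open>Eta-expansion\<close>

lemma typed_cong: "(\<And>y. y \<in> set_link l \<Longrightarrow> lab M y = lab N y) \<Longrightarrow> typed N l \<Longrightarrow> typed M l"
 by (cases l) (auto, (metis insertCI)+)

text \<open>The sources of the added pairs are fresh vertices that nothing points to, so no cycle
  can pass through them.\<close>

lemma acyclic_fresh:
 assumes "acyclic r" "Range (r \<union> s) \<inter> Domain s = {}" shows "acyclic (r \<union> s)"
proof -
 have p: "(a, b) \<in> r\<^sup>+" if "(a, b) \<in> (r \<union> s)\<^sup>+" "a \<notin> Domain s" for a b
  using that(1)
 proof (induction rule: trancl_induct)
  case (base y)
  then show ?case using that(2) by auto
 next
  case (step y z)
  have "y \<in> Range (r \<union> s)" using step(1) by (metis Range.intros Range_Un_eq Un_iff tranclE)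
  then have "(y, z) \<in> r" using step(2) assms(2) by blast
  then show ?case using step.IH by simp
 qed
 show ?thesis unfolding acyclic_def
 proof (intro allI notI)
  fix a assume a: "(a, a) \<in> (r \<union> s)\<^sup>+"
  then have "a \<in> Range (r \<union> s)" by (metis Range.intros Range_Un_eq Un_iff tranclE)
  then have "a \<notin> Domain s" using assms(2) by auto
  then show False using p[OF a] assms(1) by (auto simp: acyclic_def)
 qed
qed

text \<open>An expansion step puts a finite set \<open>K\<close> of links on fresh edges
  \<open>F\<close> in the place of an axiom, with the same two pending conclusions. The assumptions
  are the local checks on \<open>K\<close> from which all clauses of \<open>is_net\<close> follow,
  shared by the four rules.\<close>

lemma replace_axiom:
 assumes N: "is_net N" and ax: "AxL (Upair e e') \<in> links N"
  and M: "links M = links N - {AxL (Upair e e')} \<union> K" and K: "finite K"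
  and F: "F \<inter> edges N = {}" and KF: "\<And>l. l \<in> K \<Longrightarrow> prems l \<subseteq> F \<and> concls l \<subseteq> F \<union> {e, e'}"
  and c1: "\<And>y. y \<in> F \<union> {e, e'} \<Longrightarrow> \<exists>l\<in>K. y \<in> concls l"
  and c2: "\<And>l l'. l \<in> K \<Longrightarrow> l' \<in> K \<Longrightarrow> concls l \<inter> concls l' \<noteq> {} \<Longrightarrow> l = l'"
  and p: "\<And>y. y \<in> F \<Longrightarrow> \<exists>l\<in>K. y \<in> prems l"
  and d: "\<And>l l'. l \<in> K \<Longrightarrow> l' \<in> K \<Longrightarrow> prems l \<inter> prems l' \<noteq> {} \<Longrightarrow> l = l'"
  and old: "\<And>y. y \<notin> F \<Longrightarrow> lab M y = lab N y \<and> loc M y = loc N y"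
  and t: "\<And>l. l \<in> K \<Longrightarrow> typed M l"
  and b1: "\<And>l y y'. l \<in> K \<Longrightarrow> \<not> is_door l \<Longrightarrow> y \<in> set_link l \<Longrightarrow> y' \<in> set_link l \<Longrightarrow> loc M y = loc M y'"
  and b2: "\<And>p c. BangL p c \<in> K \<Longrightarrow> loc M p = Some c"
  and b3: "\<And>p c. PaxL p c \<in> K \<Longrightarrow> \<exists>b. loc M p = Some b \<and> loc M c = loc M b"
  and b4: "\<And>y. y \<in> F \<Longrightarrow> loc M y = loc N e \<or> loc M y = Some e \<and> (\<exists>a. BangL a e \<in> K)"
 shows "is_net M \<and> conclusions M = conclusions N \<and> edges M = edges N \<union> F"
proof -
 have c: "\<exists>!l. l \<in> K \<and> y \<in> concls l" if "y \<in> F \<union> {e, e'}" for y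
  using c1[OF that] c2 by blast
 let ?a = "AxL (Upair e e')"
 have eE: "e \<in> edges N" "e' \<in> edges N" using concls_subset[OF ax] by auto
 have oldc: "l = ?a" if "l \<in> links N" "e \<in> concls l \<or> e' \<in> concls l" for l
  using producer_unique[OF N that(1) ax] that(2) by auto
 have oldE: "set_link l \<inter> F = {}" if "l \<in> links N" for l using set_link_subset[OF that] F by blast
 have KE: "set_link l \<subseteq> F \<union> {e, e'}" if "l \<in> K" for l using KF[OF that] by (auto simp: set_link_eq)
 have locK: "\<And>y. y \<in> edges N \<Longrightarrow> lab M y = lab N y \<and> loc M y = loc N y" using old F by blast
 have noloc: "loc N y \<noteq> Some e" if "y \<in> edges N" for y
 proof
  assume "loc N y = Some e"
  then obtain a where "BangL a e \<in> links N" using loc_box[OF N \<open>y \<in> edges N\<close>] by blast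
  then show False using oldc by fastforce
 qed
 have E: "edges M = edges N \<union> F"
 proof
  show "edges M \<subseteq> edges N \<union> F" unfolding edges_eq M using KE eE by (auto simp: edges_eq)
  show "edges N \<union> F \<subseteq> edges M"
  proof
   fix y assume "y \<in> edges N \<union> F"
   then consider "y \<in> F \<union> {e, e'}" | "y \<in> edges N" "y \<noteq> e" "y \<noteq> e'" by auto
   then show "y \<in> edges M"
   proof cases
    case 1
    then obtain l where "l \<in> K" "y \<in> concls l" using c by blast
    then show ?thesis using M by (auto simp: edges_def)
   next
    case 2
    then obtain l where "l \<in> links N" "y \<in> concls l" using producer_ex[OF N] by blast
    moreover have "l \<noteq> ?a" using 2 calculation by auto
    ultimately show ?thesis using M by (auto simp: edges_def)
   qed
  qed
 qed
 have C: "conclusions M = conclusions N"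
 proof (intro set_eqI iffI)
  fix y assume y: "y \<in> conclusions M"
  then have "y \<notin> F" using p M by (auto simp: conclusions_def)
  moreover have "y \<notin> prems l" if "l \<in> links N" for l
   using y that M by (cases "l = ?a") (auto simp: conclusions_def)
  ultimately show "y \<in> conclusions N" using y E by (auto simp: conclusions_def)
 next
  fix y assume y: "y \<in> conclusions N"
  then have "y \<notin> F" using F by (auto simp: conclusions_def)
  then have "y \<notin> prems l" if "l \<in> K" for l using KF[OF that] by auto
  then show "y \<in> conclusions M" using y E M by (auto simp: conclusions_def)
 qed
 have uniq: "\<exists>!l. l \<in> links M \<and> y \<in> concls l" if y: "y \<in> edges M" for y
 proof (cases "y \<in> F \<union> {e, e'}")
  case True
  have "y \<notin> concls l" if "l \<in> links N - {?a}" for l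
   using True oldc[of l] that F concls_subset[of l N] by auto
  then show ?thesis using c[OF True] M by auto
 next
  case False
  then have "y \<notin> concls l" if "l \<in> K" for l using KF[OF that] by auto
  moreover have "y \<in> edges N" "y \<notin> concls ?a" using False y E by auto
  moreover have "\<exists>!l. l \<in> links N \<and> y \<in> concls l" using N \<open>y \<in> edges N\<close> by (auto simp: is_net_def)
  ultimately show ?thesis using M by auto
 qed
 have pr: "l = l'" if l: "l \<in> links M" "l' \<in> links M" "prems l \<inter> prems l' \<noteq> {}" for l l'
 proof -
  have mixed: "prems m \<inter> prems m' = {}" if "m \<in> K" "m' \<in> links N" for m m'
   using KF[OF that(1)] prems_subset[OF that(2)] F by blast
  consider "l \<in> K" "l' \<in> K" | "l \<in> K" "l' \<in> links N" | "l \<in> links N" "l' \<in> K" | "l \<in> links N" "l' \<in> links N"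
   using l M by auto
  then show ?thesis
  proof cases
   case 1 then show ?thesis using d l by blast
  next
   case 2 then show ?thesis using mixed l by blast
  next
   case 3 then show ?thesis using mixed[of l' l] l by blast
  next
   case 4 then show ?thesis using consumer_unique[OF N] l by blast
  qed
 qed
 have ty: "typed M l" if "l \<in> links M" for l
 proof (cases "l \<in> K")
  case False
  then have l: "l \<in> links N" using that M by auto
  show ?thesis by (rule typed_cong[OF _ net_typed[OF N l]]) (use set_link_subset[OF l] locK in blast)
 qed (rule t)
 have bmem: "\<exists>a. BangL a b \<in> links M" if y: "y \<in> edges M" "loc M y = Some b" for y b
 proof -
  have oldb: "\<exists>a. BangL a b \<in> links M" if z: "z \<in> edges N" "loc N z = Some b" for z
   using loc_box[OF N z] M by auto
  show ?thesis
  proof (cases "y \<in> F")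
   case True
   then show ?thesis using b4[OF True] y(2) oldb[OF eE(1)] M by auto
  next
   case False
   then show ?thesis using oldb y old E by auto
  qed
 qed
 have acyc: "acyclic {(y, b). y \<in> edges M \<and> loc M y = Some b}"
 proof -
  let ?s = "{(y, b). y \<in> F \<and> loc M y = Some b}"
  have eq: "{(y, b). y \<in> edges M \<and> loc M y = Some b} = box_rel N \<union> ?s"
   using E locK F by (auto simp: box_rel_def)
  have "Range (box_rel N) \<subseteq> edges N" using net_boxed[OF N] by (auto simp: box_rel_def boxed_def)
  moreover have "Range ?s \<subseteq> edges N" using b4 eE net_boxed[OF N] by (fastforce simp: boxed_def)
  ultimately have "Range (box_rel N \<union> ?s) \<inter> Domain ?s = {}" using F by blast
  then show ?thesis unfolding eq by (rule acyclic_fresh[OF box_rel_acyclic[OF N]])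
 qed
 have wb: "well_boxed M" unfolding well_boxed_def
 proof (intro conjI ballI allI impI)
  fix l y y' assume l: "l \<in> links M" "\<not> is_door l" "y \<in> prems l \<union> concls l" "y' \<in> prems l \<union> concls l"
  show "loc M y = loc M y'"
  proof (cases "l \<in> K")
   case True show ?thesis by (rule b1[OF True l(2)]) (use l(3,4) in \<open>simp_all add: set_link_eq\<close>)
  next
   case False
   then have lN: "l \<in> links N" using l M by auto
   have "loc N y = loc N y'" by (rule loc_link[OF N lN l(2)]) (use l(3,4) in \<open>simp_all add: set_link_eq\<close>)
   moreover have "y \<in> edges N" "y' \<in> edges N" using set_link_subset[OF lN] l by (auto simp: set_link_eq)
   ultimately show ?thesis using locK by simp
  qed
 next
  fix q c assume l: "BangL q c \<in> links M"
  show "loc M q = Some c"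
  proof (cases "BangL q c \<in> K")
   case False
   then have lN: "BangL q c \<in> links N" using l M by auto
   then show ?thesis using loc_bang[OF N lN] locK[of q] set_link_subset[OF lN] by simp
  qed (rule b2)
 next
  fix q c assume l: "PaxL q c \<in> links M"
  show "\<exists>b. loc M q = Some b \<and> loc M c = loc M b"
  proof (cases "PaxL q c \<in> K")
   case False
   then have lN: "PaxL q c \<in> links N" using l M by auto
   then obtain b where b: "loc N q = Some b" "loc N c = loc N b" using loc_pax[OF N] by blast
   have "q \<in> edges N" "c \<in> edges N" using set_link_subset[OF lN] by auto
   moreover have "b \<in> edges N" using b \<open>q \<in> edges N\<close> net_boxed[OF N] by (auto simp: boxed_def)
   ultimately show ?thesis using locK b by auto
  qed (rule b3)
 next
  fix y b assume "y \<in> edges M" "loc M y = Some b"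
  then show "\<exists>a. BangL a b \<in> links M" by (rule bmem)
 next
  fix y assume y: "y \<in> conclusions M"
  then have "y \<in> conclusions N" using C by simp
  then show "loc M y = None" using N locK[of y] by (auto simp: is_net_def well_boxed_def conclusions_def)
 qed (rule acyc)
 have "finite (links M)" using M K N by (auto simp: is_net_def)
 then have "is_net M" unfolding is_net_def using uniq pr ty wb by blast
 then show ?thesis using E C by blast
qed

lemma axiom_dual:
 assumes "is_net N" "AxL (Upair e e') \<in> links N" "lab N e = Fm A" shows "lab N e' = Fm (dual A)" "e \<noteq> e'" "loc N e' = loc N e"
proof -
 show l: "lab N e' = Fm (dual A)"
  using net_typed[OF assms(1,2)] assms(3) by (auto simp: Upair_inject)
 have "A \<noteq> dual A" by (induction A) auto
 then show "e \<noteq> e'" using l assms(3) by auto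
 show "loc N e' = loc N e" by (rule loc_link[OF assms(1,2)]) (auto simp: is_door_def)
qed

text \<open>Expansion of an axiom without atoms can disconnect its two conclusions and lose their
  constraint. Restricting the constraint to axioms whose formula has an atom gives a condition that
  every expansion step respects in both directions.\<close>

definition weak_indexing :: "'e net \<Rightarrow> ('e \<Rightarrow> int) \<Rightarrow> bool" where
 "weak_indexing N I \<longleftrightarrow> (\<forall>l\<in>links N. (\<forall>u. l \<noteq> AxL u) \<longrightarrow> indexed I l) \<and>
   (\<forall>e e' A. AxL (Upair e e') \<in> links N \<longrightarrow> lab N e = Fm A \<longrightarrow> atoms_of A \<noteq> {} \<longrightarrow> I e = I e')"

lemma atoms_dual [simp]: "atoms_of (dual A) = atoms_of A"
 by (induction A) auto

lemma indexed_cong: "(\<And>y. y \<in> set_link l \<Longrightarrow> I y = J y) \<Longrightarrow> indexed I l = indexed J l"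
 by (cases l) auto

lemma eta_step_net:
 assumes "eta_step N N'" and N: "is_net N"
 shows "is_net N' \<and> conclusions N' = conclusions N \<and> (\<forall>c\<in>edges N. lab N' c = lab N c) \<and> (cut_free N \<longrightarrow> cut_free N')"
 using assms(1)
proof cases
 case (unit e e')
 note d = axiom_dual[OF N unit(2,3)]
 have di: True and ne: True by simp_all
 have "is_net N' \<and> conclusions N' = conclusions N \<and> edges N' = edges N \<union> {}"
 proof (rule replace_axiom[OF N unit(2), where K = "{OneL e, BotL e'}" and F = "{}"])
  show "links N' = links N - {AxL (Upair e e')} \<union> {OneL e, BotL e'}" unfolding unit(1) by simp
  show "{} \<inter> edges N = {}" using unit by simp
  show "prems l \<subseteq> {} \<and> concls l \<subseteq> {} \<union> {e, e'}" if "l \<in> {OneL e, BotL e'}" for l using that by auto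
  show "\<exists>l\<in>{OneL e, BotL e'}. v \<in> concls l" if "v \<in> {} \<union> {e, e'}" for v using that by auto
  show "\<exists>l\<in>{OneL e, BotL e'}. v \<in> prems l" if "v \<in> {}" for v using that by auto
  show "l = l'" if "l \<in> {OneL e, BotL e'}" "l' \<in> {OneL e, BotL e'}" "concls l \<inter> concls l' \<noteq> {}" for l l'
   using that di ne d(2) by (elim insertE emptyE) auto
  show "l = l'" if "l \<in> {OneL e, BotL e'}" "l' \<in> {OneL e, BotL e'}" "prems l \<inter> prems l' \<noteq> {}" for l l'
   using that di ne d(2) by (elim insertE emptyE) auto
  show "lab N' v = lab N v \<and> loc N' v = loc N v" if "v \<notin> {}" for v using that unfolding unit(1) by simp
  show "typed N' l" if "l \<in> {OneL e, BotL e'}" for l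
   using that di ne d(1) unit(3) unfolding unit(1) by (elim insertE emptyE) auto
  show "loc N' z = loc N' z'" if "l \<in> {OneL e, BotL e'}" "\<not> is_door l" "z \<in> set_link l" "z' \<in> set_link l" for l z z'
   using that di ne d(3) unfolding unit(1) by (elim insertE emptyE) (auto simp: is_door_def)
  show "loc N' r = Some c" if "BangL r c \<in> {OneL e, BotL e'}" for r c using that di ne unfolding unit(1) by auto
  show "\<exists>b. loc N' r = Some b \<and> loc N' c = loc N' b" if "PaxL r c \<in> {OneL e, BotL e'}" for r c using that di ne unfolding unit(1) by auto
  show "loc N' z = loc N e \<or> loc N' z = Some e \<and> (\<exists>a. BangL a e \<in> {OneL e, BotL e'})" if "z \<in> {}" for z
   using that di unfolding unit(1) by auto
 qed simp
 then show ?thesis using unit by (auto simp: cut_free_def)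
next
 case (mult e e' A B p q p' q')
 note d = axiom_dual[OF N mult(2,3)]
 have di: "p \<noteq> q" "p \<noteq> p'" "p \<noteq> q'" "q \<noteq> p'" "q \<noteq> q'" "p' \<noteq> q'" using mult(4) by auto
 have ne: "e \<notin> {p, q, p', q'}" "e' \<notin> {p, q, p', q'}" using concls_subset[OF mult(2)] mult(5) by auto
 have "is_net N' \<and> conclusions N' = conclusions N \<and> edges N' = edges N \<union> {p, q, p', q'}"
 proof (rule replace_axiom[OF N mult(2), where K = "{TensorL p q e, ParL p' q' e', AxL (Upair p p'), AxL (Upair q q')}" and F = "{p, q, p', q'}"])
  show "links N' = links N - {AxL (Upair e e')} \<union> {TensorL p q e, ParL p' q' e', AxL (Upair p p'), AxL (Upair q q')}" unfolding mult(1) by simp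
  show "{p, q, p', q'} \<inter> edges N = {}" using mult by simp
  show "prems l \<subseteq> {p, q, p', q'} \<and> concls l \<subseteq> {p, q, p', q'} \<union> {e, e'}" if "l \<in> {TensorL p q e, ParL p' q' e', AxL (Upair p p'), AxL (Upair q q')}" for l using that by auto
  show "\<exists>l\<in>{TensorL p q e, ParL p' q' e', AxL (Upair p p'), AxL (Upair q q')}. v \<in> concls l" if "v \<in> {p, q, p', q'} \<union> {e, e'}" for v using that by auto
  show "\<exists>l\<in>{TensorL p q e, ParL p' q' e', AxL (Upair p p'), AxL (Upair q q')}. v \<in> prems l" if "v \<in> {p, q, p', q'}" for v using that by auto
  show "l = l'" if "l \<in> {TensorL p q e, ParL p' q' e', AxL (Upair p p'), AxL (Upair q q')}" "l' \<in> {TensorL p q e, ParL p' q' e', AxL (Upair p p'), AxL (Upair q q')}" "concls l \<inter> concls l' \<noteq> {}" for l l'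
   using that di ne d(2) by (elim insertE emptyE) auto
  show "l = l'" if "l \<in> {TensorL p q e, ParL p' q' e', AxL (Upair p p'), AxL (Upair q q')}" "l' \<in> {TensorL p q e, ParL p' q' e', AxL (Upair p p'), AxL (Upair q q')}" "prems l \<inter> prems l' \<noteq> {}" for l l'
   using that di ne d(2) by (elim insertE emptyE) auto
  show "lab N' v = lab N v \<and> loc N' v = loc N v" if "v \<notin> {p, q, p', q'}" for v using that unfolding mult(1) by simp
  show "typed N' l" if "l \<in> {TensorL p q e, ParL p' q' e', AxL (Upair p p'), AxL (Upair q q')}" for l
   using that di ne d(1) mult(3) unfolding mult(1) by (elim insertE emptyE) auto
  show "loc N' z = loc N' z'" if "l \<in> {TensorL p q e, ParL p' q' e', AxL (Upair p p'), AxL (Upair q q')}" "\<not> is_door l" "z \<in> set_link l" "z' \<in> set_link l" for l z z'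
   using that di ne d(3) unfolding mult(1) by (elim insertE emptyE) (auto simp: is_door_def)
  show "loc N' r = Some c" if "BangL r c \<in> {TensorL p q e, ParL p' q' e', AxL (Upair p p'), AxL (Upair q q')}" for r c using that di ne unfolding mult(1) by auto
  show "\<exists>b. loc N' r = Some b \<and> loc N' c = loc N' b" if "PaxL r c \<in> {TensorL p q e, ParL p' q' e', AxL (Upair p p'), AxL (Upair q q')}" for r c using that di ne unfolding mult(1) by auto
  show "loc N' z = loc N e \<or> loc N' z = Some e \<and> (\<exists>a. BangL a e \<in> {TensorL p q e, ParL p' q' e', AxL (Upair p p'), AxL (Upair q q')})" if "z \<in> {p, q, p', q'}" for z
   using that di unfolding mult(1) by auto
 qed simp
 then show ?thesis using mult by (auto simp: cut_free_def)
next
 case (para e e' A p p')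
 note d = axiom_dual[OF N para(2,3)]
 have di: "p \<noteq> p'" using para(4) by auto
 have ne: "e \<notin> {p, p'}" "e' \<notin> {p, p'}" using concls_subset[OF para(2)] para(5) by auto
 have "is_net N' \<and> conclusions N' = conclusions N \<and> edges N' = edges N \<union> {p, p'}"
 proof (rule replace_axiom[OF N para(2), where K = "{ParagraphL p e, ParagraphL p' e', AxL (Upair p p')}" and F = "{p, p'}"])
  show "links N' = links N - {AxL (Upair e e')} \<union> {ParagraphL p e, ParagraphL p' e', AxL (Upair p p')}" unfolding para(1) by simp
  show "{p, p'} \<inter> edges N = {}" using para by simp
  show "prems l \<subseteq> {p, p'} \<and> concls l \<subseteq> {p, p'} \<union> {e, e'}" if "l \<in> {ParagraphL p e, ParagraphL p' e', AxL (Upair p p')}" for l using that by auto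
  show "\<exists>l\<in>{ParagraphL p e, ParagraphL p' e', AxL (Upair p p')}. v \<in> concls l" if "v \<in> {p, p'} \<union> {e, e'}" for v using that by auto
  show "\<exists>l\<in>{ParagraphL p e, ParagraphL p' e', AxL (Upair p p')}. v \<in> prems l" if "v \<in> {p, p'}" for v using that by auto
  show "l = l'" if "l \<in> {ParagraphL p e, ParagraphL p' e', AxL (Upair p p')}" "l' \<in> {ParagraphL p e, ParagraphL p' e', AxL (Upair p p')}" "concls l \<inter> concls l' \<noteq> {}" for l l'
   using that di ne d(2) by (elim insertE emptyE) auto
  show "l = l'" if "l \<in> {ParagraphL p e, ParagraphL p' e', AxL (Upair p p')}" "l' \<in> {ParagraphL p e, ParagraphL p' e', AxL (Upair p p')}" "prems l \<inter> prems l' \<noteq> {}" for l l'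
   using that di ne d(2) by (elim insertE emptyE) auto
  show "lab N' v = lab N v \<and> loc N' v = loc N v" if "v \<notin> {p, p'}" for v using that unfolding para(1) by simp
  show "typed N' l" if "l \<in> {ParagraphL p e, ParagraphL p' e', AxL (Upair p p')}" for l
   using that di ne d(1) para(3) unfolding para(1) by (elim insertE emptyE) auto
  show "loc N' z = loc N' z'" if "l \<in> {ParagraphL p e, ParagraphL p' e', AxL (Upair p p')}" "\<not> is_door l" "z \<in> set_link l" "z' \<in> set_link l" for l z z'
   using that di ne d(3) unfolding para(1) by (elim insertE emptyE) (auto simp: is_door_def)
  show "loc N' r = Some c" if "BangL r c \<in> {ParagraphL p e, ParagraphL p' e', AxL (Upair p p')}" for r c using that di ne unfolding para(1) by auto
  show "\<exists>b. loc N' r = Some b \<and> loc N' c = loc N' b" if "PaxL r c \<in> {ParagraphL p e, ParagraphL p' e', AxL (Upair p p')}" for r c using that di ne unfolding para(1) by auto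
  show "loc N' z = loc N e \<or> loc N' z = Some e \<and> (\<exists>a. BangL a e \<in> {ParagraphL p e, ParagraphL p' e', AxL (Upair p p')})" if "z \<in> {p, p'}" for z
   using that di unfolding para(1) by auto
 qed simp
 then show ?thesis using para by (auto simp: cut_free_def)
next
 case (expo e e' A p p' x y)
 note d = axiom_dual[OF N expo(2,3)]
 have di: "p \<noteq> p'" "p \<noteq> x" "p \<noteq> y" "p' \<noteq> x" "p' \<noteq> y" "x \<noteq> y" using expo(4) by auto
 have ne: "e \<notin> {p, p', x, y}" "e' \<notin> {p, p', x, y}" using concls_subset[OF expo(2)] expo(5) by auto
 have "is_net N' \<and> conclusions N' = conclusions N \<and> edges N' = edges N \<union> {p, p', x, y}"
 proof (rule replace_axiom[OF N expo(2), where K = "{BangL p e, AxL (Upair p p'), FlatL p' x, PaxL x y, WhynotL {|y|} e'}" and F = "{p, p', x, y}"])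
  show "links N' = links N - {AxL (Upair e e')} \<union> {BangL p e, AxL (Upair p p'), FlatL p' x, PaxL x y, WhynotL {|y|} e'}" unfolding expo(1) by simp
  show "{p, p', x, y} \<inter> edges N = {}" using expo by simp
  show "prems l \<subseteq> {p, p', x, y} \<and> concls l \<subseteq> {p, p', x, y} \<union> {e, e'}" if "l \<in> {BangL p e, AxL (Upair p p'), FlatL p' x, PaxL x y, WhynotL {|y|} e'}" for l using that by auto
  show "\<exists>l\<in>{BangL p e, AxL (Upair p p'), FlatL p' x, PaxL x y, WhynotL {|y|} e'}. v \<in> concls l" if "v \<in> {p, p', x, y} \<union> {e, e'}" for v using that by auto
  show "\<exists>l\<in>{BangL p e, AxL (Upair p p'), FlatL p' x, PaxL x y, WhynotL {|y|} e'}. v \<in> prems l" if "v \<in> {p, p', x, y}" for v using that by auto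
  show "l = l'" if "l \<in> {BangL p e, AxL (Upair p p'), FlatL p' x, PaxL x y, WhynotL {|y|} e'}" "l' \<in> {BangL p e, AxL (Upair p p'), FlatL p' x, PaxL x y, WhynotL {|y|} e'}" "concls l \<inter> concls l' \<noteq> {}" for l l'
   using that di ne d(2) by (elim insertE emptyE) auto
  show "l = l'" if "l \<in> {BangL p e, AxL (Upair p p'), FlatL p' x, PaxL x y, WhynotL {|y|} e'}" "l' \<in> {BangL p e, AxL (Upair p p'), FlatL p' x, PaxL x y, WhynotL {|y|} e'}" "prems l \<inter> prems l' \<noteq> {}" for l l'
   using that di ne d(2) by (elim insertE emptyE) auto
  show "lab N' v = lab N v \<and> loc N' v = loc N v" if "v \<notin> {p, p', x, y}" for v using that unfolding expo(1) by simp
  show "typed N' l" if "l \<in> {BangL p e, AxL (Upair p p'), FlatL p' x, PaxL x y, WhynotL {|y|} e'}" for l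
   using that di ne d(1) expo(3) unfolding expo(1) by (elim insertE emptyE) auto
  show "loc N' z = loc N' z'" if "l \<in> {BangL p e, AxL (Upair p p'), FlatL p' x, PaxL x y, WhynotL {|y|} e'}" "\<not> is_door l" "z \<in> set_link l" "z' \<in> set_link l" for l z z'
   using that di ne d(3) unfolding expo(1) by (elim insertE emptyE) (auto simp: is_door_def)
  show "loc N' r = Some c" if "BangL r c \<in> {BangL p e, AxL (Upair p p'), FlatL p' x, PaxL x y, WhynotL {|y|} e'}" for r c using that di ne unfolding expo(1) by auto
  show "\<exists>b. loc N' r = Some b \<and> loc N' c = loc N' b" if "PaxL r c \<in> {BangL p e, AxL (Upair p p'), FlatL p' x, PaxL x y, WhynotL {|y|} e'}" for r c using that di ne unfolding expo(1) by auto
  show "loc N' z = loc N e \<or> loc N' z = Some e \<and> (\<exists>a. BangL a e \<in> {BangL p e, AxL (Upair p p'), FlatL p' x, PaxL x y, WhynotL {|y|} e'})" if "z \<in> {p, p', x, y}" for z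
   using that di unfolding expo(1) by auto
 qed simp
 then show ?thesis using expo by (auto simp: cut_free_def)
qed

text \<open>In one direction an indexing has to be extended to the fresh edges of \<open>K\<close>,
  which is \<open>up\<close>. In the other, \<open>down\<close> recovers the constraint of the
  removed axiom from the new links.\<close>

lemma weak_replace:
 assumes N: "is_net N" and ax: "AxL (Upair e e') \<in> links N" "lab N e = Fm A"
  and M: "links M = links N - {AxL (Upair e e')} \<union> K"
  and lb: "\<And>y. y \<in> edges N \<Longrightarrow> lab M y = lab N y"
  and up: "\<And>I :: 'e \<Rightarrow> int. (atoms_of A \<noteq> {} \<Longrightarrow> I e = I e') \<Longrightarrow> \<exists>J. (\<forall>y\<in>edges N. J y = I y) \<and>
   (\<forall>l\<in>K. (\<forall>u. l \<noteq> AxL u) \<longrightarrow> indexed J l) \<and>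
   (\<forall>a b B. AxL (Upair a b) \<in> K \<longrightarrow> lab M a = Fm B \<longrightarrow> atoms_of B \<noteq> {} \<longrightarrow> J a = J b)"
  and down: "\<And>J :: 'e \<Rightarrow> int. (\<And>l. l \<in> K \<Longrightarrow> \<forall>u. l \<noteq> AxL u \<Longrightarrow> indexed J l) \<Longrightarrow>
   (\<And>a b B. AxL (Upair a b) \<in> K \<Longrightarrow> lab M a = Fm B \<Longrightarrow> atoms_of B \<noteq> {} \<Longrightarrow> J a = J b) \<Longrightarrow> atoms_of A \<noteq> {} \<Longrightarrow> J e = J e'"
 shows "(\<exists>I. weak_indexing N I) \<longleftrightarrow> (\<exists>J. weak_indexing M J)"
proof
 assume "\<exists>I. weak_indexing N I"
 then obtain I where I: "weak_indexing N I" by blast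
 then have "atoms_of A \<noteq> {} \<Longrightarrow> I e = I e'" using ax by (auto simp: weak_indexing_def)
 from up[OF this] obtain J where J: "\<forall>y\<in>edges N. J y = I y" "\<forall>l\<in>K. (\<forall>u. l \<noteq> AxL u) \<longrightarrow> indexed J l"
  "\<forall>a b B. AxL (Upair a b) \<in> K \<longrightarrow> lab M a = Fm B \<longrightarrow> atoms_of B \<noteq> {} \<longrightarrow> J a = J b" by blast
 have "weak_indexing M J" unfolding weak_indexing_def
 proof (intro conjI ballI allI impI)
  fix l assume l: "l \<in> links M" "\<forall>u. l \<noteq> AxL u"
  show "indexed J l"
  proof (cases "l \<in> K")
   case True then show ?thesis using J(2) l(2) by blast
  next
   case False
   then have lN: "l \<in> links N" using l M by auto
   have "indexed J l = indexed I l" by (rule indexed_cong) (use J(1) set_link_subset[OF lN] in blast)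
   then show ?thesis using I lN l(2) by (simp add: weak_indexing_def)
  qed
 next
  fix a b B assume l: "AxL (Upair a b) \<in> links M" "lab M a = Fm B" "atoms_of B \<noteq> {}"
  show "J a = J b"
  proof (cases "AxL (Upair a b) \<in> K")
   case True then show ?thesis using J(3) l by blast
  next
   case False
   then have lN: "AxL (Upair a b) \<in> links N" using l M by auto
   then have "a \<in> edges N" "b \<in> edges N" using concls_subset[OF lN] by auto
   then show ?thesis using I lN l lb J(1) by (auto simp: weak_indexing_def)
  qed
 qed
 then show "\<exists>J. weak_indexing M J" by blast
next
 assume "\<exists>J. weak_indexing M J"
 then obtain J where J: "weak_indexing M J" by blast
 have ee: "J e = J e'" if "atoms_of A \<noteq> {}"
  by (rule down[OF _ _ that]) (use J M in \<open>auto simp: weak_indexing_def\<close>)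
 have "weak_indexing N J" unfolding weak_indexing_def
 proof (intro conjI ballI allI impI)
  fix l assume l: "l \<in> links N" "\<forall>u. l \<noteq> AxL u"
  then have "l \<in> links M" using M by auto
  then show "indexed J l" using J l(2) by (simp add: weak_indexing_def)
 next
  fix a b B assume l: "AxL (Upair a b) \<in> links N" "lab N a = Fm B" "atoms_of B \<noteq> {}"
  show "J a = J b"
  proof (cases "Upair a b = Upair e e'")
   case True
   then consider "a = e" "b = e'" | "a = e'" "b = e" by (auto simp: Upair_inject)
   then show ?thesis
   proof cases
    case 1 then show ?thesis using ee l ax(2) by simp
   next
    case 2
    then have "B = dual A" using axiom_dual(1)[OF N ax] l by simp
    then show ?thesis using ee l 2 by simp
   qed
  next
   case False
   then have "AxL (Upair a b) \<in> links M" using l M by auto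
   moreover have "a \<in> edges N" using concls_subset[OF l(1)] by auto
   ultimately show ?thesis using J l lb by (auto simp: weak_indexing_def)
  qed
 qed
 then show "\<exists>I. weak_indexing N I" by blast
qed

lemma eta_step_weak:
 assumes "eta_step N N'" and N: "is_net N"
 shows "(\<exists>I. weak_indexing N I) \<longleftrightarrow> (\<exists>I. weak_indexing N' I)"
 using assms(1)
proof cases
 case (unit e e')
 show ?thesis
 proof (rule weak_replace[OF N unit(2,3), where K = "{OneL e, BotL e'}"])
  show "links N' = links N - {AxL (Upair e e')} \<union> {OneL e, BotL e'}" unfolding unit(1) by simp
  show "\<exists>J. (\<forall>y\<in>edges N. J y = I y) \<and> (\<forall>l\<in>{OneL e, BotL e'}. (\<forall>u. l \<noteq> AxL u) \<longrightarrow> indexed J l) \<and>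
   (\<forall>a b B. AxL (Upair a b) \<in> {OneL e, BotL e'} \<longrightarrow> lab N' a = Fm B \<longrightarrow> atoms_of B \<noteq> {} \<longrightarrow> J a = J b)" for I :: "'a \<Rightarrow> int"
   by (intro exI[of _ I]) auto
 qed (simp_all add: unit(1))
next
 case (mult e e' A B p q p' q')
 note d = axiom_dual[OF N mult(2,3)]
 have fresh: "y \<notin> {p, q, p', q'}" if "y \<in> edges N" for y using that mult(5) by auto
 have ne: "e \<notin> {p, q, p', q'}" "e' \<notin> {p, q, p', q'}" using concls_subset[OF mult(2)] fresh by auto
 let ?K = "{TensorL p q e, ParL p' q' e', AxL (Upair p p'), AxL (Upair q q')}"
 have lb: "lab N' p = Fm A" "lab N' q = Fm B" "lab N' p' = Fm (dual A)" "lab N' q' = Fm (dual B)"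
  using mult(4) unfolding mult(1) by auto
 show ?thesis
 proof (rule weak_replace[OF N mult(2,3), where K = ?K])
  show "links N' = links N - {AxL (Upair e e')} \<union> ?K" unfolding mult(1) by simp
  show "lab N' y = lab N y" if "y \<in> edges N" for y using fresh[OF that] unfolding mult(1) by simp
  show "\<exists>J. (\<forall>y\<in>edges N. J y = I y) \<and> (\<forall>l\<in>?K. (\<forall>u. l \<noteq> AxL u) \<longrightarrow> indexed J l) \<and>
   (\<forall>a b C. AxL (Upair a b) \<in> ?K \<longrightarrow> lab N' a = Fm C \<longrightarrow> atoms_of C \<noteq> {} \<longrightarrow> J a = J b)"
   if I: "atoms_of (Tensor A B) \<noteq> {} \<Longrightarrow> I e = I e'" for I :: "'a \<Rightarrow> int"
  proof -
   \<comment> \<open>If no component has an atom, \<open>e\<close> and \<open>e'\<close> may have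
     different indices. So \<open>p\<close> and \<open>q\<close> are given the index of
     \<open>e\<close>, and \<open>p'\<close> and \<open>q'\<close> that of \<open>e'\<close>; the
     new axioms are then unconstrained. If only one component has an atom, the two indices agree
     already.\<close>
   have I2: "I e = I e' \<or> atoms_of A = {} \<and> atoms_of B = {}" using I by auto
   show ?thesis
    by (intro exI[of _ "I(p := I e, q := I e, p' := I e', q' := I e')"] conjI)
     (use I2 fresh ne lb mult(4) in \<open>auto simp: Upair_inject\<close>)
  qed
  show "J e = J e'" if J1: "\<And>l. l \<in> ?K \<Longrightarrow> \<forall>u. l \<noteq> AxL u \<Longrightarrow> indexed J l"
   and J2: "\<And>a b C. AxL (Upair a b) \<in> ?K \<Longrightarrow> lab N' a = Fm C \<Longrightarrow> atoms_of C \<noteq> {} \<Longrightarrow> J a = J b"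
   and at: "atoms_of (Tensor A B) \<noteq> {}" for J :: "'a \<Rightarrow> int"
   using J1[of "TensorL p q e"] J1[of "ParL p' q' e'"] J2[of p p', OF _ lb(1)] J2[of q q', OF _ lb(2)] at by auto
 qed
next
 case (para e e' A p p')
 note d = axiom_dual[OF N para(2,3)]
 have fresh: "y \<notin> {p, p'}" if "y \<in> edges N" for y using that para(5) by auto
 have ne: "e \<notin> {p, p'}" "e' \<notin> {p, p'}" using concls_subset[OF para(2)] fresh by auto
 let ?K = "{ParagraphL p e, ParagraphL p' e', AxL (Upair p p')}"
 have lb: "lab N' p = Fm A" "lab N' p' = Fm (dual A)"
  using para(4) unfolding para(1) by auto
 show ?thesis
 proof (rule weak_replace[OF N para(2,3), where K = ?K])
  show "links N' = links N - {AxL (Upair e e')} \<union> ?K" unfolding para(1) by simp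
  show "lab N' y = lab N y" if "y \<in> edges N" for y using fresh[OF that] unfolding para(1) by simp
  show "\<exists>J. (\<forall>y\<in>edges N. J y = I y) \<and> (\<forall>l\<in>?K. (\<forall>u. l \<noteq> AxL u) \<longrightarrow> indexed J l) \<and>
   (\<forall>a b C. AxL (Upair a b) \<in> ?K \<longrightarrow> lab N' a = Fm C \<longrightarrow> atoms_of C \<noteq> {} \<longrightarrow> J a = J b)"
   if I: "atoms_of (Paragraph A) \<noteq> {} \<Longrightarrow> I e = I e'" for I :: "'a \<Rightarrow> int"
  proof -
   have I2: "I e = I e' \<or> atoms_of A = {}" using I by auto
   show ?thesis
    by (intro exI[of _ "I(p := I e + 1, p' := I e' + 1)"] conjI)
     (use I2 fresh ne lb para(4) in \<open>auto simp: Upair_inject\<close>)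
  qed
  show "J e = J e'" if J1: "\<And>l. l \<in> ?K \<Longrightarrow> \<forall>u. l \<noteq> AxL u \<Longrightarrow> indexed J l"
   and J2: "\<And>a b C. AxL (Upair a b) \<in> ?K \<Longrightarrow> lab N' a = Fm C \<Longrightarrow> atoms_of C \<noteq> {} \<Longrightarrow> J a = J b"
   and at: "atoms_of (Paragraph A) \<noteq> {}" for J :: "'a \<Rightarrow> int"
   using J1[of "ParagraphL p e"] J1[of "ParagraphL p' e'"] J2[of p p', OF _ lb(1)] at by auto
 qed
next
 case (expo e e' A p p' x z)
 note d = axiom_dual[OF N expo(2,3)]
 have fresh: "y \<notin> {p, p', x, z}" if "y \<in> edges N" for y using that expo(5) by auto
 have ne: "e \<notin> {p, p', x, z}" "e' \<notin> {p, p', x, z}" using concls_subset[OF expo(2)] fresh by auto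
 let ?K = "{BangL p e, AxL (Upair p p'), FlatL p' x, PaxL x z, WhynotL {|z|} e'}"
 have lb: "lab N' p = Fm A" "lab N' p' = Fm (dual A)"
  using expo(4) unfolding expo(1) by auto
 show ?thesis
 proof (rule weak_replace[OF N expo(2,3), where K = ?K])
  show "links N' = links N - {AxL (Upair e e')} \<union> ?K" unfolding expo(1) by simp
  show "lab N' y = lab N y" if "y \<in> edges N" for y using fresh[OF that] unfolding expo(1) by simp
  show "\<exists>J. (\<forall>y\<in>edges N. J y = I y) \<and> (\<forall>l\<in>?K. (\<forall>u. l \<noteq> AxL u) \<longrightarrow> indexed J l) \<and>
   (\<forall>a b C. AxL (Upair a b) \<in> ?K \<longrightarrow> lab N' a = Fm C \<longrightarrow> atoms_of C \<noteq> {} \<longrightarrow> J a = J b)"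
   if I: "atoms_of (Bang A) \<noteq> {} \<Longrightarrow> I e = I e'" for I :: "'a \<Rightarrow> int"
  proof -
   \<comment> \<open>The of course and why not links account for the increment by one; the flat and
     pax links carry it along unchanged.\<close>
   have I2: "I e = I e' \<or> atoms_of A = {}" using I by auto
   show ?thesis
    by (intro exI[of _ "I(p := I e + 1, p' := I e' + 1, x := I e' + 1, z := I e' + 1)"] conjI)
     (use I2 fresh ne lb expo(4) in \<open>auto simp: Upair_inject\<close>)
  qed
  show "J e = J e'" if J1: "\<And>l. l \<in> ?K \<Longrightarrow> \<forall>u. l \<noteq> AxL u \<Longrightarrow> indexed J l"
   and J2: "\<And>a b C. AxL (Upair a b) \<in> ?K \<Longrightarrow> lab N' a = Fm C \<Longrightarrow> atoms_of C \<noteq> {} \<Longrightarrow> J a = J b"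
   and at: "atoms_of (Bang A) \<noteq> {}" for J :: "'a \<Rightarrow> int"
   using J1[of "BangL p e"] J1[of "FlatL p' x"] J1[of "PaxL x z"] J1[of "WhynotL {|z|} e'"] J2[of p p', OF _ lb(1)] at by auto
 qed
qed

lemma eta_steps:
 assumes "eta_step\<^sup>*\<^sup>* N N'" and N: "is_net N"
 shows "is_net N' \<and> conclusions N' = conclusions N \<and> (\<forall>c\<in>conclusions N. lab N' c = lab N c) \<and> (cut_free N \<longrightarrow> cut_free N') \<and>
  ((\<exists>I. weak_indexing N I) \<longleftrightarrow> (\<exists>I. weak_indexing N' I))"
 using assms(1)
proof (induction rule: rtranclp_induct)
 case (step M M')
 note a = eta_step_net[OF step(2)] eta_step_weak[OF step(2)]
 have "c \<in> conclusions M \<Longrightarrow> lab M' c = lab M c" for c using a(1) step.IH by (auto simp: conclusions_def)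
 then show ?case using a step.IH by auto
qed (use N in auto)

text \<open>By \<open>no_constant_axiom\<close> the weakened constraint is imposed at every axiom,
  and with one conclusion the agreement of conclusions is trivial.\<close>

lemma L3_iff_weak:
 assumes "DR_net N" and "conclusions N = {c}" and "no_constant_axiom N"
 shows "L3 N \<longleftrightarrow> (\<exists>I. weak_indexing N I)"
proof -
 have N: "is_net N" using assms(1) by (simp add: DR_net_def)
 have "exp_indexing N I \<longleftrightarrow> weak_indexing N I" for I
 proof
  assume I: "exp_indexing N I"
  show "weak_indexing N I" unfolding weak_indexing_def
  proof (intro conjI ballI allI impI)
   fix e e' A assume "AxL (Upair e e') \<in> links N"
   then have "indexed I (AxL (Upair e e'))" using I unfolding exp_indexing_def by blast
   then have "\<forall>y\<in>{e, e'}. \<forall>y'\<in>{e, e'}. I y = I y'" by (simp only: indexed.simps set_uprod_simps)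
   then show "I e = I e'" by blast
  next
   fix l assume "l \<in> links N"
   then show "indexed I l" using I unfolding exp_indexing_def by blast
  qed
 next
  assume I: "weak_indexing N I"
  have "indexed I l" if l: "l \<in> links N" for l
  proof (cases "\<exists>u. l = AxL u")
   case True
   then obtain e e' where e: "l = AxL (Upair e e')" by (metis uprod_exhaust)
   then obtain A where A: "lab N e = Fm A" using net_typed[OF N l] by (auto simp: Upair_inject)
   have "atoms_of A \<noteq> {}" using assms(3) l e A unfolding no_constant_axiom_def by blast
   then have "I e = I e'" using I l e A unfolding weak_indexing_def by blast
   then show ?thesis using e by auto
  next
   case False
   then show ?thesis using I l unfolding weak_indexing_def by blast
  qed
  then show "exp_indexing N I" using assms(2) by (simp add: exp_indexing_def)
 qed
 then show ?thesis using assms(1) by (simp add: L3_def)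
qed

text \<open>A weak indexing is the level shifted by its value at the conclusion, so it satisfies the
  axioms exactly when the levels do; atomic axioms are all constrained.\<close>

lemma weak_iff_levels:
 assumes N: "is_net N" "cut_free N" and lv: "levelling N lv" and c: "conclusions N = {c}"
  and at: "\<And>e e'. AxL (Upair e e') \<in> links N \<Longrightarrow> \<exists>Z. lab N e = Fm (Atom Z) \<or> lab N e = Fm (NAtom Z)"
 shows "(\<exists>I. weak_indexing N I) \<longleftrightarrow> (\<forall>e e'. AxL (Upair e e') \<in> links N \<longrightarrow> lv e = lv e')"
proof
 assume "\<exists>I. weak_indexing N I"
 then obtain I where I: "weak_indexing N I" by blast
 have lvI: "I e = I c + int (lv e)" if "e \<in> edges N" for e
 proof (rule indexing_levelling[OF N lv _ _ that])
  show "I d = I c" if "d \<in> conclusions N" for d using that c by simp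
  show "indexed I l" if "l \<in> links N" "\<forall>u. l \<noteq> AxL u" for l
   using I that unfolding weak_indexing_def by blast
 qed
 show "\<forall>e e'. AxL (Upair e e') \<in> links N \<longrightarrow> lv e = lv e'"
 proof (intro allI impI)
  fix e e' assume l: "AxL (Upair e e') \<in> links N"
  obtain Z where "lab N e = Fm (Atom Z) \<or> lab N e = Fm (NAtom Z)" using at[OF l] by blast
  then have "I e = I e'" using I l unfolding weak_indexing_def by fastforce
  moreover have "e \<in> edges N" "e' \<in> edges N" using concls_subset[OF l] by auto
  ultimately show "lv e = lv e'" using lvI[of e] lvI[of e'] by simp
 qed
next
 assume "\<forall>e e'. AxL (Upair e e') \<in> links N \<longrightarrow> lv e = lv e'"
 then have "weak_indexing N (\<lambda>e. int (lv e))" using lv unfolding weak_indexing_def levelling_def by auto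
 then show "\<exists>I. weak_indexing N I" by blast
qed

subsection \<open>Identity nets\<close>

abbreviation idl0 :: "form \<Rightarrow> nm link set" where
 "idl0 F \<equiv> idl F (\<lambda>_. False) 0"

lemma idl_untwisted: "idl F (\<lambda>_. False) j = idl0 F"
proof -
 have "idl F (\<lambda>_. False) j = idl F (\<lambda>_. False) j'" for j j'
 proof (induction F arbitrary: j j')
  case (Tensor A B)
  from Tensor(1)[of j j'] Tensor(2)[of j j'] show ?case by simp
 next
  case (Par A B)
  from Par(1)[of j j'] Par(2)[of j j'] show ?case by simp
 next
  case (Bang A)
  from Bang(1)[of "Suc j" "Suc j'"] show ?case by simp
 next
  case (Whynot A)
  from Whynot(1)[of "Suc j" "Suc j'"] show ?case by simp
 next
  case (Paragraph A)
  from Paragraph(1)[of "Suc j" "Suc j'"] show ?case by simp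
 qed simp_all
 then show ?thesis .
qed

text \<open>Exchanging the two sides of an identity is duality (\<open>idl_dual\<close>). It is
  needed because an axiom is unordered and its expansion can be read from either conclusion.\<close>

primrec swp :: "nm \<Rightarrow> nm" where
 "swp Neg = Pos" | "swp Pos = Neg" | "swp Flt = Flt" | "swp Aux = Aux"
| "swp (Lt n) = Lt (swp n)" | "swp (Rt n) = Rt (swp n)" | "swp (Sub n) = Sub (swp n)"

lemma swp_swp [simp]: "swp (swp n) = n"
 by (induction n) auto

lemma swp_comp [simp]: "swp \<circ> swp = id"
 by (rule ext) simp

lemma inj_swp: "inj swp"
 by (rule inj_on_inverseI[where g = swp]) simp

lemma swp_iffs [simp]: "swp n = Pos \<longleftrightarrow> n = Neg" "swp n = Neg \<longleftrightarrow> n = Pos"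
 by (cases n; simp)+

lemma nms_dual: "nms (dual A) = swp ` nms A"
 by (induction A) (auto simp: image_Un image_image)

lemma idl_dual: "idl0 (dual A) = map_link swp ` idl0 A"
proof (induction A)
 case (Tensor A B)
 have c: "Lt \<circ> swp = swp \<circ> Lt" "Rt \<circ> swp = swp \<circ> Rt" by auto
 show ?case using Tensor by (simp add: image_Un image_image map_link_comp c insert_commute)
next
 case (Par A B)
 have c: "Lt \<circ> swp = swp \<circ> Lt" "Rt \<circ> swp = swp \<circ> Rt" by auto
 show ?case using Par by (simp add: image_Un image_image map_link_comp c insert_commute)
next
 case (Bang A)
 have c: "Sub \<circ> swp = swp \<circ> Sub" by auto
 show ?case using Bang by (simp add: image_image map_link_comp c idl_untwisted[of _ "Suc 0"]) blast
next
 case (Whynot A)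
 have c: "Sub \<circ> swp = swp \<circ> Sub" by auto
 show ?case using Whynot by (simp add: image_image map_link_comp c idl_untwisted[of _ "Suc 0"]) blast
next
 case (Paragraph A)
 have c: "Sub \<circ> swp = swp \<circ> Sub" by auto
 show ?case using Paragraph by (simp add: image_image map_link_comp c idl_untwisted[of _ "Suc 0"] insert_commute)
qed (auto simp: Upair_swap)

lemma idlab_dual: "n \<in> nms A \<Longrightarrow> idlab (dual A) (swp n) = idlab A n"
 by (induction A arbitrary: n) (auto split: nm.splits)

lemma idloc_dual: "n \<in> nms A \<Longrightarrow> idloc (dual A) (swp n) = map_option swp (idloc A n)"
 by (induction A arbitrary: n) (auto simp: option.map_comp comp_def split: nm.splits option.splits)

text \<open>The identity of \<open>A\<close> sits in that of \<open>F\<close> as a subtree. Names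
  outside all boxes of the subtree share whatever box contains its root.\<close>

definition emb :: "form \<Rightarrow> form \<Rightarrow> (nm \<Rightarrow> nm) \<Rightarrow> bool" where
 "emb F A h \<longleftrightarrow> inj h \<and> (\<forall>n\<in>nms A. h n \<in> nms F \<and> idlab F (h n) = idlab A n \<and>
   idloc F (h n) = (case idloc A n of None \<Rightarrow> idloc F (h Pos) | Some m \<Rightarrow> Some (h m)))"

lemma embD:
 assumes "emb F A h"
 shows "inj h" "\<And>n. n \<in> nms A \<Longrightarrow> h n \<in> nms F" "\<And>n. n \<in> nms A \<Longrightarrow> idlab F (h n) = idlab A n"
  "\<And>n. n \<in> nms A \<Longrightarrow> idloc A n = None \<Longrightarrow> idloc F (h n) = idloc F (h Pos)"
  "\<And>n m. n \<in> nms A \<Longrightarrow> idloc A n = Some m \<Longrightarrow> idloc F (h n) = Some (h m)"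
proof -
 show "inj h" "\<And>n. n \<in> nms A \<Longrightarrow> h n \<in> nms F" "\<And>n. n \<in> nms A \<Longrightarrow> idlab F (h n) = idlab A n"
  using assms unfolding emb_def by blast+
 have l: "idloc F (h n) = (case idloc A n of None \<Rightarrow> idloc F (h Pos) | Some m \<Rightarrow> Some (h m))" if "n \<in> nms A" for n
  using assms that unfolding emb_def by blast
 show "idloc F (h n) = idloc F (h Pos)" if "n \<in> nms A" "idloc A n = None" for n
  by (rule l[OF that(1), unfolded that(2) option.case])
 show "idloc F (h n) = Some (h m)" if "n \<in> nms A" "idloc A n = Some m" for n m
  by (rule l[OF that(1), unfolded that(2) option.case])
qed

lemma embI:
 assumes "inj h" "\<And>n. n \<in> nms A \<Longrightarrow> h n \<in> nms F" "\<And>n. n \<in> nms A \<Longrightarrow> idlab F (h n) = idlab A n"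
  "\<And>n. n \<in> nms A \<Longrightarrow> idloc A n = None \<Longrightarrow> idloc F (h n) = idloc F (h Pos)"
  "\<And>n m. n \<in> nms A \<Longrightarrow> idloc A n = Some m \<Longrightarrow> idloc F (h n) = Some (h m)"
 shows "emb F A h"
 unfolding emb_def
proof (intro conjI ballI)
 fix n assume n: "n \<in> nms A"
 show "idloc F (h n) = (case idloc A n of None \<Rightarrow> idloc F (h Pos) | Some m \<Rightarrow> Some (h m))"
  using assms(4,5)[OF n] by (cases "idloc A n") simp_all
qed (rule assms, assumption?)+

lemma emb_swp: assumes h: "emb F A h" shows "emb F (dual A) (h \<circ> swp)"
proof (rule embI)
 show "inj (h \<circ> swp)" by (rule inj_compose[OF embD(1)[OF h] inj_swp])
 fix n assume "n \<in> nms (dual A)"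
 then obtain k where k: "n = swp k" "k \<in> nms A" unfolding nms_dual by blast
 show "(h \<circ> swp) n \<in> nms F" "idlab F ((h \<circ> swp) n) = idlab (dual A) n"
  using embD(2,3)[OF h k(2)] idlab_dual[OF k(2)] by (simp_all add: k(1))
 have "idloc F (h Neg) = idloc F (h Pos)" by (rule embD(4)[OF h]) simp_all
 then show "idloc (dual A) n = None \<Longrightarrow> idloc F ((h \<circ> swp) n) = idloc F ((h \<circ> swp) Pos)"
  using embD(4)[OF h k(2)] idloc_dual[OF k(2)] by (simp add: k(1))
 fix m assume "idloc (dual A) n = Some m"
 then obtain m' where "idloc A k = Some m'" "m = swp m'" using idloc_dual[OF k(2)] by (auto simp: k(1))
 then show "idloc F ((h \<circ> swp) n) = Some ((h \<circ> swp) m)" using embD(5)[OF h k(2)] by (simp add: k(1))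
qed

lemma emb_comp: assumes h: "emb F A h" and w: "emb A B w" shows "emb F B (h \<circ> w)"
proof (rule embI)
 show "inj (h \<circ> w)" by (rule inj_compose[OF embD(1)[OF h] embD(1)[OF w]])
 fix n assume n: "n \<in> nms B"
 have wn: "w n \<in> nms A" "w Pos \<in> nms A" using embD(2)[OF w] n by simp_all
 show "(h \<circ> w) n \<in> nms F" "idlab F ((h \<circ> w) n) = idlab B n"
  using embD(2,3)[OF h wn(1)] embD(3)[OF w n] by simp_all
 show "idloc F ((h \<circ> w) n) = idloc F ((h \<circ> w) Pos)" if "idloc B n = None"
 proof -
  have e: "idloc A (w n) = idloc A (w Pos)" by (rule embD(4)[OF w n that])
  show ?thesis
   using embD(4)[OF h wn(1)] embD(4)[OF h wn(2)] embD(5)[OF h wn(1)] embD(5)[OF h wn(2)] e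
   by (cases "idloc A (w Pos)") simp_all
 qed
 show "idloc F ((h \<circ> w) n) = Some ((h \<circ> w) m)" if "idloc B n = Some m" for m
  using embD(5)[OF h wn(1) embD(5)[OF w n that]] by simp
qed

lemma emb_children:
 "emb (Tensor A B) A Lt" "emb (Tensor A B) B Rt" "emb (Paragraph A) A Sub" "emb (Bang A) A Sub" "emb A A id"
 by (rule embI; simp add: inj_def)+

definition axf :: "'e net \<Rightarrow> 'e \<Rightarrow> form" where
 "axf N e = (case lab N e of Fm A \<Rightarrow> A | Fl A \<Rightarrow> A)"

text \<open>The invariant of the expansion of an axiom on \<open>F\<close>: such a net is the tree
  of \<open>F\<close> with some subtrees cut back to axioms. The map \<open>f\<close> locates the
  edges, \<open>h e\<close> the subtree still to grow at the axiom above \<open>e\<close>, with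
  interior names not yet used; the final clause says that nothing is missing. Hence every order of
  expansion ends with the same tree.\<close>

definition tree_map :: "form \<Rightarrow> 'e net \<Rightarrow> ('e \<Rightarrow> nm) \<Rightarrow> ('e \<Rightarrow> nm \<Rightarrow> nm) \<Rightarrow> bool" where
 "tree_map F N f h \<longleftrightarrow> inj_on f (edges N) \<and>
  (\<forall>y\<in>edges N. f y \<in> nms F \<and> idlab F (f y) = lab N y \<and> idloc F (f y) = map_option f (loc N y)) \<and>
  (\<forall>e e'. AxL (Upair e e') \<in> links N \<longrightarrow> emb F (axf N e) (h e) \<and> h e Pos = f e \<and> h e Neg = f e' \<and> h e' = h e \<circ> swp \<and>
    (\<forall>n\<in>nms (axf N e). h e n \<in> f ` edges N \<longrightarrow> n = Pos \<or> n = Neg)) \<and>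
  (\<forall>a a' b b' n m. AxL (Upair a a') \<in> links N \<longrightarrow> AxL (Upair b b') \<in> links N \<longrightarrow> Upair a a' \<noteq> Upair b b' \<longrightarrow>
    n \<in> nms (axf N a) \<longrightarrow> m \<in> nms (axf N b) \<longrightarrow> h a n \<noteq> h b m) \<and>
  idl0 F = map_link f ` {l \<in> links N. \<forall>u. l \<noteq> AxL u} \<union>
   (\<Union>e\<in>{e. \<exists>e'. AxL (Upair e e') \<in> links N}. map_link (h e) ` idl0 (axf N e))"

text \<open>One step lets the axiom on \<open>e\<close> grow by one node: \<open>k\<close> places
  the fresh edges in the identity of \<open>A\<close>, and \<open>w\<close> embeds the identities of
  the new axioms as its immediate subtrees. Composition with \<open>h e\<close> places everything in
  the tree of \<open>F\<close>.\<close>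

lemma tree_map_refine:
 assumes tm: "tree_map F N f h" and N: "is_net N" and ax: "AxL (Upair e e') \<in> links N" and A: "lab N e = Fm A"
  and M: "links M = links N - {AxL (Upair e e')} \<union> K"
  and R: "R \<inter> edges N = {}" and KR: "\<And>l. l \<in> K \<Longrightarrow> set_link l \<subseteq> R \<union> {e, e'}"
  and Kax: "\<And>u. AxL u \<in> K \<Longrightarrow> set_uprod u \<subseteq> R"
  and old: "\<And>y. y \<notin> R \<Longrightarrow> lab M y = lab N y \<and> loc M y = loc N y"
  and k: "k e = Pos" "k e' = Neg" "inj_on k (R \<union> {e, e'})" "k ` R \<subseteq> nms A"
  and lk: "\<And>y. y \<in> R \<Longrightarrow> idlab A (k y) = lab M y"
  and lc: "\<And>y. y \<in> R \<Longrightarrow> idloc A (k y) = None \<and> loc M y = loc N e \<or> idloc A (k y) = Some Pos \<and> loc M y = Some e"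
  and w: "\<And>p p'. AxL (Upair p p') \<in> K \<Longrightarrow> emb A (axf M p) (w p) \<and> w p Pos = k p \<and> w p Neg = k p' \<and> w p' = w p \<circ> swp \<and>
    (\<forall>n\<in>nms (axf M p). w p n \<in> k ` (R \<union> {e, e'}) \<longrightarrow> n = Pos \<or> n = Neg)"
  and w2: "\<And>a a' b b' n m. AxL (Upair a a') \<in> K \<Longrightarrow> AxL (Upair b b') \<in> K \<Longrightarrow> Upair a a' \<noteq> Upair b b' \<Longrightarrow> w a n \<noteq> w b m"
  and I: "idl0 A = map_link k ` {l \<in> K. \<forall>u. l \<noteq> AxL u} \<union>
   (\<Union>p\<in>{p. \<exists>p'. AxL (Upair p p') \<in> K}. map_link (w p) ` idl0 (axf M p))"
 shows "\<exists>f' h'. tree_map F M f' h'"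
proof -
 define f' where "f' y = (if y \<in> R then h e (k y) else f y)" for y
 define h' where "h' y = (if y \<in> R then h e \<circ> w y else h y)" for y
 have eE: "e \<in> edges N" "e' \<in> edges N" using concls_subset[OF ax] by auto
 have eR: "e \<notin> R" "e' \<notin> R" using eE R by auto
 have axA: "axf N e = A" using A by (simp add: axf_def)
 have eM: "edges M \<subseteq> edges N \<union> R"
  unfolding edges_eq[of M] M using KR eE set_link_subset by fastforce
 note T = tm[unfolded tree_map_def]
 have inj: "inj_on f (edges N)" by (rule conjunct1[OF T])
 note T = conjunct2[OF T]
 have lbl: "f y \<in> nms F \<and> idlab F (f y) = lab N y \<and> idloc F (f y) = map_option f (loc N y)" if "y \<in> edges N" for y
  by (rule bspec[OF conjunct1[OF T] that])
 note T = conjunct2[OF T]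
 have emb: "emb F (axf N e) (h e) \<and> h e Pos = f e \<and> h e Neg = f e' \<and> h e' = h e \<circ> swp \<and>
    (\<forall>n\<in>nms (axf N e). h e n \<in> f ` edges N \<longrightarrow> n = Pos \<or> n = Neg)" if "AxL (Upair e e') \<in> links N" for e e'
  by (rule conjunct1[OF T, rule_format]) (rule that)
 note T = conjunct2[OF T]
 have dis: "h a n \<noteq> h b m" if "AxL (Upair a a') \<in> links N" "AxL (Upair b b') \<in> links N" "Upair a a' \<noteq> Upair b b'"
    "n \<in> nms (axf N a)" "m \<in> nms (axf N b)" for a a' b b' n m
  by (rule conjunct1[OF T, rule_format]) (rule that)+
 note idlF = conjunct2[OF T]
 have he: "emb F A (h e)" "h e Pos = f e" "h e Neg = f e'" "h e' = h e \<circ> swp"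
  "\<And>n. n \<in> nms A \<Longrightarrow> h e n \<in> f ` edges N \<Longrightarrow> n = Pos \<or> n = Neg"
  using emb[OF ax] axA by auto
 have hinj: "h e n = h e m \<longleftrightarrow> n = m" for n m using embD(1)[OF he(1)] by (auto simp: inj_def)
 have locE: "loc N y = Some b \<Longrightarrow> y \<in> edges N \<Longrightarrow> b \<in> edges N" for y b using net_boxed[OF N] by (auto simp: boxed_def)
 have f'old: "f' y = f y" if "y \<in> edges N" for y using that R by (auto simp: f'_def)
 have f'R: "f' y = h e (k y)" if "y \<in> R \<union> {e, e'}" for y using that eR he k by (auto simp: f'_def)
 have kR: "k y \<noteq> Pos \<and> k y \<noteq> Neg \<and> k y \<in> nms A" if "y \<in> R" for y
 proof -
  have "y \<noteq> e" "y \<noteq> e'" using that eR by auto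
  then have "k y \<noteq> k e" "k y \<noteq> k e'" using inj_on_eq_iff[OF k(3), of y e] inj_on_eq_iff[OF k(3), of y e'] that by simp_all
  then show ?thesis using k that by auto
 qed
 \<comment> \<open>The fresh edges occupy interior names of the subtree, which by the invariant no
   older edge uses.\<close>
 have cross: "h e (k y) \<notin> f ` edges N" if "y \<in> R" for y using he(5) kR[OF that] by blast
 have oldax: "a \<in> edges N \<and> a' \<in> edges N \<and> h' a = h a \<and> axf M a = axf N a" if "AxL (Upair a a') \<in> links N" for a a'
 proof -
  have "a \<in> edges N" "a' \<in> edges N" using concls_subset[OF that] by auto
  then show ?thesis using R old[of a] by (auto simp: h'_def axf_def)
 qed
 have newax: "p \<in> R \<and> p' \<in> R \<and> h' p = h e \<circ> w p" if "AxL (Upair p p') \<in> K" for p p'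
  using Kax[OF that] by (auto simp: h'_def)
 have axM: "AxL (Upair a a') \<in> links M \<longleftrightarrow> AxL (Upair a a') \<in> links N \<and> Upair a a' \<noteq> Upair e e' \<or> AxL (Upair a a') \<in> K" for a a'
  using M by auto
 have wn: "w p n \<in> nms A" if "AxL (Upair p p') \<in> K" "n \<in> nms (axf M p)" for p p' n
  using w[OF that(1)] that(2) embD(2) by blast
 have "tree_map F M f' h'" unfolding tree_map_def
 proof (intro conjI)
  show "inj_on f' (edges M)"
  proof (rule inj_onI)
   fix y z assume yz: "y \<in> edges M" "z \<in> edges M" "f' y = f' z"
   consider "y \<in> edges N" "z \<in> edges N" | "y \<in> R" "z \<in> R" | "y \<in> R" "z \<in> edges N" | "y \<in> edges N" "z \<in> R"
    using yz eM by auto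
   then show "y = z"
   proof cases
    case 1 then show ?thesis using yz(3) inj_on_eq_iff[OF inj 1] f'old by simp
   next
    case 2 then show ?thesis using yz(3) inj_on_eq_iff[OF k(3), of y z] f'R[of y] f'R[of z] hinj by simp
   next
    case 3 then show ?thesis using yz cross[OF 3(1)] f'old[OF 3(2)] f'R[of y] by auto
   next
    case 4 then show ?thesis using yz cross[OF 4(2)] f'old[OF 4(1)] f'R[of z] by (metis UnI1 imageI)
   qed
  qed
  show "\<forall>y\<in>edges M. f' y \<in> nms F \<and> idlab F (f' y) = lab M y \<and> idloc F (f' y) = map_option f' (loc M y)"
  proof
   fix y assume "y \<in> edges M"
   then consider "y \<in> edges N" "y \<notin> R" | "y \<in> R" using eM R by auto
   then show "f' y \<in> nms F \<and> idlab F (f' y) = lab M y \<and> idloc F (f' y) = map_option f' (loc M y)"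
   proof cases
    case 1
    have "map_option f' (loc N y) = map_option f (loc N y)" using locE[OF _ 1(1)] f'old by (cases "loc N y") auto
    then show ?thesis using lbl[OF 1(1)] old[OF 1(2)] f'old[OF 1(1)] by simp
   next
    case 2
    note kk = kR[OF 2]
    have ky: "k y \<in> nms A" using kk by blast
    have e1: "h e (k y) \<in> nms F" "idlab F (h e (k y)) = idlab A (k y)"
     using embD(2,3)[OF he(1) ky] by blast+
    have "map_option f' (loc N e) = map_option f (loc N e)" using locE[OF _ eE(1)] f'old by (cases "loc N e") auto
    then have "idloc F (h e (k y)) = map_option f' (loc M y)"
     using lc[OF 2] embD(4,5)[OF he(1) ky] he(2) lbl[OF eE(1)] f'old[OF eE(1)] by auto
    then show ?thesis using e1 lk[OF 2] f'R[of y] 2 by simp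
   qed
  qed
  show "\<forall>a a'. AxL (Upair a a') \<in> links M \<longrightarrow> emb F (axf M a) (h' a) \<and> h' a Pos = f' a \<and> h' a Neg = f' a' \<and> h' a' = h' a \<circ> swp \<and>
    (\<forall>n\<in>nms (axf M a). h' a n \<in> f' ` edges M \<longrightarrow> n = Pos \<or> n = Neg)"
  proof (intro allI impI)
   fix a a' assume "AxL (Upair a a') \<in> links M"
   then consider "AxL (Upair a a') \<in> links N" "Upair a a' \<noteq> Upair e e'" | "AxL (Upair a a') \<in> K" unfolding axM by blast
   then show "emb F (axf M a) (h' a) \<and> h' a Pos = f' a \<and> h' a Neg = f' a' \<and> h' a' = h' a \<circ> swp \<and>
     (\<forall>n\<in>nms (axf M a). h' a n \<in> f' ` edges M \<longrightarrow> n = Pos \<or> n = Neg)"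
   proof cases
    case 1
    have l': "AxL (Upair a' a) \<in> links N" using 1 by (simp add: Upair_swap)
    note o = oldax[OF 1(1)] oldax[OF l'] emb[OF 1(1)]
    have "h a n \<notin> f' ` R" if "n \<in> nms (axf N a)" for n
     using dis[OF 1(1) ax 1(2) that] kR axA f'R by fastforce
    moreover have "f' ` edges N = f ` edges N" using f'old by (rule image_cong[OF refl])
    ultimately have "\<forall>n\<in>nms (axf N a). h a n \<in> f' ` edges M \<longrightarrow> n = Pos \<or> n = Neg"
     using o(3) eM by blast
    then show ?thesis using o f'old by simp
   next
    case 2
    have l': "AxL (Upair a' a) \<in> K" using 2 by (simp add: Upair_swap)
    note o = newax[OF 2] newax[OF l'] w[OF 2]
    have "n = Pos \<or> n = Neg" if n: "n \<in> nms (axf M a)" "h' a n \<in> f' ` edges M" for n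
    proof -
     have hn: "h' a n = h e (w a n)" using o by simp
     consider "h e (w a n) \<in> f ` edges N" | y where "y \<in> R" "h e (w a n) = h e (k y)"
     proof -
      obtain y where y: "y \<in> edges M" "h e (w a n) = f' y" using n(2) unfolding hn by auto
      then consider "y \<in> edges N" | "y \<in> R" using eM by auto
      then show thesis
      proof cases
       case 1 then show ?thesis using that(1) y f'old by simp
      next
       case 2 then show ?thesis using that(2) y f'R by simp
      qed
     qed
     then have "w a n \<in> k ` (R \<union> {e, e'})"
     proof cases
      case 1
      then have "w a n = Pos \<or> w a n = Neg" using he(5) wn[OF 2 n(1)] by blast
      then show ?thesis using k(1,2) by force
     qed (use hinj in auto)
     then show ?thesis using o n(1) by blast
    qed
    moreover have "emb F (axf M a) (h e \<circ> w a)" using emb_comp[OF he(1)] o by blast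
    ultimately show ?thesis using o f'R[of a] f'R[of a'] by (auto simp: o_assoc)
   qed
  qed
  show "\<forall>a a' b b' n m. AxL (Upair a a') \<in> links M \<longrightarrow> AxL (Upair b b') \<in> links M \<longrightarrow> Upair a a' \<noteq> Upair b b' \<longrightarrow>
    n \<in> nms (axf M a) \<longrightarrow> m \<in> nms (axf M b) \<longrightarrow> h' a n \<noteq> h' b m"
  proof (intro allI impI)
   fix a a' b b' n m
   assume l: "AxL (Upair a a') \<in> links M" "AxL (Upair b b') \<in> links M" and ne: "Upair a a' \<noteq> Upair b b'"
    and nm: "n \<in> nms (axf M a)" "m \<in> nms (axf M b)"
   have mixed: "h' c i \<noteq> h' d j" if "AxL (Upair c c') \<in> links N" "Upair c c' \<noteq> Upair e e'" "AxL (Upair d d') \<in> K"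
    "i \<in> nms (axf M c)" "j \<in> nms (axf M d)" for c c' d d' i j
    using dis[OF that(1) ax that(2), of i "w d j"] oldax[OF that(1)] newax[OF that(3)] wn[OF that(3,5)] that(4) axA by simp
   consider "AxL (Upair a a') \<in> links N" "AxL (Upair b b') \<in> links N"
    | "AxL (Upair a a') \<in> links N" "Upair a a' \<noteq> Upair e e'" "AxL (Upair b b') \<in> K"
    | "AxL (Upair a a') \<in> K" "AxL (Upair b b') \<in> links N" "Upair b b' \<noteq> Upair e e'"
    | "AxL (Upair a a') \<in> K" "AxL (Upair b b') \<in> K"
    using l unfolding axM by blast
   then show "h' a n \<noteq> h' b m"
   proof cases
    case 1 then show ?thesis using dis[OF 1 ne] oldax nm by metis
   next
    case 2 then show ?thesis using mixed nm by blast
   next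
    case 3 then show ?thesis using mixed[OF 3(2,3,1) nm(2,1)] by simp
   next
    case 4 then show ?thesis using w2[OF 4 ne] newax[OF 4(1)] newax[OF 4(2)] hinj by simp
   qed
  qed
  show "idl0 F = map_link f' ` {l \<in> links M. \<forall>u. l \<noteq> AxL u} \<union>
   (\<Union>a\<in>{a. \<exists>a'. AxL (Upair a a') \<in> links M}. map_link (h' a) ` idl0 (axf M a))"
  proof -
   let ?axN = "{a. \<exists>a'. AxL (Upair a a') \<in> links N}" and ?axK = "{a. \<exists>a'. AxL (Upair a a') \<in> K}"
   let ?axO = "{a. \<exists>a'. AxL (Upair a a') \<in> links N \<and> Upair a a' \<noteq> Upair e e'}"
   have 1: "{l \<in> links M. \<forall>u. l \<noteq> AxL u} = {l \<in> links N. \<forall>u. l \<noteq> AxL u} \<union> {l \<in> K. \<forall>u. l \<noteq> AxL u}" using M by auto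
   have 2: "map_link f' ` {l \<in> links N. \<forall>u. l \<noteq> AxL u} = map_link f ` {l \<in> links N. \<forall>u. l \<noteq> AxL u}"
    by (rule image_cong[OF refl], rule map_link_cong) (use f'old set_link_subset in blast)
   have 3: "map_link f' ` {l \<in> K. \<forall>u. l \<noteq> AxL u} = map_link (h e) ` map_link k ` {l \<in> K. \<forall>u. l \<noteq> AxL u}"
    unfolding image_image map_link_comp
    by (rule image_cong[OF refl], rule map_link_cong) (use f'R subsetD[OF KR] in auto)
   have 4: "{a. \<exists>a'. AxL (Upair a a') \<in> links M} = ?axO \<union> ?axK" unfolding axM by blast
   have 5: "(\<Union>a\<in>?axO. map_link (h' a) ` idl0 (axf M a)) = (\<Union>a\<in>?axO. map_link (h a) ` idl0 (axf N a))"
    by (rule SUP_cong[OF refl]) (use oldax in auto)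
   have 6: "(\<Union>a\<in>?axK. map_link (h' a) ` idl0 (axf M a)) = map_link (h e) ` (\<Union>a\<in>?axK. map_link (w a) ` idl0 (axf M a))"
    unfolding image_UN by (rule SUP_cong[OF refl]) (use newax in \<open>auto simp: image_image map_link_comp\<close>)
   have 7: "?axN = ?axO \<union> {e, e'}"
   proof -
    have "AxL (Upair e' e) \<in> links N" using ax by (simp only: Upair_swap)
    then show ?thesis using ax by (auto simp: Upair_inject)
   qed
   \<comment> \<open>Both conclusions of the axiom index the same subtree, read from its two sides;
     so both contributions to the union disappear together with the axiom.\<close>
   have "map_link (h e') ` idl0 (axf N e') = map_link (h e) ` idl0 A"
   proof -
    have "axf N e' = dual A" using axiom_dual(1)[OF N ax A] by (simp add: axf_def)
    then show ?thesis unfolding he(4) by (simp add: idl_dual image_image map_link_comp comp_assoc)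
   qed
   then have 8: "(\<Union>a\<in>?axN. map_link (h a) ` idl0 (axf N a)) = (\<Union>a\<in>?axO. map_link (h a) ` idl0 (axf N a)) \<union> map_link (h e) ` idl0 A"
    unfolding 7 UN_Un using axA by auto
   have 9: "map_link (h e) ` idl0 A = map_link (h e) ` map_link k ` {l \<in> K. \<forall>u. l \<noteq> AxL u} \<union>
     map_link (h e) ` (\<Union>a\<in>?axK. map_link (w a) ` idl0 (axf M a))"
    by (subst I) (rule image_Un)
   have 10: "(\<Union>a\<in>B \<union> C. G a) = (\<Union>a\<in>B. G a) \<union> (\<Union>a\<in>C. G a)" for B C and G :: "'a \<Rightarrow> nm link set" by blast
   show ?thesis unfolding 1 4 10 image_Un[of "map_link f'"] 2 3 5 6 by (subst idlF, unfold 8 9) (simp only: Un_ac)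
  qed
 qed
 then show ?thesis by blast
qed

lemma tree_map_step:
 assumes tm: "tree_map F N f h" and N: "is_net N" and st: "eta_step N M"
 shows "\<exists>f' h'. tree_map F M f' h'"
 using st
proof cases
 case (unit e e')
 note d = axiom_dual[OF N unit(2,3)]
 show ?thesis
 proof (rule tree_map_refine[OF tm N unit(2,3), where K = "{OneL e, BotL e'}" and R = "{}" and k = "\<lambda>y. if y = e then Pos else Neg"])
  have nx: "{l \<in> {OneL e, BotL e'}. \<forall>u. l \<noteq> AxL u} = {OneL e, BotL e'}" by auto
  show "idl0 One = map_link (\<lambda>y. if y = e then Pos else Neg) ` {l \<in> {OneL e, BotL e'}. \<forall>u. l \<noteq> AxL u} \<union>
    (\<Union>p\<in>{p. \<exists>p'. AxL (Upair p p') \<in> {OneL e, BotL e'}}. map_link (w p) ` idl0 (axf M p))" for w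
   unfolding nx using d(2) by auto
 qed (use d(2) in \<open>auto simp: unit(1)\<close>)
next
 case (mult e e' A B p q p' q')
 note d = axiom_dual[OF N mult(2,3)]
 let ?R = "{p, q, p', q'}" and ?F = "Tensor A B"
  and ?K = "{TensorL p q e, ParL p' q' e', AxL (Upair p p'), AxL (Upair q q')}"
  and ?k = "(\<lambda>_. Pos)(e' := Neg, p := Lt Pos, p' := Lt Neg, q := Rt Pos, q' := Rt Neg)"
  and ?w = "(\<lambda>_. Lt)(p' := Lt \<circ> swp, q := Rt, q' := Rt \<circ> swp)"
 have di: "p \<noteq> q" "p \<noteq> p'" "p \<noteq> q'" "q \<noteq> p'" "q \<noteq> q'" "p' \<noteq> q'" using mult(4) by auto
 have ne: "e \<notin> ?R" "e' \<notin> ?R" using concls_subset[OF mult(2)] mult(5) by auto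
 have lb: "lab M p = Fm A" "lab M q = Fm B" "lab M p' = Fm (dual A)" "lab M q' = Fm (dual B)"
  using di unfolding mult(1) by auto
 have ax: "axf M p = A" "axf M q = B" "axf M p' = dual A" "axf M q' = dual B" using lb by (simp_all add: axf_def)
 have em: "emb ?F A Lt" "emb ?F B Rt" "emb ?F (dual A) (Lt \<circ> swp)" "emb ?F (dual B) (Rt \<circ> swp)"
  using emb_children(1,2) emb_swp by blast+
 show ?thesis
 proof (rule tree_map_refine[OF tm N mult(2,3), where K = ?K and R = ?R and k = ?k and w = ?w])
  show "links M = links N - {AxL (Upair e e')} \<union> ?K" unfolding mult(1) by simp
  show "?R \<inter> edges N = {}" using mult by simp
  show "set_link l \<subseteq> ?R \<union> {e, e'}" if "l \<in> ?K" for l using that by auto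
  show "set_uprod u \<subseteq> ?R" if "AxL u \<in> ?K" for u using that by auto
  show "lab M v = lab N v \<and> loc M v = loc N v" if "v \<notin> ?R" for v using that unfolding mult(1) by simp
  show "?k e = Pos" "?k e' = Neg" using ne d(2) by auto
  show "inj_on ?k (?R \<union> {e, e'})" using ne di d(2) by (simp add: inj_on_def)
  show "?k ` ?R \<subseteq> nms ?F" using di by auto
  show "idlab ?F (?k v) = lab M v" if "v \<in> ?R" for v using that di lb by auto
  show "idloc ?F (?k v) = None \<and> loc M v = loc N e \<or> idloc ?F (?k v) = Some Pos \<and> loc M v = Some e" if "v \<in> ?R" for v
   using that di unfolding mult(1) by auto
  show "emb ?F (axf M a) (?w a) \<and> ?w a Pos = ?k a \<and> ?w a Neg = ?k a' \<and> ?w a' = ?w a \<circ> swp \<and>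
    (\<forall>n\<in>nms (axf M a). ?w a n \<in> ?k ` (?R \<union> {e, e'}) \<longrightarrow> n = Pos \<or> n = Neg)" if l: "AxL (Upair a a') \<in> ?K" for a a'
  proof -
   from l consider "a = p" "a' = p'" | "a = p'" "a' = p" | "a = q" "a' = q'" | "a = q'" "a' = q"
    by (auto simp: Upair_inject)
   then show ?thesis
    by cases (use di ne d(2) ax em in \<open>auto simp: o_assoc[symmetric]\<close>)
  qed
  show "?w a n \<noteq> ?w b m" if "AxL (Upair a a') \<in> ?K" "AxL (Upair b b') \<in> ?K" "Upair a a' \<noteq> Upair b b'" for a a' b b' n m
   using that di by (auto simp: Upair_inject)
  have un: "{a. \<exists>a'. AxL (Upair a a') \<in> ?K} = {p, p', q, q'}" by (auto simp: Upair_inject)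
  have nx: "{l \<in> ?K. \<forall>u. l \<noteq> AxL u} = {TensorL p q e, ParL p' q' e'}" by auto
  show "idl0 ?F = map_link ?k ` {l \<in> ?K. \<forall>u. l \<noteq> AxL u} \<union>
   (\<Union>a\<in>{a. \<exists>a'. AxL (Upair a a') \<in> ?K}. map_link (?w a) ` idl0 (axf M a))"
   unfolding un nx using di ne d(2) by (simp add: ax idl_dual idl_untwisted[of _ "Suc 0"] image_image map_link_comp comp_assoc) blast
 qed
next
 case (para e e' A p p')
 note d = axiom_dual[OF N para(2,3)]
 let ?R = "{p, p'}" and ?F = "Paragraph A"
  and ?K = "{ParagraphL p e, ParagraphL p' e', AxL (Upair p p')}"
  and ?k = "(\<lambda>_. Pos)(e' := Neg, p := Sub Pos, p' := Sub Neg)"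
  and ?w = "(\<lambda>_. Sub)(p' := Sub \<circ> swp)"
 have di: "p \<noteq> p'" using para(4) by auto
 have ne: "e \<notin> ?R" "e' \<notin> ?R" using concls_subset[OF para(2)] para(5) by auto
 have lb: "lab M p = Fm A" "lab M p' = Fm (dual A)"
  using di unfolding para(1) by auto
 have ax: "axf M p = A" "axf M p' = dual A" using lb by (simp_all add: axf_def)
 have em: "emb ?F A Sub" "emb ?F (dual A) (Sub \<circ> swp)"
  using emb_children(3) emb_swp by blast+
 show ?thesis
 proof (rule tree_map_refine[OF tm N para(2,3), where K = ?K and R = ?R and k = ?k and w = ?w])
  show "links M = links N - {AxL (Upair e e')} \<union> ?K" unfolding para(1) by simp
  show "?R \<inter> edges N = {}" using para by simp
  show "set_link l \<subseteq> ?R \<union> {e, e'}" if "l \<in> ?K" for l using that by auto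
  show "set_uprod u \<subseteq> ?R" if "AxL u \<in> ?K" for u using that by auto
  show "lab M v = lab N v \<and> loc M v = loc N v" if "v \<notin> ?R" for v using that unfolding para(1) by simp
  show "?k e = Pos" "?k e' = Neg" using ne d(2) by auto
  show "inj_on ?k (?R \<union> {e, e'})" using ne di d(2) by (simp add: inj_on_def)
  show "?k ` ?R \<subseteq> nms ?F" using di by auto
  show "idlab ?F (?k v) = lab M v" if "v \<in> ?R" for v using that di lb by auto
  show "idloc ?F (?k v) = None \<and> loc M v = loc N e \<or> idloc ?F (?k v) = Some Pos \<and> loc M v = Some e" if "v \<in> ?R" for v
   using that di unfolding para(1) by auto
  show "emb ?F (axf M a) (?w a) \<and> ?w a Pos = ?k a \<and> ?w a Neg = ?k a' \<and> ?w a' = ?w a \<circ> swp \<and>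
    (\<forall>n\<in>nms (axf M a). ?w a n \<in> ?k ` (?R \<union> {e, e'}) \<longrightarrow> n = Pos \<or> n = Neg)" if l: "AxL (Upair a a') \<in> ?K" for a a'
  proof -
   from l consider "a = p" "a' = p'" | "a = p'" "a' = p"
    by (auto simp: Upair_inject)
   then show ?thesis
    by cases (use di ne d(2) ax em in \<open>auto simp: o_assoc[symmetric]\<close>)
  qed
  show "?w a n \<noteq> ?w b m" if "AxL (Upair a a') \<in> ?K" "AxL (Upair b b') \<in> ?K" "Upair a a' \<noteq> Upair b b'" for a a' b b' n m
   using that di by (auto simp: Upair_inject)
  have un: "{a. \<exists>a'. AxL (Upair a a') \<in> ?K} = {p, p'}" by (auto simp: Upair_inject)
  have nx: "{l \<in> ?K. \<forall>u. l \<noteq> AxL u} = {ParagraphL p e, ParagraphL p' e'}" by auto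
  show "idl0 ?F = map_link ?k ` {l \<in> ?K. \<forall>u. l \<noteq> AxL u} \<union>
   (\<Union>a\<in>{a. \<exists>a'. AxL (Upair a a') \<in> ?K}. map_link (?w a) ` idl0 (axf M a))"
   unfolding un nx using di ne d(2) by (simp add: ax idl_dual idl_untwisted[of _ "Suc 0"] image_image map_link_comp comp_assoc) blast
 qed
next
 case (expo e e' A p p' x z)
 note d = axiom_dual[OF N expo(2,3)]
 let ?R = "{p, p', x, z}" and ?F = "Bang A"
  and ?K = "{BangL p e, AxL (Upair p p'), FlatL p' x, PaxL x z, WhynotL {|z|} e'}"
  and ?k = "(\<lambda>_. Pos)(e' := Neg, p := Sub Pos, p' := Sub Neg, x := Flt, z := Aux)"
  and ?w = "(\<lambda>_. Sub)(p' := Sub \<circ> swp)"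
 have di: "p \<noteq> p'" "p \<noteq> x" "p \<noteq> z" "p' \<noteq> x" "p' \<noteq> z" "x \<noteq> z" using expo(4) by auto
 have ne: "e \<notin> ?R" "e' \<notin> ?R" using concls_subset[OF expo(2)] expo(5) by auto
 have lb: "lab M p = Fm A" "lab M p' = Fm (dual A)" "lab M x = Fl (dual A)" "lab M z = Fl (dual A)"
  using di unfolding expo(1) by auto
 have ax: "axf M p = A" "axf M p' = dual A" using lb by (simp_all add: axf_def)
 have em: "emb ?F A Sub" "emb ?F (dual A) (Sub \<circ> swp)"
  using emb_children(4) emb_swp by blast+
 show ?thesis
 proof (rule tree_map_refine[OF tm N expo(2,3), where K = ?K and R = ?R and k = ?k and w = ?w])
  show "links M = links N - {AxL (Upair e e')} \<union> ?K" unfolding expo(1) by simp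
  show "?R \<inter> edges N = {}" using expo by simp
  show "set_link l \<subseteq> ?R \<union> {e, e'}" if "l \<in> ?K" for l using that by auto
  show "set_uprod u \<subseteq> ?R" if "AxL u \<in> ?K" for u using that by auto
  show "lab M v = lab N v \<and> loc M v = loc N v" if "v \<notin> ?R" for v using that unfolding expo(1) by simp
  show "?k e = Pos" "?k e' = Neg" using ne d(2) by auto
  show "inj_on ?k (?R \<union> {e, e'})" using ne di d(2) by (simp add: inj_on_def)
  show "?k ` ?R \<subseteq> nms ?F" using di by auto
  show "idlab ?F (?k v) = lab M v" if "v \<in> ?R" for v using that di lb by auto
  show "idloc ?F (?k v) = None \<and> loc M v = loc N e \<or> idloc ?F (?k v) = Some Pos \<and> loc M v = Some e" if "v \<in> ?R" for v
   using that di unfolding expo(1) by auto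
  show "emb ?F (axf M a) (?w a) \<and> ?w a Pos = ?k a \<and> ?w a Neg = ?k a' \<and> ?w a' = ?w a \<circ> swp \<and>
    (\<forall>n\<in>nms (axf M a). ?w a n \<in> ?k ` (?R \<union> {e, e'}) \<longrightarrow> n = Pos \<or> n = Neg)" if l: "AxL (Upair a a') \<in> ?K" for a a'
  proof -
   from l consider "a = p" "a' = p'" | "a = p'" "a' = p"
    by (auto simp: Upair_inject)
   then show ?thesis
    by cases (use di ne d(2) ax em in \<open>auto simp: o_assoc[symmetric]\<close>)
  qed
  show "?w a n \<noteq> ?w b m" if "AxL (Upair a a') \<in> ?K" "AxL (Upair b b') \<in> ?K" "Upair a a' \<noteq> Upair b b'" for a a' b b' n m
   using that di by (auto simp: Upair_inject)
  have un: "{a. \<exists>a'. AxL (Upair a a') \<in> ?K} = {p, p'}" by (auto simp: Upair_inject)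
  have nx: "{l \<in> ?K. \<forall>u. l \<noteq> AxL u} = {BangL p e, FlatL p' x, PaxL x z, WhynotL {|z|} e'}" by auto
  show "idl0 ?F = map_link ?k ` {l \<in> ?K. \<forall>u. l \<noteq> AxL u} \<union>
   (\<Union>a\<in>{a. \<exists>a'. AxL (Upair a a') \<in> ?K}. map_link (?w a) ` idl0 (axf M a))"
   unfolding un nx using di ne d(2) by (simp add: ax idl_dual idl_untwisted[of _ "Suc 0"] image_image map_link_comp comp_assoc) blast
 qed
qed

section \<open>The expanded identity as a tree\<close>

definition tree :: "form \<Rightarrow> (nat \<Rightarrow> bool) \<Rightarrow> nm net" where
 "tree F tw = \<lparr>links = idl F tw 0, lab = idlab F, loc = idloc F\<rparr>"

lemma tree_map_init: "\<exists>f h. tree_map F (ax_net F) f h"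
proof -
 let ?N = "ax_net F" and ?f = "\<lambda>i. if i = 0 then Neg else Pos" and ?h = "\<lambda>i. if i = 0 then swp else id"
 have l: "links ?N = {AxL (Upair 0 1)}" and e: "edges ?N = {0, 1}" by (auto simp: ax_net_def edges_def)
 have a: "axf ?N 0 = dual F" "axf ?N 1 = F" by (simp_all add: axf_def ax_net_def)
 have m: "AxL (Upair i j) \<in> links ?N \<longleftrightarrow> i = 0 \<and> j = 1 \<or> i = 1 \<and> j = 0" for i j by (auto simp: l Upair_inject)
 have em: "emb F F id" "emb F (dual F) swp" using emb_children(5) emb_swp[OF emb_children(5)] by auto
 have 1: "{l \<in> links ?N. \<forall>u. l \<noteq> AxL u} = {}" and 2: "{i. \<exists>j. AxL (Upair i j) \<in> links ?N} = {0, 1}" using m by (auto simp: l)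
 have "tree_map F ?N ?f ?h" unfolding tree_map_def 1 2
 proof (intro conjI)
  show "inj_on ?f (edges ?N)" by (auto simp: e inj_on_def)
  show "\<forall>y\<in>edges ?N. ?f y \<in> nms F \<and> idlab F (?f y) = lab ?N y \<and> idloc F (?f y) = map_option ?f (loc ?N y)"
   by (auto simp: e ax_net_def)
  show "\<forall>i j. AxL (Upair i j) \<in> links ?N \<longrightarrow> emb F (axf ?N i) (?h i) \<and> ?h i Pos = ?f i \<and> ?h i Neg = ?f j \<and> ?h j = ?h i \<circ> swp \<and>
    (\<forall>n\<in>nms (axf ?N i). ?h i n \<in> ?f ` edges ?N \<longrightarrow> n = Pos \<or> n = Neg)"
   unfolding m e using em a by (auto split: if_splits)
  show "\<forall>a a' b b' n m. AxL (Upair a a') \<in> links ?N \<longrightarrow> AxL (Upair b b') \<in> links ?N \<longrightarrow> Upair a a' \<noteq> Upair b b' \<longrightarrow>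
    n \<in> nms (axf ?N a) \<longrightarrow> m \<in> nms (axf ?N b) \<longrightarrow> ?h a n \<noteq> ?h b m"
   unfolding l by auto
  show "idl0 F = map_link ?f ` {} \<union> (\<Union>i\<in>{0, 1}. map_link (?h i) ` idl0 (axf ?N i))"
   using a by (simp add: idl_dual image_image map_link_comp link.map_id0)
 qed
 then show ?thesis by blast
qed

lemma ax_net_is_net: "is_net (ax_net F)" and ax_net_cut_free: "cut_free (ax_net F)"
proof -
 have l: "links (ax_net F) = {AxL (Upair 0 1)}" and e: "edges (ax_net F) = {0, 1}" by (auto simp: ax_net_def edges_def)
 have t: "typed (ax_net F) (AxL (Upair 0 1))"
  unfolding typed.simps by (rule exI[of _ 0], rule exI[of _ 1], rule exI[of _ "dual F"]) (simp add: ax_net_def)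
 have lo: "loc (ax_net F) e = None" for e by (simp add: ax_net_def)
 have "well_boxed (ax_net F)" unfolding well_boxed_def by (simp add: l lo acyclic_def)
 then show "is_net (ax_net F)" unfolding is_net_def using t by (auto simp: l e)
 show "cut_free (ax_net F)" by (simp add: cut_free_def l)
qed

lemma identity_net_tree:
 assumes "identity_net F N"
 shows "is_net N" "cut_free N" "\<exists>f. iso_by f N (tree F (\<lambda>_. False))"
proof -
 have st: "eta_step\<^sup>*\<^sup>* (ax_net F) N" and ex: "eta_expanded N"
  using assms by (auto simp: identity_net_def eta_expansion_def)
 show N: "is_net N" and "cut_free N" using eta_steps[OF st ax_net_is_net] ax_net_cut_free by auto
 have "\<exists>f h. tree_map F N f h" using st
 proof (induction rule: rtranclp_induct)
  case base
  show ?case by (rule tree_map_init)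
 next
  case (step M M')
  have "is_net M" using eta_steps[OF step(1) ax_net_is_net] by blast
  then show ?case using step tree_map_step by blast
 qed
 then obtain f h where tm: "tree_map F N f h" by blast
 note T = tm[unfolded tree_map_def]
 \<comment> \<open>In a fully expanded net the subtrees still to grow are single atomic axioms, so
   \<open>f\<close> alone is already the isomorphism with the tree.\<close>
 have ax: "map_link (h e) ` idl0 (axf N e) = {map_link f (AxL (Upair e e'))}" if l: "AxL (Upair e e') \<in> links N" for e e'
 proof -
  obtain Z where "lab N e = Fm (Atom Z) \<or> lab N e = Fm (NAtom Z)" using ex l by (auto simp: eta_expanded_def)
  then have "idl0 (axf N e) = {AxL (Upair Neg Pos)}" by (auto simp: axf_def)
  moreover have "h e Pos = f e" "h e Neg = f e'" using T l by blast+
  ultimately show ?thesis by (simp add: Upair_swap)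
 qed
 have "map_link f ` links N = idl0 F"
 proof -
  have "(\<Union>e\<in>{e. \<exists>e'. AxL (Upair e e') \<in> links N}. map_link (h e) ` idl0 (axf N e)) = map_link f ` {l \<in> links N. \<exists>u. l = AxL u}"
  proof (intro set_eqI iffI)
   fix k assume "k \<in> (\<Union>e\<in>{e. \<exists>e'. AxL (Upair e e') \<in> links N}. map_link (h e) ` idl0 (axf N e))"
   then obtain e e' where l: "AxL (Upair e e') \<in> links N" "k \<in> map_link (h e) ` idl0 (axf N e)" by blast
   then show "k \<in> map_link f ` {l \<in> links N. \<exists>u. l = AxL u}" unfolding ax[OF l(1)] by blast
  next
   fix k assume "k \<in> map_link f ` {l \<in> links N. \<exists>u. l = AxL u}"
   then obtain u where u: "k = map_link f (AxL u)" "AxL u \<in> links N" by blast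
   obtain e e' where "u = Upair e e'" by (metis uprod_exhaust)
   then show "k \<in> (\<Union>e\<in>{e. \<exists>e'. AxL (Upair e e') \<in> links N}. map_link (h e) ` idl0 (axf N e))"
    using u ax[of e e'] by blast
  qed
  moreover have "links N = {l \<in> links N. \<forall>u. l \<noteq> AxL u} \<union> {l \<in> links N. \<exists>u. l = AxL u}" by blast
  moreover have "idl0 F = map_link f ` {l \<in> links N. \<forall>u. l \<noteq> AxL u} \<union>
   (\<Union>e\<in>{e. \<exists>e'. AxL (Upair e e') \<in> links N}. map_link (h e) ` idl0 (axf N e))" using T by blast
  ultimately show ?thesis by (metis image_Un)
 qed
 moreover have "inj_on f (reach N)" using conjunct1[OF T] by (simp only: boxed_reach[OF net_boxed[OF N]])
 moreover have "\<forall>y\<in>edges N. idlab F (f y) = lab N y \<and> idloc F (f y) = map_option f (loc N y)"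
  using conjunct1[OF conjunct2[OF T]] by blast
 ultimately have "iso_by f N (tree F (\<lambda>_. False))" by (simp add: iso_by_def tree_def)
 then show "\<exists>f. iso_by f N (tree F (\<lambda>_. False))" by blast
qed

subsection \<open>Crossing\<close>

lemma set_link_ne: "set_link l \<noteq> {}"
proof -
 have "set_uprod u \<noteq> {}" for u :: "'b uprod" by (cases u) simp
 then show ?thesis by (cases l) auto
qed

lemma tree_prems:
 "n \<in> nms F \<Longrightarrow> n \<noteq> Neg \<Longrightarrow> n \<noteq> Pos \<Longrightarrow> \<exists>l\<in>idl F tw j. n \<in> prems l"
proof (induction F arbitrary: n j)
 case (Tensor A B)
 consider m where "n = Lt m" "m \<in> nms A" | m where "n = Rt m" "m \<in> nms B" using Tensor.prems by auto
 then show ?case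
 proof cases
  case 1
  show ?thesis
  proof (cases "m = Neg \<or> m = Pos")
   case False
   then obtain l where "l \<in> idl A tw j" "m \<in> prems l" using Tensor.IH(1) 1 by blast
   then show ?thesis using 1 by (intro bexI[of _ "map_link Lt l"]) auto
  qed (use 1 in auto)
 next
  case 2
  show ?thesis
  proof (cases "m = Neg \<or> m = Pos")
   case False
   then obtain l where "l \<in> idl B tw j" "m \<in> prems l" using Tensor.IH(2) 2 by blast
   then show ?thesis using 2 by (intro bexI[of _ "map_link Rt l"]) auto
  qed (use 2 in auto)
 qed
next
 case (Par A B)
 consider m where "n = Lt m" "m \<in> nms A" | m where "n = Rt m" "m \<in> nms B" using Par.prems by auto
 then show ?case
 proof cases
  case 1
  show ?thesis
  proof (cases "m = Neg \<or> m = Pos")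
   case False
   then obtain l where "l \<in> idl A tw j" "m \<in> prems l" using Par.IH(1) 1 by blast
   then show ?thesis using 1 by (intro bexI[of _ "map_link Lt l"]) auto
  qed (use 1 in auto)
 next
  case 2
  show ?thesis
  proof (cases "m = Neg \<or> m = Pos")
   case False
   then obtain l where "l \<in> idl B tw j" "m \<in> prems l" using Par.IH(2) 2 by blast
   then show ?thesis using 2 by (intro bexI[of _ "map_link Rt l"]) auto
  qed (use 2 in auto)
 qed
next
 case (Bang A)
 consider "n = Flt \<or> n = Aux" | m where "n = Sub m" "m \<in> nms A" using Bang.prems by auto
 then show ?case
 proof cases
  case 2
  then show ?thesis using Bang.IH[of m "Suc j"] by (cases "m = Neg \<or> m = Pos") auto
 qed auto
next
 case (Whynot A)
 consider "n = Flt \<or> n = Aux" | m where "n = Sub m" "m \<in> nms A" using Whynot.prems by auto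
 then show ?case
 proof cases
  case 2
  then show ?thesis using Whynot.IH[of m "Suc j"] by (cases "m = Neg \<or> m = Pos") auto
 qed auto
next
 case (Paragraph A)
 then obtain m where "n = Sub m" "m \<in> nms A" by auto
 then show ?case using Paragraph.IH[of m "Suc j"] by (cases "m = Neg \<or> m = Pos") auto
qed auto

lemma tree_root_prems: "l \<in> idl F tw j \<Longrightarrow> Neg \<notin> prems l \<and> Pos \<notin> prems l"
 by (cases F) (auto split: if_splits)

lemma tree_edges: "edges (tree F tw) = nms F"
 using idl_names by (simp add: edges_eq tree_def)

lemma tree_conclusions: "conclusions (tree F tw) = {Neg, Pos}"
 unfolding conclusions_def tree_edges using tree_prems[of _ F tw 0] tree_root_prems[of _ F tw 0]
 by (auto simp: tree_def)

lemma tree_boxed: "boxed (tree F tw)"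
 unfolding boxed_def tree_edges using idloc_closed by (auto simp: tree_def)

lemma iso_conclusions:
 assumes "inj_on f (edges N)" "map_link f ` links N = links M" shows "conclusions M = f ` conclusions N"
proof -
 have e: "edges M = f ` edges N" using iso_by_edges assms(2) by metis
 have "f y \<in> prems (map_link f l) \<longleftrightarrow> y \<in> prems l" if "y \<in> edges N" "l \<in> links N" for y l
  using that assms(1) prems_subset[OF that(2)] by (auto dest: inj_onD)
 then show ?thesis unfolding conclusions_def e assms(2)[symmetric] by auto
qed

section \<open>Levels and crossed subnets in the tree\<close>

primrec nlev :: "form \<Rightarrow> nat \<Rightarrow> nm \<Rightarrow> nat" where
 "nlev (Atom Z) j = (\<lambda>_. j)"
| "nlev (NAtom Z) j = (\<lambda>_. j)"
| "nlev One j = (\<lambda>_. j)"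
| "nlev Bot j = (\<lambda>_. j)"
| "nlev (Tensor A B) j = (\<lambda>n. case n of Lt m \<Rightarrow> nlev A j m | Rt m \<Rightarrow> nlev B j m | _ \<Rightarrow> j)"
| "nlev (Par A B) j = (\<lambda>n. case n of Lt m \<Rightarrow> nlev A j m | Rt m \<Rightarrow> nlev B j m | _ \<Rightarrow> j)"
| "nlev (Bang A) j = (\<lambda>n. case n of Sub m \<Rightarrow> nlev A (Suc j) m | Flt \<Rightarrow> Suc j | Aux \<Rightarrow> Suc j | _ \<Rightarrow> j)"
| "nlev (Whynot A) j = (\<lambda>n. case n of Sub m \<Rightarrow> nlev A (Suc j) m | Flt \<Rightarrow> Suc j | Aux \<Rightarrow> Suc j | _ \<Rightarrow> j)"
| "nlev (Paragraph A) j = (\<lambda>n. case n of Sub m \<Rightarrow> nlev A (Suc j) m | _ \<Rightarrow> j)"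

lemma nlev_root [simp]: "nlev F j Neg = j" "nlev F j Pos = j"
 by (cases F; simp)+

lemma indexed_map: "indexed I (map_link f l) = indexed (I \<circ> f) l"
 by (cases l) (auto simp: uprod.set_map)

lemma nlev_indexed: "l \<in> idl F tw i \<Longrightarrow> indexed (\<lambda>n. int (nlev F j n)) l"
proof (induction F arbitrary: l i j)
 case (Tensor A B)
 have c: "(\<lambda>n. int (nlev (Tensor A B) j n)) \<circ> Lt = (\<lambda>n. int (nlev A j n))"
  "(\<lambda>n. int (nlev (Tensor A B) j n)) \<circ> Rt = (\<lambda>n. int (nlev B j n))" by auto
 from Tensor.prems consider "l = ParL (Lt Neg) (Rt Neg) Neg" | "l = TensorL (Lt Pos) (Rt Pos) Pos" | "l = TensorL (Rt Pos) (Lt Pos) Pos"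
  | m where "l = map_link Lt m" "m \<in> idl A tw i" | m where "l = map_link Rt m" "m \<in> idl B tw i" by (auto split: if_splits)
 then show ?case by cases (simp_all add: indexed_map c Tensor.IH del: idl.simps nlev.simps, simp_all)
next
 case (Par A B)
 have c: "(\<lambda>n. int (nlev (Par A B) j n)) \<circ> Lt = (\<lambda>n. int (nlev A j n))"
  "(\<lambda>n. int (nlev (Par A B) j n)) \<circ> Rt = (\<lambda>n. int (nlev B j n))" by auto
 from Par.prems consider "l = TensorL (Lt Neg) (Rt Neg) Neg" | "l = ParL (Lt Pos) (Rt Pos) Pos" | "l = ParL (Rt Pos) (Lt Pos) Pos"
  | m where "l = map_link Lt m" "m \<in> idl A tw i" | m where "l = map_link Rt m" "m \<in> idl B tw i" by (auto split: if_splits)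
 then show ?case by cases (simp_all add: indexed_map c Par.IH del: idl.simps nlev.simps, simp_all)
next
 case (Bang A)
 have c: "(\<lambda>n. int (nlev (Bang A) j n)) \<circ> Sub = (\<lambda>n. int (nlev A (Suc j) n))" by auto
 show ?case using Bang.prems
  by (auto simp add: indexed_map c Bang.IH simp del: nlev.simps(7)) (simp_all add: nlev.simps(7))
next
 case (Whynot A)
 have c: "(\<lambda>n. int (nlev (Whynot A) j n)) \<circ> Sub = (\<lambda>n. int (nlev A (Suc j) n))" by auto
 show ?case using Whynot.prems
  by (auto simp add: indexed_map c Whynot.IH simp del: nlev.simps(8)) (simp_all add: nlev.simps(8))
next
 case (Paragraph A)
 have c: "(\<lambda>n. int (nlev (Paragraph A) j n)) \<circ> Sub = (\<lambda>n. int (nlev A (Suc j) n))" by auto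
 show ?case using Paragraph.prems
  by (auto simp add: indexed_map c Paragraph.IH simp del: nlev.simps(9)) (simp_all add: nlev.simps(9))
qed auto

text \<open>The image of \<open>id_subnet_at_level\<close> under the isomorphism with the tree; the
  default indexing is replaced by its explicit value \<open>nlev\<close>, with the root at level
  \<open>j\<close>.\<close>

definition tsub :: "nat \<Rightarrow> nat \<Rightarrow> form \<Rightarrow> nat \<Rightarrow> nm \<Rightarrow> nm \<Rightarrow> nm \<Rightarrow> nm \<Rightarrow> nm \<Rightarrow> nm \<Rightarrow> bool" where
 "tsub X k F j p q t p' q' u \<longleftrightarrow> id_links p q t p' q' u \<subseteq> idl0 F \<and>
   idlab F p = Fm (Atom X) \<and> idlab F q = Fm (Atom X) \<and> nlev F j t = k \<and> nlev F j u = k"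

definition crossed :: "nat \<Rightarrow> nat \<Rightarrow> form \<Rightarrow> nat \<Rightarrow> nm link set" where
 "crossed X k F j = (idl0 F - \<Union> {id_links p q t p' q' u | p q t p' q' u. tsub X k F j p q t p' q' u}) \<union>
   \<Union> {gamma_links p q t p' q' u | p q t p' q' u. tsub X k F j p q t p' q' u}"

lemma bullet_not_atom: "bullet X A \<noteq> Atom Z" "dual (bullet X A) \<noteq> Atom Z" "bullet X A \<noteq> NAtom Z" "dual (bullet X A) \<noteq> NAtom Z"
 by (cases A; simp)+

lemma mem_map_links:
 "id_links (f p) (f q) (f t) (f p') (f q') (f u) = map_link f ` id_links p q t p' q' u"
 "gamma_links (f p) (f q) (f t) (f p') (f q') (f u) = map_link f ` gamma_links p q t p' q' u"
 by (auto simp: id_links_def gamma_links_def)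

text \<open>A subnet \<open>id_links\<close> is held together by its axioms. Once its tensor lies in
  the component embedded by \<open>c\<close>, so do the axioms on its premises, and then the par on
  their other ends; the root links in \<open>R\<close> are kept out by hypothesis.\<close>

lemma id_links_inv:
 assumes inj: "inj c" and L: "id_links p q t p' q' u \<subseteq> R \<union> map_link c ` L \<union> map_link d ` L'"
  and R: "\<And>a b. AxL (Upair a b) \<notin> R" "TensorL p q t \<notin> R" "\<And>a. ParL (c a) q' u \<in> R \<Longrightarrow> q' \<notin> range c"
  and cd: "\<And>a b. c a \<noteq> d b" and T: "TensorL p q t \<in> map_link c ` L"
 shows "\<exists>p0 q0 t0 p0' q0' u0. p = c p0 \<and> q = c q0 \<and> t = c t0 \<and> p' = c p0' \<and> q' = c q0' \<and> u = c u0 \<and>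
  id_links p0 q0 t0 p0' q0' u0 \<subseteq> L"
proof -
 obtain p0 q0 t0 where 1: "p = c p0" "q = c q0" "t = c t0" "TensorL p0 q0 t0 \<in> L"
  using T unfolding mem_map_link_iffs by blast
 have ax: "\<exists>b0. b = c b0 \<and> AxL (Upair a0 b0) \<in> L" if h: "AxL (Upair (c a0) b) \<in> R \<union> map_link c ` L \<union> map_link d ` L'" for a0 b
 proof -
  have "AxL (Upair (c a0) b) \<notin> map_link d ` L'"
   unfolding mem_map_link_iffs by (metis cd map_uprod_eq_Upair)
  then have "AxL (Upair (c a0) b) \<in> map_link c ` L" using h R(1) by blast
  then obtain v where v: "AxL v \<in> L" "map_uprod c v = Upair (c a0) b" unfolding mem_map_link_iffs by auto
  then obtain x y where "v = Upair x y" "c a0 = c x" "b = c y" unfolding map_uprod_eq_Upair by blast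
  then show ?thesis using v inj by (auto simp: inj_def)
 qed
 have "AxL (Upair (c p0) p') \<in> R \<union> map_link c ` L \<union> map_link d ` L'" "AxL (Upair (c q0) q') \<in> R \<union> map_link c ` L \<union> map_link d ` L'"
  using L 1 by (auto simp: id_links_def)
 from ax[OF this(1)] ax[OF this(2)] obtain p0' q0' where 2: "p' = c p0'" "AxL (Upair p0 p0') \<in> L" "q' = c q0'" "AxL (Upair q0 q0') \<in> L" by blast
 have "ParL (c p0') (c q0') u \<in> R \<union> map_link c ` L \<union> map_link d ` L'" using L 2 by (auto simp: id_links_def)
 moreover have "ParL (c p0') (c q0') u \<notin> R" using R(3)[of p0'] 2(3) by auto
 moreover have "ParL (c p0') (c q0') u \<notin> map_link d ` L'" unfolding mem_map_link_iffs using cd by metis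
 ultimately have "ParL (c p0') (c q0') u \<in> map_link c ` L" by blast
 then obtain x y u0 where "ParL x y u0 \<in> L" "c p0' = c x" "c q0' = c y" "u = c u0" unfolding mem_map_link_iffs by blast
 then have "u = c u0" "ParL p0' q0' u0 \<in> L" using inj by (auto simp: inj_def)
 then have "id_links p0 q0 t0 p0' q0' u0 \<subseteq> L" "u = c u0" using 1(4) 2(2,4) unfolding id_links_def by blast+
 then show ?thesis using 1(1-3) 2(1,3) by blast
qed

text \<open>Packs a sixfold existential, so that the union over all crossed subnets can be pulled
  through a renaming in one step (\<open>tuples_image\<close>).\<close>

definition lifted :: "('b \<Rightarrow> 'a) \<Rightarrow> ('b \<Rightarrow> 'b \<Rightarrow> 'b \<Rightarrow> 'b \<Rightarrow> 'b \<Rightarrow> 'b \<Rightarrow> bool) \<Rightarrow> 'a \<Rightarrow> 'a \<Rightarrow> 'a \<Rightarrow> 'a \<Rightarrow> 'a \<Rightarrow> 'a \<Rightarrow> bool" where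
 "lifted c P p q t p' q' u \<longleftrightarrow> (\<exists>p0 q0 t0 p0' q0' u0.
   p = c p0 \<and> q = c q0 \<and> t = c t0 \<and> p' = c p0' \<and> q' = c q0' \<and> u = c u0 \<and> P p0 q0 t0 p0' q0' u0)"

lemma mem_tuples:
 "l \<in> \<Union> {h p q t p' q' u | p q t p' q' u. P p q t p' q' u} \<longleftrightarrow> (\<exists>p q t p' q' u. P p q t p' q' u \<and> l \<in> h p q t p' q' u)"
 by (rule iffI; elim UnionE CollectE exE conjE) (hypsubst, intro exI conjI, assumption+, intro UnionI CollectI exI conjI, rule refl)

lemma tuples_image:
 assumes h: "\<And>p q t p' q' u. h (c p) (c q) (c t) (c p') (c q') (c u) = map_link c ` g p q t p' q' u"
 shows "\<Union> {h p q t p' q' u | p q t p' q' u. lifted c P p q t p' q' u} =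
  map_link c ` \<Union> {g p q t p' q' u | p q t p' q' u. P p q t p' q' u}"
proof (rule set_eqI)
 fix l
 have "(\<exists>p q t p' q' u. (\<exists>p0 q0 t0 p0' q0' u0.
   p = c p0 \<and> q = c q0 \<and> t = c t0 \<and> p' = c p0' \<and> q' = c q0' \<and> u = c u0 \<and> P p0 q0 t0 p0' q0' u0) \<and> l \<in> h p q t p' q' u) \<longleftrightarrow>
  (\<exists>p q t p' q' u. P p q t p' q' u \<and> l \<in> h (c p) (c q) (c t) (c p') (c q') (c u))"
  by (rule iffI; elim exE conjE) (hypsubst, intro exI conjI, assumption+, intro exI conjI, (rule refl)+, assumption+)
 then show "l \<in> \<Union> {h p q t p' q' u | p q t p' q' u. lifted c P p q t p' q' u} \<longleftrightarrow>
  l \<in> map_link c ` \<Union> {g p q t p' q' u | p q t p' q' u. P p q t p' q' u}"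
  unfolding lifted_def mem_tuples h image_iff Bex_def by blast
qed

text \<open>Root links of a binary node take no part in a crossing: the premises of a root tensor
  are not atoms, and the premises of a root par lie in different components. So crossing can be done
  in the components separately.\<close>

lemma crossed_node2:
 assumes F: "idl0 F = R \<union> map_link Lt ` idl0 A \<union> map_link Rt ` idl0 B"
  and R: "\<And>a b. AxL (Upair a b) \<notin> R" "\<And>p q t. TensorL p q t \<in> R \<Longrightarrow> idlab F p \<noteq> Fm (Atom X)"
   "\<And>a b u. ParL a b u \<in> R \<Longrightarrow> a \<in> range Lt \<and> b \<in> range Rt" "\<And>l. l \<in> R \<Longrightarrow> Neg \<in> set_link l \<or> Pos \<in> set_link l"
  and lb: "\<And>n. idlab F (Lt n) = idlab A n" "\<And>n. idlab F (Rt n) = idlab B n"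
  and lv: "\<And>n. nlev F j (Lt n) = nlev A j n" "\<And>n. nlev F j (Rt n) = nlev B j n"
 shows "crossed X k F j = R \<union> map_link Lt ` crossed X k A j \<union> map_link Rt ` crossed X k B j"
proof -
 have i: "inj Lt" "inj Rt" by (auto simp: inj_def)
 have ts: "tsub X k F j p q t p' q' u \<longleftrightarrow> lifted Lt (tsub X k A j) p q t p' q' u \<or> lifted Rt (tsub X k B j) p q t p' q' u"
  for p q t p' q' u
 proof
  assume h: "tsub X k F j p q t p' q' u"
  have s: "id_links p q t p' q' u \<subseteq> R \<union> map_link Lt ` idl0 A \<union> map_link Rt ` idl0 B" using h F by (simp add: tsub_def)
  have nT: "TensorL p q t \<notin> R" using R(2) h by (auto simp: tsub_def)
  then consider "TensorL p q t \<in> map_link Lt ` idl0 A" | "TensorL p q t \<in> map_link Rt ` idl0 B"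
   using s by (auto simp: id_links_def)
  then show "lifted Lt (tsub X k A j) p q t p' q' u \<or> lifted Rt (tsub X k B j) p q t p' q' u"
  proof cases
   case 1
   have "\<exists>p0 q0 t0 p0' q0' u0. p = Lt p0 \<and> q = Lt q0 \<and> t = Lt t0 \<and> p' = Lt p0' \<and> q' = Lt q0' \<and> u = Lt u0 \<and>
     id_links p0 q0 t0 p0' q0' u0 \<subseteq> idl0 A"
    by (rule id_links_inv[OF i(1) s R(1) nT _ _ 1]) (use R(3) in auto)
   then show ?thesis using h lb lv unfolding lifted_def by (fastforce simp: tsub_def)
  next
   case 2
   have s': "id_links p q t p' q' u \<subseteq> R \<union> map_link Rt ` idl0 B \<union> map_link Lt ` idl0 A" using s by blast
   have "\<exists>p0 q0 t0 p0' q0' u0. p = Rt p0 \<and> q = Rt q0 \<and> t = Rt t0 \<and> p' = Rt p0' \<and> q' = Rt q0' \<and> u = Rt u0 \<and>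
     id_links p0 q0 t0 p0' q0' u0 \<subseteq> idl0 B"
    by (rule id_links_inv[OF i(2) s' R(1) nT _ _ 2]) (use R(3) in fastforce)+
   then show ?thesis using h lb lv unfolding lifted_def by (fastforce simp: tsub_def)
  qed
 next
  assume "lifted Lt (tsub X k A j) p q t p' q' u \<or> lifted Rt (tsub X k B j) p q t p' q' u"
  then show "tsub X k F j p q t p' q' u"
   unfolding lifted_def by (elim disjE exE conjE) (auto simp: tsub_def lb lv F mem_map_links)
 qed
 let ?I = "\<lambda>F. \<Union> {id_links p q t p' q' u | p q t p' q' u. tsub X k F j p q t p' q' u}"
 let ?G = "\<lambda>F. \<Union> {gamma_links p q t p' q' u | p q t p' q' u. tsub X k F j p q t p' q' u}"
 have I: "?I F = map_link Lt ` ?I A \<union> map_link Rt ` ?I B"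
 proof -
  have "?I F = \<Union> {id_links p q t p' q' u | p q t p' q' u. lifted Lt (tsub X k A j) p q t p' q' u} \<union>
   \<Union> {id_links p q t p' q' u | p q t p' q' u. lifted Rt (tsub X k B j) p q t p' q' u}"
   unfolding ts by (rule set_eqI) (simp only: mem_tuples Un_iff conj_disj_distribR ex_disj_distrib)
  then show ?thesis unfolding tuples_image[where g = id_links, OF mem_map_links(1)] .
 qed
 have G: "?G F = map_link Lt ` ?G A \<union> map_link Rt ` ?G B"
 proof -
  have "?G F = \<Union> {gamma_links p q t p' q' u | p q t p' q' u. lifted Lt (tsub X k A j) p q t p' q' u} \<union>
   \<Union> {gamma_links p q t p' q' u | p q t p' q' u. lifted Rt (tsub X k B j) p q t p' q' u}"
   unfolding ts by (rule set_eqI) (simp only: mem_tuples Un_iff conj_disj_distribR ex_disj_distrib)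
  then show ?thesis unfolding tuples_image[where g = gamma_links, OF mem_map_links(2)] .
 qed
 have RL: "R \<inter> (map_link Lt ` S \<union> map_link Rt ` S') = {}" for S S'
  using R(4) by (fastforce simp: link.set_map)
 have LR: "map_link Lt ` S \<inter> map_link Rt ` S' = {}" for S S'
 proof -
  have "map_link Lt a \<noteq> map_link Rt b" for a b
  proof
   assume "map_link Lt a = map_link Rt b"
   then have "Lt ` set_link a = Rt ` set_link b" by (metis link.set_map)
   then show False using set_link_ne[of a] by blast
  qed
  then show ?thesis by blast
 qed
 have D: "map_link Lt ` S - map_link Lt ` S' = map_link Lt ` (S - S')" "map_link Rt ` S - map_link Rt ` S' = map_link Rt ` (S - S')" for S S'
  by (rule image_set_diff[symmetric], rule link.inj_map, rule i)+
 have diff: "R \<inter> (a' \<union> b') = {} \<Longrightarrow> a' \<inter> b = {} \<Longrightarrow> a \<inter> b' = {} \<Longrightarrow> (R \<union> a \<union> b) - (a' \<union> b') = R \<union> (a - a') \<union> (b - b')"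
  for a b a' b' by blast
 have "idl0 F - ?I F = R \<union> map_link Lt ` (idl0 A - ?I A) \<union> map_link Rt ` (idl0 B - ?I B)"
  unfolding F I D[symmetric] by (rule diff[OF RL LR LR])
 then show ?thesis unfolding crossed_def G image_Un by (simp only: Un_ac)
qed

lemma crossed_node1:
 assumes F: "idl0 F = R \<union> map_link Sub ` idl0 A"
  and R: "\<And>u. AxL u \<notin> R" "\<And>p q t. TensorL p q t \<notin> R" "\<And>p q t. ParL p q t \<notin> R" "\<And>l. l \<in> R \<Longrightarrow> \<not> set_link l \<subseteq> range Sub"
  and lb: "\<And>n. idlab F (Sub n) = idlab A n" and lv: "\<And>n. nlev F j (Sub n) = nlev A i n"
 shows "crossed X k F j = R \<union> map_link Sub ` crossed X k A i"
proof -
 have i: "inj Sub" by (auto simp: inj_def)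
 have ts: "tsub X k F j p q t p' q' u \<longleftrightarrow> lifted Sub (tsub X k A i) p q t p' q' u"
  for p q t p' q' u
 proof
  assume h: "tsub X k F j p q t p' q' u"
  have s: "id_links p q t p' q' u \<subseteq> R \<union> map_link Sub ` idl0 A \<union> map_link Lt ` {}" using h F by (simp add: tsub_def)
  then have 1: "TensorL p q t \<in> map_link Sub ` idl0 A" using R(2) by (auto simp: id_links_def)
  have "\<exists>p0 q0 t0 p0' q0' u0. p = Sub p0 \<and> q = Sub q0 \<and> t = Sub t0 \<and> p' = Sub p0' \<and> q' = Sub q0' \<and> u = Sub u0 \<and>
    id_links p0 q0 t0 p0' q0' u0 \<subseteq> idl0 A"
   by (rule id_links_inv[OF i s R(1) R(2) _ _ 1]) (simp_all add: R(3))
  then show "lifted Sub (tsub X k A i) p q t p' q' u"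
   using h lb lv unfolding lifted_def by (fastforce simp: tsub_def)
 next
  assume "lifted Sub (tsub X k A i) p q t p' q' u"
  then show "tsub X k F j p q t p' q' u"
   unfolding lifted_def by (elim exE conjE) (auto simp: tsub_def lb lv F mem_map_links)
 qed
 let ?I = "\<lambda>F j. \<Union> {id_links p q t p' q' u | p q t p' q' u. tsub X k F j p q t p' q' u}"
 let ?G = "\<lambda>F j. \<Union> {gamma_links p q t p' q' u | p q t p' q' u. tsub X k F j p q t p' q' u}"
 have I: "?I F j = map_link Sub ` ?I A i"
  unfolding ts by (rule tuples_image[OF mem_map_links(1)])
 have G: "?G F j = map_link Sub ` ?G A i"
  unfolding ts by (rule tuples_image[OF mem_map_links(2)])
 have RL: "R \<inter> map_link Sub ` S = {}" for S
  using R(4) by (fastforce simp: link.set_map)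
 have D: "map_link Sub ` S - map_link Sub ` S' = map_link Sub ` (S - S')" for S S'
  by (rule image_set_diff[symmetric], rule link.inj_map, rule i)
 have diff: "R \<inter> a' = {} \<Longrightarrow> (R \<union> a) - a' = R \<union> (a - a')" for a a' by blast
 have "idl0 F - ?I F j = R \<union> map_link Sub ` (idl0 A - ?I A i)"
  unfolding F I D[symmetric] by (rule diff[OF RL])
 then show ?thesis unfolding crossed_def G image_Un by (simp only: Un_ac)
qed

text \<open>A test crosses the axioms, while \<open>idl\<close> crosses the positive pair link.
  Exchanging the two positive leaves at level \<open>k\<close> carries the first into the second;
  labels are preserved since both leaves carry the same atom.\<close>

primrec twist :: "form \<Rightarrow> nat \<Rightarrow> nat \<Rightarrow> nm \<Rightarrow> nm" where
 "twist (Atom Z) k j = (if j = k then id(Lt Pos := Rt Pos, Rt Pos := Lt Pos) else id)"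
| "twist (NAtom Z) k j = (if j = k then id(Lt Pos := Rt Pos, Rt Pos := Lt Pos) else id)"
| "twist One k j = id"
| "twist Bot k j = id"
| "twist (Tensor A B) k j = (\<lambda>n. case n of Lt m \<Rightarrow> Lt (twist A k j m) | Rt m \<Rightarrow> Rt (twist B k j m) | _ \<Rightarrow> n)"
| "twist (Par A B) k j = (\<lambda>n. case n of Lt m \<Rightarrow> Lt (twist A k j m) | Rt m \<Rightarrow> Rt (twist B k j m) | _ \<Rightarrow> n)"
| "twist (Bang A) k j = (\<lambda>n. case n of Sub m \<Rightarrow> Sub (twist A k (Suc j) m) | _ \<Rightarrow> n)"
| "twist (Whynot A) k j = (\<lambda>n. case n of Sub m \<Rightarrow> Sub (twist A k (Suc j) m) | _ \<Rightarrow> n)"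
| "twist (Paragraph A) k j = (\<lambda>n. case n of Sub m \<Rightarrow> Sub (twist A k (Suc j) m) | _ \<Rightarrow> n)"

lemma twist_twist: "twist A k j (twist A k j n) = n"
 by (induction A arbitrary: j n) (auto split: nm.split)

lemma twist_inj: "inj (twist A k j)"
 by (metis injI twist_twist)

lemma twist_root [simp]: "twist A k j Neg = Neg" "twist A k j Pos = Pos"
 by (cases A; simp)+

lemma twist_lab: "idlab (bullet X A) (twist A k j n) = idlab (bullet X A) n"
 by (induction A arbitrary: j n) (auto split: nm.split)

lemma twist_loc: "idloc (bullet X A) (twist A k j n) = map_option (twist A k j) (idloc (bullet X A) n)"
 by (induction A arbitrary: j n) (auto split: nm.split option.split simp: option.map_comp comp_def)

lemma bullet_not_pair: "atom_pair (Tensor (bullet X A) B) = False" "atom_pair (Par (bullet X A) B) = False"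
 by (auto simp: atom_pair_def bullet_not_atom)

lemma crossed_atom:
 assumes F: "F = Tensor (Atom X) (Atom X) \<or> F = Par (NAtom X) (NAtom X)"
 shows "map_link (if j = k then id(Lt Pos := Rt Pos, Rt Pos := Lt Pos) else id) ` crossed X k F j = idl F (\<lambda>i. i = k) j"
proof -
 \<comment> \<open>\<open>s\<close> is the side of the tensor and \<open>s'\<close> that of the par:
   positive and negative for a substituted atom, the reverse for a substituted negated atom.\<close>
 define s s' where "s = (if F = Tensor (Atom X) (Atom X) then Pos else Neg)" and "s' = (if F = Tensor (Atom X) (Atom X) then Neg else Pos)"
 have L: "idl0 F = id_links (Lt s) (Rt s) s (Lt s') (Rt s') s'"
  using F by (elim disjE) (simp_all add: s_def s'_def id_links_def insert_commute
   Upair_swap[of "Lt Pos" "Lt Neg"] Upair_swap[of "Rt Pos" "Rt Neg"])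
 have ts: "tsub X k F j p q t p' q' u \<longleftrightarrow> j = k \<and> p = Lt s \<and> q = Rt s \<and> t = s \<and> p' = Lt s' \<and> q' = Rt s' \<and> u = s'" for p q t p' q' u
 proof
  assume h: "tsub X k F j p q t p' q' u"
  then have "TensorL p q t \<in> idl0 F" "ParL p' q' u \<in> idl0 F" unfolding tsub_def id_links_def by simp_all
  then have e: "p = Lt s \<and> q = Rt s \<and> t = s \<and> p' = Lt s' \<and> q' = Rt s' \<and> u = s'" unfolding L id_links_def by simp
  have "nlev F j t = k" using h by (simp add: tsub_def)
  then show "j = k \<and> p = Lt s \<and> q = Rt s \<and> t = s \<and> p' = Lt s' \<and> q' = Rt s' \<and> u = s'" using e by (auto simp: s_def split: if_splits)
 next
  assume "j = k \<and> p = Lt s \<and> q = Rt s \<and> t = s \<and> p' = Lt s' \<and> q' = Rt s' \<and> u = s'"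
  then show "tsub X k F j p q t p' q' u" unfolding tsub_def using L F by (auto simp: s_def s'_def)
 qed
 show ?thesis
 proof (cases "j = k")
  case True
  have "crossed X k F j = gamma_links (Lt s) (Rt s) s (Lt s') (Rt s') s'"
   unfolding crossed_def ts L using True by simp
  with F True show ?thesis
   by (elim disjE) (simp_all add: s_def s'_def gamma_links_def atom_pair_def insert_commute
    Upair_swap[of "Lt Pos" "Lt Neg"] Upair_swap[of "Rt Pos" "Rt Neg"])
 next
  case False
  have "crossed X k F j = idl0 F" unfolding crossed_def ts using False by simp
  with F False show ?thesis by (elim disjE) (simp_all add: link.map_id0)
 qed
qed

lemma crossed_bullet: "map_link (twist A k j) ` crossed X k (bullet X A) j = idl (bullet X A) (\<lambda>i. i = k) j"
proof (induction A arbitrary: j)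
 case (Atom Z)
 then show ?case using crossed_atom[of "bullet X (Atom Z)" X j k] by (simp del: fun_upd_apply)
next
 case (NAtom Z)
 then show ?case using crossed_atom[of "bullet X (NAtom Z)" X j k] by (simp del: fun_upd_apply)
next
 case One
 have "crossed X k One j = idl0 One" unfolding crossed_def tsub_def by (auto simp: id_links_def)
 then show ?case by simp
next
 case Bot
 have "crossed X k Bot j = idl0 Bot" unfolding crossed_def tsub_def by (auto simp: id_links_def)
 then show ?case by simp
next
 case (Tensor A B)
 have c: "twist (Tensor A B) k j \<circ> Lt = Lt \<circ> twist A k j" "twist (Tensor A B) k j \<circ> Rt = Rt \<circ> twist B k j" by auto
 have 1: "crossed X k (bullet X (Tensor A B)) j = {ParL (Lt Neg) (Rt Neg) Neg, TensorL (Lt Pos) (Rt Pos) Pos} \<union>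
   map_link Lt ` crossed X k (bullet X A) j \<union> map_link Rt ` crossed X k (bullet X B) j"
  by (rule crossed_node2) (auto simp: bullet_not_atom)
 have 2: "map_link (twist (Tensor A B) k j) ` map_link Lt ` S = map_link Lt ` map_link (twist A k j) ` S"
  "map_link (twist (Tensor A B) k j) ` map_link Rt ` S = map_link Rt ` map_link (twist B k j) ` S" for S
  unfolding image_image map_link_comp c by simp_all
 show ?case unfolding 1 image_Un 2 Tensor.IH by (simp add: bullet_not_pair)
next
 case (Par A B)
 have c: "twist (Par A B) k j \<circ> Lt = Lt \<circ> twist A k j" "twist (Par A B) k j \<circ> Rt = Rt \<circ> twist B k j" by auto
 have 1: "crossed X k (bullet X (Par A B)) j = {TensorL (Lt Neg) (Rt Neg) Neg, ParL (Lt Pos) (Rt Pos) Pos} \<union>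
   map_link Lt ` crossed X k (bullet X A) j \<union> map_link Rt ` crossed X k (bullet X B) j"
  by (rule crossed_node2) (auto simp: bullet_not_atom)
 have 2: "map_link (twist (Par A B) k j) ` map_link Lt ` S = map_link Lt ` map_link (twist A k j) ` S"
  "map_link (twist (Par A B) k j) ` map_link Rt ` S = map_link Rt ` map_link (twist B k j) ` S" for S
  unfolding image_image map_link_comp c by simp_all
 show ?case unfolding 1 image_Un 2 Par.IH by (simp add: bullet_not_pair)
next
 case (Bang A)
 have c: "twist (Bang A) k j \<circ> Sub = Sub \<circ> twist A k (Suc j)" by auto
 have 1: "crossed X k (bullet X (Bang A)) j = {WhynotL {|Aux|} Neg, PaxL Flt Aux, FlatL (Sub Neg) Flt, BangL (Sub Pos) Pos} \<union>
   map_link Sub ` crossed X k (bullet X A) (Suc j)"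
  by (rule crossed_node1) (auto simp: idl_untwisted[of _ "Suc 0"])
 have 2: "map_link (twist (Bang A) k j) ` map_link Sub ` S = map_link Sub ` map_link (twist A k (Suc j)) ` S" for S
  unfolding image_image map_link_comp c by simp
 show ?case unfolding 1 image_Un 2 Bang.IH by simp
next
 case (Whynot A)
 have c: "twist (Whynot A) k j \<circ> Sub = Sub \<circ> twist A k (Suc j)" by auto
 have 1: "crossed X k (bullet X (Whynot A)) j = {BangL (Sub Neg) Neg, FlatL (Sub Pos) Flt, PaxL Flt Aux, WhynotL {|Aux|} Pos} \<union>
   map_link Sub ` crossed X k (bullet X A) (Suc j)"
  by (rule crossed_node1) (auto simp: idl_untwisted[of _ "Suc 0"])
 have 2: "map_link (twist (Whynot A) k j) ` map_link Sub ` S = map_link Sub ` map_link (twist A k (Suc j)) ` S" for S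
  unfolding image_image map_link_comp c by simp
 show ?case unfolding 1 image_Un 2 Whynot.IH by simp
next
 case (Paragraph A)
 have c: "twist (Paragraph A) k j \<circ> Sub = Sub \<circ> twist A k (Suc j)" by auto
 have 1: "crossed X k (bullet X (Paragraph A)) j = {ParagraphL (Sub Neg) Neg, ParagraphL (Sub Pos) Pos} \<union>
   map_link Sub ` crossed X k (bullet X A) (Suc j)"
  by (rule crossed_node1) (auto simp: idl_untwisted[of _ "Suc 0"])
 have 2: "map_link (twist (Paragraph A) k j) ` map_link Sub ` S = map_link Sub ` map_link (twist A k (Suc j)) ` S" for S
  unfolding image_image map_link_comp c by simp
 show ?case unfolding 1 image_Un 2 Paragraph.IH by simp
qed

text \<open>The expanded identity underlying a test is the tree up to isomorphism. Its crossed
  subnets are those found by \<open>nlev\<close>, and \<open>twist\<close> brings the result to the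
  form used for the stages.\<close>

lemma test_tree:
 assumes "is_test X A k T" shows "siso (tree (bullet X A) (\<lambda>i. i = k)) T"
proof -
 define F where "F = bullet X A"
 obtain N where idn: "identity_net F N" and T: "T = cross_level X k N" using assms unfolding is_test_def F_def by blast
 have N: "is_net N" "cut_free N" using identity_net_tree[OF idn] by blast+
 obtain f where f: "iso_by f N (tree F (\<lambda>_. False))" using identity_net_tree[OF idn] by blast
 have inj: "inj_on f (edges N)" using f boxed_reach[OF net_boxed[OF N(1)]] unfolding iso_by_def by metis
 have im0: "map_link f ` links N = links (tree F (\<lambda>_. False))" using f unfolding iso_by_def by blast
 have im: "map_link f ` links N = idl0 F" unfolding im0 tree_def by simp
 have cT: "conclusions (tree F (\<lambda>_. False)) = f ` conclusions N" by (rule iso_conclusions[OF inj im0])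
 have lab: "idlab F (f e) = lab N e" and loc: "idloc F (f e) = map_option f (loc N e)" if "e \<in> edges N" for e
  using f that unfolding iso_by_def by (simp_all add: tree_def)
 have eT: "edges (tree F (\<lambda>_. False)) = f ` edges N" by (rule iso_by_edges'[OF f])
 define I0 where "I0 e = nlev F 0 (f e)" for e
 have ix: "indexed (\<lambda>e. int (I0 e)) l" if "l \<in> links N" for l
 proof -
  have "map_link f l \<in> idl F (\<lambda>_. False) 0" using that unfolding im[symmetric] by blast
  then have "indexed (\<lambda>n. int (nlev F 0 n)) (map_link f l)" by (rule nlev_indexed)
  then show ?thesis unfolding indexed_map I0_def comp_def .
 qed
 have c0: "I0 e = 0" if "e \<in> conclusions N" for e
 proof -
  have "f e \<in> conclusions (tree F (\<lambda>_. False))" using that unfolding cT by blast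
  then show ?thesis unfolding tree_conclusions by (auto simp: I0_def)
 qed
 have d0: "default_indexing N (\<lambda>e. int (I0 e))"
  using ix c0 by (simp add: default_indexing_def exp_indexing_def)
 have lv0: "levelling N I0" using ix c0 by (simp add: levelling_def)
 have du: "I e = int (I0 e)" if "default_indexing N I" "e \<in> edges N" for I e
 proof -
  have I: "\<And>l. l \<in> links N \<Longrightarrow> indexed I l" "\<And>c. c \<in> conclusions N \<Longrightarrow> I c = 0"
   using that(1) unfolding default_indexing_def exp_indexing_def by blast+
  have "I e = 0 + int (I0 e)" by (rule indexing_levelling[OF N lv0 I(2) I(1) that(2)])
  then show ?thesis by simp
 qed
 have mi: "map_link f l \<in> idl0 F \<longleftrightarrow> l \<in> links N" if "set_link l \<subseteq> edges N" for l
 proof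
  assume "map_link f l \<in> idl0 F"
  then obtain l' where l': "l' \<in> links N" "map_link f l = map_link f l'" unfolding im[symmetric] by blast
  have "l = l'" by (rule link.inj_map_strong[OF _ l'(2)])
   (use that set_link_subset[OF l'(1)] inj in \<open>auto dest: inj_onD\<close>)
  then show "l \<in> links N" using l' by simp
 qed (use im in blast)
 have ids: "set_link l \<subseteq> edges N" if "l \<in> id_links p q t p' q' u" "{p, q, t, p', q', u} \<subseteq> edges N" for l p q t p' q' u
  using that by (auto simp: id_links_def)
 have ide: "{p, q, t, p', q', u} \<subseteq> edges N" if "id_links p q t p' q' u \<subseteq> links N" for p q t p' q' u
 proof -
  have "TensorL p q t \<in> links N" "ParL p' q' u \<in> links N" using that by (simp_all add: id_links_def)
  from this[THEN set_link_subset] show ?thesis by simp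
 qed
 have sub: "id_subnet_at_level X N k p q t p' q' u \<longleftrightarrow>
  {p, q, t, p', q', u} \<subseteq> edges N \<and> tsub X k F 0 (f p) (f q) (f t) (f p') (f q') (f u)" for p q t p' q' u
 proof (cases "{p, q, t, p', q', u} \<subseteq> edges N")
  case True
  have 1: "id_links (f p) (f q) (f t) (f p') (f q') (f u) \<subseteq> idl0 F \<longleftrightarrow> id_links p q t p' q' u \<subseteq> links N"
   unfolding mem_map_links using mi[OF ids[OF _ True]] by blast
  have 2: "(\<exists>I. default_indexing N I \<and> I t = int k \<and> I u = int k) \<longleftrightarrow> I0 t = k \<and> I0 u = k"
  proof
   assume "\<exists>I. default_indexing N I \<and> I t = int k \<and> I u = int k"
   then obtain I where "default_indexing N I" "I t = int k" "I u = int k" by blast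
   then show "I0 t = k \<and> I0 u = k" using du[of I t] du[of I u] True by simp
  next
   assume "I0 t = k \<and> I0 u = k"
   then show "\<exists>I. default_indexing N I \<and> I t = int k \<and> I u = int k"
    by (intro exI[of _ "\<lambda>e. int (I0 e)"] conjI d0) simp_all
  qed
  show ?thesis unfolding id_subnet_at_level_def tsub_def 1 2 using True lab[of p] lab[of q] by (simp add: I0_def)
 next
  case False
  then show ?thesis using ide unfolding id_subnet_at_level_def by blast
 qed
 have ts: "tsub X k F 0 p q t p' q' u \<longleftrightarrow> lifted f (id_subnet_at_level X N k) p q t p' q' u"
  for p q t p' q' u
 proof
  assume h: "tsub X k F 0 p q t p' q' u"
  then have "TensorL p q t \<in> idl F (\<lambda>_. False) 0" "ParL p' q' u \<in> idl F (\<lambda>_. False) 0"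
   unfolding tsub_def id_links_def by simp_all
  from this[THEN idl_set_link] have "{p, q, t, p', q', u} \<subseteq> f ` edges N" using eT tree_edges by simp
  then obtain p0 q0 t0 p0' q0' u0 where "p = f p0" "q = f q0" "t = f t0" "p' = f p0'" "q' = f q0'" "u = f u0"
   "{p0, q0, t0, p0', q0', u0} \<subseteq> edges N" by (simp add: image_iff) blast
  then show "lifted f (id_subnet_at_level X N k) p q t p' q' u" using h unfolding sub lifted_def by blast
 next
  assume "lifted f (id_subnet_at_level X N k) p q t p' q' u"
  then show "tsub X k F 0 p q t p' q' u" unfolding sub lifted_def by blast
 qed
 let ?I = "\<Union> {id_links p q t p' q' u | p q t p' q' u. id_subnet_at_level X N k p q t p' q' u}"
 let ?G = "\<Union> {gamma_links p q t p' q' u | p q t p' q' u. id_subnet_at_level X N k p q t p' q' u}"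
 have lT: "links T = (links N - ?I) \<union> ?G" "lab T = lab N" "loc T = loc N" unfolding T cross_level_def by simp_all
 have IN: "?I \<subseteq> links N" unfolding id_subnet_at_level_def by blast
 have fi: "inj_on (map_link f) (links N)"
 proof (rule inj_onI)
  fix l l' assume "l \<in> links N" "l' \<in> links N" "map_link f l = map_link f l'"
  then show "l = l'" using set_link_subset[of l N] set_link_subset[of l' N] inj by (intro link.inj_map_strong[of l l' f f]) (blast dest: inj_onD, assumption)
 qed
 have tI: "\<Union> {id_links p q t p' q' u | p q t p' q' u. tsub X k F 0 p q t p' q' u} = map_link f ` ?I"
  unfolding ts by (rule tuples_image[OF mem_map_links(1)])
 have tG: "\<Union> {gamma_links p q t p' q' u | p q t p' q' u. tsub X k F 0 p q t p' q' u} = map_link f ` ?G"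
  unfolding ts by (rule tuples_image[OF mem_map_links(2)])
 have "map_link f ` (links N - ?I) = idl0 F - map_link f ` ?I"
  using inj_on_image_set_diff[OF fi Diff_subset IN] unfolding im .
 then have cr: "map_link f ` links T = crossed X k F 0"
  unfolding lT(1) crossed_def image_Un tI tG by simp
 have ET: "edges T \<subseteq> edges N"
 proof -
  have "set_link l \<subseteq> edges N" if "l \<in> links T" for l
  proof -
   from that consider "l \<in> links N" | "l \<in> ?G" unfolding lT(1) by blast
   then show ?thesis
   proof cases
    case 1 then show ?thesis by (rule set_link_subset)
   next
    case 2
    then obtain p q t p' q' u where "id_subnet_at_level X N k p q t p' q' u" "l \<in> gamma_links p q t p' q' u"
     unfolding mem_tuples by blast
    then show ?thesis unfolding sub gamma_links_def by auto
   qed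
  qed
  then show ?thesis unfolding edges_eq[of T] by blast
 qed
 have "iso_by (twist A k 0 \<circ> f) T (tree F (\<lambda>i. i = k))" unfolding iso_by_def
 proof (intro conjI ballI)
  have "reach T \<subseteq> edges N" using ET net_boxed[OF N(1)] lT(3) unfolding reach_def boxed_def by auto
  then show "inj_on (twist A k 0 \<circ> f) (reach T)"
   by (intro comp_inj_on inj_on_subset[OF inj] inj_on_subset[OF twist_inj subset_UNIV])
  have "map_link (twist A k 0 \<circ> f) ` links T = map_link (twist A k 0) ` map_link f ` links T"
   unfolding image_image map_link_comp ..
  then show "map_link (twist A k 0 \<circ> f) ` links T = links (tree F (\<lambda>i. i = k))"
   unfolding cr unfolding F_def crossed_bullet by (simp add: tree_def)
  fix e assume "e \<in> edges T"
  then have e: "e \<in> edges N" using ET by blast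
  show "lab (tree F (\<lambda>i. i = k)) ((twist A k 0 \<circ> f) e) = lab T e"
   using lab[OF e] twist_lab[of X A k 0] by (simp add: tree_def lT F_def)
  show "loc (tree F (\<lambda>i. i = k)) ((twist A k 0 \<circ> f) e) = map_option (twist A k 0 \<circ> f) (loc T e)"
   using loc[OF e] twist_loc[of X A k 0] by (simp add: tree_def lT F_def option.map_comp)
 qed
 then have "siso T (tree F (\<lambda>i. i = k))" unfolding siso_def by blast
 then show ?thesis unfolding F_def by (rule siso_sym)
qed

subsection \<open>The substituted net\<close>

primrec base :: "'e sub \<Rightarrow> 'e" where
 "base (Whole e) = e" | "base (Lft e) = e" | "base (Rgt e) = e"

locale substituted =
 fixes N :: "'e net" and X :: nat and lv :: "'e \<Rightarrow> nat" and c :: 'e and A :: form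
 assumes net: "is_net N" and cf: "cut_free N" and lev: "levelling N lv" and eta: "eta_expanded N"
  and concl: "conclusions N = {c}" and concl_lab: "lab N c = Fm A"
begin

text \<open>Orients an axiom by putting its atom first, as \<open>bullet_net\<close> does in
  choosing the conclusion that receives the tensor.\<close>

definition ax :: "'e \<Rightarrow> 'e \<Rightarrow> bool" where
 "ax e e' \<longleftrightarrow> AxL (Upair e e') \<in> links N \<and> (\<exists>Z. lab N e = Fm (Atom Z))"

definition pos :: "'e \<Rightarrow> bool" where
 "pos e \<longleftrightarrow> (\<exists>Z. lab N e = Fm (Atom Z))"

abbreviation B :: "'e sub net" where
 "B \<equiv> bullet_net X N"

lemma ax_lab: assumes "ax e e'" shows "\<exists>Z. lab N e = Fm (Atom Z) \<and> lab N e' = Fm (NAtom Z)"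
proof -
 obtain Z where Z: "lab N e = Fm (Atom Z)" and l: "AxL (Upair e e') \<in> links N" using assms unfolding ax_def by blast
 have "typed N (AxL (Upair e e'))" using net_typed[OF net l] .
 then obtain x y F where "Upair e e' = Upair x y" "lab N x = Fm F" "lab N y = Fm (dual F)" by auto
 then show ?thesis using Z by (cases F) (auto simp: Upair_inject)
qed

lemma ax_pos: "ax e e' \<Longrightarrow> pos e" "ax e e' \<Longrightarrow> \<not> pos e'"
 using ax_lab by (fastforce simp: pos_def)+

lemma ax_ex: assumes l: "AxL u \<in> links N" shows "\<exists>e e'. u = Upair e e' \<and> ax e e'"
proof -
 obtain x y where u: "u = Upair x y" by (cases u)
 have t: "typed N (AxL u)" using net_typed[OF net l] .
 obtain x y F where u: "u = Upair x y" "lab N x = Fm F" "lab N y = Fm (dual F)" using t by auto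
 obtain Z where "F = Atom Z \<or> F = NAtom Z" using eta l u unfolding eta_expanded_def by fastforce
 then show ?thesis
 proof
  assume "F = Atom Z"
  then show ?thesis using l u unfolding ax_def by blast
 next
  assume "F = NAtom Z"
  then have "ax y x" using l u Upair_swap[of x y] unfolding ax_def by simp
  then show ?thesis using u Upair_swap[of x y] by blast
 qed
qed

section \<open>Links and edges of the substituted net\<close>

lemma links_B:
 "l \<in> links B \<longleftrightarrow> (\<exists>m\<in>links N. (\<forall>u. m \<noteq> AxL u) \<and> l = map_link Whole m) \<or>
  (\<exists>e e'. ax e e' \<and> l \<in> id_links (Lft e) (Rgt e) (Whole e) (Lft e') (Rgt e') (Whole e'))"
proof -
 have mem: "l \<in> \<Union> {h e e' | e e'. P e e'} \<longleftrightarrow> (\<exists>e e'. P e e' \<and> l \<in> h e e')" for h :: "'e \<Rightarrow> 'e \<Rightarrow> 'e sub link set" and P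
  by blast
 show ?thesis unfolding bullet_net_def ax_def net.select_convs Un_iff mem image_iff by blast
qed

lemma B_cases [consumes 1, case_names old tensor par left right]:
 assumes "l \<in> links B"
 obtains m where "m \<in> links N" "\<And>u. m \<noteq> AxL u" "l = map_link Whole m"
 | e e' where "ax e e'" "l = TensorL (Lft e) (Rgt e) (Whole e)"
 | e e' where "ax e e'" "l = ParL (Lft e') (Rgt e') (Whole e')"
 | e e' where "ax e e'" "l = AxL (Upair (Lft e) (Lft e'))"
 | e e' where "ax e e'" "l = AxL (Upair (Rgt e) (Rgt e'))"
 using assms unfolding links_B id_links_def by blast

lemma B_links:
 "m \<in> links N \<Longrightarrow> (\<And>u. m \<noteq> AxL u) \<Longrightarrow> map_link Whole m \<in> links B"
 "ax e e' \<Longrightarrow> TensorL (Lft e) (Rgt e) (Whole e) \<in> links B"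
 "ax e e' \<Longrightarrow> ParL (Lft e') (Rgt e') (Whole e') \<in> links B"
 "ax e e' \<Longrightarrow> AxL (Upair (Lft e) (Lft e')) \<in> links B"
 "ax e e' \<Longrightarrow> AxL (Upair (Rgt e) (Rgt e')) \<in> links B"
 unfolding links_B id_links_def by blast+

lemma lab_B:
 "lab B (Whole e) = bullet_label X (lab N e)"
 "lab B (Lft e) = Fm (if pos e then Atom X else NAtom X)"
 "lab B (Rgt e) = Fm (if pos e then Atom X else NAtom X)"
 by (simp_all add: bullet_net_def pos_def)

lemma loc_B: "loc B y = map_option Whole (loc N (base y))"
 by (cases y) (simp_all add: bullet_net_def)

lemma ax_edges: "ax e e' \<Longrightarrow> e \<in> edges N" "ax e e' \<Longrightarrow> e' \<in> edges N"
 unfolding ax_def using concls_subset by fastforce+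

lemma ax_loc: assumes "ax e e'" shows "loc N e' = loc N e"
 by (rule loc_link[OF net, of "AxL (Upair e e')"]) (use assms in \<open>simp_all add: ax_def is_door_def\<close>)

lemma ax_unique:
 assumes "ax e e'"
 shows "ax e d \<Longrightarrow> d = e'" "ax d e' \<Longrightarrow> d = e" "l \<in> links N \<Longrightarrow> e \<in> concls l \<Longrightarrow> l = AxL (Upair e e')"
  "l \<in> links N \<Longrightarrow> e' \<in> concls l \<Longrightarrow> l = AxL (Upair e e')"
proof -
 have l: "AxL (Upair e e') \<in> links N" using assms by (simp add: ax_def)
 show 1: "l = AxL (Upair e e')" if "l \<in> links N" "e \<in> concls l" for l
  by (rule producer_unique[OF net that(1) l that(2)]) simp
 show 2: "l = AxL (Upair e e')" if "l \<in> links N" "e' \<in> concls l" for l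
  by (rule producer_unique[OF net that(1) l that(2)]) simp
 show "d = e'" if "ax e d"
 proof -
  have "AxL (Upair e d) = AxL (Upair e e')" by (rule 1) (use that in \<open>simp_all add: ax_def\<close>)
  then show ?thesis by (auto simp: Upair_inject)
 qed
 show "d = e" if "ax d e'"
 proof -
  have "AxL (Upair d e') = AxL (Upair e e')" by (rule 2) (use that in \<open>simp_all add: ax_def\<close>)
  then show ?thesis by (auto simp: Upair_inject)
 qed
qed

definition mate :: "'e \<Rightarrow> 'e" where
 "mate e = (THE d. ax e d \<or> ax d e)"

lemma mate: assumes "ax e e'" shows "mate e = e'" "mate e' = e"
proof -
 have "ax d e \<Longrightarrow> False" "ax e' d \<Longrightarrow> False" for d using assms ax_pos by blast+
 then show "mate e = e'" "mate e' = e" unfolding mate_def using assms ax_unique(1,2) by (blast intro!: the_equality)+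
qed

lemma producer_Whole: assumes "e \<in> edges N" shows "\<exists>l\<in>links B. Whole e \<in> concls l"
proof -
 obtain l where l: "l \<in> links N" "e \<in> concls l" using producer_ex[OF net assms] by blast
 show ?thesis
 proof (cases "\<exists>u. l = AxL u")
  case True
  then obtain a b where ab: "l = AxL (Upair a b)" "ax a b" using ax_ex l(1) by blast
  then have "e = a \<or> e = b" using l(2) by auto
  then show ?thesis
  proof
   assume "e = a"
   then show ?thesis by (intro bexI[OF _ B_links(2)[OF ab(2)]]) simp
  next
   assume "e = b"
   then show ?thesis by (intro bexI[OF _ B_links(3)[OF ab(2)]]) simp
  qed
 next
  case False
  then have "map_link Whole l \<in> links B" using B_links(1)[OF l(1)] by blast
  then show ?thesis using l(2) by (intro bexI[of _ "map_link Whole l"]) simp_all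
 qed
qed

lemma B_children: assumes "ax e d \<or> ax d e" shows "\<exists>l\<in>links B. Lft e \<in> prems l \<and> Rgt e \<in> prems l"
 using assms
proof
 assume "ax e d"
 then show ?thesis by (intro bexI[OF _ B_links(2)]) simp_all
next
 assume "ax d e"
 then show ?thesis by (intro bexI[OF _ B_links(3)]) simp_all
qed

lemma B_axioms: assumes "ax e d \<or> ax d e"
 shows "\<exists>l\<in>links B. Lft e \<in> concls l" "\<exists>l\<in>links B. Rgt e \<in> concls l"
 using assms
proof -
 show "\<exists>l\<in>links B. Lft e \<in> concls l" using assms
 proof
  assume "ax e d"
  then show ?thesis by (intro bexI[OF _ B_links(4)]) simp_all
 next
  assume "ax d e"
  then show ?thesis by (intro bexI[OF _ B_links(4)]) simp_all
 qed
 show "\<exists>l\<in>links B. Rgt e \<in> concls l" using assms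
 proof
  assume "ax e d"
  then show ?thesis by (intro bexI[OF _ B_links(5)]) simp_all
 next
  assume "ax d e"
  then show ?thesis by (intro bexI[OF _ B_links(5)]) simp_all
 qed
qed

lemma edges_B:
 "y \<in> edges B \<Longrightarrow> base y \<in> edges N"
 "Whole e \<in> edges B \<longleftrightarrow> e \<in> edges N"
 "Lft e \<in> edges B \<longleftrightarrow> (\<exists>d. ax e d \<or> ax d e)" "Rgt e \<in> edges B \<longleftrightarrow> (\<exists>d. ax e d \<or> ax d e)"
proof -
 have mem: "y \<in> edges B \<longleftrightarrow> (\<exists>l\<in>links B. y \<in> set_link l)" for y unfolding edges_eq by blast
 show 1: "base y \<in> edges N" if y: "y \<in> edges B" for y
 proof -
  obtain l where "l \<in> links B" "y \<in> set_link l" using y mem by blast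
  then show ?thesis
  proof (cases rule: B_cases)
   case (old m)
   then show ?thesis using \<open>y \<in> set_link l\<close> set_link_subset[OF old(1)] by (auto simp: link.set_map)
  qed (use \<open>y \<in> set_link l\<close> ax_edges in auto)
 qed
 show "Whole e \<in> edges B \<longleftrightarrow> e \<in> edges N"
 proof
  assume "e \<in> edges N"
  then show "Whole e \<in> edges B" using producer_Whole unfolding mem set_link_eq by blast
 qed (use 1 in fastforce)
 show "Lft e \<in> edges B \<longleftrightarrow> (\<exists>d. ax e d \<or> ax d e)"
 proof
  assume "Lft e \<in> edges B"
  then obtain l where "l \<in> links B" "Lft e \<in> set_link l" unfolding mem by blast
  then show "\<exists>d. ax e d \<or> ax d e" by (cases rule: B_cases) (auto simp: link.set_map)
 next
  assume "\<exists>d. ax e d \<or> ax d e"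
  then show "Lft e \<in> edges B" using B_axioms(1) unfolding mem set_link_eq by blast
 qed
 show "Rgt e \<in> edges B \<longleftrightarrow> (\<exists>d. ax e d \<or> ax d e)"
 proof
  assume "Rgt e \<in> edges B"
  then obtain l where "l \<in> links B" "Rgt e \<in> set_link l" unfolding mem by blast
  then show "\<exists>d. ax e d \<or> ax d e" by (cases rule: B_cases) (auto simp: link.set_map)
 next
  assume "\<exists>d. ax e d \<or> ax d e"
  then show "Rgt e \<in> edges B" using B_axioms(2) unfolding mem set_link_eq by blast
 qed
qed

text \<open>A link computed from the edge it should conclude. Any link of the substituted net equals
  \<open>producer\<close> of its conclusions, which settles uniqueness of producers;
  \<open>consumer\<close> does the same for premises.\<close>

fun producer :: "'e sub \<Rightarrow> 'e sub link" where
 "producer (Whole e) = (if \<exists>d. ax e d then TensorL (Lft e) (Rgt e) (Whole e)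
   else if \<exists>d. ax d e then ParL (Lft e) (Rgt e) (Whole e) else map_link Whole (THE l. l \<in> links N \<and> e \<in> concls l))"
| "producer (Lft e) = AxL (Upair (Lft e) (Lft (mate e)))"
| "producer (Rgt e) = AxL (Upair (Rgt e) (Rgt (mate e)))"

lemma producer: assumes l: "l \<in> links B" and y: "y \<in> concls l" shows "l = producer y"
 using l
proof (cases rule: B_cases)
 case (old m)
 then obtain e where e: "y = Whole e" "e \<in> concls m" using y by auto
 have "\<not> Ex (ax e)" "\<not> (\<exists>d. ax d e)" using ax_unique(3,4) old(1,2) e(2) by blast+
 moreover have "(THE l. l \<in> links N \<and> e \<in> concls l) = m"
  using old(1) e(2) producer_unique[OF net] by (blast intro: the_equality)
 ultimately show ?thesis using old e by auto
next
 case (tensor e e')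
 then have "Ex (ax e)" by blast
 then show ?thesis using y tensor by simp
next
 case (par e e')
 then have "\<not> Ex (ax e')" "\<exists>d. ax d e'" using ax_pos by blast+
 then show ?thesis using y par by simp
next
 case (left e e')
 then show ?thesis using y mate[OF left(1)] Upair_swap[of "Lft e" "Lft e'"] by auto
next
 case (right e e')
 then show ?thesis using y mate[OF right(1)] Upair_swap[of "Rgt e" "Rgt e'"] by auto
qed

fun consumer :: "'e sub \<Rightarrow> 'e sub link" where
 "consumer (Whole e) = map_link Whole (THE l. l \<in> links N \<and> e \<in> prems l)"
| "consumer (Lft e) = (if pos e then TensorL (Lft e) (Rgt e) (Whole e) else ParL (Lft e) (Rgt e) (Whole e))"
| "consumer (Rgt e) = (if pos e then TensorL (Lft e) (Rgt e) (Whole e) else ParL (Lft e) (Rgt e) (Whole e))"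

lemma consumer: assumes l: "l \<in> links B" and y: "y \<in> prems l" shows "l = consumer y"
 using l
proof (cases rule: B_cases)
 case (old m)
 then obtain e where e: "y = Whole e" "e \<in> prems m" using y by auto
 have "(THE l. l \<in> links N \<and> e \<in> prems l) = m"
  using old(1) e(2) consumer_unique[OF net] by (blast intro: the_equality)
 then show ?thesis using old e by simp
qed (use y ax_pos in auto)

lemma conclusions_B: "conclusions B = {Whole c}"
proof -
 have "y \<in> conclusions B \<longleftrightarrow> y = Whole c" for y
 proof (cases y)
  case (Whole e)
  have "(\<exists>l\<in>links B. Whole e \<in> prems l) \<longleftrightarrow> (\<exists>m\<in>links N. e \<in> prems m)"
  proof
   assume "\<exists>l\<in>links B. Whole e \<in> prems l"
   then obtain l where "l \<in> links B" "Whole e \<in> prems l" by blast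
   then show "\<exists>m\<in>links N. e \<in> prems m" by (cases rule: B_cases) auto
  next
   assume "\<exists>m\<in>links N. e \<in> prems m"
   then obtain m where m: "m \<in> links N" "e \<in> prems m" by blast
   then have "map_link Whole m \<in> links B" by (intro B_links(1)) auto
   then show "\<exists>l\<in>links B. Whole e \<in> prems l" using m(2) by (intro bexI[of _ "map_link Whole m"]) auto
  qed
  then have "y \<in> conclusions B \<longleftrightarrow> e \<in> conclusions N" unfolding conclusions_def Whole using edges_B(2) by blast
  then show ?thesis unfolding concl Whole by simp
 next
  case (Lft e)
  have "\<exists>l\<in>links B. Lft e \<in> prems l" if "Lft e \<in> edges B"
   using that B_children unfolding edges_B by blast
  then show ?thesis unfolding Lft conclusions_def by blast
 next
  case (Rgt e)
  have "\<exists>l\<in>links B. Rgt e \<in> prems l" if "Rgt e \<in> edges B"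
   using that B_children unfolding edges_B by blast
  then show ?thesis unfolding Rgt conclusions_def by blast
 qed
 then show ?thesis by blast
qed

lemma B_typed: assumes "l \<in> links B" shows "typed B l"
 using assms
proof (cases rule: B_cases)
 case (old m)
 have "typed N m" by (rule net_typed[OF net old(1)])
 moreover have "m \<noteq> CutL u" for u using old(1) cf by (auto simp: cut_free_def)
 ultimately show ?thesis using old(2) unfolding old(3) by (cases m) (auto simp: lab_B)
next
 case (tensor e e')
 then show ?thesis using ax_lab[OF tensor(1)] ax_pos(1)[OF tensor(1)] by (auto simp: lab_B)
next
 case (par e e')
 then show ?thesis using ax_lab[OF par(1)] ax_pos(2)[OF par(1)] by (auto simp: lab_B)
next
 case (left e e')
 have "lab B (Lft e) = Fm (Atom X)" "lab B (Lft e') = Fm (dual (Atom X))" using ax_pos[OF left(1)] by (simp_all add: lab_B)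
 then show ?thesis unfolding left(2) typed.simps by blast
next
 case (right e e')
 have "lab B (Rgt e) = Fm (Atom X)" "lab B (Rgt e') = Fm (dual (Atom X))" using ax_pos[OF right(1)] by (simp_all add: lab_B)
 then show ?thesis unfolding right(2) typed.simps by blast
qed

lemma B_well_boxed: "well_boxed B"
 unfolding well_boxed_def
proof (intro conjI ballI allI impI)
 fix l y y' assume l: "l \<in> links B" and nd: "\<not> is_door l" and y: "y \<in> prems l \<union> concls l" "y' \<in> prems l \<union> concls l"
 from l show "loc B y = loc B y'"
 proof (cases rule: B_cases)
  case (old m)
  have "\<not> is_door m" using nd unfolding old(3) is_door_def by (cases m) auto
  moreover obtain e e' where "e \<in> set_link m" "e' \<in> set_link m" "y = Whole e" "y' = Whole e'"
   using y unfolding old(3) by (auto simp: set_link_eq)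
  ultimately have "loc N e = loc N e'" by (intro loc_link[OF net old(1)])
  then show ?thesis using \<open>y = Whole e\<close> \<open>y' = Whole e'\<close> by (simp add: loc_B)
 next
  case (tensor e e')
  then show ?thesis using y by (auto simp: loc_B)
 next
  case (par e e')
  then show ?thesis using y by (auto simp: loc_B)
 next
  case (left e e')
  then show ?thesis using y ax_loc[OF left(1)] by (auto simp: loc_B)
 next
  case (right e e')
  then show ?thesis using y ax_loc[OF right(1)] by (auto simp: loc_B)
 qed
next
 fix p d assume "BangL p d \<in> links B"
 then obtain a b where "BangL a b \<in> links N" "p = Whole a" "d = Whole b"
  by (cases rule: B_cases) (auto simp: map_link_eq_iffs eq_commute[of "BangL _ _"])
 then show "loc B p = Some d" using loc_bang[OF net] by (simp add: loc_B)
next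
 fix p d assume "PaxL p d \<in> links B"
 then obtain a b where "PaxL a b \<in> links N" "p = Whole a" "d = Whole b"
  by (cases rule: B_cases) (auto simp: map_link_eq_iffs eq_commute[of "PaxL _ _"])
 then show "\<exists>b. loc B p = Some b \<and> loc B d = loc B b" using loc_pax[OF net] by (fastforce simp: loc_B)
next
 fix y b assume y: "y \<in> edges B" "loc B y = Some b"
 then obtain b' where b': "loc N (base y) = Some b'" "b = Whole b'" by (auto simp: loc_B)
 then obtain a where "BangL a b' \<in> links N" using loc_box[OF net edges_B(1)[OF y(1)]] by blast
 then have "map_link Whole (BangL a b') \<in> links B" by (intro B_links(1)) auto
 then show "\<exists>a. BangL a b \<in> links B" using b' by auto
next
 \<comment> \<open>Boxes are inherited from \<open>N\<close>, so \<open>base\<close> maps the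
   nesting relation into that of \<open>N\<close> and acyclicity is pulled back.\<close>
 have "wf (box_rel N)" by (rule finite_acyclic_wf[OF box_rel_finite[OF net] box_rel_acyclic[OF net]])
 then have "wf (inv_image (box_rel N) base)" by (rule wf_inv_image)
 moreover have "{(e, b). e \<in> edges B \<and> loc B e = Some b} \<subseteq> inv_image (box_rel N) base"
  using edges_B(1) by (auto simp: box_rel_def loc_B)
 ultimately show "acyclic {(e, b). e \<in> edges B \<and> loc B e = Some b}" by (meson acyclic_subset wf_acyclic)
next
 fix y assume "y \<in> conclusions B"
 then have "y = Whole c" by (simp add: conclusions_B)
 moreover have "loc N c = None" using net concl unfolding is_net_def well_boxed_def by blast
 ultimately show "loc B y = None" by (simp add: loc_B)
qed

lemma B_net: "is_net B"
 unfolding is_net_def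
proof (intro conjI ballI impI)
 have fN: "finite (links N)" using net by (simp add: is_net_def)
 have "{(e, e'). ax e e'} \<subseteq> edges N \<times> edges N" using ax_edges by blast
 then have "finite {(e, e'). ax e e'}" using net_finite[OF net] by (meson finite_SigmaI finite_subset)
 moreover have "links B \<subseteq> map_link Whole ` links N \<union>
   (\<Union>(e, e')\<in>{(e, e'). ax e e'}. id_links (Lft e) (Rgt e) (Whole e) (Lft e') (Rgt e') (Whole e'))"
  unfolding links_B subset_iff by blast
 ultimately show "finite (links B)" using fN by (elim finite_subset) (auto simp: id_links_def)
next
 fix y assume "y \<in> edges B"
 have ex: "\<exists>l. l \<in> links B \<and> y \<in> concls l"
 proof (cases y)
  case (Whole e)
  then show ?thesis using producer_Whole \<open>y \<in> edges B\<close> edges_B(2) by blast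
 next
  case (Lft e)
  then show ?thesis using B_axioms(1) \<open>y \<in> edges B\<close> edges_B(3) by blast
 next
  case (Rgt e)
  then show ?thesis using B_axioms(2) \<open>y \<in> edges B\<close> edges_B(4) by blast
 qed
 show "\<exists>!l. l \<in> links B \<and> y \<in> concls l" using ex producer by blast
next
 fix l l' assume "l \<in> links B" "l' \<in> links B" "prems l \<inter> prems l' \<noteq> {}"
 then show "l = l'" using consumer by blast
qed (rule B_typed B_well_boxed; assumption?)+

lemma B_cut_free: "cut_free B"
 unfolding cut_free_def
proof (intro allI notI)
 fix u assume "CutL u \<in> links B"
 then show False
 proof (cases rule: B_cases)
  case (old m)
  then show ?thesis using cf by (cases m) (auto simp: cut_free_def)
 qed auto
qed

text \<open>Pair links are multiplicative and keep the index, so the new leaves have the level of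
  the axiom conclusion they come from.\<close>

lemma B_levelling: "levelling B (lv \<circ> base)"
 unfolding levelling_def
proof (intro conjI ballI impI)
 fix l assume "l \<in> links B" and na: "\<forall>u. l \<noteq> AxL u"
 then show "indexed (\<lambda>e. int ((lv \<circ> base) e)) l"
 proof (cases rule: B_cases)
  case (old m)
  have "indexed (\<lambda>e. int (lv e)) m" using lev old(1,2) unfolding levelling_def by blast
  then show ?thesis unfolding old(3) indexed_map comp_def by simp
 qed (use na in auto)
next
 fix y assume "y \<in> conclusions B"
 then show "(lv \<circ> base) y = 0" using lev concl unfolding conclusions_B levelling_def by simp
qed

section \<open>The cut with a test as the first stage\<close>

lemma B_host: "host B (lv \<circ> base)"
proof
 fix y y' assume "AxL (Upair y y') \<in> links B"
 then show "\<exists>Z. lab B y = Fm (Atom Z) \<or> lab B y = Fm (NAtom Z)"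
 proof (cases rule: B_cases)
  case (old m)
  then show ?thesis by (cases m) auto
 qed (auto simp: lab_B Upair_inject)
next
 fix y assume "y \<in> conclusions B"
 then show "\<exists>A. lab B y = Fm A" using concl_lab by (simp add: conclusions_B lab_B)
qed (rule B_net B_cut_free B_levelling)+

text \<open>The front of the empty stage is the only conclusion, at level 0. So the state is the
  host, one cut and one tree with its root at level 0, which is a test up to names.\<close>

lemma state_init:
 assumes "siso (tree (bullet X A) tw) \<theta>"
 shows "siso (host.state B (lv \<circ> base) tw {}) (cut_nets (bullet X A) B \<theta>)"
proof -
 interpret h: host B "lv \<circ> base" tw by (rule B_host)
 define F where "F = bullet X A"
 obtain g where g: "iso_by g (tree F tw) \<theta>" using assms unfolding siso_def F_def by blast
 have gi: "inj_on g (nms F)" using g boxed_reach[OF tree_boxed] tree_edges unfolding iso_by_def by metis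
 have gl: "map_link g ` links (tree F tw) = links \<theta>" using g unfolding iso_by_def by blast
 have gc: "conclusions \<theta> = {g Neg, g Pos}"
  using iso_conclusions[OF _ gl] gi unfolding tree_edges tree_conclusions by simp
 have glab: "lab \<theta> (g n) = idlab F n" "loc \<theta> (g n) = map_option g (idloc F n)" if "n \<in> nms F" for n
  using g that tree_edges unfolding iso_by_def by (auto simp: tree_def)
 have fr: "h.front {} = {Whole c}" using h.front_init conclusions_B by simp
 have lc: "lab B (Whole c) = Fm F" by (simp add: lab_B concl_lab F_def)
 have fmc: "h.fm (Whole c) = F" by (rule h.fm_Fm[OF lc])
 have lv0: "lv c = 0" using lev concl by (simp add: levelling_def)
 have locc: "loc B (Whole c) = None" using B_well_boxed conclusions_B unfolding well_boxed_def by blast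
 have lk: "h.lk {} l = map_link Old l" if l: "l \<in> links B" for l
 proof -
  have low: "h.low {} y = Old y" if "y \<in> prems l" for y
  proof -
   have "y \<notin> conclusions B" using l that unfolding conclusions_def by blast
   then show ?thesis unfolding h.low_def fr conclusions_B by simp
  qed
  have "l \<noteq> CutL u" for u using l B_cut_free by (auto simp: cut_free_def)
  then show ?thesis using low by (cases l) (auto simp: h.swapped_def intro!: fset.map_cong)
 qed
 have L: "links (h.state {}) = map_link Old ` links B \<union>
   insert (CutL (Upair (Old (Whole c)) (New (Whole c) Neg))) (map_link (New (Whole c)) ` links (tree F tw))"
  unfolding h.state_simps(1) fr h.graft_def by (simp add: image_cong[OF refl lk] fmc lv0 tree_def)
 have C: "{CutL (Upair (Inl a) (Inr d)) | a d. a \<in> conclusions B \<and> lab B a = Fm F \<and> d \<in> conclusions \<theta> \<and> lab \<theta> d = Fm (dual F)} =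
   {CutL (Upair (Inl (Whole c)) (Inr (g Neg)))}"
 proof -
  \<comment> \<open>Since no formula equals its dual, only the negative conclusion of the test
    matches, and \<open>cut_nets\<close> creates a single cut.\<close>
  have ne: "G \<noteq> dual G" for G by (induction G) auto
  have "d \<in> conclusions \<theta> \<and> lab \<theta> d = Fm (dual F) \<longleftrightarrow> d = g Neg" for d
   using glab(1)[of Neg] glab(1)[of Pos] ne[of F] unfolding gc by auto
  then show ?thesis unfolding conclusions_B using lc by auto
 qed
 define s where "s x = (case x of Old z \<Rightarrow> Inl z | New z n \<Rightarrow> Inr (g n))" for x :: "'e sub name"
 have so: "s \<circ> Old = Inl" "s \<circ> New z = Inr \<circ> g" for z by (auto simp: s_def)
 have E: "edges (h.state {}) = Old ` edges B \<union> New (Whole c) ` nms F" unfolding h.state_edges fr by (simp add: fmc)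
 have "iso_by s (h.state {}) (cut_nets F B \<theta>)" unfolding iso_by_def
 proof (intro conjI ballI)
  show "inj_on s (reach (h.state {}))"
   unfolding boxed_reach[OF h.state_boxed] E
   by (rule inj_onI) (elim UnE imageE; hypsubst; simp add: s_def; drule inj_onD[OF gi]; simp)
  have "map_link s ` links (h.state {}) = map_link Inl ` links B \<union>
    insert (CutL (Upair (Inl (Whole c)) (Inr (g Neg)))) (map_link Inr ` map_link g ` links (tree F tw))"
   unfolding L image_Un image_insert image_image map_link_comp so by (simp add: s_def)
  then show "map_link s ` links (h.state {}) = links (cut_nets F B \<theta>)"
   unfolding gl cut_nets_def net.select_convs C by (simp add: Un_ac)
  fix x assume x: "x \<in> edges (h.state {})"
  then consider z where "x = Old z" | n where "x = New (Whole c) n" "n \<in> nms F" unfolding E by blast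
  then have "lab (cut_nets F B \<theta>) (s x) = lab (h.state {}) x \<and> loc (cut_nets F B \<theta>) (s x) = map_option s (loc (h.state {}) x)"
  proof cases
   case 1
   have "map_option s (map_option Old (loc B z)) = map_option Inl (loc B z)" by (simp add: option.map_comp so)
   then show ?thesis using 1 by (simp add: cut_nets_def s_def)
  next
   case 2
   then show ?thesis using glab[OF 2(2)] by (simp add: cut_nets_def s_def fmc locc split: option.split)
  qed
  then show "lab (cut_nets F B \<theta>) (s x) = lab (h.state {}) x"
   "loc (cut_nets F B \<theta>) (s x) = map_option s (loc (h.state {}) x)" by blast+
 qed
 then show ?thesis unfolding siso_def F_def by blast
qed

section \<open>The last stage compared with the substituted net\<close>

lemma lk_final:
 "\<lbrakk>m \<in> links N; \<And>u. m \<noteq> AxL u\<rbrakk> \<Longrightarrow> host.lk B (lv \<circ> base) tw (edges B) (map_link Whole m) = map_link Old (map_link Whole m)"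
 "ax e e' \<Longrightarrow> host.lk B (lv \<circ> base) tw (edges B) (TensorL (Lft e) (Rgt e) (Whole e)) =
   (if tw (lv e) then TensorL (Old (Rgt e)) (Old (Lft e)) (Old (Whole e)) else TensorL (Old (Lft e)) (Old (Rgt e)) (Old (Whole e)))"
 "ax e e' \<Longrightarrow> host.lk B (lv \<circ> base) tw (edges B) (ParL (Lft e') (Rgt e') (Whole e')) =
   (if tw (lv e') then ParL (Old (Rgt e')) (Old (Lft e')) (Old (Whole e')) else ParL (Old (Lft e')) (Old (Rgt e')) (Old (Whole e')))"
proof -
 interpret h: host B "lv \<circ> base" tw by (rule B_host)
 have low: "h.low (edges B) = Old" using h.low_final by blast
 show "h.lk (edges B) (map_link Whole m) = map_link Old (map_link Whole m)" if m: "m \<in> links N" "\<And>u. m \<noteq> AxL u"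
 proof -
  have "typed N m" by (rule net_typed[OF net m(1)])
  moreover have "m \<noteq> CutL u" for u using m(1) cf by (auto simp: cut_free_def)
  ultimately show ?thesis using m(2)
   by (cases m) (auto simp: low h.swapped_def h.fm_def lab_B bullet_not_pair)
 qed
 assume a: "ax e e'"
 obtain Z where Z: "lab N e = Fm (Atom Z)" "lab N e' = Fm (NAtom Z)" using ax_lab[OF a] by blast
 have "atom_pair (h.fm (Whole e))" "atom_pair (h.fm (Whole e'))" by (simp_all add: h.fm_def lab_B Z atom_pair_def)
 then have sw: "h.swapped (edges B) (Whole e) = tw (lv e)" "h.swapped (edges B) (Whole e') = tw (lv e')"
  using ax_edges[OF a] by (simp_all add: h.swapped_def edges_B(2))
 show "h.lk (edges B) (TensorL (Lft e) (Rgt e) (Whole e)) =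
   (if tw (lv e) then TensorL (Old (Rgt e)) (Old (Lft e)) (Old (Whole e)) else TensorL (Old (Lft e)) (Old (Rgt e)) (Old (Whole e)))"
  "h.lk (edges B) (ParL (Lft e') (Rgt e') (Whole e')) =
   (if tw (lv e') then ParL (Old (Rgt e')) (Old (Lft e')) (Old (Whole e')) else ParL (Old (Lft e')) (Old (Rgt e')) (Old (Whole e')))"
  by (simp_all add: sw low)
qed

text \<open>Exchanging left and right above every conclusion at a selected level undoes the crossed
  pair links. If both ends of an axiom of \<open>N\<close> are affected or none is, its two copies
  are exchanged or kept, so axioms still go to axioms.\<close>

lemma final_iso:
 assumes agree: "\<And>e e'. ax e e' \<Longrightarrow> tw (lv e) = tw (lv e')"
 shows "siso (host.state B (lv \<circ> base) tw (edges B)) B"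
proof -
 interpret h: host B "lv \<circ> base" tw by (rule B_host)
 define r where "r y = (case y of Whole e \<Rightarrow> Whole e | Lft e \<Rightarrow> if tw (lv e) then Rgt e else Lft e
  | Rgt e \<Rightarrow> if tw (lv e) then Lft e else Rgt e)" for y
 define s where "s x = (case x of Old y \<Rightarrow> r y | New y n \<Rightarrow> y)" for x
 have rb: "base (r y) = base y" "r (r y) = y" for y by (cases y; simp add: r_def)+
 have rW: "r (Whole e) = Whole e" for e by (simp add: r_def)
 have so: "s (Old y) = r y" for y by (simp add: s_def)
 have old: "map_link s (h.lk (edges B) (map_link Whole m)) = map_link Whole m"
  if "m \<in> links N" "\<And>u. m \<noteq> AxL u" for m
  unfolding lk_final(1)[OF that] map_link_comp by (rule map_link_cong) (simp add: so rW)
 have tp: "map_link s (h.lk (edges B) (TensorL (Lft e) (Rgt e) (Whole e))) = TensorL (Lft e) (Rgt e) (Whole e)"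
  "map_link s (h.lk (edges B) (ParL (Lft e') (Rgt e') (Whole e'))) = ParL (Lft e') (Rgt e') (Whole e')" if "ax e e'" for e e'
  unfolding lk_final(2,3)[OF that] by (simp_all add: so r_def)
 have lr: "map_link s (h.lk (edges B) (AxL (Upair (Lft e) (Lft e')))) =
    (if tw (lv e) then AxL (Upair (Rgt e) (Rgt e')) else AxL (Upair (Lft e) (Lft e')))"
   "map_link s (h.lk (edges B) (AxL (Upair (Rgt e) (Rgt e')))) =
    (if tw (lv e) then AxL (Upair (Lft e) (Lft e')) else AxL (Upair (Rgt e) (Rgt e')))" if "ax e e'" for e e'
  using agree[OF that] by (simp_all add: so r_def)
 have im: "map_link s ` h.lk (edges B) ` links B = links B"
 proof (intro equalityI subsetI)
  fix l assume "l \<in> map_link s ` h.lk (edges B) ` links B"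
  then obtain m where "m \<in> links B" and l: "l = map_link s (h.lk (edges B) m)" by blast
  then show "l \<in> links B"
  proof (cases rule: B_cases)
   case (old m')
   then show ?thesis using \<open>m \<in> links B\<close> \<open>\<And>m. \<lbrakk>m \<in> links N; \<And>u. m \<noteq> AxL u\<rbrakk> \<Longrightarrow> map_link s (h.lk (edges B) (map_link Whole m)) = map_link Whole m\<close> l by metis
  next
   case (tensor e e')
   then show ?thesis using \<open>m \<in> links B\<close> tp(1)[OF tensor(1)] l by simp
  next
   case (par e e')
   then show ?thesis using \<open>m \<in> links B\<close> tp(2)[OF par(1)] l by simp
  next
   case (left e e')
   then show ?thesis unfolding l left(2) lr(1)[OF left(1)] using B_links(4,5)[OF left(1)] by simp
  next
   case (right e e')
   then show ?thesis unfolding l right(2) lr(2)[OF right(1)] using B_links(4,5)[OF right(1)] by simp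
  qed
 next
  fix l assume l: "l \<in> links B"
  have "\<exists>m\<in>links B. l = map_link s (h.lk (edges B) m)" using l
  proof (cases rule: B_cases)
   case (old m')
   then show ?thesis using l \<open>\<And>m. \<lbrakk>m \<in> links N; \<And>u. m \<noteq> AxL u\<rbrakk> \<Longrightarrow> map_link s (h.lk (edges B) (map_link Whole m)) = map_link Whole m\<close> by metis
  next
   case (tensor e e')
   then show ?thesis using l tp(1)[OF tensor(1)] by metis
  next
   case (par e e')
   then show ?thesis using l tp(2)[OF par(1)] by metis
  next
   case (left e e')
   show ?thesis
   proof (cases "tw (lv e)")
    case True
    show ?thesis by (rule bexI[OF _ B_links(5)[OF left(1)]]) (simp only: lr(2)[OF left(1)] left(2) True if_True)
   next
    case False
    show ?thesis by (rule bexI[OF _ B_links(4)[OF left(1)]]) (simp only: lr(1)[OF left(1)] left(2) False if_False)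
   qed
  next
   case (right e e')
   show ?thesis
   proof (cases "tw (lv e)")
    case True
    show ?thesis by (rule bexI[OF _ B_links(4)[OF right(1)]]) (simp only: lr(1)[OF right(1)] right(2) True if_True)
   next
    case False
    show ?thesis by (rule bexI[OF _ B_links(5)[OF right(1)]]) (simp only: lr(2)[OF right(1)] right(2) False if_False)
   qed
  qed
  then show "l \<in> map_link s ` h.lk (edges B) ` links B" by blast
 qed
 have fe: "h.front (edges B) = {}" by (auto simp: h.front_def)
 have E: "edges (h.state (edges B)) = Old ` edges B" unfolding h.state_edges fe by simp
 have "iso_by s (h.state (edges B)) B" unfolding iso_by_def
 proof (intro conjI ballI)
  show "inj_on s (reach (h.state (edges B)))"
   unfolding boxed_reach[OF h.state_boxed] E inj_on_def using so rb(2) by (metis imageE)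
  show "map_link s ` links (h.state (edges B)) = links B" unfolding h.links_final by (rule im)
  fix x assume "x \<in> edges (h.state (edges B))"
  then obtain y where x: "x = Old y" unfolding E by blast
  show "lab B (s x) = lab (h.state (edges B)) x" unfolding x so by (cases y) (simp_all add: r_def lab_B)
  show "loc B (s x) = map_option s (loc (h.state (edges B)) x)"
  proof -
   have "s \<circ> (Old \<circ> Whole) = Whole" by (simp add: fun_eq_iff so rW)
   then show ?thesis unfolding x so loc_B rb(1) by (simp add: loc_B option.map_comp)
  qed
 qed
 then show ?thesis unfolding siso_def by blast
qed

text \<open>The rigidity of the substituted net, which detects a crossing: leaves appear with left
  before right in pair links, and axioms join leaves of the same side.\<close>

lemma sides:
 "TensorL (Rgt a) q t \<notin> links B" "TensorL p (Lft a) t \<notin> links B"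
 "ParL (Rgt a) q t \<notin> links B" "ParL p (Lft a) t \<notin> links B"
 "AxL (Upair y y') \<in> links B \<Longrightarrow> (\<exists>a b. y = Lft a \<and> y' = Lft b) \<or> (\<exists>a b. y = Rgt a \<and> y' = Rgt b)"
proof -
 show "TensorL (Rgt a) q t \<notin> links B"
 proof
  assume "TensorL (Rgt a) q t \<in> links B"
  then show False
  proof (cases rule: B_cases)
   case (old m)
   then show ?thesis by (cases m) auto
  qed auto
 qed
 show "TensorL p (Lft a) t \<notin> links B"
 proof
  assume "TensorL p (Lft a) t \<in> links B"
  then show False
  proof (cases rule: B_cases)
   case (old m)
   then show ?thesis by (cases m) auto
  qed auto
 qed
 show "ParL (Rgt a) q t \<notin> links B"
 proof
  assume "ParL (Rgt a) q t \<in> links B"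
  then show False
  proof (cases rule: B_cases)
   case (old m)
   then show ?thesis by (cases m) auto
  qed auto
 qed
 show "ParL p (Lft a) t \<notin> links B"
 proof
  assume "ParL p (Lft a) t \<in> links B"
  then show False
  proof (cases rule: B_cases)
   case (old m)
   then show ?thesis by (cases m) auto
  qed auto
 qed
 assume "AxL (Upair y y') \<in> links B"
 then show "(\<exists>a b. y = Lft a \<and> y' = Lft b) \<or> (\<exists>a b. y = Rgt a \<and> y' = Rgt b)"
 proof (cases rule: B_cases)
  case (old m)
  then show ?thesis by (cases m) auto
 qed (auto simp: Upair_inject)
qed

text \<open>An isomorphism sends the two ends of the axiom on the left leaves to leaves of one side.
  The order of premises tells for each end whether its pair link was crossed, and the common side
  forces the same answer.\<close>

lemma final_levels:
 assumes iso: "net_iso (host.state B (lv \<circ> base) tw (edges B)) B" and a: "ax e e'"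
 shows "tw (lv e) = tw (lv e')"
proof -
 interpret h: host B "lv \<circ> base" tw by (rule B_host)
 obtain f where f: "map_link f ` h.lk (edges B) ` links B = links B"
  using iso unfolding net_iso_def h.links_final by blast
 have m: "map_link f (h.lk (edges B) l) \<in> links B" if "l \<in> links B" for l using f that by blast
 note t = m[OF B_links(2)[OF a], unfolded lk_final(2)[OF a]] m[OF B_links(3)[OF a], unfolded lk_final(3)[OF a]]
 have "AxL (Upair (f (Old (Lft e))) (f (Old (Lft e')))) \<in> links B" using m[OF B_links(4)[OF a]] by simp
 from sides(5)[OF this] show ?thesis
 proof
  assume "\<exists>a b. f (Old (Lft e)) = Lft a \<and> f (Old (Lft e')) = Lft b"
  then have "\<not> tw (lv e)" "\<not> tw (lv e')" using t sides by (auto split: if_splits)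
  then show ?thesis by simp
 next
  assume "\<exists>a b. f (Old (Lft e)) = Rgt a \<and> f (Old (Lft e')) = Rgt b"
  then have "tw (lv e)" "tw (lv e')" using t sides by (auto split: if_splits)
  then show ?thesis by simp
 qed
qed

text \<open>Every reduct of the cut is a state up to names and some reduction reaches the last one,
  so reducing to \<open>B\<close> means that the last state is isomorphic to \<open>B\<close>. The
  two injections serve the two directions of transport between the types of edges.\<close>

lemma test_iff:
 assumes \<theta>: "siso (tree (bullet X A) tw) (\<theta> :: 'f net)"
  and i: "inj (i :: 'e sub name \<Rightarrow> 'e sub + 'f)" "inj (j :: 'e sub + 'f \<Rightarrow> 'e sub name)"
 shows "reduces (cut_nets (bullet X A) B \<theta>) B \<longleftrightarrow> (\<forall>e e'. ax e e' \<longrightarrow> tw (lv e) = tw (lv e'))"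
proof
 interpret h: host B "lv \<circ> base" tw by (rule B_host)
 note init = state_init[OF \<theta>]
 {
  assume "reduces (cut_nets (bullet X A) B \<theta>) B"
  then obtain M where M: "beta\<^sup>*\<^sup>* (cut_nets (bullet X A) B \<theta>) M" "net_iso M B" unfolding reduces_def by blast
  obtain D where D: "h.stage D" "siso (h.state D) M" using h.state_reducts[OF M(1) init h.stage_empty i(2)] by blast
  have iso: "net_iso (h.state D) B" by (rule net_iso_trans[OF siso_net_iso[OF D(2)] M(2)])
  then obtain f where f: "map_link f ` links (h.state D) = links B" unfolding net_iso_def by blast
  \<comment> \<open>A remaining cut would be carried by the isomorphism to a cut of the substituted
    net, which has none.\<close>
  have "h.front D = {}"
  proof (rule ccontr)
   assume "h.front D \<noteq> {}"
   then obtain x where "CutL (Upair (Old x) (New x Neg)) \<in> links (h.state D)" using h.state_cut by blast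
   then have "map_link f (CutL (Upair (Old x) (New x Neg))) \<in> links B" using f by blast
   then show False using B_cut_free by (simp add: cut_free_def)
  qed
  then have "D = edges B" by (rule h.front_empty[OF D(1)])
  then show "\<forall>e e'. ax e e' \<longrightarrow> tw (lv e) = tw (lv e')" using final_levels[of tw] iso by blast
 next
  assume agree: "\<forall>e e'. ax e e' \<longrightarrow> tw (lv e) = tw (lv e')"
  obtain M D where M: "beta\<^sup>*\<^sup>* (cut_nets (bullet X A) B \<theta>) M" "h.stage D" "siso (h.state D) M" "h.front D = {}"
   using h.state_normalizes[OF init h.stage_empty i(1)] by blast
  have "D = edges B" by (rule h.front_empty[OF M(2,4)])
  then have "siso (h.state D) B" using final_iso[of tw] agree by blast
  then have "net_iso M B" using siso_net_iso siso_trans[OF siso_sym[OF M(3)]] by blast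
  then show "reduces (cut_nets (bullet X A) B \<theta>) B" using M(1) unfolding reduces_def by blast
 }
qed

end

text \<open>Countability of the names yields the injection from names of states into names of the
  cut net required by \<open>test_iff\<close>.\<close>

instance sub :: (countable) countable by countable_datatype
instance nm :: countable by countable_datatype
instance name :: (countable) countable by countable_datatype

theorem mainTheorem15:
  fixes \<pi> \<pi>\<eta> :: "nat net" and \<theta> :: "nat \<Rightarrow> nat net" and A :: form and X :: nat
  assumes "DR_net \<pi>" and "cut_free \<pi>" and "net_of_conclusion \<pi> A"
    and "no_constant_axiom \<pi>"
    and "eta_expansion \<pi> \<pi>\<eta>"
    and "\<And>k. is_test X A k (\<theta> k)"
  shows "L3 \<pi> \<longleftrightarrow>
    (\<forall>k. reduces (cut_nets (bullet X A) (bullet_net X \<pi>\<eta>) (\<theta> k)) (bullet_net X \<pi>\<eta>))"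
proof -
  obtain c where c: "conclusions \<pi> = {c}" "lab \<pi> c = Fm A" using assms(3) unfolding net_of_conclusion_def by blast
  have steps: "eta_step\<^sup>*\<^sup>* \<pi> \<pi>\<eta>" and ex: "eta_expanded \<pi>\<eta>" using assms(5) unfolding eta_expansion_def by blast+
  have "is_net \<pi>" using assms(1) by (simp add: DR_net_def)
  note e = eta_steps[OF steps this]
  have ne: "is_net \<pi>\<eta>" "cut_free \<pi>\<eta>" "conclusions \<pi>\<eta> = {c}" "lab \<pi>\<eta> c = Fm A" using e c assms(2) by auto
  obtain lv where lv: "levelling \<pi>\<eta> lv" using levelling_ex[OF ne(1,2)] by blast
  interpret substituted \<pi>\<eta> X lv c A by unfold_locales (rule ne lv ex)+
  have "L3 \<pi> \<longleftrightarrow> (\<exists>I. weak_indexing \<pi>\<eta> I)" using L3_iff_weak[OF assms(1) c(1) assms(4)] e by blast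
  also have "\<dots> \<longleftrightarrow> (\<forall>e e'. AxL (Upair e e') \<in> links \<pi>\<eta> \<longrightarrow> lv e = lv e')"
    by (rule weak_iff_levels[OF ne(1,2) lv ne(3)]) (use ex in \<open>unfold eta_expanded_def, blast\<close>)
  also have "\<dots> \<longleftrightarrow> (\<forall>e e'. ax e e' \<longrightarrow> lv e = lv e')"
  proof
    assume h: "\<forall>e e'. ax e e' \<longrightarrow> lv e = lv e'"
    show "\<forall>e e'. AxL (Upair e e') \<in> links \<pi>\<eta> \<longrightarrow> lv e = lv e'"
    proof (intro allI impI)
      fix e e' assume "AxL (Upair e e') \<in> links \<pi>\<eta>"
      then obtain a b where "Upair e e' = Upair a b" "ax a b" using ax_ex by blast
      then show "lv e = lv e'" using h by (auto simp: Upair_inject)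
    qed
  qed (simp add: ax_def)
  \<comment> \<open>A single test compares the ends of an axiom only with level \<open>k\<close>;
    taking \<open>k\<close> to be the level of one end recovers equality.\<close>
  also have "\<dots> \<longleftrightarrow> (\<forall>k. \<forall>e e'. ax e e' \<longrightarrow> (lv e = k) = (lv e' = k))" by metis
  also have "\<dots> \<longleftrightarrow> (\<forall>k. reduces (cut_nets (bullet X A) (bullet_net X \<pi>\<eta>) (\<theta> k)) (bullet_net X \<pi>\<eta>))"
  proof -
    \<comment> \<open>States need names for nodes of trees while the cut net is built on sums with
      natural numbers. The first map encodes every name as a number in the right summand; the second
      uses one reserved tree name per number.\<close>
    have i: "inj (Inr \<circ> to_nat :: nat sub name \<Rightarrow> nat sub + nat)" by (intro inj_compose inj_to_nat) simp
    have j: "inj (case_sum Old (\<lambda>n. New (Whole n) Neg) :: nat sub + nat \<Rightarrow> nat sub name)"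
      by (auto simp: inj_def split: sum.splits)
    show ?thesis using test_iff[OF test_tree[OF assms(6)] i j] by simp
  qed
  finally show ?thesis .
qed

end
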